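(* Let $\|\cdot\|_{\mathcal P}$ be a norm on $\mathbb{R}^2$ whose closed unit ball $\mathcal{P}$ is a quadrilateral with facets $\pm F_1,\pm F_2$. Let $G$ be a $\mathbb{Z}_2$-symmetric graph where the action $\theta$ is free on the vertex set of $G$, and let $(G_0,\psi)$ be the signed quotient graph of $G$. The following are equivalent. (i) There exist a representation $\tau:\mathbb{Z}_2\to\mathrm{Isom}(\mathbb{R}^2,\|\cdot\|_{\mathcal P})$, where $\tau(-1)$ is a reflection in the mirror $\ker\varphi_{F_1}$ along $\ker\varphi_{F_2}$, and a realisation $p$ such that the bar-joint framework $(G,p)$ is well-positioned, $\mathbb{Z}_2$-symmetric (with respect to $\theta$ and $\tau$) and symmetrically isostatic in $(\mathbb{R}^2,\|\cdot\|_{\mathcal P})$. (ii) $(G_0,\psi)$ is $(2,2,1)$-gain-tight. (iii) $(G_0,\psi)$ can be constructed (up to switching) from a single unbalanced loop by a sequence of H1a-, H1b-, H1c-moves, H2a-, H2b-, H2c-moves, vertex-to-$K_4$ moves, and vertex splitting (edge-to-$K_3$) moves.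
   Context: **Signed quotient graphs.** $G=(V,E)$ is a finite simple undirected graph; $\mathbb{Z}_2=\{1,-1\}$. A $\mathbb{Z}_2$-symmetric graph is $G$ with a homomorphism $\theta:\mathbb{Z}_2\to\mathrm{Aut}(G)$; write $-v=\theta(-1)v$, $-e=(-v)(-w)$ for $e=vw$. Free on vertices: $v\neq-v$ for all $v$; edges with $e=-e$ (fixed edges) are allowed. Orbits $[v]=\{v,-v\}$, $[e]=\{e,-e\}$ form sets $V_0,E_0$. The quotient graph $G_0=(V_0,E_0)$ has $[e]$ incident to $[v]$ if $e$ is incident to $v$ or $-v$; fixed edges give loops. For a choice $\tilde V_0$ of vertex orbit representatives, the gain $\psi:E_0\to\mathbb{Z}_2$ is $\psi_{[e]}=1$ if $e$ or $-e$ joins two vertices of $\tilde V_0$, else $-1$. $(G_0,\psi)$ is a signed quotient graph with covering graph $G$. Signed quotient graphs are characterised by: parallel edges have different gains (so at most two parallel edges join two vertices), and loops have gain $-1$ (at most one loop per vertex). Replacing a representative $\tilde v$ by $-\tilde v$ changes the sign of the gain of all non-loop edges at $[v]$; this is the switching operation at $[v]$. Signed quotient graphs related by switching have the same covering graph and are not distinguished. The gain of a cycle is the product of the gains of its edges (loops and pairs of parallel edges count as cycles). An edge set is balanced if all its cycles (if any) have gain $1$, otherwise unbalanced. A "single unbalanced loop" is the graph with one vertex and one loop (gain $-1$). $(G_0,\psi)$ is $(2,2,1)$-gain-sparse if $|F|\le2|V(F)|-2$ for every nonempty balanced $F\subseteq E_0$ and $|F|\le2|V(F)|-1$ for every nonempty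 $F\subseteq E_0$ ($V(F)$ = vertices incident with $F$); it is $(2,2,1)$-gain-tight if also $|E_0|=2|V_0|-1$. **Moves** (applied to a $(2,2,1)$-gain-tight signed quotient graph). *Henneberg 1:* add a new vertex $[v]$ and two new edges $[e_1],[e_2]$ incident with $[v]$, not both loops at $[v]$; if parallel, they get different gains. H1a: non-parallel, neither a loop. H1b: parallel. H1c: one is a loop at $[v]$ (gain $-1$). *Henneberg 2:* delete an edge $[e]$ and add a new vertex $[v]$ of degree 3: $[e]$ is subdivided into edges $[e_1],[e_2]$, both incident with $[v]$, with $\psi_{[e_1]}\psi_{[e_2]}=\psi_{[e]}$; a third new edge $[e_3]$ joins $[v]$ to a vertex $[z]$ of the original graph so that every 2-cycle $[e_i][e_j]$, if any, is unbalanced. H2a: $[e]$ not a loop and no two of the $[e_i]$ parallel. H2b: $[e]$ not a loop and two of the $[e_i]$ parallel (i.e. $[z]$ is an end-vertex of $[e]$). H2c: $[e]$ is a loop. *Vertex-to-$K_4$:* remove a vertex $[v]$ and all incident edges, add a copy of $K_4$ with all gains $1$; each removed edge $[x][v]$ ($[x]\ne[v]$) is replaced by an edge $[x][y]$ of the same gain for some $[y]$ in the new $K_4$; a loop at $[v]$, if present, is replaced by an edge $[y][z]$ of gain $-1$ where $[y],[z]$ are (not necessarily distinct) vertices of the new $K_4$. *Edge-to-$K_3$ (vertex splitting):* given $[v]$ incident to an edge $[v][u]$ of gain $1$ and to further edges $[v][u_i]$, $i=1,\dots,t$ (which may include an edge $[v][u]$ of gain $-1$ and a loop at $[v]$), remove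 $[v]$ and its incident edges, add new vertices $[v_0],[v_1]$ and edges $[v_0][v_1],[v_0][u],[v_1][u]$ of gain $1$; each $[v][u_i]$ with $[u_i]\ne[v]$ is replaced by $[v_0][u_i]$ or $[v_1][u_i]$ with the same gain; a loop at $[v]$ is replaced by a loop (gain $-1$) at $[v_0]$ or $[v_1]$. **Frameworks.** For a finite dimensional real normed space $(X,\|\cdot\|)$, a bar-joint framework is a pair $(G,p)$, $p\in X^{|V|}$, $p_v\neq p_w$ for $vw\in E$. It is well-positioned if $f_G(x)=(\|x_v-x_w\|)_{vw\in E}$ is differentiable at $p$. An infinitesimal flex is $u\in X^{|V|}$ with directional derivative $D_uf_G(p)=0$. A rigid motion is a family of continuous paths $\{\alpha_x:[-1,1]\to X\}_{x\in X}$, differentiable at $0$, with $\alpha_x(0)=x$ and $\|\alpha_x(t)-\alpha_y(t)\|=\|x-y\|$ for all $x,y,t$; a flex is trivial if it equals $(\alpha'_{p_v}(0))_{v\in V}$ for some rigid motion. $\mathrm{Isom}(X,\|\cdot\|)$ is the group of linear isometries. $(G,p)$ is $\mathbb{Z}_2$-symmetric (w.r.t. $\theta,\tau$) if $\tau(-1)p_v=p_{-v}$ for all $v$. A flex is symmetric if $u_{-v}=\tau(-1)u_v$ for all $v$. $(G,p)$ is symmetrically infinitesimally rigid if every symmetric infinitesimal flex is trivial; symmetrically isostatic if in addition no $(H,p)$ with $H\ne G$ a $\theta$-invariant spanning subgraph is symmetrically infinitesimally rigid. A reflection in the mirror $Z$ along $W$ (where $X=Z\oplus W$, $\dim W=1$)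 is a linear isometry $I-2P$ with $P$ the projection with range $W$ and kernel $Z$. **Quadrilateral norms.** $\mathcal{P}=\bigcap_{j=1,2}\{x:|x\cdot\hat F_j|\le1\}$, $\|x\|_{\mathcal P}=\max_j|\hat F_j\cdot x|$, $F_j=\{x\in\mathcal{P}:\hat F_j\cdot x=1\}$, and $\varphi_{F_j}(x)=\hat F_j\cdot x$. *)

theory Defs
  imports "HOL-Analysis.Analysis" "HOL-Algebra.Group"
begin

section \<open>Symmetric graphs\<close>

text \<open>A finite simple graph has as its vertices the elements of a (nonempty) finite type
  and is given by its set of edges, which are two-element sets of vertices.\<close>

definition simple_graph :: "'v::finite set set \<Rightarrow> bool" where
  "simple_graph E \<longleftrightarrow> (\<forall>e\<in>E. card e = 2)"

definition Z2 :: "int monoid" where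
  "Z2 = \<lparr>carrier = {1, -1}, mult = (*), one = 1\<rparr>"

definition aut_group :: "'v::finite set set \<Rightarrow> ('v \<Rightarrow> 'v) monoid" where
  "aut_group E = \<lparr>carrier = {f. bij f \<and> (\<forall>v w. {f v, f w} \<in> E \<longleftrightarrow> {v, w} \<in> E)},
                  mult = (\<circ>), one = id\<rparr>"

definition Z2_symmetric_graph :: "'v::finite set set \<Rightarrow> (int \<Rightarrow> 'v \<Rightarrow> 'v) \<Rightarrow> bool" where
  "Z2_symmetric_graph E \<theta> \<longleftrightarrow> simple_graph E \<and> \<theta> \<in> hom Z2 (aut_group E)"

definition free_on_vertices :: "(int \<Rightarrow> 'v \<Rightarrow> 'v) \<Rightarrow> bool" where
  "free_on_vertices \<theta> \<longleftrightarrow> (\<forall>v. \<theta> (-1) v \<noteq> v)"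

definition vertex_orbit :: "(int \<Rightarrow> 'v \<Rightarrow> 'v) \<Rightarrow> 'v \<Rightarrow> 'v set" where
  "vertex_orbit \<theta> v = {v, \<theta> (-1) v}"

definition edge_orbit :: "(int \<Rightarrow> 'v \<Rightarrow> 'v) \<Rightarrow> 'v set \<Rightarrow> 'v set set" where
  "edge_orbit \<theta> e = {e, \<theta> (-1) ` e}"


section \<open>Signed quotient graphs\<close>

text \<open>Parallel edges of a signed quotient graph have different gains, so an edge is determined
  by the set of its end-vertices (a singleton for a loop) together with its gain.
  Edges are therefore represented by such pairs; see \<open>quotient_edge_inj\<close> below.\<close>

type_synonym 'a sedge = "'a set \<times> int"

record 'a sgraph =
  verts :: "'a set"
  edges :: "'a sedge set"

definition signed_quotient_graph :: "'a sgraph \<Rightarrow> bool" where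
  "signed_quotient_graph H \<longleftrightarrow> finite (verts H) \<and>
     (\<forall>(S, g)\<in>edges H. S \<subseteq> verts H \<and> (card S = 1 \<or> card S = 2) \<and>
                       g \<in> {1, -1} \<and> (card S = 1 \<longrightarrow> g = -1))"

definition representatives :: "(int \<Rightarrow> 'v \<Rightarrow> 'v) \<Rightarrow> 'v set \<Rightarrow> bool" where
  "representatives \<theta> R \<longleftrightarrow> (\<forall>x\<in>range (vertex_orbit \<theta>). \<exists>!v. v \<in> x \<inter> R)"

text \<open>In the following two definitions \<open>x\<close> is an edge orbit.\<close>

definition quotient_ends :: "(int \<Rightarrow> 'v \<Rightarrow> 'v) \<Rightarrow> 'v set set \<Rightarrow> 'v set set" where
  "quotient_ends \<theta> x = {y \<in> range (vertex_orbit \<theta>). \<exists>e\<in>x. \<exists>v\<in>y. v \<in> e}"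

definition quotient_gain :: "'v set \<Rightarrow> 'v set set \<Rightarrow> int" where
  "quotient_gain R x = (if \<exists>e\<in>x. e \<subseteq> R then 1 else -1)"

definition quotient_edge :: "(int \<Rightarrow> 'v \<Rightarrow> 'v) \<Rightarrow> 'v set \<Rightarrow> 'v set set \<Rightarrow> 'v set sedge" where
  "quotient_edge \<theta> R x = (quotient_ends \<theta> x, quotient_gain R x)"

definition quotient_graph :: "'v::finite set set \<Rightarrow> (int \<Rightarrow> 'v \<Rightarrow> 'v) \<Rightarrow> 'v set \<Rightarrow> 'v set sgraph" where
  "quotient_graph E \<theta> R =
     \<lparr>verts = range (vertex_orbit \<theta>),
      edges = quotient_edge \<theta> R ` edge_orbit \<theta> ` E\<rparr>"

definition switch :: "'a \<Rightarrow> 'a sgraph \<Rightarrow> 'a sgraph" where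
  "switch v H = H\<lparr>edges := (\<lambda>(S, g). if v \<in> S \<and> S \<noteq> {v} then (S, - g) else (S, g)) ` edges H\<rparr>"

definition sgraph_iso :: "'a sgraph \<Rightarrow> 'b sgraph \<Rightarrow> bool" where
  "sgraph_iso H K \<longleftrightarrow> (\<exists>f. bij_betw f (verts H) (verts K) \<and>
                            edges K = (\<lambda>(S, g). (f ` S, g)) ` edges H)"


section \<open>Gain-tightness\<close>

text \<open>\<open>vs\<close> and \<open>es\<close> are the successive vertices and edges of the cycle;
  cycles of length one are loops, those of length two are pairs of parallel edges.\<close>

definition cycle :: "'a sedge set \<Rightarrow> 'a list \<Rightarrow> 'a sedge list \<Rightarrow> bool" where
  "cycle F vs es \<longleftrightarrow> vs \<noteq> [] \<and> length es = length vs \<and> distinct vs \<and> distinct es \<and> set es \<subseteq> F \<and>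
     (\<forall>i<length vs. fst (es ! i) = {vs ! i, vs ! (Suc i mod length vs)})"

definition balanced :: "'a sedge set \<Rightarrow> bool" where
  "balanced F \<longleftrightarrow> (\<forall>vs es. cycle F vs es \<longrightarrow> prod_list (map snd es) = 1)"

definition incident_verts :: "'a sedge set \<Rightarrow> 'a set" where
  "incident_verts F = \<Union> (fst ` F)"

definition gain_sparse :: "'a sgraph \<Rightarrow> bool" where
  "gain_sparse H \<longleftrightarrow>
     (\<forall>F\<subseteq>edges H. F \<noteq> {} \<longrightarrow> balanced F \<longrightarrow> int (card F) \<le> 2 * int (card (incident_verts F)) - 2) \<and>
     (\<forall>F\<subseteq>edges H. F \<noteq> {} \<longrightarrow> int (card F) \<le> 2 * int (card (incident_verts F)) - 1)"

definition gain_tight :: "'a sgraph \<Rightarrow> bool" where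
  "gain_tight H \<longleftrightarrow> gain_sparse H \<and> int (card (edges H)) = 2 * int (card (verts H)) - 1"


section \<open>Moves\<close>

inductive move :: "'a sgraph \<Rightarrow> 'a sgraph \<Rightarrow> bool" for H :: "'a sgraph" where
  H1a: "\<lbrakk>v \<notin> verts H; x \<in> verts H; y \<in> verts H; x \<noteq> y; g \<in> {1, -1}; h \<in> {1, -1}\<rbrakk> \<Longrightarrow>
    move H \<lparr>verts = insert v (verts H),
            edges = edges H \<union> {({v, x}, g), ({v, y}, h)}\<rparr>"
| H1b: "\<lbrakk>v \<notin> verts H; x \<in> verts H\<rbrakk> \<Longrightarrow>
    move H \<lparr>verts = insert v (verts H),
            edges = edges H \<union> {({v, x}, 1), ({v, x}, -1)}\<rparr>"
| H1c: "\<lbrakk>v \<notin> verts H; x \<in> verts H; g \<in> {1, -1}\<rbrakk> \<Longrightarrow>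
    move H \<lparr>verts = insert v (verts H),
            edges = edges H \<union> {({v, x}, g), ({v}, -1)}\<rparr>"
| H2a: "\<lbrakk>v \<notin> verts H; ({x, y}, k) \<in> edges H; x \<noteq> y; z \<in> verts H; z \<notin> {x, y};
         g1 \<in> {1, -1}; g2 \<in> {1, -1}; g1 * g2 = k; g3 \<in> {1, -1}\<rbrakk> \<Longrightarrow>
    move H \<lparr>verts = insert v (verts H),
            edges = (edges H - {({x, y}, k)}) \<union> {({v, x}, g1), ({v, y}, g2), ({v, z}, g3)}\<rparr>"
  \<comment> \<open>Exchanging the roles of \<open>x\<close> and \<open>y\<close> if necessary, the third edge joins \<open>v\<close> to \<open>x\<close>.\<close>
| H2b: "\<lbrakk>v \<notin> verts H; ({x, y}, k) \<in> edges H; x \<noteq> y;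
         g1 \<in> {1, -1}; g2 \<in> {1, -1}; g1 * g2 = k\<rbrakk> \<Longrightarrow>
    move H \<lparr>verts = insert v (verts H),
            edges = (edges H - {({x, y}, k)}) \<union> {({v, x}, g1), ({v, y}, g2), ({v, x}, - g1)}\<rparr>"
  \<comment> \<open>A third edge from \<open>v\<close> to \<open>x\<close> would form a balanced 2-cycle, so \<open>z\<close> is not \<open>x\<close>.\<close>
| H2c: "\<lbrakk>v \<notin> verts H; ({x}, -1) \<in> edges H; z \<in> verts H; z \<noteq> x; g3 \<in> {1, -1}\<rbrakk> \<Longrightarrow>
    move H \<lparr>verts = insert v (verts H),
            edges = (edges H - {({x}, -1)}) \<union> {({v, x}, 1), ({v, x}, -1), ({v, z}, g3)}\<rparr>"
  \<comment> \<open>\<open>f x g\<close> is the new end-vertex of the edge from \<open>x\<close> to \<open>v\<close> with gain \<open>g\<close>.\<close>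
| vertex_to_K4: "\<lbrakk>v \<in> verts H; card K = 4; K \<inter> verts H = {};
         \<And>x g. x \<noteq> v \<Longrightarrow> ({x, v}, g) \<in> edges H \<Longrightarrow> f x g \<in> K; y \<in> K; z \<in> K\<rbrakk> \<Longrightarrow>
    move H \<lparr>verts = (verts H - {v}) \<union> K,
            edges = {e \<in> edges H. v \<notin> fst e}
                    \<union> {({a, b}, 1) | a b. a \<in> K \<and> b \<in> K \<and> a \<noteq> b}
                    \<union> {({x, f x g}, g) | x g. x \<noteq> v \<and> ({x, v}, g) \<in> edges H}
                    \<union> (if ({v}, -1) \<in> edges H then {({y, z}, -1)} else {})\<rparr>"
| edge_to_K3: "\<lbrakk>u \<noteq> v; ({v, u}, 1) \<in> edges H; v0 \<notin> verts H; v1 \<notin> verts H; v0 \<noteq> v1;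
         \<And>x g. x \<noteq> v \<Longrightarrow> ({x, v}, g) \<in> edges H \<Longrightarrow> f x g \<in> {v0, v1}; y \<in> {v0, v1}\<rbrakk> \<Longrightarrow>
    move H \<lparr>verts = (verts H - {v}) \<union> {v0, v1},
            edges = {e \<in> edges H. v \<notin> fst e}
                    \<union> {({v0, v1}, 1), ({v0, u}, 1), ({v1, u}, 1)}
                    \<union> {({x, f x g}, g) | x g. x \<noteq> v \<and> ({x, v}, g) \<in> edges H \<and> (x, g) \<noteq> (u, 1)}
                    \<union> (if ({v}, -1) \<in> edges H then {({y}, -1)} else {})\<rparr>"

inductive constructible :: "'a sgraph \<Rightarrow> bool" where
  loop: "constructible \<lparr>verts = {a}, edges = {({a}, -1)}\<rparr>"
| switching: "constructible H \<Longrightarrow> v \<in> verts H \<Longrightarrow> constructible (switch v H)"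
| move: "constructible H \<Longrightarrow> signed_quotient_graph H \<Longrightarrow> gain_tight H \<Longrightarrow> move H H' \<Longrightarrow> constructible H'"


section \<open>Frameworks\<close>

text \<open>The norm \<open>N\<close> of the framework is in general not the Euclidean norm of the type.
  As all norms on a finite dimensional space are equivalent, continuity and differentiability
  do not depend on this choice.\<close>

definition is_norm :: "('a::real_vector \<Rightarrow> real) \<Rightarrow> bool" where
  "is_norm N \<longleftrightarrow> (\<forall>x. N x \<ge> 0) \<and> (\<forall>x. N x = 0 \<longleftrightarrow> x = 0) \<and>
     (\<forall>c x. N (c *\<^sub>R x) = \<bar>c\<bar> * N x) \<and> (\<forall>x y. N (x + y) \<le> N x + N y)"

definition isom_group :: "('a::real_vector \<Rightarrow> real) \<Rightarrow> ('a \<Rightarrow> 'a) monoid" where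
  "isom_group N = \<lparr>carrier = {T. linear T \<and> bij T \<and> (\<forall>x. N (T x) = N x)}, mult = (\<circ>), one = id\<rparr>"

definition is_reflection :: "('a::euclidean_space \<Rightarrow> 'a) \<Rightarrow> 'a set \<Rightarrow> 'a set \<Rightarrow> bool" where
  "is_reflection T Z W \<longleftrightarrow> subspace Z \<and> subspace W \<and> Z \<inter> W = {0} \<and> {z + w | z w. z \<in> Z \<and> w \<in> W} = UNIV \<and>
     dim W = 1 \<and>
     (\<exists>P. linear P \<and> P \<circ> P = P \<and> range P = W \<and> {x. P x = 0} = Z \<and> T = (\<lambda>x. x - 2 *\<^sub>R P x))"

definition framework :: "'v::finite set set \<Rightarrow> 'a::euclidean_space ^ 'v \<Rightarrow> bool" where
  "framework E p \<longleftrightarrow> simple_graph E \<and> (\<forall>v w. {v, w} \<in> E \<longrightarrow> p $ v \<noteq> p $ w)"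

text \<open>The coordinates of the edge length map are indexed by all ordered pairs of vertices, so every
  edge occurs twice; coordinates not belonging to an edge vanish.\<close>

definition edge_lengths ::
  "('a::euclidean_space \<Rightarrow> real) \<Rightarrow> 'v::finite set set \<Rightarrow> 'a ^ 'v \<Rightarrow> real ^ ('v \<times> 'v)" where
  "edge_lengths N E x = (\<chi> vw. if {fst vw, snd vw} \<in> E then N (x $ fst vw - x $ snd vw) else 0)"

definition well_positioned ::
  "('a::euclidean_space \<Rightarrow> real) \<Rightarrow> 'v::finite set set \<Rightarrow> 'a ^ 'v \<Rightarrow> bool" where
  "well_positioned N E p \<longleftrightarrow> edge_lengths N E differentiable (at p)"

definition inf_flex ::
  "('a::euclidean_space \<Rightarrow> real) \<Rightarrow> 'v::finite set set \<Rightarrow> 'a ^ 'v \<Rightarrow> 'a ^ 'v \<Rightarrow> bool" where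
  "inf_flex N E p u \<longleftrightarrow> ((\<lambda>t. edge_lengths N E (p + t *\<^sub>R u)) has_vector_derivative 0) (at 0)"

definition rigid_motion ::
  "('a::euclidean_space \<Rightarrow> real) \<Rightarrow> ('a \<Rightarrow> real \<Rightarrow> 'a) \<Rightarrow> bool" where
  "rigid_motion N \<alpha> \<longleftrightarrow>
     (\<forall>x. continuous_on {-1..1} (\<alpha> x) \<and> \<alpha> x differentiable (at 0) \<and> \<alpha> x 0 = x) \<and>
     (\<forall>x y. \<forall>t\<in>{-1..1}. N (\<alpha> x t - \<alpha> y t) = N (x - y))"

definition trivial_flex ::
  "('a::euclidean_space \<Rightarrow> real) \<Rightarrow> 'a ^ 'v::finite \<Rightarrow> 'a ^ 'v \<Rightarrow> bool" where
  "trivial_flex N p u \<longleftrightarrow>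
     (\<exists>\<alpha>. rigid_motion N \<alpha> \<and> (\<forall>v. (\<alpha> (p $ v) has_vector_derivative u $ v) (at 0)))"

text \<open>Symmetry of a placement and symmetry of a flex are given by the same equation.\<close>

definition Z2_symmetric ::
  "(int \<Rightarrow> 'v \<Rightarrow> 'v) \<Rightarrow> (int \<Rightarrow> 'a \<Rightarrow> 'a) \<Rightarrow> 'a ^ 'v::finite \<Rightarrow> bool" where
  "Z2_symmetric \<theta> \<tau> x \<longleftrightarrow> (\<forall>v. \<tau> (-1) (x $ v) = x $ (\<theta> (-1) v))"

definition symm_inf_rigid ::
  "('a::euclidean_space \<Rightarrow> real) \<Rightarrow> (int \<Rightarrow> 'v \<Rightarrow> 'v) \<Rightarrow> (int \<Rightarrow> 'a \<Rightarrow> 'a) \<Rightarrow>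
   'v::finite set set \<Rightarrow> 'a ^ 'v \<Rightarrow> bool" where
  "symm_inf_rigid N \<theta> \<tau> E p \<longleftrightarrow>
     (\<forall>u. Z2_symmetric \<theta> \<tau> u \<longrightarrow> inf_flex N E p u \<longrightarrow> trivial_flex N p u)"

definition invariant_edges :: "(int \<Rightarrow> 'v \<Rightarrow> 'v) \<Rightarrow> 'v set set \<Rightarrow> bool" where
  "invariant_edges \<theta> E \<longleftrightarrow> (\<forall>e\<in>E. \<theta> (-1) ` e \<in> E)"

definition symm_isostatic ::
  "('a::euclidean_space \<Rightarrow> real) \<Rightarrow> (int \<Rightarrow> 'v \<Rightarrow> 'v) \<Rightarrow> (int \<Rightarrow> 'a \<Rightarrow> 'a) \<Rightarrow>
   'v::finite set set \<Rightarrow> 'a ^ 'v \<Rightarrow> bool" where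
  "symm_isostatic N \<theta> \<tau> E p \<longleftrightarrow> symm_inf_rigid N \<theta> \<tau> E p \<and>
     (\<forall>E'. E' \<subset> E \<longrightarrow> invariant_edges \<theta> E' \<longrightarrow> \<not> symm_inf_rigid N \<theta> \<tau> E' p)"


section \<open>Quadrilateral norms\<close>

definition quad_norm :: "real ^ 2 \<Rightarrow> real ^ 2 \<Rightarrow> real ^ 2 \<Rightarrow> real" where
  "quad_norm h1 h2 x = max \<bar>h1 \<bullet> x\<bar> \<bar>h2 \<bullet> x\<bar>"

definition quad_ball :: "real ^ 2 \<Rightarrow> real ^ 2 \<Rightarrow> (real ^ 2) set" where
  "quad_ball h1 h2 = {x. \<bar>x \<bullet> h1\<bar> \<le> 1} \<inter> {x. \<bar>x \<bullet> h2\<bar> \<le> 1}"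

definition quad_facet :: "real ^ 2 \<Rightarrow> real ^ 2 \<Rightarrow> real ^ 2 \<Rightarrow> (real ^ 2) set" where
  "quad_facet h1 h2 h = {x \<in> quad_ball h1 h2. h \<bullet> x = 1}"

definition quadrilateral_norm :: "real ^ 2 \<Rightarrow> real ^ 2 \<Rightarrow> bool" where
  "quadrilateral_norm h1 h2 \<longleftrightarrow> is_norm (quad_norm h1 h2) \<and>
     (let F1 = quad_facet h1 h2 h1; F2 = quad_facet h1 h2 h2
      in {F. F facet_of quad_ball h1 h2} = {F1, uminus ` F1, F2, uminus ` F2} \<and>
         card {F1, uminus ` F1, F2, uminus ` F2} = 4)"


section \<open>Distinct edge orbits give distinct pairs of end-vertices and gain\<close>

lemma theta_facts:
  assumes "Z2_symmetric_graph E \<theta>"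
  shows "\<theta> (-1) (\<theta> (-1) v) = v" "bij (\<theta> (-1))" "{v, w} \<in> E \<Longrightarrow> {\<theta> (-1) v, \<theta> (-1) w} \<in> E"
proof -
  have h: "\<theta> \<in> hom Z2 (aut_group E)" using assms by (simp add: Z2_symmetric_graph_def)
  have b: "bij (\<theta> 1)" "bij (\<theta> (-1))" and i: "{\<theta> (-1) v, \<theta> (-1) w} \<in> E \<longleftrightarrow> {v, w} \<in> E" for v w
    using h by (auto simp: hom_def Z2_def aut_group_def Pi_def)
  have m: "\<theta> (1 * 1) = \<theta> 1 \<circ> \<theta> 1" "\<theta> (-1 * -1) = \<theta> (-1) \<circ> \<theta> (-1)"
    using h by (auto simp: hom_def Z2_def aut_group_def)
  have "\<theta> 1 (\<theta> 1 v) = \<theta> 1 v" using m(1) by (metis comp_apply mult_1)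
  then have "\<theta> 1 v = v" using b(1) by (simp add: bij_is_inj inj_eq)
  then show "\<theta> (-1) (\<theta> (-1) v) = v" using m(2) by (metis comp_apply minus_mult_minus mult_1)
  show "bij (\<theta> (-1))" by (fact b(2))
  show "{v, w} \<in> E \<Longrightarrow> {\<theta> (-1) v, \<theta> (-1) w} \<in> E" using i by blast
qed

lemma edge_normal_form:
  assumes G: "Z2_symmetric_graph E \<theta>" and R: "representatives \<theta> R" and "e \<in> E"
  obtains a b where "a \<in> R" "b \<in> R" "quotient_ends \<theta> (edge_orbit \<theta> e) = {vertex_orbit \<theta> a, vertex_orbit \<theta> b}"
    "edge_orbit \<theta> e = (if quotient_gain R (edge_orbit \<theta> e) = 1 then edge_orbit \<theta> {a, b}
                       else edge_orbit \<theta> {a, \<theta> (-1) b})"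
proof -
  let ?s = "\<theta> (-1)"
  have s: "?s (?s v) = v" for v using theta_facts(1)[OF G] .
  have orb: "vertex_orbit \<theta> v = vertex_orbit \<theta> w \<longleftrightarrow> v = w \<or> v = ?s w" for v w
    unfolding vertex_orbit_def using s by (metis doubleton_eq_iff)
  have Rs: "?s v \<in> R" if "v \<notin> R" for v
  proof -
    have "\<exists>!u. u \<in> vertex_orbit \<theta> v \<inter> R" using R by (simp add: representatives_def)
    then show ?thesis using that by (auto simp: vertex_orbit_def)
  qed
  have mem: "y = vertex_orbit \<theta> u \<longleftrightarrow> u \<in> y" if "y \<in> range (vertex_orbit \<theta>)" for y u
    using that by (force simp: vertex_orbit_def s)
  have ends: "quotient_ends \<theta> (edge_orbit \<theta> {v, w}) = {vertex_orbit \<theta> v, vertex_orbit \<theta> w}" for v w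
  proof -
    have "y \<in> quotient_ends \<theta> (edge_orbit \<theta> {v, w}) \<longleftrightarrow>
        y \<in> range (vertex_orbit \<theta>) \<and> (v \<in> y \<or> w \<in> y \<or> ?s v \<in> y \<or> ?s w \<in> y)" for y
      by (auto simp: quotient_ends_def edge_orbit_def)
    moreover have "vertex_orbit \<theta> (?s u) = vertex_orbit \<theta> u" for u using orb by blast
    ultimately have "y \<in> quotient_ends \<theta> (edge_orbit \<theta> {v, w}) \<longleftrightarrow>
        y \<in> range (vertex_orbit \<theta>) \<and> (y = vertex_orbit \<theta> v \<or> y = vertex_orbit \<theta> w)" for y
      using mem by metis
    then show ?thesis by blast
  qed
  have swap: "edge_orbit \<theta> {?s v, ?s w} = edge_orbit \<theta> {v, w}" for v w
    by (auto simp: edge_orbit_def s)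
  obtain v w where e: "e = {v, w}"
    using G \<open>e \<in> E\<close> by (metis Z2_symmetric_graph_def simple_graph_def card_2_iff)
  show thesis
  proof (cases "quotient_gain R (edge_orbit \<theta> e) = 1")
    case True
    then have "{v, w} \<subseteq> R \<or> {?s v, ?s w} \<subseteq> R"
      by (auto simp: quotient_gain_def edge_orbit_def e split: if_splits)
    then show thesis
      using that[of v w] that[of "?s v" "?s w"] True ends e swap by (metis insert_subset)
  next
    case False
    then have "\<not> {v, w} \<subseteq> R" "\<not> {?s v, ?s w} \<subseteq> R"
      by (auto simp: quotient_gain_def edge_orbit_def e split: if_splits)
    then consider "v \<in> R" "?s w \<in> R" | "?s v \<in> R" "w \<in> R" using Rs by blast
    then show thesis
    proof cases
      case 1
      then show thesis using that[of v "?s w"] False ends[of v w] orb[of "?s w" w] e s by simp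
    next
      case 2
      then show thesis using that[of "?s v" w] False ends[of v w] orb[of "?s v" v] e swap[of v w] by simp
    qed
  qed
qed

lemma quotient_edge_inj:
  assumes G: "Z2_symmetric_graph E \<theta>" and R: "representatives \<theta> R"
  shows "inj_on (quotient_edge \<theta> R) (edge_orbit \<theta> ` E)"
proof -
  have s: "\<theta> (-1) (\<theta> (-1) v) = v" for v using theta_facts(1)[OF G] .
  have inj: "a = b" if "a \<in> R" "b \<in> R" "vertex_orbit \<theta> a = vertex_orbit \<theta> b" for a b
    using R that unfolding representatives_def vertex_orbit_def by blast
  have "edge_orbit \<theta> e = edge_orbit \<theta> e'" if e: "e \<in> E" "e' \<in> E"
    and eq: "quotient_edge \<theta> R (edge_orbit \<theta> e) = quotient_edge \<theta> R (edge_orbit \<theta> e')" for e e'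
  proof -
    obtain a b where 1: "a \<in> R" "b \<in> R"
      "quotient_ends \<theta> (edge_orbit \<theta> e) = {vertex_orbit \<theta> a, vertex_orbit \<theta> b}"
      "edge_orbit \<theta> e = (if quotient_gain R (edge_orbit \<theta> e) = 1 then edge_orbit \<theta> {a, b}
                         else edge_orbit \<theta> {a, \<theta> (-1) b})"
      using edge_normal_form[OF G R e(1)] .
    obtain c d where 2: "c \<in> R" "d \<in> R"
      "quotient_ends \<theta> (edge_orbit \<theta> e') = {vertex_orbit \<theta> c, vertex_orbit \<theta> d}"
      "edge_orbit \<theta> e' = (if quotient_gain R (edge_orbit \<theta> e') = 1 then edge_orbit \<theta> {c, d}
                         else edge_orbit \<theta> {c, \<theta> (-1) d})"
      using edge_normal_form[OF G R e(2)] .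
    have "{vertex_orbit \<theta> a, vertex_orbit \<theta> b} = {vertex_orbit \<theta> c, vertex_orbit \<theta> d}"
      using 1(3) 2(3) eq by (simp add: quotient_edge_def)
    then have "a = c \<and> b = d \<or> a = d \<and> b = c"
      using inj 1(1,2) 2(1,2) by (metis doubleton_eq_iff)
    moreover have "edge_orbit \<theta> {a, b} = edge_orbit \<theta> {b, a}"
      "edge_orbit \<theta> {a, \<theta> (-1) b} = edge_orbit \<theta> {b, \<theta> (-1) a}"
      by (auto simp: edge_orbit_def s insert_commute)
    moreover have "quotient_gain R (edge_orbit \<theta> e) = quotient_gain R (edge_orbit \<theta> e')"
      using eq by (simp add: quotient_edge_def)
    ultimately show ?thesis using 1(4) 2(4) by (metis (full_types))
  qed
  then show ?thesis by (auto simp: inj_on_def)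
qed

end

theory Submission
  imports Defs
begin

text \<open>
  The functionals \<open>h1\<close> and \<open>h2\<close> are coordinates in which the norm is the maximum norm and the
  reflection changes the sign of the first coordinate. An edge of a well-positioned framework is
  longer in exactly one coordinate, and an infinitesimal flex must leave just this coordinate of the
  edge unchanged to first order. Trivial flexes are translations. A symmetric placement or flex
  is determined by its coordinates on the vertex orbits. So a symmetric framework becomes a pair of
  functions \<open>a\<close>, \<open>b\<close> on the vertices of the signed quotient graph: an edge \<open>xy\<close> of gain \<open>g\<close> is horizontal
  if \<open>\<bar>b x - b y\<bar> < \<bar>a x - g * a y\<bar>\<close> and vertical if the opposite strict inequality holds, and
  symmetric rigidity (\<open>rigidly_placed\<close>) says that the equations \<open>c x = g * c y\<close> on the horizontal
  edges force \<open>c = 0\<close> and the equations \<open>d x = d y\<close> on the vertical edges force \<open>d\<close> to be constant.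
  These equations have \<open>2 * card V\<close> unknowns and a solution space of dimension 1. Hence isostatic means
  rigid with \<open>2 * card V - 1\<close> edges (\<open>rigidly_placed_card\<close>, \<open>redundant_edge\<close>); a signed graph with such a
  placement is called realisable. The lemmas \<open>isostatic_imp_realisable\<close> and
  \<open>realisable_imp_isostatic\<close> identify the existence of an isostatic framework with realisability of the
  quotient. It remains to close a circle of three implications.

  Realisable signed graphs are tight by counting dimensions (\<open>rigidly_placed_sparse\<close>): an edge set
  with too many edges on its vertices leaves too few constraints for the other vertices.

  Tight signed graphs are constructible (\<open>tight_imp_constructible\<close>). Some vertex has degree at most 3,
  a loop counting twice. Degree 2 and a vertex with a loop are undone by a Henneberg 1 move, degree 3
  by a Henneberg 2 move, unless the edge that this requires is present or spanned by a set that already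
  attains a sparsity bound. Sets of this kind have unions of the same kind (\<open>full_Un\<close>,
  \<open>full_Un_balanced_full\<close>, \<open>balanced_full_Un\<close>), and from this it follows that a degree 3 vertex for
  which everything is blocked lies with its neighbours in a complete graph that is balanced. Either
  this graph can be contracted to a vertex, or a vertex outside sends two edges of equal gain to it;
  in the latter case a maximal balanced set of this shape contains a triangle that can be contracted
  (\<open>constructible_triangle_extension\<close>).

  Constructible signed graphs are realisable, since every move extends placements
  (\<open>realisable_move\<close>). Henneberg moves add one edge of each colour, or put the new vertex close to the
  line of the edge that is subdivided; the other two moves replace a vertex by a cluster of vertices
  very close to its old position (\<open>realisation_vertex_split\<close>).

  Balance is used throughout in the form of a potential, an assignment of signs to the vertices such
  that the gain of every edge is the product of the signs at its ends (\<open>balanced_imp_potential\<close>,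
  \<open>potential_imp_balanced\<close>).
\<close>

section \<open>Signed graphs and potentials\<close>

definition signed_graph :: "'a set \<Rightarrow> 'a sedge set \<Rightarrow> bool" where
  "signed_graph V E \<longleftrightarrow> finite V \<and>
     (\<forall>e\<in>E. \<exists>x\<in>V. \<exists>y\<in>V. \<exists>g\<in>{1,-1}. e = ({x, y}, g) \<and> (x = y \<longrightarrow> g = -1))"

text \<open>A switching function that turns every gain into 1. It also excludes loops, whose gain is \<open>-1\<close>
  while the product of a sign with itself is 1.\<close>

definition potential :: "('a \<Rightarrow> int) \<Rightarrow> 'a sedge set \<Rightarrow> bool" where
  "potential \<sigma> F \<longleftrightarrow> (\<forall>x. \<sigma> x = 1 \<or> \<sigma> x = -1) \<and> (\<forall>x y g. ({x, y}, g) \<in> F \<longrightarrow> g = \<sigma> x * \<sigma> y)"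

text \<open>The bounds refer to any vertex set that contains the incident vertices. Such sets are closed under
  union and intersection even where the edge sets meet in nothing, which is what the counting
  arguments below need.\<close>

definition sparse_edges :: "'a sedge set \<Rightarrow> bool" where
  "sparse_edges E \<longleftrightarrow> (\<forall>F X. F \<subseteq> E \<longrightarrow> finite X \<longrightarrow> X \<noteq> {} \<longrightarrow> incident_verts F \<subseteq> X \<longrightarrow>
     card F + 1 \<le> 2 * card X \<and> ((\<exists>\<sigma>. potential \<sigma> F) \<longrightarrow> card F + 2 \<le> 2 * card X))"

definition tight :: "'a set \<Rightarrow> 'a sedge set \<Rightarrow> bool" where
  "tight V E \<longleftrightarrow> signed_graph V E \<and> sparse_edges E \<and> card E + 1 = 2 * card V"

lemma signed_graph_edgeE:
  assumes "signed_graph V E" "e \<in> E"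
  obtains x y g where "x \<in> V" "y \<in> V" "g = 1 \<or> g = -1" "e = ({x, y}, g)" "x = y \<Longrightarrow> g = -1"
  using assms unfolding signed_graph_def by blast

text \<open>An edge can be written as \<open>({x, y}, g)\<close> in two ways; the data of an edge do not depend on the choice.\<close>

lemma signed_graph_memD:
  assumes "signed_graph V E" "({x, y}, g) \<in> E"
  shows "x \<in> V" "y \<in> V" "g = 1 \<or> g = -1" "x = y \<Longrightarrow> g = -1"
proof -
  obtain a b h where "a \<in> V" "b \<in> V" "h = 1 \<or> h = -1" "({x,y},g) = ({a, b}, h)" "a = b \<Longrightarrow> h = -1"
    using signed_graph_edgeE[OF assms] by metis
  then show "x \<in> V" "y \<in> V" "g = 1 \<or> g = -1" "x = y \<Longrightarrow> g = -1"
    by (auto simp: doubleton_eq_iff)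
qed

lemma signed_graphI:
  assumes "finite V"
    and "\<And>e. e \<in> E \<Longrightarrow> \<exists>x y g. e = ({x, y}, g) \<and> x \<in> V \<and> y \<in> V \<and> (g = 1 \<or> g = -1) \<and> (x = y \<longrightarrow> g = -1)"
  shows "signed_graph V E"
  unfolding signed_graph_def
proof (intro conjI ballI)
  fix e assume "e \<in> E"
  then obtain x y g where "e = ({x, y}, g)" "x \<in> V" "y \<in> V" "g = 1 \<or> g = -1" "x = y \<longrightarrow> g = -1"
    using assms(2) by blast
  then show "\<exists>x\<in>V. \<exists>y\<in>V. \<exists>g\<in>{1,-1}. e = ({x, y}, g) \<and> (x = y \<longrightarrow> g = -1)"
    by (intro bexI[of _ x] bexI[of _ y] bexI[of _ g]) auto
qed (rule assms(1))

lemma signed_quotient_graph_iff: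
  "signed_quotient_graph H \<longleftrightarrow> signed_graph (verts H) (edges H)"
proof
  assume H: "signed_quotient_graph H"
  show "signed_graph (verts H) (edges H)"
  proof (rule signed_graphI)
    show "finite (verts H)" using H by (simp add: signed_quotient_graph_def)
    fix e assume "e \<in> edges H"
    then obtain S g where e: "e = (S, g)" "S \<subseteq> verts H" "card S = 1 \<or> card S = 2" "g \<in> {1, -1}"
      "card S = 1 \<longrightarrow> g = -1"
      using H unfolding signed_quotient_graph_def by blast
    from e(3) obtain x y where "S = {x, y}" by (metis card_1_singletonE card_2_iff insert_absorb2)
    then show "\<exists>x y g. e = ({x, y}, g) \<and> x \<in> verts H \<and> y \<in> verts H \<and> (g = 1 \<or> g = -1) \<and> (x = y \<longrightarrow> g = -1)"
      using e by (intro exI[of _ x] exI[of _ y] exI[of _ g]) auto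
  qed
next
  assume H: "signed_graph (verts H) (edges H)"
  show "signed_quotient_graph H"
    unfolding signed_quotient_graph_def
  proof (intro conjI ballI)
    show "finite (verts H)" using H by (simp add: signed_graph_def)
    fix e assume "e \<in> edges H"
    then obtain x y g where "x \<in> verts H" "y \<in> verts H" "g = 1 \<or> g = -1" "e = ({x, y}, g)" "x = y \<Longrightarrow> g = -1"
      using signed_graph_edgeE[OF H] by metis
    then show "case e of (S, g) \<Rightarrow> S \<subseteq> verts H \<and> (card S = 1 \<or> card S = 2) \<and> g \<in> {1, -1} \<and> (card S = 1 \<longrightarrow> g = -1)"
      by (cases "x = y") auto
  qed
qed

lemma incident_verts_simps [simp]:
  "incident_verts {} = {}" "incident_verts (insert e F) = fst e \<union> incident_verts F"
  "incident_verts (F \<union> F') = incident_verts F \<union> incident_verts F'"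
  by (auto simp: incident_verts_def)

lemma incident_vertsI: "(S, g) \<in> F \<Longrightarrow> x \<in> S \<Longrightarrow> x \<in> incident_verts F"
  by (force simp: incident_verts_def)

lemma incident_verts_mono: "F \<subseteq> F' \<Longrightarrow> incident_verts F \<subseteq> incident_verts F'"
  by (auto simp: incident_verts_def)

lemma signed_graph_incident: "signed_graph V E \<Longrightarrow> incident_verts E \<subseteq> V"
  unfolding signed_graph_def incident_verts_def by force

lemma signed_graph_mono: "signed_graph V E \<Longrightarrow> F \<subseteq> E \<Longrightarrow> signed_graph V F"
  unfolding signed_graph_def by blast

lemma signed_graph_finite_edges:
  assumes "signed_graph V E" shows "finite E"
proof (rule finite_subset)
  show "E \<subseteq> (\<lambda>(x, y, g). ({x, y}, g)) ` (V \<times> V \<times> {1, -1})"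
  proof
    fix e assume "e \<in> E"
    then obtain x y g where "x \<in> V" "y \<in> V" "g = 1 \<or> g = -1" "e = ({x, y}, g)"
      using signed_graph_edgeE[OF assms] by metis
    then show "e \<in> (\<lambda>(x, y, g). ({x, y}, g)) ` (V \<times> V \<times> {1, -1})"
      by (intro image_eqI[of _ _ "(x, y, g)"]) auto
  qed
  show "finite ((\<lambda>(x, y, g). ({x, y}, g :: int)) ` (V \<times> V \<times> {1, -1}))"
    using assms by (simp add: signed_graph_def)
qed

lemma potential_mono: "potential \<sigma> F \<Longrightarrow> F' \<subseteq> F \<Longrightarrow> potential \<sigma> F'"
  unfolding potential_def by blast

lemma potential_Un: "potential \<sigma> F \<Longrightarrow> potential \<sigma> F' \<Longrightarrow> potential \<sigma> (F \<union> F')"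
  unfolding potential_def by blast

lemma potential_cong:
  assumes "potential \<sigma> F" "\<And>x. \<sigma>' x = 1 \<or> \<sigma>' x = -1" "\<And>x. x \<in> incident_verts F \<Longrightarrow> \<sigma>' x = \<sigma> x"
  shows "potential \<sigma>' F"
  unfolding potential_def
proof (intro conjI allI impI)
  fix x y g assume "({x, y}, g) \<in> F"
  then have "x \<in> incident_verts F" "y \<in> incident_verts F" "g = \<sigma> x * \<sigma> y"
    using assms(1) by (auto intro: incident_vertsI simp: potential_def)
  then show "g = \<sigma>' x * \<sigma>' y" using assms(3) by simp
qed (rule assms(2))

lemma potential_uminus: "potential \<sigma> F \<Longrightarrow> potential (\<lambda>x. - \<sigma> x) F"
  unfolding potential_def by fastforce

lemma potential_insert:
  assumes "potential \<sigma> F" "g = \<sigma> x * \<sigma> y"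
  shows "potential \<sigma> (insert ({x, y}, g) F)"
  using assms unfolding potential_def by (auto simp: doubleton_eq_iff)

lemma potential_sign: "potential \<sigma> F \<Longrightarrow> \<sigma> x = 1 \<or> \<sigma> x = -1"
  by (simp add: potential_def)

lemma sign_square: "\<sigma> x = 1 \<or> \<sigma> x = -1 \<Longrightarrow> \<sigma> x * \<sigma> x = (1::int)"
  by auto

section \<open>Balance is the existence of a potential\<close>

text \<open>Around a cycle every vertex sign occurs twice in the product of the gains, once for each of the two
  edges that meet there.\<close>

lemma potential_imp_balanced:
  assumes "potential \<sigma> F" shows "balanced F"
  unfolding balanced_def
proof (intro allI impI)
  fix vs es assume c: "cycle F vs es"
  define n where "n = length vs"
  have n: "n > 0" "length es = n" using c by (auto simp: cycle_def n_def)
  \<comment> \<open>the cyclic shift of the positions on the cycle\<close>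
  let ?f = "\<lambda>i. Suc i mod n"
  have f: "?f ` {0..<n} = {0..<n}" "inj_on ?f {0..<n}"
  proof -
    show "inj_on ?f {0..<n}" by (auto simp: inj_on_def mod_Suc split: if_splits)
    then show "?f ` {0..<n} = {0..<n}" using n(1) by (intro endo_inj_surj) auto
  qed
  have e: "snd (es ! i) = \<sigma> (vs ! i) * \<sigma> (vs ! ?f i)" if "i < n" for i
  proof -
    have "es ! i \<in> F" "fst (es ! i) = {vs ! i, vs ! ?f i}"
      using c that n by (auto simp: cycle_def n_def)
    then have "({vs ! i, vs ! ?f i}, snd (es ! i)) \<in> F" by (metis prod.collapse)
    then show ?thesis using assms by (simp add: potential_def)
  qed
  have "prod_list (map snd es) = (\<Prod>i = 0..<n. snd (es ! i))"
    using n by (simp add: prod.list_conv_set_nth)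
  also have "\<dots> = (\<Prod>i = 0..<n. \<sigma> (vs ! i)) * (\<Prod>i = 0..<n. \<sigma> (vs ! ?f i))"
    using e by (simp add: prod.distrib)
  also have "(\<Prod>i = 0..<n. \<sigma> (vs ! ?f i)) = (\<Prod>i\<in>?f ` {0..<n}. \<sigma> (vs ! i))"
    using prod.reindex[OF f(2), of "\<lambda>i. \<sigma> (vs ! i)"] by simp
  also have "(\<Prod>i = 0..<n. \<sigma> (vs ! i)) * \<dots> = (\<Prod>i = 0..<n. \<sigma> (vs ! i) * \<sigma> (vs ! i))"
    unfolding f(1) by (simp add: prod.distrib)
  also have "\<dots> = 1"
    using assms by (intro prod.neutral) (simp add: potential_def sign_square)
  finally show "prod_list (map snd es) = 1" .
qed

text \<open>Only repeated vertices are excluded; distinct edges follow. The list of vertices is one longer than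
  the list of edges.\<close>

definition vertex_path :: "'a sedge set \<Rightarrow> 'a list \<Rightarrow> 'a sedge list \<Rightarrow> bool" where
  "vertex_path F vs es \<longleftrightarrow> distinct vs \<and> length vs = Suc (length es) \<and> set es \<subseteq> F \<and>
     (\<forall>i<length es. fst (es ! i) = {vs ! i, vs ! Suc i})"

text \<open>The set of end-vertices of paths from a given vertex is closed under adjacency: a path that already
  visits the new vertex is cut off there.\<close>

lemma vertex_path_extend:
  assumes p: "vertex_path F vs es" and e: "({last vs, z}, g) \<in> F"
  obtains vs' es' where "vertex_path F vs' es'" "hd vs' = hd vs" "last vs' = z"
proof (cases "z \<in> set vs")
  case True
  then obtain k where k: "k < length vs" "vs ! k = z" by (metis in_set_conv_nth)
  have "vertex_path F (take (Suc k) vs) (take k es)"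
    using p k set_take_subset[of k es] by (auto simp: vertex_path_def)
  moreover have "hd (take (Suc k) vs) = hd vs" by simp
  moreover have "last (take (Suc k) vs) = z" using k by (simp add: last_conv_nth take_Suc_conv_app_nth)
  ultimately show thesis using that by blast
next
  case False
  have ne: "vs \<noteq> []" using p by (auto simp: vertex_path_def)
  then have l: "last vs = vs ! length es" using p by (simp add: vertex_path_def last_conv_nth)
  have "vertex_path F (vs @ [z]) (es @ [({last vs, z}, g)])"
    unfolding vertex_path_def
  proof (intro conjI allI impI)
    fix i assume i: "i < length (es @ [({last vs, z}, g)])"
    show "fst ((es @ [({last vs, z}, g)]) ! i) = {(vs @ [z]) ! i, (vs @ [z]) ! Suc i}"
    proof (cases "i < length es")
      case True then show ?thesis using p by (simp add: vertex_path_def nth_append)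
    next
      case False
      then have "i = length es" using i by simp
      then show ?thesis using p l by (simp add: vertex_path_def nth_append)
    qed
  qed (use p e False in \<open>auto simp: vertex_path_def\<close>)
  then show thesis using that[of "vs @ [z]"] ne by simp
qed

lemma vertex_path_distinct_edges:
  assumes "vertex_path F vs es" shows "distinct es"
  unfolding distinct_conv_nth
proof (intro allI impI)
  fix i j assume ij: "i < length es" "j < length es" "i \<noteq> j"
  have eq: "vs ! k = vs ! l \<longleftrightarrow> k = l" if "k \<le> length es" "l \<le> length es" for k l
    using assms that by (simp add: vertex_path_def nth_eq_iff_index_eq)
  have "{vs ! i, vs ! Suc i} \<noteq> {vs ! j, vs ! Suc j}"
    using ij by (auto simp: doubleton_eq_iff eq)
  then show "es ! i \<noteq> es ! j" using assms ij by (metis vertex_path_def)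
qed

text \<open>The gain of a path telescopes to the product of the signs of its two ends.\<close>

lemma vertex_path_gain:
  assumes "vertex_path F vs es" "potential \<sigma> F"
  shows "prod_list (map snd es) = \<sigma> (hd vs) * \<sigma> (last vs)"
proof -
  have e: "snd (es ! i) = \<sigma> (vs ! i) * \<sigma> (vs ! Suc i)" if "i < length es" for i
  proof -
    have "es ! i \<in> F" "fst (es ! i) = {vs ! i, vs ! Suc i}"
      using assms(1) that by (auto simp: vertex_path_def)
    then have "({vs ! i, vs ! Suc i}, snd (es ! i)) \<in> F" by (metis prod.collapse)
    then show ?thesis using assms(2) by (simp add: potential_def)
  qed
  have s: "\<sigma> x * \<sigma> x = 1" for x using assms(2) by (simp add: potential_def sign_square)
  have tele: "(\<Prod>i = 0..<m. \<sigma> (vs ! i) * \<sigma> (vs ! Suc i)) = \<sigma> (vs ! 0) * \<sigma> (vs ! m)" for m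
  proof (induction m)
    case (Suc m)
    have "\<sigma> (vs ! 0) * \<sigma> (vs ! m) * (\<sigma> (vs ! m) * \<sigma> (vs ! Suc m))
        = \<sigma> (vs ! 0) * (\<sigma> (vs ! m) * \<sigma> (vs ! m)) * \<sigma> (vs ! Suc m)" by (simp add: ac_simps)
    then show ?case using Suc s by simp
  qed (simp add: s)
  have "vs \<noteq> []" using assms(1) by (auto simp: vertex_path_def)
  then have "hd vs = vs ! 0" "last vs = vs ! length es"
    using assms(1) by (auto simp: vertex_path_def hd_conv_nth last_conv_nth)
  moreover have "prod_list (map snd es) = (\<Prod>i = 0..<length es. snd (es ! i))"
    by (simp add: prod.list_conv_set_nth)
  ultimately show ?thesis using e tele by simp
qed

lemma balanced_mono: "balanced F \<Longrightarrow> F' \<subseteq> F \<Longrightarrow> balanced F'"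
  unfolding balanced_def cycle_def by (meson subset_trans)

text \<open>Edges are added one at a time. If the ends \<open>x\<close>, \<open>y\<close> of the new edge are joined by a path of old
  edges, the cycle that the new edge closes has gain 1, and this says that the old potential fits the
  new edge. Otherwise the potential may be negated on the component of \<open>y\<close>, and one of the two
  choices fits.\<close>

lemma balanced_imp_potential:
  assumes "signed_graph V F" "balanced F"
  shows "\<exists>\<sigma>. potential \<sigma> F"
proof -
  have "finite F" using assms(1) by (rule signed_graph_finite_edges)
  then show ?thesis using assms
  proof (induction F rule: finite_induct)
    case empty
    then show ?case by (intro exI[of _ "\<lambda>_. 1"]) (simp add: potential_def)
  next
    case (insert e F)
    then obtain \<sigma> where \<sigma>: "potential \<sigma> F"
      by (metis balanced_mono signed_graph_mono subset_insertI)
    obtain x y g where e: "e = ({x, y}, g)" and g: "g = 1 \<or> g = -1"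
      using insert.prems(1) by (metis insertI1 signed_graph_edgeE)
      \<comment> \<open>the component of \<open>y\<close> before the new edge is added\<close>
  define C where "C = {z. \<exists>vs es. vertex_path F vs es \<and> hd vs = y \<and> last vs = z}"
    have yC: "y \<in> C" unfolding C_def mem_Collect_eq
      by (rule exI[of _ "[y]"], rule exI[of _ "[]"]) (simp add: vertex_path_def)
    have step: "z' \<in> C" if zC: "z \<in> C" and F: "({z, z'}, h) \<in> F" for z z' h
    proof -
      obtain vs es where "vertex_path F vs es" "hd vs = y" "last vs = z"
        using zC unfolding C_def by blast
      then obtain vs' es' where "vertex_path F vs' es'" "hd vs' = y" "last vs' = z'"
        using vertex_path_extend F by metis
      then show ?thesis unfolding C_def by blast
    qed
    show ?case
    proof (cases "x \<in> C")
      case True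
      then obtain vs es where p: "vertex_path F vs es" "hd vs = y" "last vs = x"
        unfolding C_def by blast
      have "cycle (insert e F) vs (es @ [e])"
        unfolding cycle_def
      proof (intro conjI allI impI)
        fix i assume i: "i < length vs"
        have vs: "vs \<noteq> []" "length vs = Suc (length es)" using p(1) by (auto simp: vertex_path_def)
        have "vs ! 0 = y" "vs ! length es = x" using p vs by (auto simp: hd_conv_nth last_conv_nth)
        moreover have "i < length es \<or> i = length es" using i vs by auto
        ultimately show "fst ((es @ [e]) ! i) = {vs ! i, vs ! (Suc i mod length vs)}"
          using p(1) vs e by (auto simp: vertex_path_def nth_append)
      qed (use p insert.hyps vertex_path_distinct_edges[OF p(1)] in \<open>auto simp: vertex_path_def\<close>)
      then have "prod_list (map snd (es @ [e])) = 1"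
        using insert.prems(2) unfolding balanced_def by blast
      then have "\<sigma> y * \<sigma> x * g = 1" using vertex_path_gain[OF p(1) \<sigma>] p e by simp
      then have "g = \<sigma> x * \<sigma> y"
        using potential_sign[OF \<sigma>, of x] potential_sign[OF \<sigma>, of y] g by auto
      then show ?thesis using potential_insert[OF \<sigma>] e by blast
    next
      case False
      define \<sigma>' where "\<sigma>' z = (if z \<in> C then g * \<sigma> x * \<sigma> y * \<sigma> z else \<sigma> z)" for z
      have sg: "\<sigma> z = 1 \<or> \<sigma> z = -1" for z using potential_sign[OF \<sigma>] .
      have "potential \<sigma>' F" unfolding potential_def
      proof (intro conjI allI impI)
        show "\<sigma>' z = 1 \<or> \<sigma>' z = -1" for z
          using sg[of z] sg[of x] sg[of y] g unfolding \<sigma>'_def by auto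
        fix a b h assume ab: "({a, b}, h) \<in> F"
        then have "a \<in> C \<longleftrightarrow> b \<in> C" using step by (metis insert_commute)
        moreover have "h = \<sigma> a * \<sigma> b" using \<sigma> ab by (simp add: potential_def)
        ultimately show "h = \<sigma>' a * \<sigma>' b"
          using sg[of x] sg[of y] g unfolding \<sigma>'_def by auto
      qed
      moreover have "g = \<sigma>' x * \<sigma>' y"
        using sg[of x] sg[of y] g yC False unfolding \<sigma>'_def by auto
      ultimately show ?thesis unfolding e by (intro exI[of _ \<sigma>'] potential_insert)
    qed
  qed
qed

text \<open>Enlarging the vertex set weakens the bounds, so it suffices to compare them on the incident vertices.\<close>

lemma gain_sparse_iff:
  assumes "signed_graph (verts H) (edges H)"
  shows "gain_sparse H \<longleftrightarrow> sparse_edges (edges H)"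
proof
  assume gs: "gain_sparse H"
  show "sparse_edges (edges H)" unfolding sparse_edges_def
  proof (intro allI impI)
    fix F X assume F: "F \<subseteq> edges H" "finite X" "X \<noteq> {}" "incident_verts F \<subseteq> X"
    have c: "card (incident_verts F) \<le> card X" "card X \<ge> 1"
      using F by (auto intro: card_mono simp: Suc_le_eq card_gt_0_iff)
    show "card F + 1 \<le> 2 * card X \<and> ((\<exists>\<sigma>. potential \<sigma> F) \<longrightarrow> card F + 2 \<le> 2 * card X)"
    proof (cases "F = {}")
      case False
      then have 1: "int (card F) \<le> 2 * int (card (incident_verts F)) - 1" 
        and 2: "balanced F \<Longrightarrow> int (card F) \<le> 2 * int (card (incident_verts F)) - 2"
        using gs F(1) unfolding gain_sparse_def by blast+
      show ?thesis
      proof (intro conjI impI)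
        show "card F + 1 \<le> 2 * card X" using 1 c by linarith
        assume "\<exists>\<sigma>. potential \<sigma> F"
        then have "balanced F" using potential_imp_balanced by blast
        then show "card F + 2 \<le> 2 * card X" using 2 c by linarith
      qed
    qed (use c in auto)
  qed
next
  assume sp: "sparse_edges (edges H)"
  have *: "int (card F) \<le> 2 * int (card (incident_verts F)) - 1 \<and>
      (balanced F \<longrightarrow> int (card F) \<le> 2 * int (card (incident_verts F)) - 2)"
    if F: "F \<subseteq> edges H" "F \<noteq> {}" for F
  proof -
    have "incident_verts F \<subseteq> verts H"
      using signed_graph_incident[OF signed_graph_mono[OF assms F(1)]] .
    then have fin: "finite (incident_verts F)" using assms by (meson finite_subset signed_graph_def)
    obtain e where "e \<in> F" using F(2) by blast
    then obtain x y g where "({x, y}, g) \<in> F" using signed_graph_edgeE[OF assms] F(1) by (metis subsetD)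
    then have "incident_verts F \<noteq> {}" using incident_vertsI by fastforce
    then have "card F + 1 \<le> 2 * card (incident_verts F)"
      and 2: "(\<exists>\<sigma>. potential \<sigma> F) \<Longrightarrow> card F + 2 \<le> 2 * card (incident_verts F)"
      using sp F(1) fin unfolding sparse_edges_def by blast+
    moreover have "balanced F \<Longrightarrow> card F + 2 \<le> 2 * card (incident_verts F)"
      using 2 balanced_imp_potential[OF signed_graph_mono[OF assms F(1)]] by blast
    ultimately show ?thesis by linarith
  qed
  show "gain_sparse H" unfolding gain_sparse_def using * by blast
qed

lemma tight_iff:
  "signed_quotient_graph H \<and> gain_tight H \<longleftrightarrow> tight (verts H) (edges H)"
proof -
  have "int (card (edges H)) = 2 * int (card (verts H)) - 1 \<longleftrightarrow> card (edges H) + 1 = 2 * card (verts H)"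
    by linarith
  then show ?thesis
    unfolding signed_quotient_graph_iff gain_tight_def tight_def
    using gain_sparse_iff[of H] by blast
qed

section \<open>Full sets\<close>

lemma sparse_edgesD:
  assumes "sparse_edges E" "F \<subseteq> E" "finite X" "X \<noteq> {}" "incident_verts F \<subseteq> X"
  shows "card F + 1 \<le> 2 * card X" "potential \<sigma> F \<Longrightarrow> card F + 2 \<le> 2 * card X"
proof -
  have *: "card F + 1 \<le> 2 * card X \<and> ((\<exists>\<sigma>. potential \<sigma> F) \<longrightarrow> card F + 2 \<le> 2 * card X)"
    using assms(1)[unfolded sparse_edges_def, rule_format, OF assms(2-5)] .
  show "card F + 1 \<le> 2 * card X" using * by (rule conjunct1)
  show "potential \<sigma> F \<Longrightarrow> card F + 2 \<le> 2 * card X" using * by (metis)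
qed

lemma tightD:
  assumes "tight V E"
  shows "signed_graph V E" "sparse_edges E" "card E + 1 = 2 * card V" "finite V" "finite E" "incident_verts E \<subseteq> V"
proof -
  show sg: "signed_graph V E" and "sparse_edges E" "card E + 1 = 2 * card V"
    using assms by (simp_all add: tight_def)
  show "finite V" using sg by (simp add: signed_graph_def)
  show "finite E" using sg by (rule signed_graph_finite_edges)
  show "incident_verts E \<subseteq> V" using sg by (rule signed_graph_incident)
qed

text \<open>Together with \<open>balanced_full\<close>, the obstructions to adding an edge: an edge with both ends in a full
  set violates the first sparsity bound, and one that also respects the potential of a balanced full
  set violates the second.\<close>

definition full :: "'a sedge set \<Rightarrow> 'a sedge set \<Rightarrow> 'a set \<Rightarrow> bool" where
  "full E F X \<longleftrightarrow> F \<subseteq> E \<and> finite X \<and> X \<noteq> {} \<and> incident_verts F \<subseteq> X \<and> 2 * card X \<le> card F + 1"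

definition balanced_full :: "('a \<Rightarrow> int) \<Rightarrow> 'a sedge set \<Rightarrow> 'a sedge set \<Rightarrow> 'a set \<Rightarrow> bool" where
  "balanced_full \<sigma> E F X \<longleftrightarrow>
     F \<subseteq> E \<and> finite X \<and> X \<noteq> {} \<and> incident_verts F \<subseteq> X \<and> potential \<sigma> F \<and> 2 * card X \<le> card F + 2"

lemma incident_verts_Int: "incident_verts F \<subseteq> X \<Longrightarrow> incident_verts F' \<subseteq> X' \<Longrightarrow> incident_verts (F \<inter> F') \<subseteq> X \<inter> X'"
  by (rule Int_greatest; rule order_trans[OF incident_verts_mono]) auto

lemma sparse_edges_Int:
  assumes "sparse_edges E" "F \<subseteq> E" "finite X" "incident_verts F \<subseteq> X" "incident_verts F' \<subseteq> X'" "X \<inter> X' \<noteq> {}"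
  shows "card (F \<inter> F') + 1 \<le> 2 * card (X \<inter> X')"
    "potential \<sigma> F' \<Longrightarrow> card (F \<inter> F') + 2 \<le> 2 * card (X \<inter> X')"
proof -
  have 1: "F \<inter> F' \<subseteq> E" using assms(2) by blast
  have 2: "finite (X \<inter> X')" using assms(3) by simp
  have 3: "incident_verts (F \<inter> F') \<subseteq> X \<inter> X'" by (rule incident_verts_Int[OF assms(4,5)])
  show "card (F \<inter> F') + 1 \<le> 2 * card (X \<inter> X')"
    by (rule sparse_edgesD(1)[OF assms(1) 1 2 assms(6) 3])
  assume "potential \<sigma> F'"
  then have "potential \<sigma> (F \<inter> F')" by (rule potential_mono) simp
  then show "card (F \<inter> F') + 2 \<le> 2 * card (X \<inter> X')"
    by (rule sparse_edgesD(2)[OF assms(1) 1 2 assms(6) 3])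
qed

lemma card_Un_Int_both:
  assumes "finite F" "finite F'" "finite X" "finite X'"
  shows "card F + card F' = card (F \<union> F') + card (F \<inter> F')" "card X + card X' = card (X \<union> X') + card (X \<inter> X')"
  by (rule card_Un_Int[OF assms(1,2)], rule card_Un_Int[OF assms(3,4)])

text \<open>Sets of edges and of vertices are counted by inclusion and exclusion; the intersection satisfies the
  sparsity bound, so the union attains it.\<close>

lemma full_Un:
  assumes "tight V E" "full E F X" "full E F' X'" "X \<inter> X' \<noteq> {}"
  shows "full E (F \<union> F') (X \<union> X')"
proof -
  note a = assms(2,3)[unfolded full_def] and t = tightD[OF assms(1)]
  have fin: "finite F" "finite F'" using a t(5) by (meson finite_subset)+
  have "card (F \<inter> F') + 1 \<le> 2 * card (X \<inter> X')"
    using a by (intro sparse_edges_Int(1)[OF t(2) _ _ _ _ assms(4)]) simp_all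
  moreover have "card F + card F' = card (F \<union> F') + card (F \<inter> F')" "card X + card X' = card (X \<union> X') + card (X \<inter> X')"
    by (rule card_Un_Int_both; use fin a in simp)+
  ultimately have "2 * card (X \<union> X') \<le> card (F \<union> F') + 1" using a by linarith
  then show ?thesis using a by (auto simp: full_def)
qed

text \<open>The intersection inherits the potential and satisfies the sharper bound, which makes up for the
  deficit of one edge in a balanced full set.\<close>

lemma full_Un_balanced_full:
  assumes "tight V E" "full E F X" "balanced_full \<sigma> E F' X'" "X \<inter> X' \<noteq> {}"
  shows "full E (F \<union> F') (X \<union> X')"
proof -
  note a = assms(2)[unfolded full_def] and b = assms(3)[unfolded balanced_full_def] and t = tightD[OF assms(1)]
  have fin: "finite F" "finite F'" using a b t(5) by (meson finite_subset)+
  have "card (F \<inter> F') + 2 \<le> 2 * card (X \<inter> X')"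
    using a b by (intro sparse_edges_Int(2)[OF t(2) _ _ _ _ assms(4), of _ _ \<sigma>]) simp_all
  moreover have "card F + card F' = card (F \<union> F') + card (F \<inter> F')" "card X + card X' = card (X \<union> X') + card (X \<inter> X')"
    by (rule card_Un_Int_both; use fin a b in simp)+
  ultimately have "2 * card (X \<union> X') \<le> card (F \<union> F') + 1" using a b by linarith
  then show ?thesis using a b by (auto simp: full_def)
qed

text \<open>The ratio of two potentials is constant along edges, so every edge lies either where they agree or
  where they differ. If both parts were nonempty, the balanced bound for each part would leave at most
  \<open>2 * card X - 4\<close> edges. The hypothesis on the number of edges thus replaces connectedness.\<close>

lemma potentials_agree:
  assumes t: "tight V E" and F: "F \<subseteq> E" "finite X" "incident_verts F \<subseteq> X"
    and pot: "potential \<sigma> F" "potential \<sigma>' F" and x: "x \<in> X" "\<sigma> x = \<sigma>' x"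
    and c: "2 * card X \<le> card F + 3" and y: "y \<in> X"
  shows "\<sigma> y = \<sigma>' y"
proof (rule ccontr)
  assume ne: "\<sigma> y \<noteq> \<sigma>' y"
  define A where "A = {z \<in> X. \<sigma> z = \<sigma>' z}"
  define B where "B = {z \<in> X. \<sigma> z \<noteq> \<sigma>' z}"
  define FA where "FA = {e \<in> F. fst e \<subseteq> A}"
  define FB where "FB = {e \<in> F. fst e \<subseteq> B}"
  have sub: "FA \<subseteq> F" "FB \<subseteq> F" by (auto simp: FA_def FB_def)
  have "e \<in> FA \<union> FB" if e: "e \<in> F" for e
  proof -
    obtain a b g where e': "e = ({a, b}, g)" using signed_graph_edgeE[OF tightD(1)[OF t]] e F(1) by (metis subsetD)
    have ab: "a \<in> X" "b \<in> X" using e e' F(3) incident_vertsI[of "{a,b}" g F] by auto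
    have "\<sigma> a * \<sigma> b = \<sigma>' a * \<sigma>' b" using pot e e' unfolding potential_def by metis
    then have "\<sigma> a = \<sigma>' a \<longleftrightarrow> \<sigma> b = \<sigma>' b"
      using potential_sign[OF pot(1), of a] potential_sign[OF pot(1), of b]
        potential_sign[OF pot(2), of a] potential_sign[OF pot(2), of b] by auto
    then show ?thesis using ab e e' by (auto simp: A_def B_def FA_def FB_def)
  qed
  then have F_eq: "F = FA \<union> FB" using sub by blast
  have fin: "finite A" "finite B" using F(2) by (auto simp: A_def B_def)
  have "card FA + 2 \<le> 2 * card A"
  proof (rule sparse_edgesD(2)[OF tightD(2)[OF t]])
    show "potential \<sigma> FA" using potential_mono[OF pot(1) sub(1)] .
  qed (use sub F fin x in \<open>auto simp: A_def FA_def incident_verts_def\<close>)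
  moreover have "card FB + 2 \<le> 2 * card B"
  proof (rule sparse_edgesD(2)[OF tightD(2)[OF t]])
    show "potential \<sigma> FB" using potential_mono[OF pot(1) sub(2)] .
  qed (use sub F fin y ne in \<open>auto simp: B_def FB_def incident_verts_def\<close>)
  moreover have "card F \<le> card FA + card FB" unfolding F_eq by (rule card_Un_le)
  moreover have "card A + card B = card X"
  proof -
    have "X = A \<union> B" "A \<inter> B = {}" by (auto simp: A_def B_def)
    then show ?thesis using fin card_Un_disjoint by metis
  qed
  ultimately show False using c by linarith
qed

text \<open>The intersection has at most \<open>2m - 2\<close> edges on its \<open>m\<close> vertices. With fewer, the union has an edge
  to spare and is full. With exactly that many, the two potentials agree on the common vertices and
  can be glued.\<close>

lemma balanced_full_Un:
  assumes t: "tight V E" and b: "balanced_full \<sigma> E F X" and b': "balanced_full \<sigma>' E F' X'"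
    and x: "x \<in> X" "x \<in> X'" "\<sigma> x = \<sigma>' x"
  obtains "full E (F \<union> F') (X \<union> X')"
  | \<tau> where "balanced_full \<tau> E (F \<union> F') (X \<union> X')" "\<And>y. y \<in> X \<Longrightarrow> \<tau> y = \<sigma> y" "\<And>y. y \<in> X' \<Longrightarrow> \<tau> y = \<sigma>' y"
proof -
  note a = b[unfolded balanced_full_def] and a' = b'[unfolded balanced_full_def] and t' = tightD[OF t]
  have fin: "finite F" "finite F'" using a a' t'(5) by (meson finite_subset)+
  have eq: "card F + card F' = card (F \<union> F') + card (F \<inter> F')" "card X + card X' = card (X \<union> X') + card (X \<inter> X')"
    by (rule card_Un_Int_both; use fin a a' in simp)+
  have pots: "potential \<sigma> (F \<inter> F')" "potential \<sigma>' (F \<inter> F')"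
    using a a' by (meson potential_mono inf_le1 inf_le2)+
  have le: "card (F \<inter> F') + 2 \<le> 2 * card (X \<inter> X')"
    using a a' x by (intro sparse_edges_Int(2)[OF t'(2), of F X F' X' \<sigma>']) auto
  show thesis
  proof (cases "card (F \<inter> F') + 3 \<le> 2 * card (X \<inter> X')")
    case True
    then have "2 * card (X \<union> X') \<le> card (F \<union> F') + 1" using a a' eq by linarith
    then show thesis using that(1) a a' by (auto simp: full_def)
  next
    case False
    have agree: "\<sigma> y = \<sigma>' y" if "y \<in> X" "y \<in> X'" for y
    proof (rule potentials_agree[OF t _ _ _ pots])
      show "incident_verts (F \<inter> F') \<subseteq> X \<inter> X'" using a a' by (intro incident_verts_Int) auto
    qed (use a a' x that False in auto)
    define \<tau> where "\<tau> y = (if y \<in> X then \<sigma> y else \<sigma>' y)" for y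
    have \<tau>: "\<tau> y = \<sigma> y" if "y \<in> X" for y using that by (simp add: \<tau>_def)
    have \<tau>': "\<tau> y = \<sigma>' y" if "y \<in> X'" for y using that agree by (simp add: \<tau>_def)
    have sg: "\<tau> y = 1 \<or> \<tau> y = -1" for y
      using a a' potential_sign unfolding \<tau>_def by metis
    have "potential \<tau> F" 
      by (rule potential_cong[of \<sigma> F, OF _ sg \<tau>]) (use a in auto)
    moreover have "potential \<tau> F'" 
      by (rule potential_cong[of \<sigma>' F', OF _ sg \<tau>']) (use a' in auto)
    ultimately have "potential \<tau> (F \<union> F')" by (rule potential_Un)
    moreover have "2 * card (X \<union> X') \<le> card (F \<union> F') + 2" using a a' eq le by linarith
    ultimately have "balanced_full \<tau> E (F \<union> F') (X \<union> X')" using a a' by (auto simp: balanced_full_def)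
    then show thesis using that(2) \<tau> \<tau>' by blast
  qed
qed

section \<open>Switching\<close>

definition flip_edge :: "'a \<Rightarrow> 'a sedge \<Rightarrow> 'a sedge" where
  "flip_edge v = (\<lambda>(S, g). if v \<in> S \<and> S \<noteq> {v} then (S, - g) else (S, g))"

lemma switch_eq: "switch v \<lparr>verts = V, edges = E\<rparr> = \<lparr>verts = V, edges = flip_edge v ` E\<rparr>"
  by (simp add: switch_def flip_edge_def)

lemma flip_edge_flip_edge [simp]: "flip_edge v (flip_edge v e) = e"
  by (auto simp: flip_edge_def split: prod.splits if_splits)

lemma flip_edge_doubleton:
  "flip_edge v ({x, y}, g) = ({x, y}, if v \<in> {x, y} \<and> x \<noteq> y then - g else g)"
  by (auto simp: flip_edge_def)

lemma fst_flip_edge [simp]: "fst (flip_edge v e) = fst e"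
  by (auto simp: flip_edge_def split: prod.splits)

lemma flip_edge_image_image [simp]: "flip_edge v ` flip_edge v ` E = E"
  by (simp add: image_image)

lemma in_flip_image: "e \<in> flip_edge v ` E \<longleftrightarrow> flip_edge v e \<in> E"
proof
  assume "e \<in> flip_edge v ` E" then show "flip_edge v e \<in> E" by auto
next
  assume "flip_edge v e \<in> E"
  then have "flip_edge v (flip_edge v e) \<in> flip_edge v ` E" by (rule imageI)
  then show "e \<in> flip_edge v ` E" by simp
qed

lemma inj_flip_edge: "inj_on (flip_edge v) E"
  by (rule inj_on_inverseI[of _ "flip_edge v"]) simp

lemma incident_verts_flip [simp]: "incident_verts (flip_edge v ` E) = incident_verts E"
  by (simp add: incident_verts_def image_image)

lemma potential_flip:
  assumes "potential \<sigma> F"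
  shows "potential (\<sigma>(v := - \<sigma> v)) (flip_edge v ` F)"
  unfolding potential_def
proof (intro conjI allI impI)
  fix x show "(\<sigma>(v := - \<sigma> v)) x = 1 \<or> (\<sigma>(v := - \<sigma> v)) x = -1"
    using potential_sign[OF assms, of x] by auto
next
  fix x y g assume "({x, y}, g) \<in> flip_edge v ` F"
  then have "({x, y}, if v \<in> {x, y} \<and> x \<noteq> y then - g else g) \<in> F"
    by (simp only: in_flip_image flip_edge_doubleton)
  then have "(if v \<in> {x, y} \<and> x \<noteq> y then - g else g) = \<sigma> x * \<sigma> y"
    using assms unfolding potential_def by blast
  then show "g = (\<sigma>(v := - \<sigma> v)) x * (\<sigma>(v := - \<sigma> v)) y" by (auto split: if_splits)
qed

lemma tight_flip:
  assumes "tight V E" shows "tight V (flip_edge v ` E)"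
proof -
  note t = tightD[OF assms]
  have "signed_graph V (flip_edge v ` E)"
  proof (rule signed_graphI)
    fix e assume "e \<in> flip_edge v ` E"
    then obtain x y g where "x \<in> V" "y \<in> V" "g = 1 \<or> g = -1" "e = flip_edge v ({x, y}, g)" "x = y \<Longrightarrow> g = -1"
      using signed_graph_edgeE[OF t(1)] by (metis imageE)
    then show "\<exists>x y g. e = ({x, y}, g) \<and> x \<in> V \<and> y \<in> V \<and> (g = 1 \<or> g = -1) \<and> (x = y \<longrightarrow> g = -1)"
      unfolding flip_edge_doubleton
      by (intro exI[of _ x] exI[of _ y] exI[of _ "if v \<in> {x, y} \<and> x \<noteq> y then - g else g"]) auto
  qed (rule t(4))
  moreover have "sparse_edges (flip_edge v ` E)"
    unfolding sparse_edges_def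
  proof (intro allI impI)
    fix F X assume F: "F \<subseteq> flip_edge v ` E" "finite X" "X \<noteq> {}" "incident_verts F \<subseteq> X"
    have sub: "flip_edge v ` F \<subseteq> E" using F(1) by (metis flip_edge_image_image image_mono)
    have c: "card (flip_edge v ` F) = card F" by (rule card_image[OF inj_flip_edge])
    have inc: "incident_verts (flip_edge v ` F) \<subseteq> X" using F by simp
    show "card F + 1 \<le> 2 * card X \<and> ((\<exists>\<sigma>. potential \<sigma> F) \<longrightarrow> card F + 2 \<le> 2 * card X)"
      using sparse_edgesD[OF t(2) sub F(2,3) inc] potential_flip unfolding c by metis
  qed
  moreover have "card (flip_edge v ` E) = card E" by (rule card_image[OF inj_flip_edge])
  ultimately show ?thesis using t by (simp add: tight_def)
qed

text \<open>Switching is an involution, so a reduction may first switch to convenient gains.\<close>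

lemma constructible_flipD:
  assumes "constructible \<lparr>verts = V, edges = flip_edge v ` E\<rparr>" "v \<in> V"
  shows "constructible \<lparr>verts = V, edges = E\<rparr>"
  using constructible.switching[OF assms(1), of v] assms(2) by (simp add: switch_eq)

section \<open>Vertices of degree two\<close>

text \<open>The induction hypothesis under which a single reduction step is proved.\<close>

definition smaller_constructible :: "'a set \<Rightarrow> bool" where
  "smaller_constructible V \<longleftrightarrow>
     (\<forall>V' E'. card V' < card V \<longrightarrow> tight V' E' \<longrightarrow> constructible \<lparr>verts = V' :: 'a set, edges = E'\<rparr>)"

lemma constructible_by_move:
  fixes V V' :: "'a set"
  assumes "smaller_constructible V" "card V' < card V" "tight V' E'" "move \<lparr>verts = V', edges = E'\<rparr> H"
  shows "constructible H"
proof -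
  have "signed_quotient_graph \<lparr>verts = V', edges = E'\<rparr> \<and> gain_tight \<lparr>verts = V', edges = E'\<rparr>"
    using assms(3) tight_iff[of "\<lparr>verts = V', edges = E'\<rparr>"] by simp
  moreover have "constructible \<lparr>verts = V', edges = E'\<rparr>"
    using assms(1-3) unfolding smaller_constructible_def by blast
  ultimately show ?thesis using assms(4) by (auto intro: constructible.move)
qed

definition star :: "'a sedge set \<Rightarrow> 'a \<Rightarrow> 'a sedge set" where
  "star E v = {e \<in> E. v \<in> fst e}"

lemma star_edgeE:
  assumes "signed_graph V E" "e \<in> star E v"
  obtains x g where "e = ({v, x}, g)" "x \<in> V" "g = 1 \<or> g = -1" "x = v \<Longrightarrow> g = -1"
proof -
  obtain x y g where e: "x \<in> V" "y \<in> V" "g = 1 \<or> g = -1" "e = ({x, y}, g)" "x = y \<Longrightarrow> g = -1"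
    using signed_graph_edgeE[OF assms(1), of e] assms(2) by (auto simp: star_def)
  then consider "v = x" | "v = y" using assms(2) by (auto simp: star_def)
  then show thesis by cases (use that[of y g] that[of x g] e in \<open>auto simp: insert_commute\<close>)
qed

lemma remove_vertex:
  assumes t: "tight V E" and v: "v \<in> V"
  shows "signed_graph (V - {v}) (E - star E v)" "card (E - star E v) + card (star E v) = card E"
    "card (V - {v}) + 1 = card V" "incident_verts (E - star E v) \<subseteq> V - {v}"
proof -
  note t' = tightD[OF t]
  show sg: "signed_graph (V - {v}) (E - star E v)"
  proof (rule signed_graphI)
    fix e assume "e \<in> E - star E v"
    then have e: "e \<in> E" "v \<notin> fst e" by (auto simp: star_def)
    then obtain x y g where "x \<in> V" "y \<in> V" "g = 1 \<or> g = -1" "e = ({x, y}, g)" "x = y \<Longrightarrow> g = -1"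
      using signed_graph_edgeE[OF t'(1)] by metis
    then show "\<exists>x y g. e = ({x, y}, g) \<and> x \<in> V - {v} \<and> y \<in> V - {v} \<and> (g = 1 \<or> g = -1) \<and> (x = y \<longrightarrow> g = -1)"
      using e(2) by (intro exI[of _ x] exI[of _ y] exI[of _ g]) auto
  qed (use t' in simp)
  show "card (E - star E v) + card (star E v) = card E"
  proof -
    have "star E v \<subseteq> E" by (auto simp: star_def)
    then show ?thesis using t'(5) by (metis card_Diff_subset card_mono finite_subset le_add_diff_inverse2)
  qed
  show "card (V - {v}) + 1 = card V" using v t'(4) by (metis Suc_eq_plus1 card_Suc_Diff1)
  show "incident_verts (E - star E v) \<subseteq> V - {v}" by (rule signed_graph_incident[OF sg])
qed

text \<open>Fewer than two edges at a vertex would leave too many edges for the remaining vertices.\<close>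

lemma card_star_ge_2:
  assumes t: "tight V E" and v: "v \<in> V" and V: "card V \<ge> 2"
  shows "card (star E v) \<ge> 2"
proof -
  note r = remove_vertex[OF t v] and t' = tightD[OF t]
  have "V - {v} \<noteq> {}" using r(3) V by (metis Suc_eq_plus1 card.empty numeral_2_eq_2 not_less_eq_eq le_numeral_extra(3))
  then have "card (E - star E v) + 1 \<le> 2 * card (V - {v})"
    using t' r by (intro sparse_edgesD[OF t'(2)]) auto
  then show ?thesis using r t'(3) by linarith
qed

lemma sparse_edges_mono: "sparse_edges E \<Longrightarrow> F \<subseteq> E \<Longrightarrow> sparse_edges F"
  unfolding sparse_edges_def by (metis order_trans)

lemma remove_vertex_of_degree_2:
  assumes t: "tight V E" and v: "v \<in> V" and d: "card (star E v) = 2"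
  shows "tight (V - {v}) (E - star E v)"
proof -
  have "sparse_edges (E - star E v)" by (rule sparse_edges_mono[OF tightD(2)[OF t]]) auto
  then show ?thesis using remove_vertex[OF t v] d tightD(3)[OF t] by (simp add: tight_def)
qed

text \<open>If loops count twice, the degrees add up to \<open>2 * card E = 4 * card V - 2\<close>, so they cannot all be
  at least 4.\<close>

lemma exists_vertex_of_degree_le_3:
  assumes t: "tight V E"
  obtains v where "v \<in> V" "card (star E v) + of_bool (({v}, -1) \<in> E) \<le> 3"
proof -
  note t' = tightD[OF t]
  have inner: "(\<Sum>v\<in>V. of_bool (v \<in> fst e) + of_bool (e = ({v}, -1))) = (2::nat)" if e0: "e \<in> E" for e
  proof -
    obtain x y g where e: "x \<in> V" "y \<in> V" "g = 1 \<or> g = -1" "e = ({x, y}, g)" "x = y \<Longrightarrow> g = -1"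
      using signed_graph_edgeE[OF t'(1) e0] by metis
    have sub: "{x, y} \<subseteq> V" using e by simp
    have a: "(\<Sum>v\<in>V. of_bool (v \<in> fst e)) = card {x, y}"
    proof -
      have "(\<Sum>v\<in>V. of_bool (v \<in> fst e) :: nat) = card (V \<inter> {v. v \<in> fst e})" by (simp add: t'(4))
      also have "V \<inter> {v. v \<in> fst e} = {x, y}" using e by auto
      finally show ?thesis .
    qed
    have b: "(\<Sum>v\<in>V. of_bool (e = ({v}, -1))) = (if x = y then 1 else 0 :: nat)"
    proof -
      have "(\<Sum>v\<in>V. of_bool (e = ({v}, -1)) :: nat) = card (V \<inter> {v. e = ({v}, -1)})" by (simp add: t'(4))
      also have "V \<inter> {v. e = ({v}, -1)} = (if x = y then {x} else {})" using e by auto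
      finally show ?thesis by simp
    qed
    show ?thesis unfolding sum.distrib a b by auto
  qed
  have deg: "card (star E v) + of_bool (({v}, -1) \<in> E) = (\<Sum>e\<in>E. of_bool (v \<in> fst e) + of_bool (e = ({v}, -1)))" for v
  proof -
    have "(\<Sum>e\<in>E. of_bool (v \<in> fst e) :: nat) = card (star E v)"
    proof -
      have "(\<Sum>e\<in>E. of_bool (v \<in> fst e) :: nat) = card (E \<inter> {e. v \<in> fst e})" by (simp add: t'(5))
      also have "E \<inter> {e. v \<in> fst e} = star E v" by (auto simp: star_def)
      finally show ?thesis .
    qed
    moreover have "(\<Sum>e\<in>E. of_bool (e = ({v}, -1)) :: nat) = of_bool (({v}, -1) \<in> E)"
    proof -
      have "(\<Sum>e\<in>E. of_bool (e = ({v}, -1)) :: nat) = card (E \<inter> {e. e = ({v}, -1)})" by (simp add: t'(5))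
      also have "E \<inter> {e. e = ({v}, -1)} = (if ({v}, -1) \<in> E then {({v}, -1)} else {})" by auto
      finally show ?thesis by simp
    qed
    ultimately show ?thesis by (simp add: sum.distrib)
  qed
  have "(\<Sum>v\<in>V. card (star E v) + of_bool (({v}, -1) \<in> E)) = (\<Sum>e\<in>E. \<Sum>v\<in>V. of_bool (v \<in> fst e) + of_bool (e = ({v}, -1)))"
    unfolding deg by (rule sum.swap)
  also have "\<dots> = 2 * card E" using inner by simp
  finally have total: "(\<Sum>v\<in>V. card (star E v) + of_bool (({v}, -1) \<in> E)) = 2 * card E" .
  show thesis
  proof (rule ccontr)
    assume "\<not> thesis"
    then have "\<And>v. v \<in> V \<Longrightarrow> 4 \<le> card (star E v) + of_bool (({v}, -1) \<in> E)"
      using that by force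
    then have "card V * 4 \<le> 2 * card E" 
      using sum_bounded_below[of V "4::nat" "\<lambda>v. card (star E v) + of_bool (({v}, -1) \<in> E)"] total by simp
    then show False using t'(3) by linarith
  qed
qed

lemma constructible_degree_2:
  assumes t: "tight V E" and s: "smaller_constructible V" and v: "v \<in> V" and d: "card (star E v) = 2"
  shows "constructible \<lparr>verts = V, edges = E\<rparr>"
proof -
  note t' = tightD[OF t] and r = remove_vertex[OF t v]
  let ?V = "V - {v}" and ?E = "E - star E v"
  have tr: "tight ?V ?E" by (rule remove_vertex_of_degree_2[OF t v d])
  have c: "card ?V < card V" using r(3) by linarith
  obtain e1 e2 where st: "star E v = {e1, e2}" "e1 \<noteq> e2" using d by (metis card_2_iff)
  obtain x g where e1: "e1 = ({v, x}, g)" "x \<in> V" "g = 1 \<or> g = -1" "x = v \<Longrightarrow> g = -1"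
    using star_edgeE[OF t'(1), of e1 v] st by blast
  obtain y h where e2: "e2 = ({v, y}, h)" "y \<in> V" "h = 1 \<or> h = -1" "y = v \<Longrightarrow> h = -1"
    using star_edgeE[OF t'(1), of e2 v] st by blast
  have V: "insert v (verts \<lparr>verts = ?V, edges = ?E\<rparr>) = V" using v by auto
  have E: "E = edges \<lparr>verts = ?V, edges = ?E\<rparr> \<union> {e1, e2}" using st by (auto simp: star_def)
  have loop: "constructible \<lparr>verts = V, edges = E\<rparr>"
    if "E = edges \<lparr>verts = ?V, edges = ?E\<rparr> \<union> {({v, z}, k), ({v}, -1)}" "z \<in> V" "z \<noteq> v" "k = 1 \<or> k = -1" for z k
    using constructible_by_move[OF s c tr move.H1c[of v "\<lparr>verts = ?V, edges = ?E\<rparr>" z k]] that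
    unfolding V that(1)[symmetric] by auto
  have nn: "\<not> (x = v \<and> y = v)" using st e1 e2 by auto
  consider "x \<noteq> v" "y \<noteq> v" "x \<noteq> y" | "x \<noteq> v" "x = y" | "x = v" "y \<noteq> v" | "x \<noteq> v" "y = v"
    using nn by metis
  then show ?thesis
  proof cases
    case 1
    then show ?thesis
      using constructible_by_move[OF s c tr move.H1a[of v "\<lparr>verts = ?V, edges = ?E\<rparr>" x y g h]] e1 e2
      unfolding V E[unfolded e1(1) e2(1), symmetric] by auto
  next
    case 2
    then have "{e1, e2} = {({v, x}, 1), ({v, x}, -1)}" using e1 e2 st(2) by auto
    then have E2: "E = edges \<lparr>verts = ?V, edges = ?E\<rparr> \<union> {({v, x}, 1), ({v, x}, -1)}" using E by simp
    then show ?thesis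
      using constructible_by_move[OF s c tr move.H1b[of v "\<lparr>verts = ?V, edges = ?E\<rparr>" x]] e1 2
      unfolding V E2[symmetric] by auto
  next
    case 3
    then have "{e1, e2} = {({v, y}, h), ({v}, -1)}" using e1 e2 by auto
    then show ?thesis using loop[of y h] e2 3 E by simp
  next
    case 4
    then have "{e1, e2} = {({v, x}, g), ({v}, -1)}" using e1 e2 by auto
    then show ?thesis using loop[of x g] e1 4 E by simp
  qed
qed

section \<open>Vertices of degree three\<close>

lemma star_disjoint: "incident_verts F \<subseteq> X \<Longrightarrow> v \<notin> X \<Longrightarrow> F \<inter> star E v = {}"
  by (auto simp: star_def incident_verts_def)

lemma edge_notinI: "incident_verts F \<subseteq> X \<Longrightarrow> z \<notin> X \<Longrightarrow> z \<in> S \<Longrightarrow> (S, g) \<notin> F"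
  using incident_vertsI[of S g F z] by auto

lemma fullD:
  assumes "full E F X"
  shows "F \<subseteq> E" "finite X" "X \<noteq> {}" "incident_verts F \<subseteq> X" "2 * card X \<le> card F + 1"
  using assms by (simp_all add: full_def)

lemma balanced_fullD:
  assumes "balanced_full \<sigma> E F X"
  shows "F \<subseteq> E" "finite X" "X \<noteq> {}" "incident_verts F \<subseteq> X" "potential \<sigma> F" "2 * card X \<le> card F + 2"
  using assms by (simp_all add: balanced_full_def)

lemma balanced_full_scale:
  assumes b: "balanced_full \<sigma> E F X" and k: "k = 1 \<or> k = -1"
  shows "balanced_full (\<lambda>u. k * \<sigma> u) E F X"
proof -
  have "(\<lambda>u. k * \<sigma> u) = \<sigma> \<or> (\<lambda>u. k * \<sigma> u) = (\<lambda>u. - \<sigma> u)" using k by auto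
  then have "potential (\<lambda>u. k * \<sigma> u) F"
    using balanced_fullD(5)[OF b] potential_uminus[OF balanced_fullD(5)[OF b]] by metis
  then show ?thesis using b by (simp add: balanced_full_def)
qed

lemma full_add_edges:
  assumes t: "tight V E" and f: "full E F X" and N: "N \<subseteq> E" "F \<inter> N = {}" "incident_verts N \<subseteq> X \<union> W" "finite W"
  shows "card N \<le> 2 * card (W - X)"
proof -
  note t' = tightD[OF t] and f' = fullD[OF f]
  have fin: "finite F" "finite N" using f' N t'(5) by (meson finite_subset)+
  have eq: "X \<union> W = X \<union> (W - X)" by blast
  have "card (F \<union> N) + 1 \<le> 2 * card (X \<union> W)"
    by (rule sparse_edgesD(1)[OF t'(2)]) (use f' N in auto)
  moreover have "card (F \<union> N) = card F + card N" using fin N(2) by (rule card_Un_disjoint)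
  moreover have "card (X \<union> W) = card X + card (W - X)"
    unfolding eq using f'(2) N(4) by (intro card_Un_disjoint) auto
  ultimately show ?thesis using f'(5) by linarith
qed

lemma balanced_full_add_edges:
  assumes t: "tight V E" and f: "balanced_full \<sigma> E F X"
    and N: "N \<subseteq> E" "F \<inter> N = {}" "incident_verts N \<subseteq> X \<union> W" "finite W"
  shows "card N \<le> 2 * card (W - X) + 1" "potential \<sigma> (F \<union> N) \<Longrightarrow> card N \<le> 2 * card (W - X)"
proof -
  note t' = tightD[OF t] and f' = balanced_fullD[OF f]
  have fin: "finite F" "finite N" using f' N t'(5) by (meson finite_subset)+
  have eq: "X \<union> W = X \<union> (W - X)" by blast
  have c: "card (F \<union> N) = card F + card N" using fin N(2) by (rule card_Un_disjoint)
  have c': "card (X \<union> W) = card X + card (W - X)"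
    unfolding eq using f'(2) N(4) by (intro card_Un_disjoint) auto
  have "card (F \<union> N) + 1 \<le> 2 * card (X \<union> W)"
    by (rule sparse_edgesD(1)[OF t'(2)]) (use f' N in auto)
  then show "card N \<le> 2 * card (W - X) + 1" using f'(6) c c' by linarith
  assume p: "potential \<sigma> (F \<union> N)"
  have "card (F \<union> N) + 2 \<le> 2 * card (X \<union> W)"
    by (rule sparse_edgesD(2)[OF t'(2) _ _ _ _ p]) (use f' N in auto)
  then show "card N \<le> 2 * card (W - X)" using f'(6) c c' by linarith
qed

text \<open>Adding the vertex and its three edges to the full set would break the sparsity bound.\<close>

lemma not_full_around:
  assumes t: "tight V E" and d: "card (star E v) = 3" and f: "full E F X" and v: "v \<notin> X"
    and N: "incident_verts (star E v) \<subseteq> insert v X"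
  shows False
proof -
  have "card (star E v) \<le> 2 * card ({v} - X)"
  proof (rule full_add_edges[OF t f])
    show "star E v \<subseteq> E" by (auto simp: star_def)
    show "F \<inter> star E v = {}" using star_disjoint[OF fullD(4)[OF f] v] .
  qed (use N in auto)
  then show False using d v by (simp add: insert_Diff_if)
qed

text \<open>As before, with the potential extended to the new vertex by the sign \<open>s\<close>.\<close>

lemma not_balanced_full_around:
  assumes t: "tight V E" and d: "card (star E v) = 3" and f: "balanced_full \<sigma> E F X" and v: "v \<notin> X"
    and N: "incident_verts (star E v) \<subseteq> insert v X" and s: "s = 1 \<or> s = -1"
    and p: "potential (\<sigma>(v := s)) (star E v)"
  shows False
proof -
  let ?\<sigma> = "\<sigma>(v := s)"
  note f' = balanced_fullD[OF f]
  have "potential ?\<sigma> F"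
    by (rule potential_cong[OF f'(5)]) (use f'(4) v s potential_sign[OF f'(5)] in auto)
  then have f2: "balanced_full ?\<sigma> E F X" and pp: "potential ?\<sigma> (F \<union> star E v)"
    using f p by (auto simp: balanced_full_def intro: potential_Un)
  have "card (star E v) \<le> 2 * card ({v} - X)"
  proof (rule balanced_full_add_edges(2)[OF t f2 _ _ _ _ pp])
    show "star E v \<subseteq> E" by (auto simp: star_def)
    show "F \<inter> star E v = {}" using star_disjoint[OF f'(4) v] .
  qed (use N in auto)
  then show False using d v by (simp add: insert_Diff_if)
qed

text \<open>An edge set that violates a bound after the exchange must contain the new edge; without it, it is
  full, or balanced full with a potential that fits the new edge.\<close>

lemma degree_3_reinsertion_blocked:
  assumes t: "tight V E" and v: "v \<in> V" and d: "card (star E v) = 3"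
    and xy: "x \<in> V" "y \<in> V" "x \<noteq> v" "y \<noteq> v" and g: "g = 1 \<or> g = -1" "x = y \<Longrightarrow> g = -1"
    and new: "({x, y}, g) \<notin> E"
    and nt: "\<not> tight (V - {v}) (insert ({x, y}, g) (E - star E v))"
  obtains F X where "full E F X" "v \<notin> X" "x \<in> X" "y \<in> X"
  | \<sigma> F X where "balanced_full \<sigma> E F X" "v \<notin> X" "x \<in> X" "y \<in> X" "g = \<sigma> x * \<sigma> y"
proof -
  note t' = tightD[OF t] and r = remove_vertex[OF t v]
  let ?e = "({x, y}, g)"
  let ?E = "insert ?e (E - star E v)"
  have fin: "finite (E - star E v)" using t'(5) by simp
  have "card ?E + 1 = 2 * card (V - {v})" using r new d t'(3) fin by simp
  moreover have sg: "signed_graph (V - {v}) ?E"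
  proof (rule signed_graphI)
    fix e assume "e \<in> ?E"
    then show "\<exists>x y g. e = ({x, y}, g) \<and> x \<in> V - {v} \<and> y \<in> V - {v} \<and> (g = 1 \<or> g = -1) \<and> (x = y \<longrightarrow> g = -1)"
    proof
      assume "e = ?e"
      then show ?thesis using xy g by (intro exI[of _ x] exI[of _ y] exI[of _ g]) auto
    next
      assume "e \<in> E - star E v"
      then show ?thesis using signed_graph_edgeE[OF r(1)] by metis
    qed
  qed (use t' in simp)
  ultimately have "\<not> sparse_edges ?E" using nt by (simp add: tight_def)
  then obtain F' X' where F': "F' \<subseteq> ?E" "finite X'" "X' \<noteq> {}" "incident_verts F' \<subseteq> X'"
    and bad: "\<not> (card F' + 1 \<le> 2 * card X' \<and> ((\<exists>\<sigma>. potential \<sigma> F') \<longrightarrow> card F' + 2 \<le> 2 * card X'))"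
    unfolding sparse_edges_def by blast
  have eF': "?e \<in> F'"
  proof (rule ccontr)
    assume "?e \<notin> F'"
    then have sub: "F' \<subseteq> E" using F'(1) by blast
    show False using bad sparse_edgesD[OF t'(2) sub F'(2-4)] by blast
  qed
  define F where "F = F' - {?e}"
  define X where "X = X' - {v}"
  have F_sub: "F \<subseteq> E - star E v" using F'(1) by (auto simp: F_def)
  have finF: "finite F" using F_sub fin by (rule finite_subset)
  have F'_eq: "F' = insert ?e F" using eF' by (auto simp: F_def)
  have "?e \<notin> F" by (simp add: F_def)
  then have cF: "card F' = card F + 1" unfolding F'_eq using finF by simp
  have cX: "card X \<le> card X'" "finite X" using F'(2) by (auto simp: X_def intro: card_mono)
  have xyX: "x \<in> X" "y \<in> X" "v \<notin> X"
    using F'(4) xy eF' incident_vertsI[OF eF'] by (auto simp: X_def)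
  have inc: "incident_verts F \<subseteq> X"
  proof -
    have "incident_verts F \<subseteq> incident_verts F'" by (rule incident_verts_mono) (simp add: F_def)
    moreover have "v \<notin> incident_verts F" using F_sub by (auto simp: star_def incident_verts_def)
    ultimately show ?thesis using F'(4) by (auto simp: X_def)
  qed
  show thesis
  proof (cases "2 * card X \<le> card F + 1")
    case True
    then have "full E F X" using F_sub inc cX xyX by (auto simp: full_def)
    then show thesis using that(1) xyX by blast
  next
    case False
    then obtain \<sigma> where \<sigma>: "potential \<sigma> F'" "2 * card X' < card F' + 2"
      using bad cF cX by force
    have "potential \<sigma> F" using \<sigma>(1) by (rule potential_mono) (simp add: F_def)
    then have "balanced_full \<sigma> E F X" using F_sub inc cX xyX \<sigma>(2) cF by (auto simp: balanced_full_def)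
    moreover have "g = \<sigma> x * \<sigma> y" using \<sigma>(1) eF' by (simp add: potential_def)
    ultimately show thesis using that(2) xyX by blast
  qed
qed

text \<open>A loop at \<open>x\<close> or one of the two edges \<open>xy\<close> can be reinserted. A full set cannot contain both \<open>x\<close>
  and \<open>y\<close>. If the loop is blocked, there is a full set \<open>F0\<close> at \<open>x\<close>; its union with a balanced full
  set containing \<open>x\<close> and \<open>y\<close> would be full. So an edge \<open>xy\<close> can only be blocked by being present, and
  if both are present, adding them to \<open>F0\<close> again gives a full set containing \<open>x\<close> and \<open>y\<close>.\<close>

lemma constructible_degree_3_double:
  assumes t: "tight V E" and s: "smaller_constructible V" and v: "v \<in> V"
    and st: "star E v = {({v, x}, 1), ({v, x}, -1), ({v, y}, g)}"
    and xy: "x \<in> V" "y \<in> V" "x \<noteq> v" "y \<noteq> v" "x \<noteq> y" and g: "g = 1 \<or> g = -1"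
  shows "constructible \<lparr>verts = V, edges = E\<rparr>"
proof (rule ccontr)
  assume nc: "\<not> ?thesis"
  note t' = tightD[OF t] and r = remove_vertex[OF t v]
  let ?V = "V - {v}" and ?E = "E - star E v"
  have d: "card (star E v) = 3" unfolding st using xy by (simp add: doubleton_eq_iff)
  have c: "card ?V < card V" using r(3) by linarith
  have starE: "star E v \<subseteq> E" by (auto simp: star_def)
  have inc: "incident_verts (star E v) \<subseteq> insert v X" if "x \<in> X" "y \<in> X" for X
    unfolding st using that by auto
  have no_full: False if "full E F X" "v \<notin> X" "x \<in> X" "y \<in> X" for F X
    using not_full_around[OF t d that(1,2)] inc that(3,4) by blast
  have "\<exists>F X. full E F X \<and> v \<notin> X \<and> x \<in> X"
  proof (cases "({x}, -1) \<in> E")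
    case True
    then have "full E {({x}, -1)} {x}" by (simp add: full_def)
    then show ?thesis using xy by blast
  next
    case False
    have "\<not> tight ?V (insert ({x}, -1) ?E)"
    proof
      assume tt: "tight ?V (insert ({x}, -1) ?E)"
      let ?H = "\<lparr>verts = ?V, edges = insert ({x}, -1) ?E\<rparr>"
      have E: "(edges ?H - {({x}, -1)}) \<union> {({v, x}, 1), ({v, x}, -1), ({v, y}, g)} = E"
        using False starE unfolding st by auto
      have "move ?H \<lparr>verts = insert v (verts ?H), edges = (edges ?H - {({x}, -1)}) \<union> {({v, x}, 1), ({v, x}, -1), ({v, y}, g)}\<rparr>"
        by (rule move.H2c) (use xy g in auto)
      then show False using constructible_by_move[OF s c tt] nc unfolding E by (simp add: insert_absorb[OF v])
    qed
    then have nt: "\<not> tight ?V (insert ({x, x}, -1) ?E)" by simp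
    have new: "({x, x}, -1) \<notin> E" using False by simp
    show ?thesis
    proof (rule degree_3_reinsertion_blocked[OF t v d xy(1,1,3,3) _ _ new nt])
      fix \<sigma> F X assume "balanced_full \<sigma> E F X" "-1 = \<sigma> x * \<sigma> x"
      then show ?thesis using sign_square[of \<sigma> x] potential_sign[OF balanced_fullD(5)] by fastforce
    qed auto
  qed
  then obtain F0 X0 where F0: "full E F0 X0" "v \<notin> X0" "x \<in> X0" by blast
  have y0: "y \<notin> X0" using no_full F0 by blast
  \<comment> \<open>with the two edges \<open>vx\<close>, the third edge at \<open>v\<close> closes triangles of gain \<open>k * g\<close> for both signs \<open>k\<close>\<close>
  have present: "({x, y}, k * g) \<in> E" if k: "k = 1 \<or> k = -1" for k
  proof (rule ccontr)
    assume new: "({x, y}, k * g) \<notin> E"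
    have "\<not> tight ?V (insert ({x, y}, k * g) ?E)"
    proof
      assume tt: "tight ?V (insert ({x, y}, k * g) ?E)"
      let ?H = "\<lparr>verts = ?V, edges = insert ({x, y}, k * g) ?E\<rparr>"
      have "{({v, x}, k), ({v, y}, g), ({v, x}, - k)} = star E v" unfolding st using k by auto
      then have E: "(edges ?H - {({x, y}, k * g)}) \<union> {({v, x}, k), ({v, y}, g), ({v, x}, - k)} = E"
        using new starE by auto
      have "move ?H \<lparr>verts = insert v (verts ?H), edges = (edges ?H - {({x, y}, k * g)}) \<union> {({v, x}, k), ({v, y}, g), ({v, x}, - k)}\<rparr>"
        by (rule move.H2b) (use xy g k in auto)
      then show False using constructible_by_move[OF s c tt] nc unfolding E by (simp add: insert_absorb[OF v])
    qed
    moreover have "k * g = 1 \<or> k * g = -1" using k g by auto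
    ultimately show False
    proof (rule_tac degree_3_reinsertion_blocked[OF t v d xy(1-4) _ _ new])
      fix F X assume "full E F X" "v \<notin> X" "x \<in> X" "y \<in> X"
      then show False by (rule no_full)
    next
      fix \<sigma> F X assume b: "balanced_full \<sigma> E F X" "v \<notin> X" "x \<in> X" "y \<in> X"
      have "full E (F0 \<union> F) (X0 \<union> X)" by (rule full_Un_balanced_full[OF t F0(1) b(1)]) (use F0 b in auto)
      then show False using no_full F0 b by blast
    qed (use xy in auto)
  qed
  let ?N = "{({x, y}, 1 * g), ({x, y}, -1 * g)}"
  have dis: "F0 \<inter> ?N = {}"
    using edge_notinI[OF fullD(4)[OF F0(1)] y0] by simp
  have fin0: "finite F0" using fullD(1)[OF F0(1)] t'(5) by (rule finite_subset)
  have "card ?N = 2" using g by auto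
  then have "card (F0 \<union> ?N) = card F0 + 2" using card_Un_disjoint[OF fin0 _ dis] by simp
  moreover have "card (insert y X0) = card X0 + 1" using y0 fullD(2)[OF F0(1)] by simp
  ultimately have "full E (F0 \<union> ?N) (insert y X0)"
    using fullD[OF F0(1)] present[of 1] present[of "-1"] F0 by (auto simp: full_def)
  then show False using no_full F0 xy by blast
qed

lemma star_flip: "star (flip_edge w ` E) v = flip_edge w ` star E v"
  by (auto simp: star_def)

text \<open>Suppose that \<open>xy\<close> is missing. It is then blocked by a full or balanced full set. If \<open>xz\<close> or \<open>yz\<close>
  were blocked in this way too, the union of the two blocking sets would contain all three neighbours
  of \<open>v\<close>, as a full set or with a potential that fits the edges at \<open>v\<close>, and adding \<open>v\<close> would break
  a bound. So \<open>xz\<close> and \<open>yz\<close> are present; added to the set that blocks \<open>xy\<close>, together with \<open>v\<close>,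
  they break a bound as well.\<close>

lemma irreducible_degree_3_neighbours_adjacent:
  assumes t: "tight V E" and s: "smaller_constructible V" and v: "v \<in> V"
    and st: "star E v = {({v, x}, 1), ({v, y}, 1), ({v, z}, 1)}"
    and V: "x \<in> V" "y \<in> V" "z \<in> V" and dist: "x \<noteq> v" "y \<noteq> v" "z \<noteq> v" "x \<noteq> y" "x \<noteq> z" "y \<noteq> z"
    and nc: "\<not> constructible \<lparr>verts = V, edges = E\<rparr>"
  shows "({x, y}, 1) \<in> E"
proof (rule ccontr)
  assume xy: "({x, y}, 1) \<notin> E"
  note t' = tightD[OF t] and r = remove_vertex[OF t v]
  let ?V = "V - {v}" and ?E = "E - star E v"
  have d: "card (star E v) = 3" unfolding st using dist by (simp add: doubleton_eq_iff)
  have c: "card ?V < card V" using r(3) by linarith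
  have starE: "star E v \<subseteq> E" by (auto simp: star_def)
  have inc: "incident_verts (star E v) \<subseteq> insert v X" if "x \<in> X" "y \<in> X" "z \<in> X" for X
    unfolding st using that by auto
  have no_full: False if "full E F X" "v \<notin> X" "x \<in> X" "y \<in> X" "z \<in> X" for F X
    using not_full_around[OF t d that(1,2)] inc that(3-5) by blast
  have no_balanced_full: False
    if b: "balanced_full \<sigma> E F X" "v \<notin> X" "x \<in> X" "y \<in> X" "z \<in> X" "\<sigma> x = \<sigma> y" "\<sigma> x = \<sigma> z" for \<sigma> F X
  proof (rule not_balanced_full_around[OF t d b(1,2) inc[OF b(3-5)]])
    have sx: "\<sigma> x = 1 \<or> \<sigma> x = -1" by (rule potential_sign[OF balanced_fullD(5)[OF b(1)]])
    then show "\<sigma> x = 1 \<or> \<sigma> x = -1" .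
    have "potential (\<sigma>(v := \<sigma> x)) {}"
      using sx potential_sign[OF balanced_fullD(5)[OF b(1)]] by (auto simp: potential_def)
    then show "potential (\<sigma>(v := \<sigma> x)) (star E v)"
      unfolding st using b(6,7) dist sx by (intro potential_insert) auto
  qed
  define block where "block a b \<longleftrightarrow> (\<exists>F X. full E F X \<and> v \<notin> X \<and> a \<in> X \<and> b \<in> X) \<or>
    (\<exists>\<sigma> F X. balanced_full \<sigma> E F X \<and> v \<notin> X \<and> a \<in> X \<and> b \<in> X \<and> \<sigma> a = \<sigma> b)" for a b
  have block: "block a b" if st': "star E v = {({v, a}, 1), ({v, b}, 1), ({v, w}, 1)}"
    and ab: "a \<in> V" "b \<in> V" "w \<in> V" "a \<noteq> v" "b \<noteq> v" "w \<noteq> v" "a \<noteq> b" "w \<noteq> a" "w \<noteq> b"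
    and new: "({a, b}, 1) \<notin> E" for a b w
  proof -
    have "\<not> tight ?V (insert ({a, b}, 1) ?E)"
    proof
      assume tt: "tight ?V (insert ({a, b}, 1) ?E)"
      let ?H = "\<lparr>verts = ?V, edges = insert ({a, b}, 1) ?E\<rparr>"
      have E: "(edges ?H - {({a, b}, 1)}) \<union> {({v, a}, 1), ({v, b}, 1), ({v, w}, 1)} = E"
        using new starE unfolding st'[symmetric] by auto
      have "move ?H \<lparr>verts = insert v (verts ?H), edges = (edges ?H - {({a, b}, 1)}) \<union> {({v, a}, 1), ({v, b}, 1), ({v, w}, 1)}\<rparr>"
        by (rule move.H2a) (use ab in auto)
      then show False using constructible_by_move[OF s c tt] nc unfolding E by (simp add: insert_absorb[OF v])
    qed
    then show "block a b"
    proof (rule_tac degree_3_reinsertion_blocked[OF t v d ab(1,2,4,5) _ _ new])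
      fix F X assume "full E F X" "v \<notin> X" "a \<in> X" "b \<in> X"
      then show ?thesis unfolding block_def by blast
    next
      fix \<sigma> F X assume b: "balanced_full \<sigma> E F X" "v \<notin> X" "a \<in> X" "b \<in> X" "1 = \<sigma> a * \<sigma> b"
      then have "\<sigma> a = \<sigma> b"
        using potential_sign[OF balanced_fullD(5)[OF b(1)], of a] potential_sign[OF balanced_fullD(5)[OF b(1)], of b] by auto
      then show ?thesis unfolding block_def using b by blast
    qed (use ab in auto)
  qed
  have block_block: False if "block x y" and bz: "block a z" and a: "a = x \<or> a = y" for a
  proof -
    have ac: "a \<in> X" if "x \<in> X" "y \<in> X" for X using a that by blast
    from \<open>block x y\<close> consider (f) F X where "full E F X" "v \<notin> X" "x \<in> X" "y \<in> X"
      | (b) \<sigma> F X where "balanced_full \<sigma> E F X" "v \<notin> X" "x \<in> X" "y \<in> X" "\<sigma> x = \<sigma> y"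
      unfolding block_def by blast
    then show False
    proof cases
      case f
      from bz consider (f') F' X' where "full E F' X'" "v \<notin> X'" "a \<in> X'" "z \<in> X'"
        | (b') \<sigma>' F' X' where "balanced_full \<sigma>' E F' X'" "v \<notin> X'" "a \<in> X'" "z \<in> X'"
        unfolding block_def by blast
      then show False
      proof cases
        case f'
        have "full E (F \<union> F') (X \<union> X')"
          by (rule full_Un[OF t f(1) f'(1)]) (use ac[OF f(3,4)] f' in auto)
        then show False by (rule no_full) (use f f' in auto)
      next
        case b'
        have "full E (F \<union> F') (X \<union> X')"
          by (rule full_Un_balanced_full[OF t f(1) b'(1)]) (use ac[OF f(3,4)] b' in auto)
        then show False by (rule no_full) (use f b' in auto)
      qed
    next
      case b
      from bz consider (f') F' X' where "full E F' X'" "v \<notin> X'" "a \<in> X'" "z \<in> X'"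
        | (b') \<sigma>' F' X' where "balanced_full \<sigma>' E F' X'" "v \<notin> X'" "a \<in> X'" "z \<in> X'" "\<sigma>' a = \<sigma>' z"
        unfolding block_def by blast
      then show False
      proof cases
        case f'
        have "full E (F' \<union> F) (X' \<union> X)"
          by (rule full_Un_balanced_full[OF t f'(1) b(1)]) (use ac[OF b(3,4)] f' in auto)
        then show False by (rule no_full) (use b f' in auto)
      next
        case b'
        \<comment> \<open>rescaled so that the two potentials agree at the common vertex \<open>a\<close>\<close>
        define \<sigma>'' where "\<sigma>'' u = \<sigma> a * \<sigma>' a * \<sigma>' u" for u
        have sg: "\<sigma> u = 1 \<or> \<sigma> u = -1" "\<sigma>' u = 1 \<or> \<sigma>' u = -1" for u
          using potential_sign balanced_fullD(5) b(1) b'(1) by metis+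
        have "\<sigma> a * \<sigma>' a = 1 \<or> \<sigma> a * \<sigma>' a = -1" using sg(1)[of a] sg(2)[of a] by auto
        from balanced_full_scale[OF b'(1) this] have b'': "balanced_full \<sigma>'' E F' X'"
          unfolding \<sigma>''_def .
        have eqs: "\<sigma>'' z = \<sigma> a" "\<sigma> a = \<sigma>'' a" 
          using sg(1)[of a] sg(2)[of a] b'(5) unfolding \<sigma>''_def by auto
        show False
        proof (rule balanced_full_Un[OF t b(1) b'' ac[OF b(3,4)] b'(3) eqs(2)])
          assume "full E (F \<union> F') (X \<union> X')"
          then show False by (rule no_full) (use b b' in auto)
        next
          fix \<tau> assume \<tau>: "balanced_full \<tau> E (F \<union> F') (X \<union> X')" "\<And>y. y \<in> X \<Longrightarrow> \<tau> y = \<sigma> y" "\<And>y. y \<in> X' \<Longrightarrow> \<tau> y = \<sigma>'' y"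
          have "\<tau> x = \<tau> y" "\<tau> x = \<tau> z" using \<tau>(2)[OF b(3)] \<tau>(2)[OF b(4)] \<tau>(3)[OF b'(4)] b(5) eqs(1) a by auto
          then show False by (intro no_balanced_full[OF \<tau>(1)]) (use b b' in auto)
        qed
      qed
    qed
  qed
  have bxy: "block x y" by (rule block[OF st V dist(1-4)]) (use dist xy in auto)
  have "({x, z}, 1) \<in> E"
  proof (rule ccontr)
    assume "({x, z}, 1) \<notin> E"
    then have "block x z" by (intro block[of x z y]) (use st V dist in \<open>auto simp: insert_commute\<close>)
    then show False using block_block bxy by blast
  qed
  moreover have "({y, z}, 1) \<in> E"
  proof (rule ccontr)
    assume "({y, z}, 1) \<notin> E"
    then have "block y z" by (intro block[of y z x]) (use st V dist in \<open>auto simp: insert_commute\<close>)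
    then show False using block_block bxy by blast
  qed
  ultimately have xz: "({x, z}, 1) \<in> E" and yz: "({y, z}, 1) \<in> E" .
  have vv: "({v, x}, 1) \<in> E" "({v, y}, 1) \<in> E" "({v, z}, 1) \<in> E" using st starE by auto
  from bxy consider (f) F X where "full E F X" "v \<notin> X" "x \<in> X" "y \<in> X"
    | (b) \<sigma> F X where "balanced_full \<sigma> E F X" "v \<notin> X" "x \<in> X" "y \<in> X" "\<sigma> x = \<sigma> y"
    unfolding block_def by blast
  then show False
  proof cases
    case f
    then have z: "z \<notin> X" using no_full by blast
    let ?N = "{({v, x}, 1 :: int), ({v, y}, 1), ({v, z}, 1), ({x, z}, 1), ({y, z}, 1)}"
    have "card ?N \<le> 2 * card ({v, z} - X)"
    proof (rule full_add_edges[OF t f(1)])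
      show "F \<inter> ?N = {}"
        using edge_notinI[OF fullD(4)[OF f(1)] z] edge_notinI[OF fullD(4)[OF f(1)] f(2)] by simp
    qed (use vv xz yz f in auto)
    moreover have "{v, z} - X = {v, z}" using z f by auto
    ultimately show False using dist by (simp add: doubleton_eq_iff)
  next
    case b
    note b' = balanced_fullD[OF b(1)]
    define \<tau> where "\<tau> = (\<lambda>u. if u = v \<or> u \<notin> X then \<sigma> x else \<sigma> u)"
    have sg: "\<tau> u = 1 \<or> \<tau> u = -1" for u using potential_sign[OF b'(5)] by (auto simp: \<tau>_def)
    have p: "potential \<tau> F"
      by (rule potential_cong[OF b'(5) sg]) (use b'(4) b(2) in \<open>auto simp: \<tau>_def\<close>)
    have bt: "balanced_full \<tau> E F X" using b(1) p by (simp add: balanced_full_def)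
    show False
    proof (cases "z \<in> X")
      case False
      let ?N = "{({v, x}, 1 :: int), ({v, y}, 1), ({v, z}, 1), ({x, z}, 1), ({y, z}, 1)}"
      have "\<tau> v * \<tau> x = 1" "\<tau> v * \<tau> y = 1" "\<tau> v * \<tau> z = 1" "\<tau> x * \<tau> z = 1" "\<tau> y * \<tau> z = 1"
        using sg[of x] b False by (auto simp: \<tau>_def)
      then have pp: "potential \<tau> (F \<union> ?N)"
        using p by (simp only: Un_insert_right Un_empty_right) (intro potential_insert; simp)
      have "card ?N \<le> 2 * card ({v, z} - X)"
      proof (rule balanced_full_add_edges(2)[OF t bt _ _ _ _ pp])
        show "F \<inter> ?N = {}"
          using edge_notinI[OF b'(4) False] edge_notinI[OF b'(4) b(2)] by simp
      qed (use vv xz yz b in auto)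
      moreover have "{v, z} - X = {v, z}" using False b by auto
      ultimately show False using dist by (simp add: doubleton_eq_iff)
    next
      case True
      have ne: "\<sigma> x \<noteq> \<sigma> z" using no_balanced_full[OF b(1-4) True b(5)] by blast
      let ?N = "{({v, x}, 1 :: int), ({v, y}, 1), ({v, z}, 1), ({x, z}, 1)}"
      have "({x, z}, 1) \<notin> F"
      proof
        assume "({x, z}, 1) \<in> F"
        then have "1 = \<sigma> x * \<sigma> z" using b'(5) unfolding potential_def by blast
        then show False using ne potential_sign[OF b'(5), of x] potential_sign[OF b'(5), of z] by auto
      qed
      then have "F \<inter> ?N = {}" using edge_notinI[OF b'(4) b(2)] by simp
      then have "card ?N \<le> 2 * card ({v} - X) + 1"
        by (intro balanced_full_add_edges(1)[OF t b(1)]) (use vv xz b True in auto)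
      then show False using dist b(2) by (simp add: doubleton_eq_iff insert_Diff_if)
    qed
  qed
qed

section \<open>Collapsing a set of vertices\<close>

definition collapse :: "'a set \<Rightarrow> 'a \<Rightarrow> 'a \<Rightarrow> 'a" where
  "collapse K u x = (if x \<in> K then u else x)"

text \<open>Keeps the gain. Edges inside \<open>K\<close> become loops.\<close>

definition collapse_edge :: "'a set \<Rightarrow> 'a \<Rightarrow> 'a sedge \<Rightarrow> 'a sedge" where
  "collapse_edge K u = (\<lambda>(S, g). (collapse K u ` S, g))"

lemma collapse_edge_doubleton:
  "collapse_edge K u ({x, y}, g) = ({collapse K u x, collapse K u y}, g)"
  by (simp add: collapse_edge_def)

lemma collapse_simps [simp]:
  "x \<in> K \<Longrightarrow> collapse K u x = u" "x \<notin> K \<Longrightarrow> collapse K u x = x"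
  by (auto simp: collapse_def)

lemma signed_graph_edge_casesE:
  assumes "signed_graph V E" "e \<in> E"
  obtains (inside) a b g where "e = ({a, b}, g)" "a \<in> V" "b \<in> V" "a \<in> K" "b \<in> K"
  | (across) a b g where "e = ({a, b}, g)" "a \<in> V" "b \<in> V" "a \<notin> K" "b \<in> K"
  | (outside) a b g where "e = ({a, b}, g)" "a \<in> V" "b \<in> V" "a \<notin> K" "b \<notin> K"
proof -
  obtain a b g where e: "a \<in> V" "b \<in> V" "e = ({a, b}, g)" using signed_graph_edgeE[OF assms] by metis
  then have "e = ({b, a}, g)" by (simp add: insert_commute)
  then show thesis using that e by metis
qed

text \<open>Collapsing identifies two edges only if they run from the same vertex to \<open>K\<close> with the same gain, or
  if both run inside \<open>K\<close>.\<close>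

lemma inj_on_collapse_edge:
  assumes sg: "signed_graph V F" and u: "u \<notin> V"
    and across: "\<And>x k l g. x \<notin> K \<Longrightarrow> k \<in> K \<Longrightarrow> l \<in> K \<Longrightarrow> ({x, k}, g) \<in> F \<Longrightarrow> ({x, l}, g) \<in> F \<Longrightarrow> k = l"
    and inside: "\<And>e e'. e \<in> F \<Longrightarrow> e' \<in> F \<Longrightarrow> fst e \<subseteq> K \<Longrightarrow> fst e' \<subseteq> K \<Longrightarrow> e = e'"
  shows "inj_on (collapse_edge K u) F"
proof (rule inj_onI)
  fix e e' assume e: "e \<in> F" "e' \<in> F" and eq: "collapse_edge K u e = collapse_edge K u e'"
  from sg e(1) show "e = e'"
  proof (cases rule: signed_graph_edge_casesE[where K = K])
    case 1: (inside a b g)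
    from sg e(2) show ?thesis
    proof (cases rule: signed_graph_edge_casesE[where K = K])
      case (inside c d h)
      then show ?thesis using 1 assms(4)[OF e] by simp
    qed (use 1 eq u in \<open>auto simp: collapse_edge_doubleton\<close>)
  next
    case 1: (across a b g)
    from sg e(2) show ?thesis
    proof (cases rule: signed_graph_edge_casesE[where K = K])
      case (across c d h)
      then have "c = a" "h = g" using 1 eq u by (auto simp: collapse_edge_doubleton doubleton_eq_iff)
      then show ?thesis using across 1 assms(3)[of a b d g] e by simp
    qed (use 1 eq u in \<open>auto simp: collapse_edge_doubleton doubleton_eq_iff\<close>)
  next
    case 1: (outside a b g)
    from sg e(2) show ?thesis
      by (cases rule: signed_graph_edge_casesE[where K = K])
        (use 1 eq u in \<open>auto simp: collapse_edge_doubleton doubleton_eq_iff\<close>)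
  qed
qed

lemma card_collapsed_vertices:
  assumes "finite V" "K \<subseteq> V" "u \<notin> V"
  shows "card (insert u (V - K)) + card K = card V + 1"
proof -
  have "card (V - K) = card V - card K" using assms by (intro card_Diff_subset) (auto intro: finite_subset)
  moreover have "card K \<le> card V" by (rule card_mono[OF assms(1,2)])
  moreover have "card (insert u (V - K)) = card (V - K) + 1" using assms by simp
  ultimately show ?thesis by linarith
qed

text \<open>An edge set at the new vertex \<open>u\<close> pulls back to one whose vertex set contains \<open>K\<close>, and a potential
  pulls back to one that is constant on \<open>K\<close>. The two bounds are what sparsity after the collapse
  means in terms of these preimages; \<open>D\<close> is the set of edges that disappear.\<close>

lemma tight_collapse:
  assumes t: "tight V E" and K: "K \<subseteq> V" "K \<noteq> {}" and u: "u \<notin> V" and D: "D \<subseteq> E" "card D + 2 = 2 * card K"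
    and inj: "inj_on (collapse_edge K u) (E - D)"
    and inner: "\<And>a b. a \<in> K \<Longrightarrow> b \<in> K \<Longrightarrow> ({a, b}, 1) \<notin> E - D"
    and bound: "\<And>F X. F \<subseteq> E - D \<Longrightarrow> finite X \<Longrightarrow> K \<subseteq> X \<Longrightarrow> incident_verts F \<subseteq> X \<Longrightarrow>
        card F + 2 * card K \<le> 2 * card X + 1"
    and balanced_bound: "\<And>F X \<sigma>. F \<subseteq> E - D \<Longrightarrow> finite X \<Longrightarrow> K \<subseteq> X \<Longrightarrow> incident_verts F \<subseteq> X \<Longrightarrow>
        potential \<sigma> F \<Longrightarrow> (\<And>a b. a \<in> K \<Longrightarrow> b \<in> K \<Longrightarrow> \<sigma> a = \<sigma> b) \<Longrightarrow> card F + 2 * card K \<le> 2 * card X"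
  shows "tight (insert u (V - K)) (collapse_edge K u ` (E - D))"
proof -
  note t' = tightD[OF t]
  let ?c = "collapse K u" and ?ce = "collapse_edge K u"
  have finK: "finite K" using K(1) t'(4) by (rule finite_subset)
  have finD: "finite D" using D(1) t'(5) by (rule finite_subset)
  have u': "x \<noteq> u" if "x \<in> V" for x using u that by blast
  have sg: "signed_graph V (E - D)" by (rule signed_graph_mono[OF t'(1)]) blast
  have cV: "card (insert u (V - K)) + card K = card V + 1" by (rule card_collapsed_vertices[OF t'(4) K(1) u])
  have "card (?ce ` (E - D)) + card D = card E"
  proof -
    have "card (E - D) = card E - card D" by (rule card_Diff_subset[OF finD D(1)])
    moreover have "card D \<le> card E" by (rule card_mono[OF t'(5) D(1)])
    moreover have "card (?ce ` (E - D)) = card (E - D)" by (rule card_image[OF inj])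
    ultimately show ?thesis by linarith
  qed
  then have "card (?ce ` (E - D)) + 1 = 2 * card (insert u (V - K))"
    using cV D(2) t'(3) by linarith
  moreover have "signed_graph (insert u (V - K)) (?ce ` (E - D))"
  proof (rule signed_graphI)
    fix e' assume "e' \<in> ?ce ` (E - D)"
    then obtain e where e: "e \<in> E - D" "e' = ?ce e" by blast
    obtain x y g where xy: "x \<in> V" "y \<in> V" "g = 1 \<or> g = -1" "e = ({x, y}, g)" "x = y \<Longrightarrow> g = -1"
      using signed_graph_edgeE[OF sg e(1)] by metis
    have "?c x = ?c y \<longrightarrow> g = -1"
      using xy u' e inner[of x y] by (auto simp: collapse_def)
    then show "\<exists>x y g. e' = ({x, y}, g) \<and> x \<in> insert u (V - K) \<and> y \<in> insert u (V - K) \<and>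
        (g = 1 \<or> g = -1) \<and> (x = y \<longrightarrow> g = -1)"
      using xy e(2) by (intro exI[of _ "?c x"] exI[of _ "?c y"] exI[of _ g])
        (auto simp: collapse_edge_doubleton collapse_def)
  qed (use t' in simp)
  moreover have "sparse_edges (?ce ` (E - D))"
    unfolding sparse_edges_def
  proof (intro allI impI)
    fix F' X' assume F': "F' \<subseteq> ?ce ` (E - D)" "finite X'" "X' \<noteq> {}" "incident_verts F' \<subseteq> X'"
    define F where "F = {e \<in> E - D. ?ce e \<in> F'}"
    have FE: "F \<subseteq> E - D" by (auto simp: F_def)
    have img: "F' = ?ce ` F" using F'(1) by (auto simp: F_def)
    have cF: "card F' = card F" unfolding img by (rule card_image[OF inj_on_subset[OF inj FE]])
    have edge: "({?c a, ?c b}, g) \<in> F'" if "({a, b}, g) \<in> F" for a b g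
      using that by (auto simp: F_def collapse_edge_doubleton)
    have end_in: "?c a \<in> X'" "?c b \<in> X'" if "({a, b}, g) \<in> F" for a b g
      using F'(4) incident_vertsI[OF edge[OF that]] by auto
    have endV: "a \<in> V" "b \<in> V" if "({a, b}, g) \<in> F" for a b g
      using signed_graph_memD[OF sg] that FE by blast+
    have incI: "incident_verts F \<subseteq> X"
      if "\<And>a b g. ({a, b}, g) \<in> F \<Longrightarrow> a \<in> X \<and> b \<in> X" for X
    proof
      fix z assume "z \<in> incident_verts F"
      then obtain e where e: "e \<in> F" "z \<in> fst e" by (auto simp: incident_verts_def)
      obtain a b g where "e = ({a, b}, g)" using signed_graph_edgeE[OF sg] e(1) FE by (metis subsetD)
      then show "z \<in> X" using that[of a b g] e by auto
    qed
    show "card F' + 1 \<le> 2 * card X' \<and> ((\<exists>\<sigma>. potential \<sigma> F') \<longrightarrow> card F' + 2 \<le> 2 * card X')"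
    proof (cases "u \<in> X'")
      case False
      have out: "a \<notin> K \<and> b \<notin> K" if "({a, b}, g) \<in> F" for a b g
        using end_in[OF that] False by (auto simp: collapse_def split: if_splits)
      have "?ce e = e" if e: "e \<in> F" for e
      proof -
        have "e \<in> E - D" using e FE by blast
        then obtain a b g where ab: "e = ({a, b}, g)" using signed_graph_edgeE[OF sg] by metis
        then have "a \<notin> K" "b \<notin> K" using out e by blast+
        then show ?thesis using ab by (simp add: collapse_edge_doubleton)
      qed
      then have "F' = F" unfolding img by simp
      then have sub: "F' \<subseteq> E" using FE by blast
      show ?thesis using sparse_edgesD[OF t'(2) sub F'(2-4)] by blast
    next
      case True
      \<comment> \<open>the preimage of the vertex set, which contains all of \<open>K\<close>\<close>
      define X where "X = (X' - {u} - K) \<union> K"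
      have fX: "finite X" "K \<subseteq> X" using F'(2) finK by (auto simp: X_def)
      have inc: "incident_verts F \<subseteq> X"
      proof (rule incI)
        fix a b g assume ab: "({a, b}, g) \<in> F"
        show "a \<in> X \<and> b \<in> X"
          using end_in[OF ab] u'[OF endV(1)[OF ab]] u'[OF endV(2)[OF ab]] by (auto simp: X_def collapse_def split: if_splits)
      qed
      have "card X \<le> card (X' - {u} - K) + card K" unfolding X_def by (rule card_Un_le)
      moreover have "card (X' - {u} - K) \<le> card (X' - {u})" using F'(2) by (intro card_mono) auto
      moreover have "card (X' - {u}) + 1 = card X'" using True F'(2) by (metis Suc_eq_plus1 card_Suc_Diff1)
      ultimately have cX: "card X + 1 \<le> card X' + card K" by linarith
      show ?thesis
      proof (intro conjI impI)
        show "card F' + 1 \<le> 2 * card X'" using bound[OF FE fX inc] cX cF by linarith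
        assume "\<exists>\<sigma>. potential \<sigma> F'"
        then obtain \<sigma> where \<sigma>: "potential \<sigma> F'" by blast
        have "potential (\<lambda>x. \<sigma> (?c x)) F"
          using \<sigma> edge unfolding potential_def by blast
        then have "card F + 2 * card K \<le> 2 * card X"
          by (rule balanced_bound[OF FE fX inc]) simp
        then show "card F' + 2 \<le> 2 * card X'" using cX cF by linarith
      qed
    qed
  qed
  ultimately show ?thesis by (simp add: tight_def)
qed

text \<open>Describes the graph before the collapse in the form in which the moves describe their result: \<open>f\<close>
  gives the new ends of the edges at \<open>u\<close>, and \<open>L\<close> is the edge that became a loop, if any.\<close>

lemma expand_collapse:
  assumes sg: "signed_graph V (E - D)" and K: "K \<subseteq> V" and u: "u \<notin> V"
    and inj: "inj_on (collapse_edge K u) (E - D)"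
    and inner: "\<And>a b. a \<in> K \<Longrightarrow> b \<in> K \<Longrightarrow> ({a, b}, 1) \<notin> E - D"
    and E': "E' = collapse_edge K u ` (E - D)"
  obtains f L where
    "\<And>x g. x \<noteq> u \<Longrightarrow> ({x, u}, g) \<in> E' \<Longrightarrow> f x g \<in> K"
    "E - D = {e \<in> E'. u \<notin> fst e} \<union> {({x, f x g}, g) | x g. x \<noteq> u \<and> ({x, u}, g) \<in> E'} \<union> L"
    "({u}, -1) \<notin> E' \<Longrightarrow> L = {}"
    "({u}, -1) \<in> E' \<Longrightarrow> \<exists>y\<in>K. \<exists>z\<in>K. ({y, z}, -1) \<in> E \<and> L = {({y, z}, -1)}"
    "\<And>x k g. x \<notin> K \<Longrightarrow> k \<in> K \<Longrightarrow> ({x, k}, g) \<in> E - D \<Longrightarrow> f x g = k \<and> ({x, u}, g) \<in> E'"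
proof -
  let ?c = "collapse K u" and ?ce = "collapse_edge K u"
  have u': "x \<noteq> u" if "x \<in> V" for x using u that by blast
  have uK: "u \<notin> K" using K u by blast
  define f where "f x g = (SOME k. k \<in> K \<and> ({x, k}, g) \<in> E - D)" for x g
  define L where "L = {e \<in> E - D. fst e \<subseteq> K}"
  have across: "x \<notin> K \<and> (\<exists>k\<in>K. ({x, k}, g) \<in> E - D)" if x: "x \<noteq> u" and e: "({x, u}, g) \<in> E'" for x g
  proof -
    obtain e where e: "e \<in> E - D" "({x, u}, g) = ?ce e" using e E' by blast
    from sg e(1) show ?thesis
    proof (cases rule: signed_graph_edge_casesE[where K = K])
      case (across a b h)
      then have "x = a" "g = h" using e x by (auto simp: collapse_edge_doubleton doubleton_eq_iff)
      then show ?thesis using across e by blast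
    next
      case (inside a b h)
      then have "{x, u} = {u}" using e by (simp add: collapse_edge_doubleton)
      then show ?thesis using x by blast
    next
      case (outside a b h)
      then have "{x, u} = {a, b}" using e by (simp add: collapse_edge_doubleton)
      then have "u \<in> {a, b}" by (metis insertI1 insertI2)
      then show ?thesis using u'[OF outside(2)] u'[OF outside(3)] by simp
    qed
  qed
  have f: "f x g \<in> K \<and> ({x, f x g}, g) \<in> E - D" if "x \<noteq> u" "({x, u}, g) \<in> E'" for x g
    unfolding f_def by (rule someI_ex) (use across[OF that] in blast)
  have f_eq: "f x g = k \<and> ({x, u}, g) \<in> E'" if x: "x \<notin> K" and k: "k \<in> K" and e: "({x, k}, g) \<in> E - D" for x k g
  proof -
    have xu: "x \<noteq> u" using signed_graph_memD(1)[OF sg e] u' by blast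
    have "?ce ({x, k}, g) = ({x, u}, g)" using x k by (simp add: collapse_edge_doubleton)
    then have e': "({x, u}, g) \<in> E'" unfolding E' using e by (metis imageI)
    note fx = f[OF xu e']
    have "?ce ({x, f x g}, g) = ({x, u}, g)" using x fx by (simp add: collapse_edge_doubleton)
    then have "({x, f x g}, g) = ({x, k}, g)"
      using inj_onD[OF inj, of "({x, f x g}, g)" "({x, k}, g)"] fx e \<open>?ce ({x, k}, g) = ({x, u}, g)\<close> by metis
    then have "f x g = k" using x k fx by (auto simp: doubleton_eq_iff)
    then show ?thesis using e' by blast
  qed
  have eq: "E - D = {e \<in> E'. u \<notin> fst e} \<union> {({x, f x g}, g) | x g. x \<noteq> u \<and> ({x, u}, g) \<in> E'} \<union> L"
  proof (rule equalityI; rule subsetI)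
    fix e assume e: "e \<in> E - D"
    from sg e show "e \<in> {e \<in> E'. u \<notin> fst e} \<union> {({x, f x g}, g) | x g. x \<noteq> u \<and> ({x, u}, g) \<in> E'} \<union> L"
    proof (cases rule: signed_graph_edge_casesE[where K = K])
      case (inside a b g)
      then show ?thesis using e by (simp add: L_def)
    next
      case (across a b g)
      then have "f a g = b" "({a, u}, g) \<in> E'" using f_eq e by blast+
      then show ?thesis using across u'[of a] by blast
    next
      case (outside a b g)
      then have "?ce e = e" by (simp add: collapse_edge_doubleton)
      then have "e \<in> E'" unfolding E' using e by (metis imageI)
      moreover have "u \<notin> fst e" using outside u' by auto
      ultimately show ?thesis by blast
    qed
  next
    fix e assume "e \<in> {e \<in> E'. u \<notin> fst e} \<union> {({x, f x g}, g) | x g. x \<noteq> u \<and> ({x, u}, g) \<in> E'} \<union> L"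
    then consider "e \<in> E'" "u \<notin> fst e" | x g where "e = ({x, f x g}, g)" "x \<noteq> u" "({x, u}, g) \<in> E'" | "e \<in> L"
      by blast
    then show "e \<in> E - D"
    proof cases
      case 1
      then obtain e0 where e0: "e0 \<in> E - D" "e = ?ce e0" unfolding E' by blast
      from sg e0(1) show ?thesis
        by (cases rule: signed_graph_edge_casesE[where K = K])
          (use e0 1 in \<open>auto simp: collapse_edge_doubleton\<close>)
    next
      case 2
      then show ?thesis using f by blast
    next
      case 3
      then show ?thesis by (simp add: L_def)
    qed
  qed
  have L_collapse: "?ce e = ({u}, -1)" if "e \<in> L" for e
  proof -
    have e: "e \<in> E - D" "fst e \<subseteq> K" using that by (auto simp: L_def)
    obtain a b g where ab: "a \<in> V" "b \<in> V" "g = 1 \<or> g = -1" "e = ({a, b}, g)" "a = b \<Longrightarrow> g = -1"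
      using signed_graph_edgeE[OF sg e(1)] by metis
    then have "g = -1" using e inner[of a b] by auto
    then show ?thesis using ab e by (simp add: collapse_edge_doubleton)
  qed
  have "L = {}" if "({u}, -1) \<notin> E'"
    using that L_collapse unfolding E' L_def by (metis (no_types, lifting) Collect_empty_eq imageI mem_Collect_eq)
  moreover have "\<exists>y\<in>K. \<exists>z\<in>K. ({y, z}, -1) \<in> E \<and> L = {({y, z}, -1)}" if "({u}, -1) \<in> E'"
  proof -
    obtain e where e: "e \<in> E - D" "({u}, -1) = ?ce e" using \<open>({u}, -1) \<in> E'\<close> E' by blast
    obtain y z where yz: "y \<in> K" "z \<in> K" "e = ({y, z}, -1)"
    proof -
      from sg e(1) show thesis
        by (cases rule: signed_graph_edge_casesE[where K = K])
          (use e u' that in \<open>auto simp: collapse_edge_doubleton\<close>)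
    qed
    then have "e \<in> L" using e by (simp add: L_def)
    moreover have "e' = e" if "e' \<in> L" for e'
      using inj_onD[OF inj, of e' e] that e L_collapse[OF that] by (simp add: L_def)
    ultimately have "L = {e}" by blast
    then show ?thesis using yz e by blast
  qed
  ultimately show thesis using that[of f L, OF _ eq] f f_eq by blast
qed

section \<open>Contracting complete graphs and triangles\<close>

lemma card_complete_edges:
  assumes "finite K"
  shows "card {({a, b}, 1 :: int) | a b. a \<in> K \<and> b \<in> K \<and> a \<noteq> b} = card K choose 2"
proof -
  have img: "{({a, b}, 1 :: int) | a b. a \<in> K \<and> b \<in> K \<and> a \<noteq> b} = (\<lambda>S. (S, 1)) ` {S. S \<subseteq> K \<and> card S = 2}"
    (is "?D = ?I")
  proof (rule equalityI; rule subsetI)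
    fix e assume "e \<in> ?D"
    then obtain a b where "e = ({a, b}, 1)" "a \<in> K" "b \<in> K" "a \<noteq> b" by blast
    then show "e \<in> ?I" by (intro image_eqI[of _ _ "{a, b}"]) auto
  next
    fix e assume "e \<in> ?I"
    then obtain S where S: "e = (S, 1)" "S \<subseteq> K" "card S = 2" by blast
    then obtain a b where "S = {a, b}" "a \<noteq> b" by (metis card_2_iff)
    then show "e \<in> ?D" using S by blast
  qed
  show ?thesis unfolding img using n_subsets[OF assms, of 2] by (simp add: card_image inj_on_def)
qed

text \<open>A violation after the contraction would, together with the six edges of the complete graph, be a
  violation before. What is needed besides is that no two edges become parallel with equal gain.\<close>

lemma constructible_contract_K4:
  fixes V :: "nat set"
  assumes t: "tight V E" and s: "smaller_constructible V" and K: "K \<subseteq> V" "card K = 4"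
    and K4: "\<And>a b. a \<in> K \<Longrightarrow> b \<in> K \<Longrightarrow> a \<noteq> b \<Longrightarrow> ({a, b}, 1) \<in> E"
    and across: "\<And>x k l g. x \<notin> K \<Longrightarrow> k \<in> K \<Longrightarrow> l \<in> K \<Longrightarrow> ({x, k}, g) \<in> E \<Longrightarrow> ({x, l}, g) \<in> E \<Longrightarrow> k = l"
  shows "constructible \<lparr>verts = V, edges = E\<rparr>"
proof -
  note t' = tightD[OF t]
  obtain u where u: "u \<notin> V" using ex_new_if_finite[OF infinite_UNIV_nat t'(4)] by blast
  have finK: "finite K" using K(1) t'(4) by (rule finite_subset)
  have Kne: "K \<noteq> {}" using K(2) by auto
  define D :: "nat sedge set" where "D = {({a, b}, 1) | a b. a \<in> K \<and> b \<in> K \<and> a \<noteq> b}"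
  have D_memD: "g = 1 \<and> x \<in> K \<and> y \<in> K" if "({x, y}, g) \<in> D" for x y g
    using that unfolding D_def by (auto simp: doubleton_eq_iff)
  have cD: "card D = 6" unfolding D_def card_complete_edges[OF finK] K(2) by (simp add: numeral_eq_Suc)
  have DE: "D \<subseteq> E" unfolding D_def using K4 by blast
  have finD: "finite D" using DE t'(5) by (rule finite_subset)
  have incD: "incident_verts D \<subseteq> X" if "K \<subseteq> X" for X
    using that unfolding D_def incident_verts_def by auto
  have potD: "potential \<sigma> D" if "\<And>x. \<sigma> x = 1 \<or> \<sigma> x = -1" "\<And>a b. a \<in> K \<Longrightarrow> b \<in> K \<Longrightarrow> \<sigma> a = \<sigma> b" for \<sigma>
    unfolding potential_def
  proof (intro conjI allI impI)
    fix x y g assume "({x, y}, g) \<in> D"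
    then have "g = 1" "x \<in> K" "y \<in> K" using D_memD by blast+
    then show "g = \<sigma> x * \<sigma> y" using that(1)[of x] that(2)[of x y] by auto
  qed (rule that(1))
  have bound: "card F + 2 * card K \<le> 2 * card X + 1 \<and>
      (potential \<sigma> F \<longrightarrow> (\<forall>a\<in>K. \<forall>b\<in>K. \<sigma> a = \<sigma> b) \<longrightarrow> card F + 2 * card K \<le> 2 * card X)"
    if F: "F \<subseteq> E - D" "finite X" "K \<subseteq> X" "incident_verts F \<subseteq> X" for F X \<sigma>
  proof -
    have "F \<inter> D = {}" using F(1) by blast
    moreover have "finite F" using F(1) t'(5) by (meson finite_Diff finite_subset)
    ultimately have c: "card (F \<union> D) = card F + 6" using finD cD by (simp add: card_Un_disjoint)
    have sub: "F \<union> D \<subseteq> E" using F(1) DE by blast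
    have ne: "X \<noteq> {}" using F(3) Kne by blast
    have inc: "incident_verts (F \<union> D) \<subseteq> X" using F(4) incD[OF F(3)] by simp
    have 1: "card F + 6 + 1 \<le> 2 * card X" using sparse_edgesD(1)[OF t'(2) sub F(2) ne inc] c by linarith
    have 2: "card F + 6 + 2 \<le> 2 * card X" if "potential \<sigma> F" "\<forall>a\<in>K. \<forall>b\<in>K. \<sigma> a = \<sigma> b"
    proof -
      have "potential \<sigma> (F \<union> D)"
        by (rule potential_Un[OF that(1) potD[OF potential_sign[OF that(1)]]]) (use that(2) in blast)
      then show ?thesis using sparse_edgesD(2)[OF t'(2) sub F(2) ne inc] unfolding c by simp
    qed
    show ?thesis
    proof (intro conjI impI)
      show "card F + 2 * card K \<le> 2 * card X + 1" using 1 K(2) by linarith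
      assume "potential \<sigma> F" "\<forall>a\<in>K. \<forall>b\<in>K. \<sigma> a = \<sigma> b"
      then show "card F + 2 * card K \<le> 2 * card X" using 2 K(2) by linarith
    qed
  qed
  have sg: "signed_graph V (E - D)" by (rule signed_graph_mono[OF t'(1)]) blast
  have inner: "({a, b}, 1) \<notin> E - D" if "a \<in> K" "b \<in> K" for a b
  proof
    assume e: "({a, b}, 1) \<in> E - D"
    then have "a \<noteq> b" using signed_graph_memD(4)[OF t'(1), of a b 1] by auto
    then have "({a, b}, 1) \<in> D" using that unfolding D_def by blast
    then show False using e by blast
  qed
  have inj: "inj_on (collapse_edge K u) (E - D)"
  proof (rule inj_on_collapse_edge[OF sg u])
    fix e e' assume e: "e \<in> E - D" "e' \<in> E - D" "fst e \<subseteq> K" "fst e' \<subseteq> K"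
    show "e = e'"
    proof (rule ccontr)
      assume ne: "e \<noteq> e'"
      have "incident_verts {e, e'} \<subseteq> K" "{e, e'} \<subseteq> E - D" using e by auto
      then have "card {e, e'} + 2 * card K \<le> 2 * card K + 1" using bound[of "{e, e'}" K] finK by blast
      then show False using ne by simp
    qed
  qed (use across in blast)
  define E' where "E' = collapse_edge K u ` (E - D)"
  have tt: "tight (insert u (V - K)) E'"
    unfolding E'_def
  proof (rule tight_collapse[OF t K(1) Kne u DE _ inj inner])
    show "card D + 2 = 2 * card K" using cD K(2) by simp
    show "card F + 2 * card K \<le> 2 * card X + 1"
      if "F \<subseteq> E - D" "finite X" "K \<subseteq> X" "incident_verts F \<subseteq> X" for F X
      using bound[OF that] by blast
    show "card F + 2 * card K \<le> 2 * card X"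
      if "F \<subseteq> E - D" "finite X" "K \<subseteq> X" "incident_verts F \<subseteq> X" "potential \<sigma> F"
        "\<And>a b. a \<in> K \<Longrightarrow> b \<in> K \<Longrightarrow> \<sigma> a = \<sigma> b" for F X \<sigma>
      using bound[OF that(1-4), of \<sigma>] that(5,6) by blast
  qed
  have cV: "card (insert u (V - K)) < card V" using card_collapsed_vertices[OF t'(4) K(1) u] K(2) by linarith
  obtain f L where f: "\<And>x g. x \<noteq> u \<Longrightarrow> ({x, u}, g) \<in> E' \<Longrightarrow> f x g \<in> K"
    and ED: "E - D = {e \<in> E'. u \<notin> fst e} \<union> {({x, f x g}, g) | x g. x \<noteq> u \<and> ({x, u}, g) \<in> E'} \<union> L"
    and L: "({u}, -1) \<notin> E' \<Longrightarrow> L = {}"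
      "({u}, -1) \<in> E' \<Longrightarrow> \<exists>y\<in>K. \<exists>z\<in>K. ({y, z}, -1) \<in> E \<and> L = {({y, z}, -1)}"
    and fE: "\<And>x k g. x \<notin> K \<Longrightarrow> k \<in> K \<Longrightarrow> ({x, k}, g) \<in> E - D \<Longrightarrow> f x g = k \<and> ({x, u}, g) \<in> E'"
  proof (rule expand_collapse[OF sg K(1) u inj _ E'_def], goal_cases)
    case (1 a b)
    show ?case using 1(2,3) by (rule inner)
  next
    case (2 f L)
    show ?case using 2(2-6) by (rule 2(1))
  qed
  have "\<exists>y\<in>K. \<exists>z\<in>K. L = (if ({u}, -1) \<in> E' then {({y, z}, -1)} else {})"
    using L Kne by (cases "({u}, -1) \<in> E'") auto
  then obtain y z where yz: "y \<in> K" "z \<in> K" "L = (if ({u}, -1) \<in> E' then {({y, z}, -1)} else {})" by blast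
  let ?H = "\<lparr>verts = insert u (V - K), edges = E'\<rparr>"
  have "E = {e \<in> E'. u \<notin> fst e} \<union> D \<union> {({x, f x g}, g) | x g. x \<noteq> u \<and> ({x, u}, g) \<in> E'} \<union> L"
    using ED DE by blast
  then have E: "E = {e \<in> edges ?H. u \<notin> fst e} \<union> {({a, b}, 1) | a b. a \<in> K \<and> b \<in> K \<and> a \<noteq> b}
      \<union> {({x, f x g}, g) | x g. x \<noteq> u \<and> ({x, u}, g) \<in> edges ?H}
      \<union> (if ({u}, -1) \<in> edges ?H then {({y, z}, -1)} else {})"
    unfolding yz(3) D_def by simp
  have V: "V = (verts ?H - {u}) \<union> K" using u K(1) by auto
  have "move ?H \<lparr>verts = (verts ?H - {u}) \<union> K,
      edges = {e \<in> edges ?H. u \<notin> fst e} \<union> {({a, b}, 1) | a b. a \<in> K \<and> b \<in> K \<and> a \<noteq> b}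
      \<union> {({x, f x g}, g) | x g. x \<noteq> u \<and> ({x, u}, g) \<in> edges ?H}
      \<union> (if ({u}, -1) \<in> edges ?H then {({y, z}, -1)} else {})\<rparr>"
    by (rule move.vertex_to_K4) (use K u f yz in auto)
  then have "move ?H \<lparr>verts = V, edges = E\<rparr>" unfolding E[symmetric] V[symmetric] .
  then show ?thesis by (rule constructible_by_move[OF s cV tt])
qed

text \<open>The edges \<open>ab\<close> and \<open>bc\<close> disappear. A vertex set that contains \<open>c\<close> can be enlarged by both, so its
  bound survives. A vertex set without \<open>c\<close> can only be enlarged by \<open>ab\<close>, which is one edge short; the
  last two assumptions supply it.\<close>

lemma constructible_contract_triangle:
  fixes V :: "nat set"
  assumes t: "tight V E" and s: "smaller_constructible V"
    and tri: "({a, b}, 1) \<in> E" "({a, c}, 1) \<in> E" "({b, c}, 1) \<in> E" "a \<noteq> b" "a \<noteq> c" "b \<noteq> c"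
    and par: "({a, b}, -1) \<notin> E"
    and nbr: "\<And>x g. x \<notin> {a, b} \<Longrightarrow> ({x, a}, g) \<in> E \<Longrightarrow> ({x, b}, g) \<in> E \<Longrightarrow> x = c \<and> g = 1"
    and no_full: "\<And>F X. full E F X \<Longrightarrow> a \<in> X \<Longrightarrow> b \<in> X \<Longrightarrow> c \<in> X"
    and no_balanced_full: "\<And>\<sigma> F X. balanced_full \<sigma> E F X \<Longrightarrow> a \<in> X \<Longrightarrow> b \<in> X \<Longrightarrow> \<sigma> a = \<sigma> b \<Longrightarrow> c \<in> X"
  shows "constructible \<lparr>verts = V, edges = E\<rparr>"
proof -
  note t' = tightD[OF t]
  obtain u where u: "u \<notin> V" using ex_new_if_finite[OF infinite_UNIV_nat t'(4)] by blast
  have abcV: "a \<in> V" "b \<in> V" "c \<in> V" using signed_graph_memD[OF t'(1)] tri by blast+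
  define K where "K = {a, b}"
  have K: "K \<subseteq> V" "card K = 2" "finite K" "K \<noteq> {}" using abcV tri(4) by (auto simp: K_def)
  have aK: "a \<in> K" "b \<in> K" by (simp_all add: K_def)
  define D where "D = {({a, b}, 1 :: int), ({b, c}, 1)}"
  have cD: "card D = 2" unfolding D_def using tri by (simp add: doubleton_eq_iff)
  have DE: "D \<subseteq> E" unfolding D_def using tri by blast
  have finD: "finite D" by (simp add: D_def)
  have acD: "({a, c}, 1) \<notin> D" unfolding D_def using tri by (simp add: doubleton_eq_iff)
  have bound: "card F + 2 * card K \<le> 2 * card X + 1 \<and>
      (potential \<sigma> F \<longrightarrow> (\<forall>a\<in>K. \<forall>b\<in>K. \<sigma> a = \<sigma> b) \<longrightarrow> card F + 2 * card K \<le> 2 * card X)"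
    if F: "F \<subseteq> E - D" "finite X" "K \<subseteq> X" "incident_verts F \<subseteq> X" for F X \<sigma>
  proof -
    have FD: "F \<inter> D = {}" using F(1) by blast
    have finF: "finite F" using F(1) t'(5) by (meson finite_Diff finite_subset)
    have abX: "a \<in> X" "b \<in> X" "X \<noteq> {}" using F(3) by (auto simp: K_def)
    show ?thesis
    proof (cases "c \<in> X")
      case True
      have cFD: "card (F \<union> D) = card F + 2" using card_Un_disjoint[OF finF finD FD] cD by simp
      have incD: "incident_verts D \<subseteq> X" unfolding D_def using abX True by simp
      have sub: "F \<union> D \<subseteq> E" using F(1) DE by blast
      have inc: "incident_verts (F \<union> D) \<subseteq> X" using F(4) incD by simp
      have 1: "card F + 2 + 1 \<le> 2 * card X" using sparse_edgesD(1)[OF t'(2) sub F(2) abX(3) inc] cFD by linarith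
      have 2: "card F + 4 \<le> 2 * card X" if p: "potential \<sigma> F" and eq: "\<forall>a\<in>K. \<forall>b\<in>K. \<sigma> a = \<sigma> b"
      proof (cases "({a, c}, 1) \<in> F")
        case True
        have ab: "\<sigma> a = \<sigma> b" using eq aK by blast
        have "1 = \<sigma> a * \<sigma> c" using p True unfolding potential_def by blast
        then have 1: "1 = \<sigma> b * \<sigma> c" unfolding ab .
        have 2: "1 = \<sigma> a * \<sigma> b" using ab sign_square[of \<sigma> b, OF potential_sign[OF p]] by simp
        have "potential \<sigma> (F \<union> D)"
          unfolding D_def Un_insert_right Un_empty_right
          by (rule potential_insert[OF potential_insert[OF p 1] 2])
        from sparse_edgesD(2)[OF t'(2) sub F(2) abX(3) inc this] show ?thesis unfolding cFD by linarith
      next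
        case False
        have sub': "insert ({a, c}, 1) (F \<union> D) \<subseteq> E" using sub tri by blast
        have inc': "incident_verts (insert ({a, c}, 1) (F \<union> D)) \<subseteq> X" using inc abX \<open>c \<in> X\<close> by simp
        have "({a, c}, 1) \<notin> F \<union> D" using False acD by blast
        then have "card (insert ({a, c}, 1) (F \<union> D)) = card F + 3" using cFD finF finD by simp
        then show ?thesis using sparse_edgesD(1)[OF t'(2) sub' F(2) abX(3) inc'] by linarith
      qed
      show ?thesis
      proof (intro conjI impI)
        show "card F + 2 * card K \<le> 2 * card X + 1" using 1 K(2) by linarith
        assume "potential \<sigma> F" "\<forall>a\<in>K. \<forall>b\<in>K. \<sigma> a = \<sigma> b"
        then show "card F + 2 * card K \<le> 2 * card X" using 2 K(2) by linarith
      qed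
    next
      case False
      let ?F = "insert ({a, b}, 1) F"
      have "({a, b}, 1) \<notin> F" using FD by (auto simp: D_def)
      then have cF: "card ?F = card F + 1" using finF by simp
      have sub: "?F \<subseteq> E" using F(1) tri by blast
      have inc: "incident_verts ?F \<subseteq> X" using F(4) abX by simp
      have "\<not> full E ?F X" using no_full abX False by blast
      then have 1: "card F + 3 \<le> 2 * card X" using sub inc abX F(2) cF by (simp add: full_def)
      have 2: "card F + 4 \<le> 2 * card X" if p: "potential \<sigma> F" and eq: "\<forall>a\<in>K. \<forall>b\<in>K. \<sigma> a = \<sigma> b"
      proof -
        have ab: "\<sigma> a = \<sigma> b" using eq aK by blast
        then have "1 = \<sigma> a * \<sigma> b" using sign_square[of \<sigma> b, OF potential_sign[OF p]] by simp
        then have "potential \<sigma> ?F" by (rule potential_insert[OF p])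
        moreover have "\<not> balanced_full \<sigma> E ?F X" using no_balanced_full abX False ab by blast
        ultimately show ?thesis using sub inc abX F(2) cF by (simp add: balanced_full_def)
      qed
      show ?thesis
      proof (intro conjI impI)
        show "card F + 2 * card K \<le> 2 * card X + 1" using 1 K(2) by linarith
        assume "potential \<sigma> F" "\<forall>a\<in>K. \<forall>b\<in>K. \<sigma> a = \<sigma> b"
        then show "card F + 2 * card K \<le> 2 * card X" using 2 K(2) by linarith
      qed
    qed
  qed
  have sg: "signed_graph V (E - D)" by (rule signed_graph_mono[OF t'(1)]) blast
  have inner: "({x, y}, 1) \<notin> E - D" if "x \<in> K" "y \<in> K" for x y
  proof
    assume e: "({x, y}, 1) \<in> E - D"
    then have "x \<noteq> y" using signed_graph_memD(4)[OF t'(1), of x y 1] by auto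
    then have "{x, y} = {a, b}" using that by (auto simp: K_def)
    then show False using e by (simp add: D_def)
  qed
  have inside_loop: "\<exists>y\<in>K. e = ({y}, -1)" if e: "e \<in> E - D" "fst e \<subseteq> K" for e
  proof -
    obtain x y g where xy: "e = ({x, y}, g)" "g = 1 \<or> g = -1"
      using signed_graph_edgeE[OF sg e(1)] by metis
    then have xyK: "x \<in> K" "y \<in> K" "g = -1" using e inner[of x y] by auto
    have "x = y"
    proof (rule ccontr)
      assume "x \<noteq> y"
      then have "{x, y} = {a, b}" using xyK by (auto simp: K_def)
      then show False using par xy xyK e by simp
    qed
    then show ?thesis using xy xyK by auto
  qed
  have inj: "inj_on (collapse_edge K u) (E - D)"
  proof (rule inj_on_collapse_edge[OF sg u])
    fix x k l g assume x: "x \<notin> K" "k \<in> K" "l \<in> K" and e: "({x, k}, g) \<in> E - D" "({x, l}, g) \<in> E - D"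
    show "k = l"
    proof (rule ccontr)
      assume "k \<noteq> l"
      then have "({x, a}, g) \<in> E" "({x, b}, g) \<in> E" "({x, b}, g) \<notin> D" using x e by (auto simp: K_def)
      then show False using nbr[of x g] x by (auto simp: K_def D_def insert_commute)
    qed
  next
    fix e e' assume e: "e \<in> E - D" "e' \<in> E - D" "fst e \<subseteq> K" "fst e' \<subseteq> K"
    show "e = e'"
    proof (rule ccontr)
      assume ne: "e \<noteq> e'"
      have "\<not> (({a}, -1) \<in> E \<and> ({b}, -1) \<in> E)"
      proof
        assume l: "({a}, -1) \<in> E \<and> ({b}, -1) \<in> E"
        have "card {({a}, -1 :: int), ({b}, -1), ({a, b}, 1)} = 3" using tri by simp
        then have "full E {({a}, -1), ({b}, -1), ({a, b}, 1)} {a, b}"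
          using l tri by (simp add: full_def)
        then show False using no_full[of _ "{a, b}"] tri by blast
      qed
      then show False using inside_loop[OF e(1,3)] inside_loop[OF e(2,4)] ne e by (auto simp: K_def)
    qed
  qed
  define E' where "E' = collapse_edge K u ` (E - D)"
  have tt: "tight (insert u (V - K)) E'"
    unfolding E'_def
  proof (rule tight_collapse[OF t K(1) K(4) u DE _ inj inner])
    show "card D + 2 = 2 * card K" using cD K(2) by simp
    show "card F + 2 * card K \<le> 2 * card X + 1"
      if "F \<subseteq> E - D" "finite X" "K \<subseteq> X" "incident_verts F \<subseteq> X" for F X
      using bound[OF that] by blast
    show "card F + 2 * card K \<le> 2 * card X"
      if "F \<subseteq> E - D" "finite X" "K \<subseteq> X" "incident_verts F \<subseteq> X" "potential \<sigma> F"
        "\<And>a b. a \<in> K \<Longrightarrow> b \<in> K \<Longrightarrow> \<sigma> a = \<sigma> b" for F X \<sigma>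
      using bound[OF that(1-4), of \<sigma>] that(5,6) by blast
  qed
  have cV: "card (insert u (V - K)) < card V" using card_collapsed_vertices[OF t'(4) K(1) u] K(2) by linarith
  obtain f L where f: "\<And>x g. x \<noteq> u \<Longrightarrow> ({x, u}, g) \<in> E' \<Longrightarrow> f x g \<in> K"
    and ED: "E - D = {e \<in> E'. u \<notin> fst e} \<union> {({x, f x g}, g) | x g. x \<noteq> u \<and> ({x, u}, g) \<in> E'} \<union> L"
    and L: "({u}, -1) \<notin> E' \<Longrightarrow> L = {}"
      "({u}, -1) \<in> E' \<Longrightarrow> \<exists>y\<in>K. \<exists>z\<in>K. ({y, z}, -1) \<in> E \<and> L = {({y, z}, -1)}"
    and fE: "\<And>x k g. x \<notin> K \<Longrightarrow> k \<in> K \<Longrightarrow> ({x, k}, g) \<in> E - D \<Longrightarrow> f x g = k \<and> ({x, u}, g) \<in> E'"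
  proof (rule expand_collapse[OF sg K(1) u inj _ E'_def], goal_cases)
    case (1 a b)
    show ?case using 1(2,3) by (rule inner)
  next
    case (2 f L)
    show ?case using 2(2-6) by (rule 2(1))
  qed
  have "\<exists>y\<in>K. L = (if ({u}, -1) \<in> E' then {({y}, -1)} else {})"
  proof (cases "({u}, -1) \<in> E'")
    case True
    then obtain y z where yz: "y \<in> K" "z \<in> K" "L = {({y, z}, -1)}" using L by blast
    have "({y, z}, -1) \<in> E - D" "fst ({y, z}, -1) \<subseteq> K" using ED yz by auto
    then obtain w where "w \<in> K" "({y, z}, -1 :: int) = ({w}, -1)" using inside_loop by blast
    then show ?thesis using yz True by auto
  qed (use L(1) K in auto)
  then obtain y where y: "y \<in> K" "L = (if ({u}, -1) \<in> E' then {({y}, -1)} else {})" by blast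
  let ?H = "\<lparr>verts = insert u (V - K), edges = E'\<rparr>"
  have cK: "c \<notin> K" using tri by (auto simp: K_def)
  have "({c, a}, 1) \<in> E - D" using tri acD by (simp add: insert_commute)
  then have fc: "f c 1 = a" "({c, u}, 1) \<in> E'" using fE[OF cK, of a 1] by (auto simp: K_def)
  have cu: "c \<noteq> u" using abcV u by blast
  have R: "{({x, f x g}, g) | x g. x \<noteq> u \<and> ({x, u}, g) \<in> E'}
      = insert ({c, a}, 1) {({x, f x g}, g) | x g. x \<noteq> u \<and> ({x, u}, g) \<in> E' \<and> (x, g) \<noteq> (c, 1)}" (is "?A = ?B")
  proof (rule equalityI; rule subsetI)
    fix e assume "e \<in> ?A"
    then obtain x g where "e = ({x, f x g}, g)" "x \<noteq> u" "({x, u}, g) \<in> E'" by blast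
    then show "e \<in> ?B" using fc by (cases "(x, g) = (c, 1)") auto
  next
    fix e assume "e \<in> ?B"
    then consider "e = ({c, a}, 1)" | x g where "e = ({x, f x g}, g)" "x \<noteq> u" "({x, u}, g) \<in> E'" by blast
    then show "e \<in> ?A"
    proof cases
      case 1
      then have "e = ({c, f c 1}, 1)" using fc by simp
      then show ?thesis using fc(2) cu by blast
    qed blast
  qed
  have "E = D \<union> (E - D)" using DE by blast
  also have "\<dots> = D \<union> ({e \<in> E'. u \<notin> fst e} \<union>
      insert ({c, a}, 1) {({x, f x g}, g) | x g. x \<noteq> u \<and> ({x, u}, g) \<in> E' \<and> (x, g) \<noteq> (c, 1)} \<union> L)"
    by (simp only: ED R)
  also have "\<dots> = {e \<in> E'. u \<notin> fst e} \<union> {({a, b}, 1), ({a, c}, 1), ({b, c}, 1)}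
      \<union> {({x, f x g}, g) | x g. x \<noteq> u \<and> ({x, u}, g) \<in> E' \<and> (x, g) \<noteq> (c, 1)} \<union> L"
    unfolding D_def insert_commute[of c a "{}"] by blast
  finally have E: "E = {e \<in> edges ?H. u \<notin> fst e} \<union> {({a, b}, 1), ({a, c}, 1), ({b, c}, 1)}
      \<union> {({x, f x g}, g) | x g. x \<noteq> u \<and> ({x, u}, g) \<in> edges ?H \<and> (x, g) \<noteq> (c, 1)}
      \<union> (if ({u}, -1) \<in> edges ?H then {({y}, -1)} else {})"
    unfolding y(2) by simp
  have V: "V = (verts ?H - {u}) \<union> {a, b}" using u abcV by (auto simp: K_def)
  have "move ?H \<lparr>verts = (verts ?H - {u}) \<union> {a, b},
      edges = {e \<in> edges ?H. u \<notin> fst e} \<union> {({a, b}, 1), ({a, c}, 1), ({b, c}, 1)}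
      \<union> {({x, f x g}, g) | x g. x \<noteq> u \<and> ({x, u}, g) \<in> edges ?H \<and> (x, g) \<noteq> (c, 1)}
      \<union> (if ({u}, -1) \<in> edges ?H then {({y}, -1)} else {})\<rparr>"
  proof (rule move.edge_to_K3)
    show "({u, c}, 1) \<in> edges ?H" using fc by (simp add: insert_commute)
    show "a \<notin> verts ?H" "b \<notin> verts ?H" using u abcV by (auto simp: K_def)
    show "f x g \<in> {a, b}" if "x \<noteq> u" "({x, u}, g) \<in> edges ?H" for x g using f that by (simp add: K_def)
    show "y \<in> {a, b}" using y(1) by (simp add: K_def)
  qed (use cu tri in auto)
  then have "move ?H \<lparr>verts = V, edges = E\<rparr>" unfolding E[symmetric] V[symmetric] .
  then show ?thesis by (rule constructible_by_move[OF s cV tt])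
qed

text \<open>Start from a balanced full set \<open>M\<close> with gains 1 and a vertex \<open>w\<close> outside that forms a triangle with
  an edge \<open>pq\<close> of \<open>M\<close>. A full or balanced full set containing \<open>w\<close> and \<open>p\<close> but not \<open>q\<close> would, joined
  with \<open>M\<close> and the edge \<open>wq\<close>, break a bound. So the triangle can be contracted along \<open>wp\<close> unless \<open>wp\<close>
  is doubled or \<open>w\<close> and \<open>p\<close> have a further common neighbour \<open>x\<close> along edges of equal gain. Counting
  shows that \<open>x\<close> lies outside \<open>M\<close>; after switching, \<open>M\<close> extended by \<open>w\<close> and the vertex \<open>x\<close> form a
  larger configuration of the same kind, and induction applies. The same holds for \<open>wq\<close>, and counting
  excludes that both \<open>wp\<close> and \<open>wq\<close> are doubled.\<close>

lemma constructible_triangle_extension: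
  fixes V :: "nat set"
  assumes s: "smaller_constructible V"
  shows "tight V E \<Longrightarrow> balanced_full (\<lambda>_. 1) E M X \<Longrightarrow> X \<subseteq> V \<Longrightarrow> ({p, q}, 1) \<in> M \<Longrightarrow> w \<in> V \<Longrightarrow> w \<notin> X \<Longrightarrow>
    ({w, p}, 1) \<in> E \<Longrightarrow> ({w, q}, 1) \<in> E \<Longrightarrow> constructible \<lparr>verts = V, edges = E\<rparr>"
proof (induction "card V - card X" arbitrary: E M X p q w rule: less_induct)
  case less
  note t = less.prems(1) and bf = less.prems(2) and XV = less.prems(3) and pqM = less.prems(4)
    and wV = less.prems(5) and wX = less.prems(6) and wp = less.prems(7) and wq = less.prems(8)
  note t' = tightD[OF t] and bf' = balanced_fullD[OF bf]
  have pqE: "({p, q}, 1) \<in> E" using pqM bf'(1) by blast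
  have pq: "p \<noteq> q"
  proof
    assume "p = q" then show False using signed_graph_memD(4)[OF t'(1) pqE] by simp
  qed
  have pX: "p \<in> X" and qX: "q \<in> X" using bf'(4) incident_vertsI[OF pqM] by auto
  have M1: "g = 1" if "({x, y}, g) \<in> M" for x y g using bf'(5) that unfolding potential_def by (metis mult_1)
  have finM: "finite M" using bf'(1) t'(5) by (rule finite_subset)
  have wM: "({w, a}, g) \<notin> M" for a g by (rule edge_notinI[OF bf'(4) wX]) simp
  \<comment> \<open>two new edges for one new vertex keep the set full\<close>
  define M' where "M' = insert ({w, p}, 1) (insert ({w, q}, 1) M)"
  have bf1: "balanced_full (\<lambda>_. 1) E M' (insert w X)"
  proof -
    have "card M' = card M + 2" unfolding M'_def using finM wM pq by (simp add: doubleton_eq_iff)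
    moreover have "card (insert w X) = card X + 1" using wX bf'(2) by simp
    moreover have "potential (\<lambda>_. 1) M'" unfolding M'_def by (intro potential_insert bf'(5)) simp_all
    moreover have "M' \<subseteq> E" unfolding M'_def using wp wq bf'(1) by blast
    moreover have "incident_verts M' \<subseteq> insert w X" unfolding M'_def using bf'(4) pX qX by auto
    ultimately show ?thesis using bf'(2,6) by (simp add: balanced_full_def)
  qed
  have smaller: "card V - card (insert w X) < card V - card X"
  proof -
    have "card (insert w X) \<le> card V" using wV XV t'(4) by (intro card_mono) auto
    then show ?thesis using wX bf'(2) by simp
  qed
  have w'V: "insert w X \<subseteq> V" using wV XV by blast
  show ?case
  proof (rule ccontr)
    assume nc: "\<not> constructible \<lparr>verts = V, edges = E\<rparr>"
    have negative: "({w, a}, -1) \<in> E" if ab: "a = p \<and> b = q \<or> a = q \<and> b = p" for a b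
    proof (rule ccontr)
      assume par: "({w, a}, -1) \<notin> E"
      have aX: "a \<in> X" and bX: "b \<in> X" and ne: "a \<noteq> b" using ab pX qX pq by auto
      have wa: "({w, a}, 1) \<in> E" and wb: "({w, b}, 1) \<in> E" and abE: "({a, b}, 1) \<in> E"
        using ab wp wq pqE by (auto simp: insert_commute)
      have waM: "({w, a}, 1) \<in> M'" using ab unfolding M'_def by blast
      have wa_ne: "w \<noteq> a" "w \<noteq> b" using wX aX bX by auto
      have no_full: "b \<in> Y" if f: "full E F Y" and Y: "w \<in> Y" "a \<in> Y" for F Y
      proof (rule ccontr)
        assume b: "b \<notin> Y"
        have f2: "full E (F \<union> M) (Y \<union> X)" by (rule full_Un_balanced_full[OF t f bf]) (use Y aX in blast)
        have "({w, b}, 1) \<notin> F" by (rule edge_notinI[OF fullD(4)[OF f] b]) simp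
        then have "card {({w, b}, 1 :: int)} \<le> 2 * card ({} - (Y \<union> X))"
          using wM wb Y bX by (intro full_add_edges[OF t f2]) auto
        then show False by simp
      qed
      have no_balanced_full: "b \<in> Y" if f: "balanced_full \<sigma> E F Y" and Y: "w \<in> Y" "a \<in> Y" and eq: "\<sigma> w = \<sigma> a" for \<sigma> F Y
      proof (rule ccontr)
        assume b: "b \<notin> Y"
        have sa: "\<sigma> a * \<sigma> a = 1" using sign_square[of \<sigma> a] potential_sign[OF balanced_fullD(5)[OF f]] by blast
        have fa: "balanced_full (\<lambda>u. \<sigma> a * \<sigma> u) E F Y"
          by (rule balanced_full_scale[OF f potential_sign[OF balanced_fullD(5)[OF f]]])
        have wbF: "({w, b}, 1) \<notin> F \<union> M" using edge_notinI[OF balanced_fullD(4)[OF f] b, of "{w, b}" 1] wM by simp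
        show False
        proof (rule balanced_full_Un[OF t fa bf Y(2) aX sa])
          assume f2: "full E (F \<union> M) (Y \<union> X)"
          have "card {({w, b}, 1 :: int)} \<le> 2 * card ({} - (Y \<union> X))"
            using wbF wb Y bX by (intro full_add_edges[OF t f2]) auto
          then show False by simp
        next
          fix \<tau> assume \<tau>: "balanced_full \<tau> E (F \<union> M) (Y \<union> X)"
            "\<And>y. y \<in> Y \<Longrightarrow> \<tau> y = \<sigma> a * \<sigma> y" "\<And>y. y \<in> X \<Longrightarrow> \<tau> y = 1"
          have "\<tau> w = 1" "\<tau> b = 1" using \<tau>(2)[OF Y(1)] \<tau>(3)[OF bX] eq sa by auto
          then have "potential \<tau> ((F \<union> M) \<union> {({w, b}, 1)})"
            using potential_insert[OF balanced_fullD(5)[OF \<tau>(1)], of 1 w b] by simp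
          then have "card {({w, b}, 1 :: int)} \<le> 2 * card ({} - (Y \<union> X))"
            by (intro balanced_full_add_edges(2)[OF t \<tau>(1)]) (use wbF wb Y bX in auto)
          then show False by simp
        qed
      qed
      have nbr: "x = b \<and> g = 1" if x: "x \<notin> {w, a}" and xw: "({x, w}, g) \<in> E" and xa: "({x, a}, g) \<in> E" for x g
      proof (rule ccontr)
        assume other: "\<not> (x = b \<and> g = 1)"
        have g: "g = 1 \<or> g = -1" and xV: "x \<in> V" using signed_graph_memD[OF t'(1) xw] by auto
        have xw': "({w, x}, g) \<in> E" using xw by (simp add: insert_commute)
        show False
        proof (cases "x \<in> X")
          case True
          show False
          proof (cases "g = 1")
            case g1: True
            then have xb: "x \<noteq> b" using other by blast
            let ?N = "{({w, a}, 1 :: int), ({w, b}, 1), ({w, x}, 1)}"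
            have pp: "potential (\<lambda>_. 1) (M \<union> ?N)"
              unfolding Un_insert_right Un_empty_right by (intro potential_insert bf'(5)) simp_all
            have "card ?N \<le> 2 * card ({w} - X)"
              by (rule balanced_full_add_edges(2)[OF t bf _ _ _ _ pp]) (use wM wa wb xw' g1 aX bX True in auto)
            moreover have "card ?N = 3" using xb x ne by (simp add: doubleton_eq_iff)
            ultimately show False using wX by (simp add: insert_Diff_if)
          next
            case False
            then have gm: "g = -1" using g by blast
            let ?N = "{({w, a}, 1 :: int), ({w, b}, 1), ({w, x}, -1), ({x, a}, -1)}"
            have "({x, a}, -1) \<notin> M" using M1 by force
            then have dis: "M \<inter> ?N = {}" using wM by simp
            have "card ?N \<le> 2 * card ({w} - X) + 1"
              by (rule balanced_full_add_edges(1)[OF t bf _ dis]) (use wa wb xw' xa gm aX bX True in auto)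
            moreover have "card ?N = 4" using x ne wa_ne by (simp add: doubleton_eq_iff)
            ultimately show False using wX by (simp add: insert_Diff_if)
          qed
        next
          case False
          then have xX': "x \<notin> insert w X" using x by simp
          show False
          proof (cases "g = 1")
            case True
            have "constructible \<lparr>verts = V, edges = E\<rparr>"
              by (rule less.hyps[OF smaller t bf1 w'V waM xV xX']) (use xw xa True in simp_all)
            then show False using nc by blast
          next
            case False
            then have gm: "g = -1" using g by blast
            let ?E2 = "flip_edge x ` E"
            note b1' = balanced_fullD[OF bf1]
            have "M' \<subseteq> ?E2"
            proof
              fix e assume e: "e \<in> M'"
              then have "x \<notin> fst e" using b1'(4) xX' by (auto simp: incident_verts_def)
              then have "flip_edge x e = e" by (auto simp: flip_edge_def split: prod.splits)
              then show "e \<in> ?E2" unfolding in_flip_image using e b1'(1) by auto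
            qed
            then have bf2: "balanced_full (\<lambda>_. 1) ?E2 M' (insert w X)" using bf1 by (simp add: balanced_full_def)
            have x2: "({x, w}, 1) \<in> ?E2" "({x, a}, 1) \<in> ?E2"
              unfolding in_flip_image flip_edge_doubleton using xw xa x gm by simp_all
            have "constructible \<lparr>verts = V, edges = ?E2\<rparr>"
              by (rule less.hyps[OF smaller tight_flip[OF t] bf2 w'V waM xV xX' x2])
            from constructible_flipD[OF this xV] show False using nc by blast
          qed
        qed
      qed
      have "constructible \<lparr>verts = V, edges = E\<rparr>"
        by (rule constructible_contract_triangle[OF t s wa wb abE wa_ne ne par nbr no_full no_balanced_full])
      then show False using nc by blast
    qed
    let ?N = "{({w, p}, 1 :: int), ({w, q}, 1), ({w, p}, -1), ({w, q}, -1)}"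
    have "card ?N \<le> 2 * card ({w} - X) + 1"
      by (rule balanced_full_add_edges(1)[OF t bf]) (use wM wp wq negative[of p q] negative[of q p] pX qX in auto)
    moreover have "card ?N = 4" using pq by (simp add: doubleton_eq_iff)
    ultimately show False using wX by (simp add: insert_Diff_if)
  qed
qed

section \<open>Tight signed graphs are constructible\<close>

text \<open>If no edge can be reinserted, \<open>v\<close> and its neighbours form a complete graph with gains 1. It can be
  contracted unless some vertex sends two edges of equal gain to it, and then the complete graph
  itself is the balanced full set from which a triangle can be contracted.\<close>

lemma constructible_degree_3_gain_1:
  fixes V :: "nat set"
  assumes t: "tight V E" and s: "smaller_constructible V" and v: "v \<in> V"
    and st: "star E v = {({v, x}, 1), ({v, y}, 1), ({v, z}, 1)}"
    and V: "x \<in> V" "y \<in> V" "z \<in> V" and dist: "x \<noteq> v" "y \<noteq> v" "z \<noteq> v" "x \<noteq> y" "x \<noteq> z" "y \<noteq> z"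
  shows "constructible \<lparr>verts = V, edges = E\<rparr>"
proof (rule ccontr)
  assume nc: "\<not> ?thesis"
  have xy: "({x, y}, 1) \<in> E" by (rule irreducible_degree_3_neighbours_adjacent[OF t s v st V dist nc])
  have st2: "star E v = {({v, x}, 1), ({v, z}, 1), ({v, y}, 1)}" using st by auto
  have xz: "({x, z}, 1) \<in> E"
    by (rule irreducible_degree_3_neighbours_adjacent[OF t s v st2 V(1,3,2) dist(1,3,2,5,4) dist(6)[symmetric] nc])
  have st3: "star E v = {({v, y}, 1), ({v, z}, 1), ({v, x}, 1)}" using st by auto
  have yz: "({y, z}, 1) \<in> E"
    by (rule irreducible_degree_3_neighbours_adjacent[OF t s v st3 V(2,3,1) dist(2,3,1,6) dist(4)[symmetric] dist(5)[symmetric] nc])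
  have starE: "star E v \<subseteq> E" by (auto simp: star_def)
  define K where "K = {v, x, y, z}"
  have K: "K \<subseteq> V" "card K = 4" "finite K" using v V dist by (auto simp: K_def)
  define M where "M = {({v, x}, 1 :: int), ({v, y}, 1), ({v, z}, 1), ({x, y}, 1), ({x, z}, 1), ({y, z}, 1)}"
  have ME: "M \<subseteq> E" unfolding M_def using st starE xy xz yz by auto
  have KM: "({a, b}, 1) \<in> M" if "a \<in> K" "b \<in> K" "a \<noteq> b" for a b
    using that unfolding K_def M_def by (auto simp: insert_commute)
  have cM: "card M = 6" unfolding M_def using dist by (simp add: doubleton_eq_iff)
  have incM: "incident_verts M \<subseteq> K" unfolding M_def K_def by simp
  have potM: "potential (\<lambda>_. 1) M"
    unfolding potential_def M_def by auto
  have bfM: "balanced_full (\<lambda>_. 1) E' M K" if "M \<subseteq> E'" for E'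
    using that K cM incM potM by (auto simp: balanced_full_def K_def)
  have across: "k = l" if w: "w \<notin> K" "k \<in> K" "l \<in> K" and e: "({w, k}, g) \<in> E" "({w, l}, g) \<in> E" for w k l g
  proof (rule ccontr)
    assume "k \<noteq> l"
    then have kl: "({k, l}, 1) \<in> M" using KM w by blast
    have wV: "w \<in> V" and g: "g = 1 \<or> g = -1" using signed_graph_memD[OF tightD(1)[OF t] e(1)] by auto
    have wkl: "w \<noteq> k" "w \<noteq> l" using w by auto
    show False
    proof (cases "g = 1")
      case True
      then show False using constructible_triangle_extension[OF s t bfM[OF ME] K(1) kl wV w(1)] e nc by blast
    next
      case False
      then have gm: "g = -1" using g by blast
      have "M \<subseteq> flip_edge w ` E"
      proof
        fix e assume e: "e \<in> M"
        then have "w \<notin> fst e" using incM w by (auto simp: incident_verts_def)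
        then have "flip_edge w e = e" by (auto simp: flip_edge_def split: prod.splits)
        then show "e \<in> flip_edge w ` E" unfolding in_flip_image using e ME by auto
      qed
      moreover have "({w, k}, 1) \<in> flip_edge w ` E" "({w, l}, 1) \<in> flip_edge w ` E"
        unfolding in_flip_image flip_edge_doubleton using e gm wkl by simp_all
      ultimately have "constructible \<lparr>verts = V, edges = flip_edge w ` E\<rparr>"
        using constructible_triangle_extension[OF s tight_flip[OF t] bfM K(1) kl wV w(1)] by blast
      from constructible_flipD[OF this wV] show False using nc by blast
    qed
  qed
  have K4: "({a, b}, 1) \<in> E" if "a \<in> K" "b \<in> K" "a \<noteq> b" for a b using KM[OF that] ME by blast
  have "constructible \<lparr>verts = V, edges = E\<rparr>"
    by (rule constructible_contract_K4[OF t s K(1,2)]) (fact K4, fact across)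
  then show False using nc by blast
qed

text \<open>The three gains become 1 by switching at the three neighbours.\<close>

lemma constructible_degree_3_distinct:
  fixes V :: "nat set"
  assumes s: "smaller_constructible V" and t: "tight V E" and v: "v \<in> V"
    and st: "star E v = {({v, x}, g1), ({v, y}, g2), ({v, z}, g3)}"
    and g: "g1 = 1 \<or> g1 = -1" "g2 = 1 \<or> g2 = -1" "g3 = 1 \<or> g3 = -1"
    and V: "x \<in> V" "y \<in> V" "z \<in> V" and dist: "x \<noteq> v" "y \<noteq> v" "z \<noteq> v" "x \<noteq> y" "x \<noteq> z" "y \<noteq> z"
  shows "constructible \<lparr>verts = V, edges = E\<rparr>"
proof -
  have 1: "constructible \<lparr>verts = V, edges = E\<rparr>"
    if t: "tight V E" and st: "star E v = {({v, x}, g1), ({v, y}, 1), ({v, z}, 1)}" for E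
  proof (cases "g1 = 1")
    case True
    then show ?thesis using constructible_degree_3_gain_1[OF t s v _ V dist] st by simp
  next
    case False
    then have g1: "g1 = -1" using g by blast
    have "star (flip_edge x ` E) v = {({v, x}, 1), ({v, y}, 1), ({v, z}, 1)}"
      unfolding star_flip st using g1 dist by (simp add: flip_edge_doubleton)
    then have "constructible \<lparr>verts = V, edges = flip_edge x ` E\<rparr>"
      using constructible_degree_3_gain_1[OF tight_flip[OF t] s v _ V dist] by simp
    then show ?thesis by (rule constructible_flipD[OF _ V(1)])
  qed
  have 2: "constructible \<lparr>verts = V, edges = E\<rparr>"
    if t: "tight V E" and st: "star E v = {({v, x}, g1), ({v, y}, g2), ({v, z}, 1)}" for E
  proof (cases "g2 = 1")
    case True
    then show ?thesis using 1[OF t] st by simp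
  next
    case False
    then have g2: "g2 = -1" using g by blast
    have "star (flip_edge y ` E) v = {({v, x}, g1), ({v, y}, 1), ({v, z}, 1)}"
      unfolding star_flip st using g2 dist by (simp add: flip_edge_doubleton)
    then have "constructible \<lparr>verts = V, edges = flip_edge y ` E\<rparr>"
      using 1[OF tight_flip[OF t]] by simp
    then show ?thesis by (rule constructible_flipD[OF _ V(2)])
  qed
  show ?thesis
  proof (cases "g3 = 1")
    case True
    then show ?thesis using 2[OF t] st by simp
  next
    case False
    then have g3: "g3 = -1" using g by blast
    have "star (flip_edge z ` E) v = {({v, x}, g1), ({v, y}, g2), ({v, z}, 1)}"
      unfolding star_flip st using g3 dist by (simp add: flip_edge_doubleton)
    then have "constructible \<lparr>verts = V, edges = flip_edge z ` E\<rparr>"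
      using 2[OF tight_flip[OF t]] by simp
    then show ?thesis by (rule constructible_flipD[OF _ V(3)])
  qed
qed

theorem tight_imp_constructible:
  fixes V :: "nat set"
  assumes "tight V E"
  shows "constructible \<lparr>verts = V, edges = E\<rparr>"
  using assms
proof (induction "card V" arbitrary: V E rule: less_induct)
  case less
  note t = less.prems
  note t' = tightD[OF t]
  have s: "smaller_constructible V" 
    unfolding smaller_constructible_def
  proof (intro allI impI)
    fix V' :: "nat set" and E'
    assume "card V' < card V" "tight V' E'"
    then show "constructible \<lparr>verts = V', edges = E'\<rparr>" by (rule less.hyps)
  qed
  show ?case
  proof (cases "card V = 1")
    case True
    then obtain a where V: "V = {a}" by (metis card_1_singletonE)
    have "card E = 1" using t'(3) True by simp
    then obtain e where E: "E = {e}" by (metis card_1_singletonE)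
    obtain x y g where "x \<in> V" "y \<in> V" "g = 1 \<or> g = -1" "e = ({x, y}, g)" "x = y \<Longrightarrow> g = -1"
      using signed_graph_edgeE[OF t'(1), of e] E by auto
    then have "E = {({a}, -1)}" using V E by auto
    then show ?thesis using V constructible.loop by simp
  next
    case False
    then have V2: "card V \<ge> 2" using t'(3) by linarith
    obtain v where v: "v \<in> V" and d: "card (star E v) + of_bool (({v}, -1) \<in> E) \<le> 3"
      using exists_vertex_of_degree_le_3[OF t] .
    note d2 = card_star_ge_2[OF t v V2]
    show ?thesis
    proof (cases "card (star E v) = 2")
      case True
      then show ?thesis by (rule constructible_degree_2[OF t s v])
    next
      case False
      then have d3: "card (star E v) = 3" and noloop: "({v}, -1) \<notin> E" using d d2 by (auto split: if_splits)
      have edge: "\<exists>x g. e = ({v, x}, g) \<and> x \<in> V \<and> x \<noteq> v \<and> (g = 1 \<or> g = -1)" if e: "e \<in> star E v" for e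
      proof -
        obtain x g where xg: "e = ({v, x}, g)" "x \<in> V" "g = 1 \<or> g = -1" "x = v \<Longrightarrow> g = -1"
          using star_edgeE[OF t'(1) e] by metis
        have "x \<noteq> v" using xg e noloop by (auto simp: star_def)
        then show ?thesis using xg by blast
      qed
      obtain e1 e2 e3 where st: "star E v = {e1, e2, e3}" and ne: "e1 \<noteq> e2" "e1 \<noteq> e3" "e2 \<noteq> e3"
        using d3 by (metis card_3_iff)
      obtain x1 g1 where 1: "e1 = ({v, x1}, g1)" "x1 \<in> V" "x1 \<noteq> v" "g1 = 1 \<or> g1 = -1" using edge[of e1] st by auto
      obtain x2 g2 where 2: "e2 = ({v, x2}, g2)" "x2 \<in> V" "x2 \<noteq> v" "g2 = 1 \<or> g2 = -1" using edge[of e2] st by auto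
      obtain x3 g3 where 3: "e3 = ({v, x3}, g3)" "x3 \<in> V" "x3 \<noteq> v" "g3 = 1 \<or> g3 = -1" using edge[of e3] st by auto
      have double: ?thesis
        if st: "star E v = {({v, x}, g), ({v, x}, h), ({v, y}, k)}" and xy: "x \<in> V" "y \<in> V" "x \<noteq> v" "y \<noteq> v"
          and g: "g = 1 \<or> g = -1" "h = 1 \<or> h = -1" "k = 1 \<or> k = -1" "g \<noteq> h" for x y g h k
      proof -
        have st': "star E v = {({v, x}, 1), ({v, x}, -1), ({v, y}, k)}" using st g by auto
        have "x \<noteq> y"
        proof
          assume "x = y"
          then have "star E v = {({v, x}, 1), ({v, x}, -1)}" using st' g by auto
          then show False using d3 by simp
        qed
        then show ?thesis using constructible_degree_3_double[OF t s v st' xy] g by blast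
      qed
      consider "x1 \<noteq> x2" "x1 \<noteq> x3" "x2 \<noteq> x3" | "x1 = x2" | "x1 = x3" | "x2 = x3" by blast
      then show ?thesis
      proof cases
        case all: 1
        show ?thesis
          by (rule constructible_degree_3_distinct[OF s t v st[unfolded 1(1) 2(1) 3(1)]])
            (use 1 2 3 all in auto)
      next
        case eq: 2
        have "star E v = {({v, x1}, g1), ({v, x1}, g2), ({v, x3}, g3)}" using st 1(1) 2(1) 3(1) eq by simp
        moreover have "g1 \<noteq> g2" using ne(1) 1(1) 2(1) eq by auto
        ultimately show ?thesis using double 1 2 3 by blast
      next
        case eq: 3
        have "star E v = {({v, x1}, g1), ({v, x1}, g3), ({v, x2}, g2)}" using st 1(1) 2(1) 3(1) eq by auto
        moreover have "g1 \<noteq> g3" using ne(2) 1(1) 3(1) eq by auto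
        ultimately show ?thesis using double 1 2 3 by blast
      next
        case eq: 4
        have "star E v = {({v, x2}, g2), ({v, x2}, g3), ({v, x1}, g1)}" using st 1(1) 2(1) 3(1) eq by auto
        moreover have "g2 \<noteq> g3" using ne(3) 2(1) 3(1) eq by auto
        ultimately show ?thesis using double 1 2 3 by blast
      qed
    qed
  qed
qed

section \<open>Homogeneous linear systems\<close>

text \<open>Elimination of one unknown by one equation.\<close>

lemma homogeneous_system:
  fixes A :: "('i \<Rightarrow> real) set"
  assumes "finite I" "finite A" "card A < card I"
  shows "\<exists>w. (\<exists>i\<in>I. w i \<noteq> 0) \<and> (\<forall>f\<in>A. (\<Sum>i\<in>I. f i * w i) = 0)"
  using assms
proof (induction "card A" arbitrary: A I rule: less_induct)
  case less
  note I = \<open>finite I\<close> and A = \<open>finite A\<close> and c = \<open>card A < card I\<close>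
  show ?case
  proof (cases "A = {}")
    case True
    then have "I \<noteq> {}" using c by auto
    then show ?thesis using True by (intro exI[of _ "\<lambda>_. 1"]) auto
  next
    case False
    then obtain f where f: "f \<in> A" by blast
    have cA: "card (A - {f}) < card A" using f A by (meson card_Diff1_less)
    show ?thesis
    proof (cases "\<exists>i0\<in>I. f i0 \<noteq> 0")
      case False
      have "\<exists>w. (\<exists>i\<in>I. w i \<noteq> 0) \<and> (\<forall>f\<in>A - {f}. (\<Sum>i\<in>I. f i * w i) = 0)"
        by (rule less.hyps[OF cA I]) (use A cA c in auto)
      then obtain w where w: "\<exists>i\<in>I. w i \<noteq> 0" "\<forall>h\<in>A - {f}. (\<Sum>i\<in>I. h i * w i) = 0" by blast
      have "(\<Sum>i\<in>I. f i * w i) = 0" using False by (intro sum.neutral) simp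
      then have "\<forall>h\<in>A. (\<Sum>i\<in>I. h i * w i) = 0" using w(2) by blast
      then show ?thesis using w(1) by blast
    next
      case True
      then obtain i0 where i0: "i0 \<in> I" "f i0 \<noteq> 0" by blast
      \<comment> \<open>eliminates the unknown \<open>i0\<close> from the equation \<open>h\<close> by means of \<open>f\<close>\<close>
      define el where "el h = (\<lambda>i. h i - h i0 / f i0 * f i)" for h :: "'i \<Rightarrow> real"
      have c1: "card (el ` (A - {f})) \<le> card (A - {f})" using A by (intro card_image_le) simp
      have c2: "card (I - {i0}) + 1 = card I" using i0(1) I by (metis Suc_eq_plus1 card_Suc_Diff1)
      have "\<exists>w. (\<exists>i\<in>I - {i0}. w i \<noteq> 0) \<and> (\<forall>f\<in>el ` (A - {f}). (\<Sum>i\<in>I - {i0}. f i * w i) = 0)"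
      proof (rule less.hyps)
        show "card (el ` (A - {f})) < card A" using c1 cA by linarith
        show "card (el ` (A - {f})) < card (I - {i0})" using c1 c2 cA c by linarith
      qed (use A I in auto)
      then obtain w where w: "\<exists>i\<in>I - {i0}. w i \<noteq> 0"
        "\<And>h. h \<in> A - {f} \<Longrightarrow> (\<Sum>i\<in>I - {i0}. el h i * w i) = 0" by blast
      define S where "S h = (\<Sum>i\<in>I - {i0}. h i * w i)" for h
      define w' where "w' = w(i0 := - S f / f i0)"
      have split: "(\<Sum>i\<in>I. h i * w' i) = h i0 * w' i0 + S h" for h
      proof -
        have "(\<Sum>i\<in>I - {i0}. h i * w' i) = S h"
          unfolding S_def by (rule sum.cong) (auto simp: w'_def)
        then show ?thesis using sum.remove[OF I i0(1), of "\<lambda>i. h i * w' i"] by simp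
      qed
      have "(\<Sum>i\<in>I. h i * w' i) = 0" if h: "h \<in> A" for h
      proof (cases "h = f")
        case True
        then show ?thesis using split[of f] i0 by (simp add: w'_def)
      next
        case False
        have "(\<Sum>i\<in>I - {i0}. el h i * w i) = S h - h i0 / f i0 * S f"
          unfolding S_def el_def by (simp add: left_diff_distrib sum_subtractf sum_distrib_left mult.assoc)
        then have "S h = h i0 / f i0 * S f" using w(2)[of h] h False by simp
        then show ?thesis using split[of h] by (simp add: w'_def)
      qed
      moreover have "\<exists>i\<in>I. w' i \<noteq> 0" using w(1) by (auto simp: w'_def)
      ultimately show ?thesis by blast
    qed
  qed
qed

definition difference_row :: "'i \<Rightarrow> real \<Rightarrow> 'i \<Rightarrow> 'i \<Rightarrow> real" where
  "difference_row p k q = (\<lambda>i. of_bool (i = p) - k * of_bool (i = q))"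

lemma sum_difference_row:
  assumes "finite I" "p \<in> I" "q \<in> I"
  shows "(\<Sum>i\<in>I. difference_row p k q i * w i) = w p - k * w q"
proof -
  have "(\<Sum>i\<in>I. difference_row p k q i * w i)
      = (\<Sum>i\<in>I. (if i = p then w i else 0) - k * (if i = q then w i else 0))"
    by (rule sum.cong) (auto simp: difference_row_def algebra_simps)
  also have "\<dots> = (\<Sum>i\<in>I. if i = p then w i else 0) - k * (\<Sum>i\<in>I. if i = q then w i else 0)"
    by (simp add: sum_subtractf sum_distrib_left)
  finally show ?thesis using assms by simp
qed

text \<open>All constraints below have the form \<open>w p = k * w q\<close>; the condition \<open>w p = 0\<close> is the case \<open>k = 0\<close>.\<close>

lemma binary_difference_system:
  fixes C :: "('i \<times> real \<times> 'i) set"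
  assumes I: "finite I" and C: "finite C" "card C < card I" and ends: "\<forall>(p, k, q)\<in>C. p \<in> I \<and> q \<in> I"
  shows "\<exists>w. (\<exists>i\<in>I. w i \<noteq> 0) \<and> (\<forall>(p, k, q)\<in>C. w p = k * w q)"
proof -
  let ?A = "(\<lambda>(p, k, q). difference_row p k q) ` C"
  have "card ?A < card I" using card_image_le[OF C(1)] C(2) by (rule le_less_trans)
  then obtain w where w: "\<exists>i\<in>I. w i \<noteq> 0" "\<forall>f\<in>?A. (\<Sum>i\<in>I. f i * w i) = 0"
    using homogeneous_system[OF I, of ?A] C(1) by blast
  have "w p = k * w q" if pq: "(p, k, q) \<in> C" for p k q
  proof -
    have "difference_row p k q \<in> ?A" using pq by force
    then have "(\<Sum>i\<in>I. difference_row p k q i * w i) = 0" using w(2) by blast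
    then show ?thesis using sum_difference_row[OF I, of p q k w] ends pq by auto
  qed
  then show ?thesis using w(1) by blast
qed

section \<open>Placements of signed graphs\<close>

text \<open>The points over \<open>x\<close> are \<open>(a x, b x)\<close> and its mirror image \<open>(- a x, b x)\<close>. An edge of gain \<open>g\<close>
  joins \<open>(a x, b x)\<close> to the point over \<open>y\<close> with first coordinate \<open>g * a y\<close>; a loop joins a point to
  its mirror image.\<close>

definition horizontal :: "('a \<Rightarrow> real) \<Rightarrow> ('a \<Rightarrow> real) \<Rightarrow> 'a \<Rightarrow> 'a \<Rightarrow> int \<Rightarrow> bool" where
  "horizontal a b x y g \<longleftrightarrow> \<bar>b x - b y\<bar> < \<bar>a x - of_int g * a y\<bar>"

definition vertical :: "('a \<Rightarrow> real) \<Rightarrow> ('a \<Rightarrow> real) \<Rightarrow> 'a \<Rightarrow> 'a \<Rightarrow> int \<Rightarrow> bool" where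
  "vertical a b x y g \<longleftrightarrow> \<bar>a x - of_int g * a y\<bar> < \<bar>b x - b y\<bar>"

definition well_placed :: "'a sedge set \<Rightarrow> ('a \<Rightarrow> real) \<Rightarrow> ('a \<Rightarrow> real) \<Rightarrow> bool" where
  "well_placed E a b \<longleftrightarrow> (\<forall>x y g. ({x, y}, g) \<in> E \<longrightarrow> horizontal a b x y g \<or> vertical a b x y g)"

definition horizontal_flex :: "'a sedge set \<Rightarrow> ('a \<Rightarrow> real) \<Rightarrow> ('a \<Rightarrow> real) \<Rightarrow> ('a \<Rightarrow> real) \<Rightarrow> bool" where
  "horizontal_flex E a b c \<longleftrightarrow>
     (\<forall>x y g. ({x, y}, g) \<in> E \<longrightarrow> horizontal a b x y g \<longrightarrow> c x = of_int g * c y)"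

definition vertical_flex :: "'a sedge set \<Rightarrow> ('a \<Rightarrow> real) \<Rightarrow> ('a \<Rightarrow> real) \<Rightarrow> ('a \<Rightarrow> real) \<Rightarrow> bool" where
  "vertical_flex E a b d \<longleftrightarrow> (\<forall>x y g. ({x, y}, g) \<in> E \<longrightarrow> vertical a b x y g \<longrightarrow> d x = d y)"

text \<open>The symmetric infinitesimal flexes are the translations parallel to the mirror only. This is how
  symmetric infinitesimal rigidity looks in the quotient.\<close>

definition rigidly_placed :: "'a set \<Rightarrow> 'a sedge set \<Rightarrow> ('a \<Rightarrow> real) \<Rightarrow> ('a \<Rightarrow> real) \<Rightarrow> bool" where
  "rigidly_placed V E a b \<longleftrightarrow>
     (\<forall>c. horizontal_flex E a b c \<longrightarrow> (\<forall>x\<in>V. c x = 0)) \<and>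
     (\<forall>d. vertical_flex E a b d \<longrightarrow> (\<forall>x\<in>V. \<forall>y\<in>V. d x = d y))"

lemma abs_gain_diff_commute:
  assumes "g = 1 \<or> g = (-1::int)" shows "\<bar>s - of_int g * t\<bar> = \<bar>t - of_int g * (s::real)\<bar>"
  using assms by auto

lemma horizontal_commute: "g = 1 \<or> g = -1 \<Longrightarrow> horizontal a b x y g \<longleftrightarrow> horizontal a b y x g"
  unfolding horizontal_def using abs_gain_diff_commute[of g "a x" "a y"] by (simp add: abs_minus_commute)

lemma vertical_commute: "g = 1 \<or> g = -1 \<Longrightarrow> vertical a b x y g \<longleftrightarrow> vertical a b y x g"
  unfolding vertical_def using abs_gain_diff_commute[of g "a x" "a y"] by (simp add: abs_minus_commute)

lemma not_horizontal_and_vertical: "horizontal a b x y g \<Longrightarrow> \<not> vertical a b x y g"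
  by (simp add: horizontal_def vertical_def)

section \<open>Counting constraints\<close>

text \<open>An arbitrary orientation, so that an edge yields one equation. The equation does not depend on it.\<close>

definition edge_ends :: "'a sedge \<Rightarrow> 'a \<times> 'a" where
  "edge_ends e = (SOME (x, y). fst e = {x, y})"

lemma edge_ends:
  assumes "edge_ends ({x, y}, g) = (x', y')"
  shows "x' = x \<and> y' = y \<or> x' = y \<and> y' = x"
proof -
  have "case edge_ends ({x, y}, g) of (x', y') \<Rightarrow> fst ({x, y}, g) = {x', y'}"
    unfolding edge_ends_def by (rule someI[of _ "(x, y)"]) simp
  then show ?thesis using assms by (auto simp: doubleton_eq_iff)
qed

text \<open>The triple \<open>(p, k, q)\<close> stands for the equation \<open>w p = k * w q\<close>. The unknowns \<open>(x, True)\<close> and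
  \<open>(x, False)\<close> are the horizontal and the vertical velocity of \<open>x\<close>.\<close>

definition edge_constraint :: "('a \<Rightarrow> real) \<Rightarrow> ('a \<Rightarrow> real) \<Rightarrow> 'a sedge \<Rightarrow> ('a \<times> bool) \<times> real \<times> ('a \<times> bool)" where
  "edge_constraint a b e = (case edge_ends e of (x, y) \<Rightarrow>
     if horizontal a b x y (snd e) then ((x, True), of_int (snd e), (y, True)) else ((x, False), 1, (y, False)))"

lemma edge_constraint_ends:
  assumes "signed_graph V E" "e \<in> E" "edge_constraint a b e = (p, k, q)"
  shows "p \<in> fst e \<times> UNIV \<and> q \<in> fst e \<times> UNIV"
proof -
  obtain x y g where e: "e = ({x, y}, g)" using signed_graph_edgeE[OF assms(1,2)] by metis
  obtain x' y' where e': "edge_ends e = (x', y')" by fastforce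
  have "x' = x \<and> y' = y \<or> x' = y \<and> y' = x" by (rule edge_ends[OF e'[unfolded e]])
  then have "fst e = {x', y'}" using e by auto
  moreover have "fst p = x' \<and> fst q = y'" using assms(3) e' by (auto simp: edge_constraint_def split: if_splits)
  ultimately show ?thesis by (metis SigmaI UNIV_I insertCI prod.collapse)
qed

definition edge_solution :: "('a \<Rightarrow> real) \<Rightarrow> ('a \<Rightarrow> real) \<Rightarrow> 'a sedge set \<Rightarrow> ('a \<times> bool \<Rightarrow> real) \<Rightarrow> bool" where
  "edge_solution a b E w \<longleftrightarrow> (\<forall>e\<in>E. \<forall>p k q. edge_constraint a b e = (p, k, q) \<longrightarrow> w p = k * w q)"

lemma edge_solutionD: "edge_solution a b E w \<Longrightarrow> e \<in> E \<Longrightarrow> edge_constraint a b e = (p, k, q) \<Longrightarrow> w p = k * w q"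
  unfolding edge_solution_def by blast

lemma flexes_of_edge_solution:
  assumes sg: "signed_graph V E" and w: "edge_solution a b E w"
  shows "horizontal_flex E a b (\<lambda>x. w (x, True))" "vertical_flex E a b (\<lambda>x. w (x, False))"
proof -
  show "horizontal_flex E a b (\<lambda>x. w (x, True))" unfolding horizontal_flex_def
  proof (intro allI impI)
    fix x y g assume e: "({x, y}, g) \<in> E" and h: "horizontal a b x y g"
    have g: "g = 1 \<or> g = -1" by (rule signed_graph_memD(3)[OF sg e])
    obtain x' y' where e': "edge_ends ({x, y}, g) = (x', y')" by fastforce
    have xy: "x' = x \<and> y' = y \<or> x' = y \<and> y' = x" by (rule edge_ends[OF e'])
    then have "horizontal a b x' y' g" using h horizontal_commute[OF g, of a b x y] by metis
    then have "edge_constraint a b ({x, y}, g) = ((x', True), of_int g, (y', True))"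
      by (simp add: edge_constraint_def e')
    then have "w (x', True) = of_int g * w (y', True)" by (rule edge_solutionD[OF w e])
    then show "w (x, True) = of_int g * w (y, True)" using xy g by auto
  qed
  show "vertical_flex E a b (\<lambda>x. w (x, False))" unfolding vertical_flex_def
  proof (intro allI impI)
    fix x y g assume e: "({x, y}, g) \<in> E" and v: "vertical a b x y g"
    have g: "g = 1 \<or> g = -1" by (rule signed_graph_memD(3)[OF sg e])
    obtain x' y' where e': "edge_ends ({x, y}, g) = (x', y')" by fastforce
    have xy: "x' = x \<and> y' = y \<or> x' = y \<and> y' = x" by (rule edge_ends[OF e'])
    then have "vertical a b x' y' g" using v vertical_commute[OF g, of a b x y] by metis
    then have "\<not> horizontal a b x' y' g" using not_horizontal_and_vertical[of a b x' y' g] by blast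
    then have "edge_constraint a b ({x, y}, g) = ((x', False), 1, (y', False))"
      by (simp add: edge_constraint_def e')
    then have "w (x', False) = 1 * w (y', False)" by (rule edge_solutionD[OF w e])
    then show "w (x, False) = w (y, False)" using xy by auto
  qed
qed

lemma edge_solution_of_flexes:
  assumes sg: "signed_graph V E" and wp: "well_placed E a b"
    and fl: "horizontal_flex E a b (\<lambda>x. w (x, True))" "vertical_flex E a b (\<lambda>x. w (x, False))"
  shows "edge_solution a b E w"
  unfolding edge_solution_def
proof (intro ballI allI impI)
  fix e p k q assume e: "e \<in> E" and c: "edge_constraint a b e = (p, k, q)"
  obtain x y g where xy: "e = ({x, y}, g)" using signed_graph_edgeE[OF sg e] by metis
  obtain x' y' where e': "edge_ends e = (x', y')" by fastforce
  have "x' = x \<and> y' = y \<or> x' = y \<and> y' = x" by (rule edge_ends[OF e'[unfolded xy]])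
  then have e2: "e = ({x', y'}, g)" using xy by auto
  then have hv: "horizontal a b x' y' g \<or> vertical a b x' y' g" using wp e unfolding well_placed_def by blast
  show "w p = k * w q"
  proof (cases "horizontal a b x' y' g")
    case True
    then have "p = (x', True)" "k = of_int g" "q = (y', True)" using c e' xy by (auto simp: edge_constraint_def)
    then show "w p = k * w q" using fl(1) True e e2 unfolding horizontal_flex_def by blast
  next
    case False
    then have "p = (x', False)" "k = 1" "q = (y', False)" using c e' xy by (auto simp: edge_constraint_def)
    then show "w p = k * w q" using fl(2) False hv e e2 unfolding vertical_flex_def by (metis mult_1)
  qed
qed

lemma rigidly_placed_trivial_solution:
  assumes sg: "signed_graph V E" and r: "rigidly_placed V E a b" and w: "edge_solution a b E w"
    and x0: "x0 \<in> V" "w (x0, False) = 0"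
  shows "\<not> (\<exists>i\<in>V \<times> UNIV. w i \<noteq> 0)"
proof -
  note f = flexes_of_edge_solution[OF sg w]
  have "w (x, True) = 0" if "x \<in> V" for x using r f(1) that unfolding rigidly_placed_def by blast
  moreover have "w (x, False) = 0" if "x \<in> V" for x
  proof -
    have "w (x, False) = w (x0, False)" using r f(2) that x0(1) unfolding rigidly_placed_def by blast
    then show ?thesis using x0(2) by simp
  qed
  ultimately show ?thesis by (metis (full_types) SigmaE)
qed

lemma card_times_bool: "finite V \<Longrightarrow> card (V \<times> (UNIV :: bool set)) = 2 * card V"
  by (simp add: card_cartesian_product card_UNIV_bool)

text \<open>With fewer edges, these constraints and the condition that \<open>x0\<close> has vertical velocity 0 would still
  have a nonzero solution.\<close>

lemma rigidly_placed_card: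
  assumes sg: "signed_graph V E" and r: "rigidly_placed V E a b" and x0: "x0 \<in> V"
  shows "2 * card V \<le> card E + 1"
proof (rule ccontr)
  assume less: "\<not> 2 * card V \<le> card E + 1"
  have finV: "finite V" using sg by (simp add: signed_graph_def)
  have finE: "finite E" by (rule signed_graph_finite_edges[OF sg])
  let ?C = "insert ((x0, False), 0, (x0, False)) (edge_constraint a b ` E)"
  have "card ?C \<le> Suc (card (edge_constraint a b ` E))" using finE by (simp add: card_insert_if)
  also have "\<dots> \<le> Suc (card E)" using card_image_le[OF finE] by simp
  also have "\<dots> < card (V \<times> (UNIV :: bool set))" using less card_times_bool[OF finV] by simp
  finally have cC: "card ?C < card (V \<times> (UNIV :: bool set))" .
  have ends: "p \<in> V \<times> UNIV \<and> q \<in> V \<times> UNIV" if pq: "(p, k, q) \<in> ?C" for p k q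
  proof -
    from pq consider "p = (x0, False)" "q = (x0, False)" | e where "e \<in> E" "edge_constraint a b e = (p, k, q)"
      by (metis Pair_inject image_iff insert_iff)
    then show ?thesis
    proof cases
      case (2 e)
      have "fst e \<subseteq> V" using signed_graph_incident[OF sg] 2(1) by (auto simp: incident_verts_def)
      then show ?thesis using edge_constraint_ends[OF sg 2] by blast
    qed (use x0 in simp)
  qed
  have fin1: "finite (V \<times> (UNIV :: bool set))" and fin2: "finite ?C" using finV finE by simp_all
  obtain w where w: "\<exists>i\<in>V \<times> UNIV. w i \<noteq> 0" "\<forall>(p, k, q)\<in>?C. w p = k * w q"
    using binary_difference_system[OF fin1 fin2 cC] ends by blast
  have "edge_solution a b E w" unfolding edge_solution_def
  proof (intro ballI allI impI)
    fix e p k q assume "e \<in> E" "edge_constraint a b e = (p, k, q)"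
    then have "(p, k, q) \<in> ?C" by (metis image_eqI insertI2)
    then show "w p = k * w q" using w(2) by blast
  qed
  moreover have "w (x0, False) = 0" using w(2) by simp
  ultimately show False using rigidly_placed_trivial_solution[OF sg r _ x0] w(1) by blast
qed

text \<open>Suppose that \<open>F\<close> has too many edges for the vertex set \<open>Y\<close>. Replace the constraints of \<open>F\<close> by the
  \<open>2 * card Y\<close> conditions that all velocities on \<open>Y\<close> vanish or, if \<open>F\<close> has a potential \<open>\<sigma>\<close>, by the
  \<open>2 * card Y - 1\<close> conditions that the horizontal velocities on \<open>Y\<close> are a multiple of \<open>\<sigma>\<close> and the
  vertical ones vanish. They imply the constraints of \<open>F\<close>, and they are so few that the whole system
  has a nonzero solution, against rigidity.\<close>

lemma rigidly_placed_sparse: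
  assumes sg: "signed_graph V E" and r: "rigidly_placed V E a b" and cE: "card E + 1 = 2 * card V"
  shows "sparse_edges E"
  unfolding sparse_edges_def
proof (intro allI impI)
  fix F X assume F: "F \<subseteq> E" "finite X" "X \<noteq> {}" "incident_verts F \<subseteq> X"
  have finV: "finite V" using sg by (simp add: signed_graph_def)
  have finE: "finite E" by (rule signed_graph_finite_edges[OF sg])
  have sgF: "signed_graph V F" by (rule signed_graph_mono[OF sg F(1)])
  define Y where "Y = X \<inter> V"
  have finY: "finite Y" and YV: "Y \<subseteq> V" and cYX: "card Y \<le> card X"
    using F(2) by (auto simp: Y_def intro: card_mono)
  have FY: "fst e \<subseteq> Y" if "e \<in> F" for e
    using F(4) signed_graph_incident[OF sgF] that by (auto simp: incident_verts_def Y_def)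
  have cEF: "card (E - F) + card F = card E"
    using F(1) finE by (metis card_Diff_subset card_mono finite_subset le_add_diff_inverse2)
  \<comment> \<open>a few linear conditions on Y that imply the constraints of F\<close>
  have key: False
    if C: "finite C" "card C \<le> card F" "\<forall>(p, k, q)\<in>C. p \<in> Y \<times> UNIV \<and> q \<in> Y \<times> UNIV"
      and x0: "x0 \<in> Y" "((x0, False), 0, (x0, False)) \<in> C"
      and impl: "\<forall>w. (\<forall>(p, k, q)\<in>C. w p = k * w q) \<longrightarrow> edge_solution a b F w"
    for C x0
  proof -
    let ?C = "C \<union> edge_constraint a b ` (E - F)"
    have "card ?C \<le> card C + card (edge_constraint a b ` (E - F))" by (rule card_Un_le)
    also have "\<dots> \<le> card C + card (E - F)" using finE by (simp add: card_image_le)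
    also have "\<dots> < card (V \<times> (UNIV :: bool set))" using C(2) cEF cE card_times_bool[OF finV] by linarith
    finally have cC: "card ?C < card (V \<times> (UNIV :: bool set))" .
    have ends: "p \<in> V \<times> UNIV \<and> q \<in> V \<times> UNIV" if pq: "(p, k, q) \<in> ?C" for p k q
    proof -
      show ?thesis
      proof (cases "(p, k, q) \<in> C")
        case True
        then show ?thesis using C(3) YV by auto
      next
        case False
        then have "(p, k, q) \<in> edge_constraint a b ` (E - F)" using pq by blast
        then obtain e where e: "e \<in> E" "edge_constraint a b e = (p, k, q)" by (elim imageE) auto
        have "fst e \<subseteq> V" using signed_graph_incident[OF sg] e(1) by (auto simp: incident_verts_def)
        then show ?thesis using edge_constraint_ends[OF sg e] by blast
      qed
    qed
    have fin1: "finite (V \<times> (UNIV :: bool set))" and fin2: "finite ?C" using finV finE C(1) by simp_all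
    obtain w where w: "\<exists>i\<in>V \<times> UNIV. w i \<noteq> 0" "\<forall>(p, k, q)\<in>?C. w p = k * w q"
      using binary_difference_system[OF fin1 fin2 cC] ends by blast
    have solF: "edge_solution a b F w" using impl w(2) by blast
    have "edge_solution a b E w" unfolding edge_solution_def
    proof (intro ballI allI impI)
      fix e p k q assume e: "e \<in> E" "edge_constraint a b e = (p, k, q)"
      show "w p = k * w q"
      proof (cases "e \<in> F")
        case True
        then show ?thesis using edge_solutionD[OF solF _ e(2)] by blast
      next
        case False
        then have "(p, k, q) \<in> ?C" using e by (metis DiffI UnI2 image_eqI)
        then show ?thesis using w(2) by blast
      qed
    qed
    moreover have "w (x0, False) = 0"
    proof -
      have "((x0, False), 0, (x0, False)) \<in> ?C" using x0(2) by blast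
      then have "w (x0, False) = 0 * w (x0, False)" using w(2) by blast
      then show ?thesis by simp
    qed
    moreover have "x0 \<in> V" using x0(1) YV by blast
    ultimately show False using rigidly_placed_trivial_solution[OF sg r, of w x0] w(1) by blast
  qed
  have X1: "card X \<ge> 1" using F(2,3) by (simp add: Suc_le_eq card_gt_0_iff)
  show "card F + 1 \<le> 2 * card X \<and> ((\<exists>\<sigma>. potential \<sigma> F) \<longrightarrow> card F + 2 \<le> 2 * card X)"
  proof (cases "F = {}")
    case True
    then show ?thesis using X1 by simp
  next
    case False
    then obtain e where e: "e \<in> F" by blast
    then obtain x y g where "e = ({x, y}, g)" using signed_graph_edgeE[OF sgF] by metis
    then obtain x0 where x0: "x0 \<in> Y" using FY[OF e] by auto
    have 1: "card F + 1 \<le> 2 * card Y"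
    proof (rule ccontr)
      assume big: "\<not> card F + 1 \<le> 2 * card Y"
      let ?C = "(\<lambda>i. (i, 0 :: real, i)) ` (Y \<times> (UNIV :: bool set))"
      have "card ?C = 2 * card Y"
        using card_times_bool[OF finY] by (simp add: card_image inj_on_def)
      then have "card ?C \<le> card F" using big by linarith
      have impl: "edge_solution a b F w" if w: "\<forall>(p, k, q)\<in>?C. w p = k * w q" for w
        unfolding edge_solution_def
      proof (intro ballI allI impI)
        fix e p k q assume e: "e \<in> F" "edge_constraint a b e = (p, k, q)"
        have w0: "w i = 0" if "i \<in> Y \<times> UNIV" for i
        proof -
          have "(i, 0, i) \<in> ?C" using that by blast
          then have "w i = 0 * w i" using w by blast
          then show ?thesis by simp
        qed
        have "p \<in> Y \<times> UNIV" "q \<in> Y \<times> UNIV"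
          using edge_constraint_ends[OF sgF e] FY[OF e(1)] by blast+
        then show "w p = k * w q" using w0 by simp
      qed
      have fin: "finite ?C" using finY by simp
      have ends: "\<forall>(p, k, q)\<in>?C. p \<in> Y \<times> UNIV \<and> q \<in> Y \<times> UNIV" by auto
      have mem: "((x0, False), 0, (x0, False)) \<in> ?C" using x0 by blast
      show False using key[OF fin _ ends x0 mem] \<open>card ?C \<le> card F\<close> impl by blast
    qed
    have 2: "card F + 2 \<le> 2 * card Y" if \<sigma>: "potential \<sigma> F" for \<sigma>
    proof (rule ccontr)
      assume big: "\<not> card F + 2 \<le> 2 * card Y"
      let ?C1 = "(\<lambda>x. ((x, True), real_of_int (\<sigma> x * \<sigma> x0), (x0, True))) ` (Y - {x0})"
      let ?C2 = "(\<lambda>x. ((x, False), 0 :: real, (x, False))) ` Y"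
      have "card (?C1 \<union> ?C2) \<le> card ?C1 + card ?C2" by (rule card_Un_le)
      moreover have "card ?C1 \<le> card (Y - {x0})" "card ?C2 \<le> card Y" using finY by (simp_all add: card_image_le)
      moreover have "card (Y - {x0}) + 1 = card Y" using finY x0 by (metis Suc_eq_plus1 card_Suc_Diff1)
      ultimately have c: "card (?C1 \<union> ?C2) \<le> card F" using big by linarith
      have ss: "\<sigma> x * \<sigma> x = 1" for x using sign_square[of \<sigma> x] potential_sign[OF \<sigma>] by blast
      have fin: "finite (?C1 \<union> ?C2)" using finY by simp
      have ends: "\<forall>(p, k, q)\<in>?C1 \<union> ?C2. p \<in> Y \<times> UNIV \<and> q \<in> Y \<times> UNIV" using x0 by auto
      have mem: "((x0, False), 0, (x0, False)) \<in> ?C1 \<union> ?C2" using x0 by auto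
      have "edge_solution a b F w" if w: "\<forall>(p, k, q)\<in>?C1 \<union> ?C2. w p = k * w q" for w
        unfolding edge_solution_def
      proof (intro ballI allI impI)
        fix e p k q assume e: "e \<in> F" "edge_constraint a b e = (p, k, q)"
        have wF: "w (x, False) = 0" if x: "x \<in> Y" for x
        proof -
          have "((x, False), 0, (x, False)) \<in> ?C1 \<union> ?C2" using x by blast
          then have "w (x, False) = 0 * w (x, False)" using w by blast
          then show ?thesis by simp
        qed
        have wT: "w (x, True) = real_of_int (\<sigma> x * \<sigma> x0) * w (x0, True)" if "x \<in> Y" for x
        proof (cases "x = x0")
          case True
          then show ?thesis using ss[of x0] by simp
        next
          case False
          then have "((x, True), real_of_int (\<sigma> x * \<sigma> x0), (x0, True)) \<in> ?C1 \<union> ?C2" using that by blast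
          then show ?thesis using w by blast
        qed
        obtain x y g where xy: "e = ({x, y}, g)" using signed_graph_edgeE[OF sgF e(1)] by metis
        obtain x' y' where e': "edge_ends e = (x', y')" by fastforce
        have "x' = x \<and> y' = y \<or> x' = y \<and> y' = x" by (rule edge_ends[OF e'[unfolded xy]])
        then have e2: "e = ({x', y'}, g)" using xy by auto
        then have Y: "x' \<in> Y" "y' \<in> Y" using FY[OF e(1)] by auto
        have g: "g = \<sigma> x' * \<sigma> y'" using \<sigma> e(1) e2 unfolding potential_def by blast
        show "w p = k * w q"
        proof (cases "horizontal a b x' y' g")
          case True
          then have "p = (x', True)" "k = of_int g" "q = (y', True)" using e(2) e' xy by (auto simp: edge_constraint_def)
          moreover have "\<sigma> x' * \<sigma> x0 = g * (\<sigma> y' * \<sigma> x0)"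
          proof -
            have "g * (\<sigma> y' * \<sigma> x0) = \<sigma> x' * (\<sigma> y' * \<sigma> y') * \<sigma> x0" unfolding g by (simp add: ac_simps)
            then show ?thesis by (metis ss mult_1_right)
          qed
          ultimately show ?thesis using wT[OF Y(1)] wT[OF Y(2)] by (metis mult.assoc of_int_mult)
        next
          case False
          then have "p = (x', False)" "k = 1" "q = (y', False)" using e(2) e' xy by (auto simp: edge_constraint_def)
          then show ?thesis using wF Y by simp
        qed
      qed
      then show False using key[OF fin c ends x0 mem] by blast
    qed
    show ?thesis using 1 2 cYX by fastforce
  qed
qed

lemma rigidly_placed_tight:
  assumes "signed_graph V E" "rigidly_placed V E a b" "card E + 1 = 2 * card V"
  shows "tight V E"
  using assms rigidly_placed_sparse by (simp add: tight_def)

text \<open>The rows of the constraints are linearly dependent: there are at least \<open>2 * card V\<close> of them, and all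
  are orthogonal to the vertical translation. A row that occurs in a dependency can be omitted.\<close>

lemma redundant_edge:
  assumes sg: "signed_graph V E" and wp: "well_placed E a b" and r: "rigidly_placed V E a b"
    and c: "2 * card V \<le> card E" and x0: "x0 \<in> V"
  obtains e where "e \<in> E" "rigidly_placed V (E - {e}) a b"
proof -
  have finV: "finite V" using sg by (simp add: signed_graph_def)
  have finE: "finite E" by (rule signed_graph_finite_edges[OF sg])
  define I where "I = V \<times> (UNIV :: bool set)"
  have finI: "finite I" using finV by (simp add: I_def)
  define row where "row e = (case edge_constraint a b e of (p, k, q) \<Rightarrow> difference_row p k q)" for e
  have endsI: "p \<in> I \<and> q \<in> I" if "e \<in> E" "edge_constraint a b e = (p, k, q)" for e p k q
  proof -
    have "fst e \<subseteq> V" using signed_graph_incident[OF sg] that(1) by (auto simp: incident_verts_def)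
    then show ?thesis using edge_constraint_ends[OF sg that] by (auto simp: I_def)
  qed
  have row_sum: "(\<Sum>i\<in>I. row e i * w i) = w p - k * w q" if "e \<in> E" "edge_constraint a b e = (p, k, q)" for e p k q w
    using sum_difference_row[OF finI] endsI[OF that] that(2) by (simp add: row_def)
  let ?A = "(\<lambda>i e. row e i) ` (I - {(x0, False)})"
  have "card ?A \<le> card (I - {(x0, False)})" using finI by (intro card_image_le) simp
  also have "\<dots> < card I" using finI x0 by (intro card_Diff1_less) (auto simp: I_def)
  also have "\<dots> \<le> card E" using c card_times_bool[OF finV] by (simp add: I_def)
  finally have "card ?A < card E" .
  then obtain l where l: "\<exists>e\<in>E. l e \<noteq> 0" "\<forall>f\<in>?A. (\<Sum>e\<in>E. f e * l e) = 0"
    using homogeneous_system[OF finE, of ?A] finI by blast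
  \<comment> \<open>vertical translations lie in the kernel of every row, so the omitted column is dependent\<close>
  have col: "(\<Sum>e\<in>E. row e i * l e) = 0" if i: "i \<in> I" for i
  proof (cases "i = (x0, False)")
    case True
    define t where "t i = (if snd i then 0 else 1 :: real)" for i :: "'a \<times> bool"
    have "(\<Sum>i\<in>I. row e i * t i) = 0" if e: "e \<in> E" for e
    proof -
      obtain p k q where pkq: "edge_constraint a b e = (p, k, q)" by (metis prod_cases3)
      have "t p = k * t q" using pkq by (auto simp: edge_constraint_def t_def split: prod.splits if_splits)
      then show ?thesis using row_sum[OF e pkq] by simp
    qed
    then have "0 = (\<Sum>e\<in>E. (\<Sum>i\<in>I. row e i * t i) * l e)" by simp
    also have "\<dots> = (\<Sum>i\<in>I. \<Sum>e\<in>E. row e i * t i * l e)"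
      unfolding sum_distrib_right by (rule sum.swap)
    also have "\<dots> = (\<Sum>i\<in>I. t i * (\<Sum>e\<in>E. row e i * l e))"
      unfolding sum_distrib_left by (intro sum.cong refl) (simp add: ac_simps)
    also have "\<dots> = t i * (\<Sum>e\<in>E. row e i * l e) + (\<Sum>i\<in>I - {i}. t i * (\<Sum>e\<in>E. row e i * l e))"
      by (rule sum.remove[OF finI i])
    also have "(\<Sum>i\<in>I - {i}. t i * (\<Sum>e\<in>E. row e i * l e)) = 0"
      using l(2) True by (intro sum.neutral) auto
    finally show ?thesis using True by (simp add: t_def)
  next
    case False
    then have "(\<lambda>e. row e i) \<in> ?A" using i by blast
    then show ?thesis using l(2)[rule_format, of "\<lambda>e. row e i"] by simp
  qed
  obtain e where e: "e \<in> E" "l e \<noteq> 0" using l(1) by blast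
  have implied: "w p = k * w q"
    if w: "edge_solution a b (E - {e}) w"
      and pkq: "edge_constraint a b e = (p, k, q)" for w p k q
  proof -
    have "0 = (\<Sum>i\<in>I. (\<Sum>e\<in>E. row e i * l e) * w i)" using col by simp
    also have "\<dots> = (\<Sum>e\<in>E. \<Sum>i\<in>I. row e i * l e * w i)"
      unfolding sum_distrib_right by (rule sum.swap)
    also have "\<dots> = (\<Sum>e\<in>E. l e * (\<Sum>i\<in>I. row e i * w i))"
      unfolding sum_distrib_left by (intro sum.cong refl) (simp add: ac_simps)
    also have "\<dots> = l e * (\<Sum>i\<in>I. row e i * w i) + (\<Sum>e\<in>E - {e}. l e * (\<Sum>i\<in>I. row e i * w i))"
      by (rule sum.remove[OF finE e(1)])
    also have "(\<Sum>e\<in>E - {e}. l e * (\<Sum>i\<in>I. row e i * w i)) = 0"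
    proof (intro sum.neutral ballI)
      fix e' assume e': "e' \<in> E - {e}"
      obtain p k q where pkq: "edge_constraint a b e' = (p, k, q)" by (metis prod_cases3)
      have "(\<Sum>i\<in>I. row e' i * w i) = 0" using row_sum[of e' p k q w] e' pkq edge_solutionD[OF w e' pkq] by simp
      then show "l e' * (\<Sum>i\<in>I. row e' i * w i) = 0" by simp
    qed
    finally have "(\<Sum>i\<in>I. row e i * w i) = 0" using e(2) by simp
    then show ?thesis using row_sum[OF e(1) pkq, of w] by simp
  qed
  have sg': "signed_graph V (E - {e})" by (rule signed_graph_mono[OF sg]) blast
  have wp': "well_placed (E - {e}) a b" using wp unfolding well_placed_def by blast
  have ext: "horizontal_flex E a b c \<and> vertical_flex E a b d"
    if c: "horizontal_flex (E - {e}) a b c" and d: "vertical_flex (E - {e}) a b d" for c d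
  proof -
    define w where "w i = (if snd i then c (fst i) else d (fst i))" for i
    have cw: "c = (\<lambda>x. w (x, True))" and dw: "d = (\<lambda>x. w (x, False))" by (simp_all add: w_def)
    have w1: "edge_solution a b (E - {e}) w"
      by (rule edge_solution_of_flexes[OF sg' wp' c[unfolded cw] d[unfolded dw]])
    have "edge_solution a b E w" unfolding edge_solution_def
    proof (intro ballI allI impI)
      fix e' p k q assume e': "e' \<in> E" "edge_constraint a b e' = (p, k, q)"
      show "w p = k * w q"
      proof (cases "e' = e")
        case True
        then show ?thesis using implied[OF w1] e'(2) by blast
      next
        case False
        then show ?thesis using edge_solutionD[OF w1 _ e'(2)] e'(1) by blast
      qed
    qed
    from flexes_of_edge_solution[OF sg this] show ?thesis unfolding cw dw by blast
  qed
  have "rigidly_placed V (E - {e}) a b"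
    unfolding rigidly_placed_def
  proof (rule conjI; intro allI impI)
    fix c assume c: "horizontal_flex (E - {e}) a b c"
    have "vertical_flex (E - {e}) a b (\<lambda>_. 0)" by (simp add: vertical_flex_def)
    then have "horizontal_flex E a b c" using ext[OF c] by blast
    then show "\<forall>x\<in>V. c x = 0" using r unfolding rigidly_placed_def by blast
  next
    fix d assume d: "vertical_flex (E - {e}) a b d"
    have "horizontal_flex (E - {e}) a b (\<lambda>_. 0)" by (simp add: horizontal_flex_def)
    then have "vertical_flex E a b d" using ext[OF _ d] by blast
    then show "\<forall>x\<in>V. \<forall>y\<in>V. d x = d y" using r unfolding rigidly_placed_def by blast
  qed
  then show thesis using that e(1) by blast
qed

section \<open>Placements under changes of the graph\<close>

definition realisation :: "'a set \<Rightarrow> 'a sedge set \<Rightarrow> ('a \<Rightarrow> real) \<Rightarrow> ('a \<Rightarrow> real) \<Rightarrow> bool" where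
  "realisation V E a b \<longleftrightarrow> well_placed E a b \<and> rigidly_placed V E a b"

lemma well_placed_insert:
  assumes g: "g = 1 \<or> g = -1"
  shows "well_placed (insert ({x, y}, g) E) a b \<longleftrightarrow>
    (horizontal a b x y g \<or> vertical a b x y g) \<and> well_placed E a b"
proof
  assume "well_placed (insert ({x, y}, g) E) a b"
  then show "(horizontal a b x y g \<or> vertical a b x y g) \<and> well_placed E a b"
    unfolding well_placed_def by simp
next
  assume h: "(horizontal a b x y g \<or> vertical a b x y g) \<and> well_placed E a b"
  show "well_placed (insert ({x, y}, g) E) a b"
    unfolding well_placed_def
  proof (intro allI impI)
    fix p q k assume "({p, q}, k) \<in> insert ({x, y}, g) E"
    then consider "({p, q}, k) \<in> E" | "p = x" "q = y" "k = g" | "p = y" "q = x" "k = g"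
      by (auto simp: doubleton_eq_iff)
    then show "horizontal a b p q k \<or> vertical a b p q k"
    proof cases
      case 1
      then show ?thesis using h unfolding well_placed_def by blast
    next
      case 2
      then show ?thesis using h by simp
    next
      case 3
      then show ?thesis using h horizontal_commute[OF g, of a b x y] vertical_commute[OF g, of a b x y] by simp
    qed
  qed
qed

lemma gain_eq_commute: "g = 1 \<or> g = (-1::int) \<Longrightarrow> (s::real) = of_int g * t \<longleftrightarrow> t = of_int g * s"
  by auto

lemma horizontal_flex_insert:
  assumes g: "g = 1 \<or> g = -1"
  shows "horizontal_flex (insert ({x, y}, g) E) a b c \<longleftrightarrow>
    (horizontal a b x y g \<longrightarrow> c x = of_int g * c y) \<and> horizontal_flex E a b c"
proof
  assume "horizontal_flex (insert ({x, y}, g) E) a b c"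
  then show "(horizontal a b x y g \<longrightarrow> c x = of_int g * c y) \<and> horizontal_flex E a b c"
    unfolding horizontal_flex_def by simp
next
  assume h: "(horizontal a b x y g \<longrightarrow> c x = of_int g * c y) \<and> horizontal_flex E a b c"
  show "horizontal_flex (insert ({x, y}, g) E) a b c"
    unfolding horizontal_flex_def
  proof (intro allI impI)
    fix p q k assume e: "({p, q}, k) \<in> insert ({x, y}, g) E" and hp: "horizontal a b p q k"
    from e consider "({p, q}, k) \<in> E" | "p = x" "q = y" "k = g" | "p = y" "q = x" "k = g"
      by (auto simp: doubleton_eq_iff)
    then show "c p = of_int k * c q"
    proof cases
      case 1
      then show ?thesis using h hp unfolding horizontal_flex_def by blast
    next
      case 2
      then show ?thesis using h hp by simp
    next
      case 3
      then have "c x = of_int g * c y" using h hp horizontal_commute[OF g, of a b x y] by simp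
      then show ?thesis using 3 gain_eq_commute[OF g, of "c x" "c y"] by simp
    qed
  qed
qed

lemma vertical_flex_insert:
  assumes g: "g = 1 \<or> g = -1"
  shows "vertical_flex (insert ({x, y}, g) E) a b d \<longleftrightarrow>
    (vertical a b x y g \<longrightarrow> d x = d y) \<and> vertical_flex E a b d"
proof
  assume "vertical_flex (insert ({x, y}, g) E) a b d"
  then show "(vertical a b x y g \<longrightarrow> d x = d y) \<and> vertical_flex E a b d"
    unfolding vertical_flex_def by simp
next
  assume h: "(vertical a b x y g \<longrightarrow> d x = d y) \<and> vertical_flex E a b d"
  show "vertical_flex (insert ({x, y}, g) E) a b d"
    unfolding vertical_flex_def
  proof (intro allI impI)
    fix p q k assume e: "({p, q}, k) \<in> insert ({x, y}, g) E" and hp: "vertical a b p q k"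
    from e consider "({p, q}, k) \<in> E" | "p = x" "q = y" "k = g" | "p = y" "q = x" "k = g"
      by (auto simp: doubleton_eq_iff)
    then show "d p = d q"
    proof cases
      case 1
      then show ?thesis using h hp unfolding vertical_flex_def by blast
    next
      case 2
      then show ?thesis using h hp by simp
    next
      case 3
      then show ?thesis using h hp vertical_commute[OF g, of a b x y] by simp
    qed
  qed
qed

lemma placement_cong:
  assumes "\<And>x. x \<in> incident_verts E \<Longrightarrow> a' x = a x \<and> b' x = b x"
  shows "well_placed E a' b' = well_placed E a b" "horizontal_flex E a' b' = horizontal_flex E a b"
    "vertical_flex E a' b' = vertical_flex E a b"
proof -
  have *: "horizontal a' b' x y g = horizontal a b x y g" "vertical a' b' x y g = vertical a b x y g"
    if "({x, y}, g) \<in> E" for x y g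
  proof -
    have "x \<in> incident_verts E" "y \<in> incident_verts E" using incident_vertsI[OF that] by auto
    then show "horizontal a' b' x y g = horizontal a b x y g" "vertical a' b' x y g = vertical a b x y g"
      using assms by (simp_all add: horizontal_def vertical_def)
  qed
  show "well_placed E a' b' = well_placed E a b" unfolding well_placed_def using * by blast
  show "horizontal_flex E a' b' = horizontal_flex E a b" unfolding horizontal_flex_def using * by (intro ext) blast
  show "vertical_flex E a' b' = vertical_flex E a b" unfolding vertical_flex_def using * by (intro ext) blast
qed

lemma well_placed_mono: "well_placed E a b \<Longrightarrow> F \<subseteq> E \<Longrightarrow> well_placed F a b"
  unfolding well_placed_def by blast

text \<open>A vertex can be added if every flex of the new placement restricts to one of the old placement and
  the velocity of the new vertex is determined by the others.\<close>

lemma realisation_extend: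
  assumes wp: "well_placed E' a' b'" and r: "rigidly_placed V E a b"
    and h: "\<And>c. horizontal_flex E' a' b' c \<Longrightarrow> horizontal_flex E a b c \<and> ((\<forall>x\<in>V. c x = 0) \<longrightarrow> c v = 0)"
    and w: "\<And>d. vertical_flex E' a' b' d \<Longrightarrow> vertical_flex E a b d \<and> (\<exists>x\<in>V. d v = d x)"
  shows "realisation (insert v V) E' a' b'"
  unfolding realisation_def rigidly_placed_def
proof (rule conjI[OF wp], rule conjI; intro allI impI)
  fix c assume "horizontal_flex E' a' b' c"
  then have "\<forall>x\<in>V. c x = 0" "(\<forall>x\<in>V. c x = 0) \<longrightarrow> c v = 0"
    using h[of c] r unfolding rigidly_placed_def by blast+
  then show "\<forall>x\<in>insert v V. c x = 0" by blast
next
  fix d assume "vertical_flex E' a' b' d"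
  then obtain x0 where "\<forall>x\<in>V. \<forall>y\<in>V. d x = d y" "x0 \<in> V" "d v = d x0"
    using w[of d] r unfolding rigidly_placed_def by blast
  then have "d x = d x0" if "x \<in> insert v V" for x using that by (metis insertE)
  then show "\<forall>x\<in>insert v V. \<forall>y\<in>insert v V. d x = d y" by simp
qed

section \<open>Perturbation\<close>

lemma eventually_horizontal:
  assumes "horizontal a b x y g"
  shows "\<forall>\<^sub>F \<epsilon> in at_right 0. horizontal (\<lambda>z. a z + \<epsilon> * \<alpha> z) (\<lambda>z. b z + \<epsilon> * \<beta> z) x y g"
proof -
  let ?f = "\<lambda>\<epsilon>. \<bar>(b x + \<epsilon> * \<beta> x) - (b y + \<epsilon> * \<beta> y)\<bar> - \<bar>(a x + \<epsilon> * \<alpha> x) - of_int g * (a y + \<epsilon> * \<alpha> y)\<bar>"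
  have "(?f \<longlongrightarrow> \<bar>(b x + 0 * \<beta> x) - (b y + 0 * \<beta> y)\<bar> - \<bar>(a x + 0 * \<alpha> x) - of_int g * (a y + 0 * \<alpha> y)\<bar>) (at_right 0)"
    by (intro tendsto_intros)
  moreover have "\<bar>(b x + 0 * \<beta> x) - (b y + 0 * \<beta> y)\<bar> - \<bar>(a x + 0 * \<alpha> x) - of_int g * (a y + 0 * \<alpha> y)\<bar> < 0"
    using assms by (simp add: horizontal_def)
  ultimately have "\<forall>\<^sub>F \<epsilon> in at_right 0. ?f \<epsilon> < 0" by (rule order_tendstoD(2))
  then show ?thesis by (rule eventually_mono) (simp add: horizontal_def)
qed

lemma eventually_vertical:
  assumes "vertical a b x y g"
  shows "\<forall>\<^sub>F \<epsilon> in at_right 0. vertical (\<lambda>z. a z + \<epsilon> * \<alpha> z) (\<lambda>z. b z + \<epsilon> * \<beta> z) x y g"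
proof -
  let ?f = "\<lambda>\<epsilon>. \<bar>(a x + \<epsilon> * \<alpha> x) - of_int g * (a y + \<epsilon> * \<alpha> y)\<bar> - \<bar>(b x + \<epsilon> * \<beta> x) - (b y + \<epsilon> * \<beta> y)\<bar>"
  have "(?f \<longlongrightarrow> \<bar>(a x + 0 * \<alpha> x) - of_int g * (a y + 0 * \<alpha> y)\<bar> - \<bar>(b x + 0 * \<beta> x) - (b y + 0 * \<beta> y)\<bar>) (at_right 0)"
    by (intro tendsto_intros)
  moreover have "\<bar>(a x + 0 * \<alpha> x) - of_int g * (a y + 0 * \<alpha> y)\<bar> - \<bar>(b x + 0 * \<beta> x) - (b y + 0 * \<beta> y)\<bar> < 0"
    using assms by (simp add: vertical_def)
  ultimately have "\<forall>\<^sub>F \<epsilon> in at_right 0. ?f \<epsilon> < 0" by (rule order_tendstoD(2))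
  then show ?thesis by (rule eventually_mono) (simp add: vertical_def)
qed

lemma eventually_positive: "\<forall>\<^sub>F \<epsilon> in at_right 0. (0::real) < \<epsilon>"
  by (simp add: eventually_at_right_less)

lemma eventually_nonzero:
  assumes "s \<noteq> 0 \<or> t \<noteq> (0::real)"
  shows "\<forall>\<^sub>F \<epsilon> in at_right 0. s + \<epsilon> * t \<noteq> 0"
proof (cases "s = 0")
  case True
  then have "t \<noteq> 0" using assms by blast
  then show ?thesis using True eventually_positive by (auto elim: eventually_mono)
next
  case False
  have "((\<lambda>\<epsilon>. s + \<epsilon> * t) \<longlongrightarrow> s + 0 * t) (at_right 0)" by (intro tendsto_intros)
  then show ?thesis using False by (intro tendsto_imp_eventually_ne) auto
qed

text \<open>Colours are strict inequalities, hence stable.\<close>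

lemma eventually_same_colours:
  assumes "finite V"
  shows "\<forall>\<^sub>F \<epsilon> in at_right 0. \<forall>x\<in>V. \<forall>y\<in>V. \<forall>g\<in>{1, -1}.
    (horizontal a b x y g \<longrightarrow> horizontal (\<lambda>z. a z + \<epsilon> * \<alpha> z) (\<lambda>z. b z + \<epsilon> * \<beta> z) x y g) \<and>
    (vertical a b x y g \<longrightarrow> vertical (\<lambda>z. a z + \<epsilon> * \<alpha> z) (\<lambda>z. b z + \<epsilon> * \<beta> z) x y g)"
proof -
  have *: "\<forall>\<^sub>F \<epsilon> in at_right 0.
    (horizontal a b x y g \<longrightarrow> horizontal (\<lambda>z. a z + \<epsilon> * \<alpha> z) (\<lambda>z. b z + \<epsilon> * \<beta> z) x y g) \<and>
    (vertical a b x y g \<longrightarrow> vertical (\<lambda>z. a z + \<epsilon> * \<alpha> z) (\<lambda>z. b z + \<epsilon> * \<beta> z) x y g)" for x y g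
  proof (rule eventually_conj)
    show "\<forall>\<^sub>F \<epsilon> in at_right 0. horizontal a b x y g \<longrightarrow> horizontal (\<lambda>z. a z + \<epsilon> * \<alpha> z) (\<lambda>z. b z + \<epsilon> * \<beta> z) x y g"
      by (cases "horizontal a b x y g") (simp_all add: eventually_horizontal)
    show "\<forall>\<^sub>F \<epsilon> in at_right 0. vertical a b x y g \<longrightarrow> vertical (\<lambda>z. a z + \<epsilon> * \<alpha> z) (\<lambda>z. b z + \<epsilon> * \<beta> z) x y g"
      by (cases "vertical a b x y g") (simp_all add: eventually_vertical)
  qed
  have fin: "finite {1, -1 :: int}" by simp
  show ?thesis
    by (rule eventually_ball_finite[OF assms], rule ballI, rule eventually_ball_finite[OF assms], rule ballI,
        rule eventually_ball_finite[OF fin], rule ballI, rule *)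
qed

text \<open>No two points over \<open>V\<close> have a coordinate in common, except for the second coordinates of mirror
  images. This is what the extension steps need in order to find room.\<close>

definition generic :: "'a set \<Rightarrow> ('a \<Rightarrow> real) \<Rightarrow> ('a \<Rightarrow> real) \<Rightarrow> bool" where
  "generic V a b \<longleftrightarrow> (\<forall>x\<in>V. a x \<noteq> 0) \<and> (\<forall>x\<in>V. \<forall>y\<in>V. x \<noteq> y \<longrightarrow> a x \<noteq> a y \<and> a x \<noteq> - a y \<and> b x \<noteq> b y)"

lemma realisation_same_colours:
  assumes sg: "signed_graph V E" and r: "realisation V E a b"
    and col: "\<And>x y g. x \<in> V \<Longrightarrow> y \<in> V \<Longrightarrow> g = 1 \<or> g = -1 \<Longrightarrow>
      (horizontal a b x y g \<longrightarrow> horizontal a' b' x y g) \<and> (vertical a b x y g \<longrightarrow> vertical a' b' x y g)"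
  shows "realisation V E a' b'"
proof -
  have col': "(horizontal a b x y g \<longrightarrow> horizontal a' b' x y g) \<and> (vertical a b x y g \<longrightarrow> vertical a' b' x y g)"
    if "({x, y}, g) \<in> E" for x y g
    by (rule col) (rule signed_graph_memD[OF sg that])+
  have "well_placed E a' b'" using r col' unfolding realisation_def well_placed_def by blast
  moreover have "horizontal_flex E a b c" if "horizontal_flex E a' b' c" for c
    using that col' unfolding horizontal_flex_def by blast
  moreover have "vertical_flex E a b d" if "vertical_flex E a' b' d" for d
    using that col' unfolding vertical_flex_def by blast
  ultimately show ?thesis using r unfolding realisation_def rigidly_placed_def by blast
qed

lemma generic_realisation:
  assumes sg: "signed_graph V E" and r: "realisation V E a b"
  obtains a' b' where "realisation V E a' b'" "generic V a' b'"
proof -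
  have finV: "finite V" using sg by (simp add: signed_graph_def)
  obtain f :: "'a \<Rightarrow> nat" where f: "inj_on f V" using finite_imp_inj_to_nat_seg[OF finV] by blast
  \<comment> \<open>positive and distinct, so that no coincidence persists along the direction \<open>\<alpha>\<close>\<close>
  define \<alpha> where "\<alpha> x = real (Suc (f x))" for x
  have \<alpha>: "\<alpha> x > 0" for x by (simp add: \<alpha>_def)
  have \<alpha>_inj: "\<alpha> x \<noteq> \<alpha> y" if "x \<in> V" "y \<in> V" "x \<noteq> y" for x y
    using f that by (simp add: \<alpha>_def inj_on_eq_iff)
  let ?a = "\<lambda>\<epsilon> z. a z + \<epsilon> * \<alpha> z" and ?b = "\<lambda>\<epsilon> z. b z + \<epsilon> * \<alpha> z"
  have ev1: "\<forall>\<^sub>F \<epsilon> in at_right 0. \<forall>x\<in>V. ?a \<epsilon> x \<noteq> 0"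
  proof (rule eventually_ball_finite[OF finV], intro ballI)
    fix x show "\<forall>\<^sub>F \<epsilon> in at_right 0. ?a \<epsilon> x \<noteq> 0"
      by (rule eventually_nonzero) (use \<alpha>[of x] in simp)
  qed
  have ev2: "\<forall>\<^sub>F \<epsilon> in at_right 0. \<forall>x\<in>V. \<forall>y\<in>V. x \<noteq> y \<longrightarrow> ?a \<epsilon> x \<noteq> ?a \<epsilon> y \<and> ?a \<epsilon> x \<noteq> - ?a \<epsilon> y \<and> ?b \<epsilon> x \<noteq> ?b \<epsilon> y"
  proof (rule eventually_ball_finite[OF finV], rule ballI, rule eventually_ball_finite[OF finV], rule ballI)
    fix x y assume xy: "x \<in> V" "y \<in> V"
    show "\<forall>\<^sub>F \<epsilon> in at_right 0. x \<noteq> y \<longrightarrow> ?a \<epsilon> x \<noteq> ?a \<epsilon> y \<and> ?a \<epsilon> x \<noteq> - ?a \<epsilon> y \<and> ?b \<epsilon> x \<noteq> ?b \<epsilon> y"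
    proof (cases "x = y")
      case False
      have d: "\<alpha> x - \<alpha> y \<noteq> 0" "\<alpha> x + \<alpha> y \<noteq> 0" using \<alpha>_inj[OF xy False] \<alpha>[of x] \<alpha>[of y] by auto
      have "\<forall>\<^sub>F \<epsilon> in at_right 0. (a x - a y) + \<epsilon> * (\<alpha> x - \<alpha> y) \<noteq> 0"
        "\<forall>\<^sub>F \<epsilon> in at_right 0. (a x + a y) + \<epsilon> * (\<alpha> x + \<alpha> y) \<noteq> 0"
        "\<forall>\<^sub>F \<epsilon> in at_right 0. (b x - b y) + \<epsilon> * (\<alpha> x - \<alpha> y) \<noteq> 0"
        using d by (auto intro!: eventually_nonzero)
      then show ?thesis
        by eventually_elim (auto simp: algebra_simps)
    qed simp
  qed
  have "\<forall>\<^sub>F \<epsilon> in at_right 0. (\<forall>x\<in>V. ?a \<epsilon> x \<noteq> 0) \<and>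
      (\<forall>x\<in>V. \<forall>y\<in>V. x \<noteq> y \<longrightarrow> ?a \<epsilon> x \<noteq> ?a \<epsilon> y \<and> ?a \<epsilon> x \<noteq> - ?a \<epsilon> y \<and> ?b \<epsilon> x \<noteq> ?b \<epsilon> y) \<and>
      (\<forall>x\<in>V. \<forall>y\<in>V. \<forall>g\<in>{1, -1}.
        (horizontal a b x y g \<longrightarrow> horizontal (?a \<epsilon>) (?b \<epsilon>) x y g) \<and>
        (vertical a b x y g \<longrightarrow> vertical (?a \<epsilon>) (?b \<epsilon>) x y g))"
    by (intro eventually_conj ev1 ev2 eventually_same_colours finV)
  then obtain \<epsilon> where \<epsilon>: "\<forall>x\<in>V. ?a \<epsilon> x \<noteq> 0"
      "\<forall>x\<in>V. \<forall>y\<in>V. x \<noteq> y \<longrightarrow> ?a \<epsilon> x \<noteq> ?a \<epsilon> y \<and> ?a \<epsilon> x \<noteq> - ?a \<epsilon> y \<and> ?b \<epsilon> x \<noteq> ?b \<epsilon> y"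
      "\<forall>x\<in>V. \<forall>y\<in>V. \<forall>g\<in>{1, -1}.
        (horizontal a b x y g \<longrightarrow> horizontal (?a \<epsilon>) (?b \<epsilon>) x y g) \<and>
        (vertical a b x y g \<longrightarrow> vertical (?a \<epsilon>) (?b \<epsilon>) x y g)"
    by (rule exE[OF eventually_happens'[OF trivial_limit_at_right_real]], elim conjE) (rule that; assumption)
  have "realisation V E (?a \<epsilon>) (?b \<epsilon>)"
    by (rule realisation_same_colours[OF sg r]) (use \<epsilon>(3) in blast)
  moreover have "generic V (?a \<epsilon>) (?b \<epsilon>)" unfolding generic_def using \<epsilon>(1,2) by blast
  ultimately show thesis using that by blast
qed

section \<open>Extending a placement by a vertex\<close>

text \<open>One new edge of each colour determines both velocities of the new vertex. The horizontal edge may be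
  a loop, which forces the horizontal velocity to vanish.\<close>

lemma realisation_add_vertex:
  assumes sg: "signed_graph V E" and r: "realisation V E a b" and v: "v \<notin> V" and x: "x \<in> V" and y: "y \<in> insert v V"
    and g: "g = 1 \<or> g = -1" "y = v \<Longrightarrow> g = -1" and h: "h = 1 \<or> h = -1"
    and hor: "horizontal (a(v := s)) (b(v := t)) v y g" and ver: "vertical (a(v := s)) (b(v := t)) v x h"
  shows "realisation (insert v V) (insert ({v, y}, g) (insert ({v, x}, h) E)) (a(v := s)) (b(v := t))"
proof -
  let ?a = "a(v := s)" and ?b = "b(v := t)"
  have inc: "?a z = a z \<and> ?b z = b z" if "z \<in> incident_verts E" for z
    using signed_graph_incident[OF sg] that v by auto
  note pc = placement_cong[of E ?a a ?b b, OF inc]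
  show ?thesis
  proof (rule realisation_extend[where V = V and E = E and a = a and b = b])
    show "well_placed (insert ({v, y}, g) (insert ({v, x}, h) E)) ?a ?b"
      using r hor ver pc(1) by (simp add: well_placed_insert[OF g(1)] well_placed_insert[OF h] realisation_def)
    show "rigidly_placed V E a b" using r by (simp add: realisation_def)
    fix c assume "horizontal_flex (insert ({v, y}, g) (insert ({v, x}, h) E)) ?a ?b c"
    then have c: "horizontal_flex E a b c" "c v = of_int g * c y"
      using hor pc(2) by (simp_all add: horizontal_flex_insert[OF g(1)] horizontal_flex_insert[OF h])
    have "c v = 0" if "\<forall>x\<in>V. c x = 0"
    proof (cases "y = v")
      case True
      then show ?thesis using c(2) g by simp
    next
      case False
      then show ?thesis using c(2) that y by simp
    qed
    then show "horizontal_flex E a b c \<and> ((\<forall>x\<in>V. c x = 0) \<longrightarrow> c v = 0)" using c by blast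
  next
    fix d assume "vertical_flex (insert ({v, y}, g) (insert ({v, x}, h) E)) ?a ?b d"
    then have "vertical_flex E a b d" "d v = d x"
      using ver pc(3) by (simp_all add: vertical_flex_insert[OF g(1)] vertical_flex_insert[OF h])
    then show "vertical_flex E a b d \<and> (\<exists>x\<in>V. d v = d x)" using x by blast
  qed
qed

text \<open>The two halves of the old edge have its colour and together imply its constraint; the third edge has
  the other colour and determines the remaining velocity.\<close>

lemma realisation_subdivide:
  assumes sg: "signed_graph V E" and r: "realisation V E a b" and v: "v \<notin> V" and e: "({x, y}, k) \<in> E" and z: "z \<in> V"
    and g: "g1 = 1 \<or> g1 = -1" "g2 = 1 \<or> g2 = -1" "g3 = 1 \<or> g3 = -1" "g1 * g2 = k"
    and col: "horizontal a b x y k \<and> horizontal (a(v := s)) (b(v := t)) v x g1 \<and>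
        horizontal (a(v := s)) (b(v := t)) v y g2 \<and> vertical (a(v := s)) (b(v := t)) v z g3 \<or>
      vertical a b x y k \<and> vertical (a(v := s)) (b(v := t)) v x g1 \<and>
        vertical (a(v := s)) (b(v := t)) v y g2 \<and> horizontal (a(v := s)) (b(v := t)) v z g3"
  shows "realisation (insert v V)
    (insert ({v, x}, g1) (insert ({v, y}, g2) (insert ({v, z}, g3) (E - {({x, y}, k)})))) (a(v := s)) (b(v := t))"
proof -
  let ?a = "a(v := s)" and ?b = "b(v := t)" and ?F = "E - {({x, y}, k)}"
  let ?E' = "insert ({v, x}, g1) (insert ({v, y}, g2) (insert ({v, z}, g3) ?F))"
  have k: "k = 1 \<or> k = -1" by (rule signed_graph_memD(3)[OF sg e])
  have xy: "x \<in> V" "y \<in> V" by (rule signed_graph_memD[OF sg e])+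
  have E: "E = insert ({x, y}, k) ?F" using e by blast
  have inc: "?a z = a z \<and> ?b z = b z" if "z \<in> incident_verts ?F" for z
    using signed_graph_incident[OF sg] incident_verts_mono[of ?F E] that v by auto
  note pc = placement_cong[of ?F ?a a ?b b, OF inc]
  have wpF: "well_placed ?F a b" using r well_placed_mono[of E a b ?F] by (simp add: realisation_def)
  show ?thesis
  proof (rule realisation_extend[where V = V and E = E and a = a and b = b])
    show "well_placed ?E' ?a ?b"
      using col pc(1) wpF
      by (auto simp: well_placed_insert[OF g(1)] well_placed_insert[OF g(2)] well_placed_insert[OF g(3)])
    show "rigidly_placed V E a b" using r by (simp add: realisation_def)
  next
    fix c assume "horizontal_flex ?E' ?a ?b c"
    then have c: "horizontal_flex ?F a b c" "horizontal ?a ?b v x g1 \<Longrightarrow> c v = of_int g1 * c x"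
      "horizontal ?a ?b v y g2 \<Longrightarrow> c v = of_int g2 * c y" "horizontal ?a ?b v z g3 \<Longrightarrow> c v = of_int g3 * c z"
      using pc(2) by (simp_all add: horizontal_flex_insert[OF g(1)] horizontal_flex_insert[OF g(2)] horizontal_flex_insert[OF g(3)])
    show "horizontal_flex E a b c \<and> ((\<forall>x\<in>V. c x = 0) \<longrightarrow> c v = 0)"
      using col
    proof
      assume h: "horizontal a b x y k \<and> horizontal ?a ?b v x g1 \<and> horizontal ?a ?b v y g2 \<and> vertical ?a ?b v z g3"
      then have eq: "of_int g1 * c x = of_int g2 * c y" and cv: "c v = of_int g1 * c x" using c by auto
      have "c x = of_int k * c y" using eq g by auto
      then have "horizontal_flex E a b c"
        by (subst E) (use c(1) horizontal_flex_insert[OF k, of x y ?F] in blast)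
      then show ?thesis using cv xy by simp
    next
      assume h: "vertical a b x y k \<and> vertical ?a ?b v x g1 \<and> vertical ?a ?b v y g2 \<and> horizontal ?a ?b v z g3"
      then have "horizontal_flex E a b c"
        by (subst E) (use c(1) horizontal_flex_insert[OF k, of x y ?F a b c] not_horizontal_and_vertical[of a b x y k] in blast)
      then show ?thesis using c(4) h z by simp
    qed
  next
    fix d assume "vertical_flex ?E' ?a ?b d"
    then have d: "vertical_flex ?F a b d" "vertical ?a ?b v x g1 \<Longrightarrow> d v = d x"
      "vertical ?a ?b v y g2 \<Longrightarrow> d v = d y" "vertical ?a ?b v z g3 \<Longrightarrow> d v = d z"
      using pc(3) by (simp_all add: vertical_flex_insert[OF g(1)] vertical_flex_insert[OF g(2)] vertical_flex_insert[OF g(3)])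
    show "vertical_flex E a b d \<and> (\<exists>x\<in>V. d v = d x)"
      using col
    proof
      assume h: "horizontal a b x y k \<and> horizontal ?a ?b v x g1 \<and> horizontal ?a ?b v y g2 \<and> vertical ?a ?b v z g3"
      then have "vertical_flex E a b d"
        by (subst E) (use d(1) vertical_flex_insert[OF k, of x y ?F a b d] not_horizontal_and_vertical[of a b x y k] in blast)
      then show ?thesis using d(4) h z by blast
    next
      assume h: "vertical a b x y k \<and> vertical ?a ?b v x g1 \<and> vertical ?a ?b v y g2 \<and> horizontal ?a ?b v z g3"
      then have "d x = d y" and dv: "d v = d x" using d by auto
      then have "vertical_flex E a b d"
        by (subst E) (use d(1) vertical_flex_insert[OF k, of x y ?F a b d] in blast)
      then show ?thesis using dv xy by blast
    qed
  qed
qed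

section \<open>Replacing a vertex by a small cluster\<close>

text \<open>All of \<open>K\<close> is placed at the old position of \<open>v\<close>, displaced by small multiples of the offsets
  \<open>(\<alpha> k, \<beta> k)\<close>. Edges leaving \<open>K\<close> keep the colour they had at \<open>v\<close>, edges of gain \<open>-1\<close> inside \<open>K\<close>
  are horizontal like a loop at \<open>v\<close>, and edges of gain 1 inside \<open>K\<close> are coloured by the offsets. The
  last two assumptions say that flexes are constant on \<open>K\<close>, and then they descend to the old graph.\<close>

lemma realisation_vertex_split:
  fixes \<alpha> \<beta> :: "'a \<Rightarrow> real"
  assumes sg: "signed_graph V E" and r: "realisation V E a b" and v: "v \<in> V" "a v \<noteq> 0"
    and K: "finite K" "K \<noteq> {}" "K \<inter> V = {}" and sg': "signed_graph ((V - {v}) \<union> K) E'"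
    and new: "\<And>e. e \<in> E' \<Longrightarrow> (e \<in> E \<and> v \<notin> fst e) \<or>
        (\<exists>x k g. e = ({x, k}, g) \<and> x \<in> V \<and> x \<noteq> v \<and> k \<in> K \<and> ({x, v}, g) \<in> E) \<or>
        (\<exists>k l. e = ({k, l}, -1) \<and> k \<in> K \<and> l \<in> K) \<or>
        (\<exists>k l. e = ({k, l}, 1) \<and> k \<in> K \<and> l \<in> K \<and> \<bar>\<alpha> k - \<alpha> l\<bar> \<noteq> \<bar>\<beta> k - \<beta> l\<bar>)"
    and old: "\<And>e. e \<in> E \<Longrightarrow> v \<notin> fst e \<Longrightarrow> e \<in> E'"
    and lift: "\<And>x g. x \<noteq> v \<Longrightarrow> ({x, v}, g) \<in> E \<Longrightarrow> \<exists>k\<in>K. ({x, k}, g) \<in> E'"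
    and loop: "({v}, -1) \<in> E \<Longrightarrow> \<exists>k\<in>K. \<exists>l\<in>K. ({k, l}, -1) \<in> E'"
    and hconn: "\<And>c :: 'a \<Rightarrow> real. (\<And>k l. k \<in> K \<Longrightarrow> l \<in> K \<Longrightarrow> ({k, l}, 1) \<in> E' \<Longrightarrow> \<bar>\<beta> k - \<beta> l\<bar> < \<bar>\<alpha> k - \<alpha> l\<bar> \<Longrightarrow> c k = c l) \<Longrightarrow>
        (\<And>x k g. x \<in> V \<Longrightarrow> x \<noteq> v \<Longrightarrow> k \<in> K \<Longrightarrow> ({x, k}, g) \<in> E' \<Longrightarrow> ({x, v}, g) \<in> E \<Longrightarrow> horizontal a b x v g \<Longrightarrow> c x = of_int g * c k) \<Longrightarrow>
        \<forall>k\<in>K. \<forall>l\<in>K. c k = c l"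
    and vconn: "\<And>d :: 'a \<Rightarrow> real. (\<And>k l. k \<in> K \<Longrightarrow> l \<in> K \<Longrightarrow> ({k, l}, 1) \<in> E' \<Longrightarrow> \<bar>\<alpha> k - \<alpha> l\<bar> < \<bar>\<beta> k - \<beta> l\<bar> \<Longrightarrow> d k = d l) \<Longrightarrow>
        (\<And>x k g. x \<in> V \<Longrightarrow> x \<noteq> v \<Longrightarrow> k \<in> K \<Longrightarrow> ({x, k}, g) \<in> E' \<Longrightarrow> ({x, v}, g) \<in> E \<Longrightarrow> vertical a b x v g \<Longrightarrow> d x = d k) \<Longrightarrow>
        \<forall>k\<in>K. \<forall>l\<in>K. d k = d l"
  shows "\<exists>a' b'. realisation ((V - {v}) \<union> K) E' a' b'"
proof -
  let ?V = "(V - {v}) \<union> K"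
  have finV: "finite ?V" using sg' by (simp add: signed_graph_def)
  define a0 where "a0 x = (if x \<in> K then a v else a x)" for x
  define b0 where "b0 x = (if x \<in> K then b v else b x)" for x
  define \<alpha>0 where "\<alpha>0 x = (if x \<in> K then \<alpha> x else 0)" for x
  define \<beta>0 where "\<beta>0 x = (if x \<in> K then \<beta> x else 0)" for x
  let ?a = "\<lambda>\<epsilon> z. a0 z + \<epsilon> * \<alpha>0 z" and ?b = "\<lambda>\<epsilon> z. b0 z + \<epsilon> * \<beta>0 z"
  have "\<forall>\<^sub>F \<epsilon> in at_right 0. 0 < \<epsilon> \<and> (\<forall>x\<in>?V. \<forall>y\<in>?V. \<forall>g\<in>{1, -1}.
        (horizontal a0 b0 x y g \<longrightarrow> horizontal (?a \<epsilon>) (?b \<epsilon>) x y g) \<and>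
        (vertical a0 b0 x y g \<longrightarrow> vertical (?a \<epsilon>) (?b \<epsilon>) x y g))"
    by (intro eventually_conj eventually_positive eventually_same_colours finV)
  then obtain \<epsilon> where \<epsilon>0: "0 < \<epsilon>" and col: "\<forall>x\<in>?V. \<forall>y\<in>?V. \<forall>g\<in>{1, -1}.
        (horizontal a0 b0 x y g \<longrightarrow> horizontal (?a \<epsilon>) (?b \<epsilon>) x y g) \<and>
        (vertical a0 b0 x y g \<longrightarrow> vertical (?a \<epsilon>) (?b \<epsilon>) x y g)"
    by (rule exE[OF eventually_happens'[OF trivial_limit_at_right_real]], elim conjE) (rule that; assumption)
  define a' where "a' = ?a \<epsilon>"
  define b' where "b' = ?b \<epsilon>"
  have h0: "horizontal a0 b0 x y g \<Longrightarrow> horizontal a' b' x y g" and v0: "vertical a0 b0 x y g \<Longrightarrow> vertical a' b' x y g"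
    if "({x, y}, g) \<in> E'" for x y g
    using col signed_graph_memD[OF sg' that] unfolding a'_def b'_def by blast+
  have notK: "x \<notin> K" if "x \<in> V" for x using K(3) that by blast
  have oldcol: "horizontal a0 b0 x y g = horizontal a b x y g" "vertical a0 b0 x y g = vertical a b x y g"
    if "x \<in> V" "y \<in> V" for x y g
    using notK[OF that(1)] notK[OF that(2)] by (simp_all add: horizontal_def vertical_def a0_def b0_def)
  have liftcol: "horizontal a0 b0 x k g = horizontal a b x v g" "vertical a0 b0 x k g = vertical a b x v g"
    if "x \<in> V" "k \<in> K" for x k g
    using notK[OF that(1)] that(2) by (simp_all add: horizontal_def vertical_def a0_def b0_def)
  have loopcol: "horizontal a0 b0 k l (-1)" if "k \<in> K" "l \<in> K" for k l
    using that v by (simp add: horizontal_def a0_def b0_def)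
  have inner: "horizontal a' b' k l 1 \<longleftrightarrow> \<bar>\<beta> k - \<beta> l\<bar> < \<bar>\<alpha> k - \<alpha> l\<bar>"
    "vertical a' b' k l 1 \<longleftrightarrow> \<bar>\<alpha> k - \<alpha> l\<bar> < \<bar>\<beta> k - \<beta> l\<bar>" if "k \<in> K" "l \<in> K" for k l
  proof -
    have "a' k - a' l = \<epsilon> * (\<alpha> k - \<alpha> l)" "b' k - b' l = \<epsilon> * (\<beta> k - \<beta> l)"
      using that by (simp_all add: a'_def b'_def a0_def b0_def \<alpha>0_def \<beta>0_def algebra_simps)
    then show "horizontal a' b' k l 1 \<longleftrightarrow> \<bar>\<beta> k - \<beta> l\<bar> < \<bar>\<alpha> k - \<alpha> l\<bar>"
      "vertical a' b' k l 1 \<longleftrightarrow> \<bar>\<alpha> k - \<alpha> l\<bar> < \<bar>\<beta> k - \<beta> l\<bar>"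
      using \<epsilon>0 by (simp_all add: horizontal_def vertical_def abs_mult)
  qed
  have wp: "well_placed E a b" and rp: "rigidly_placed V E a b" using r by (simp_all add: realisation_def)
  have edge_wp: "horizontal a b x y g \<or> vertical a b x y g" if "({x, y}, g) \<in> E" for x y g
    using wp that unfolding well_placed_def by blast
  have wp': "well_placed E' a' b'"
    unfolding well_placed_def
  proof (intro allI impI)
    fix p q h assume e: "({p, q}, h) \<in> E'"
    have sh: "h = 1 \<or> h = -1" by (rule signed_graph_memD(3)[OF sg' e])
    from new[OF e] consider "({p, q}, h) \<in> E" | x k where "({p, q}, h) = ({x, k}, h)" "x \<in> V" "k \<in> K" "({x, v}, h) \<in> E"
      | k l where "({p, q}, h) = ({k, l}, -1)" "k \<in> K" "l \<in> K"
      | k l where "({p, q}, h) = ({k, l}, 1)" "k \<in> K" "l \<in> K" "\<bar>\<alpha> k - \<alpha> l\<bar> \<noteq> \<bar>\<beta> k - \<beta> l\<bar>"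
      by fastforce
    then show "horizontal a' b' p q h \<or> vertical a' b' p q h"
    proof cases
      case 1
      then have "horizontal a b p q h \<or> vertical a b p q h" by (rule edge_wp)
      then show ?thesis using h0[OF e] v0[OF e] oldcol[of p q h] signed_graph_memD[OF sg 1] by blast
    next
      case (2 x k)
      have "({x, k}, h) \<in> E'" using e 2(1) by simp
      moreover have "horizontal a b x v h \<or> vertical a b x v h" by (rule edge_wp[OF 2(4)])
      ultimately have "horizontal a' b' x k h \<or> vertical a' b' x k h"
        using h0[of x k h] v0[of x k h] liftcol[OF 2(2,3)] by blast
      then show ?thesis using 2(1) horizontal_commute[OF sh, of a' b' x k] vertical_commute[OF sh, of a' b' x k]
        by (auto simp: doubleton_eq_iff)
    next
      case (3 k l)
      then have "p \<in> K" "q \<in> K" "h = -1" by (auto simp: doubleton_eq_iff)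
      then show ?thesis using h0[OF e] loopcol[of p q] by blast
    next
      case (4 k l)
      then have "p \<in> K" "q \<in> K" "h = 1" "\<bar>\<alpha> p - \<alpha> q\<bar> \<noteq> \<bar>\<beta> p - \<beta> q\<bar>"
        by (auto simp: doubleton_eq_iff abs_minus_commute)
      then show ?thesis using inner[of p q] by (metis linorder_neqE_linordered_idom)
    qed
  qed
  obtain k0 where k0: "k0 \<in> K" using K(2) by blast
  have hflex: "\<forall>x\<in>?V. c x = 0" if c: "horizontal_flex E' a' b' c" for c
  proof -
    have cD: "c x = of_int g * c y" if "({x, y}, g) \<in> E'" "horizontal a' b' x y g" for x y g
      using c that unfolding horizontal_flex_def by blast
    have cK: "\<forall>k\<in>K. \<forall>l\<in>K. c k = c l"
    proof (rule hconn)
      fix k l assume kl: "k \<in> K" "l \<in> K" "({k, l}, 1) \<in> E'" "\<bar>\<beta> k - \<beta> l\<bar> < \<bar>\<alpha> k - \<alpha> l\<bar>"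
      then show "c k = c l" using cD[OF kl(3)] inner(1)[OF kl(1,2)] by simp
    next
      fix x k g assume x: "x \<in> V" "x \<noteq> v" "k \<in> K" "({x, k}, g) \<in> E'" "horizontal a b x v g"
      then show "c x = of_int g * c k" using cD[OF x(4)] h0[OF x(4)] liftcol[OF x(1,3)] by blast
    qed
    \<comment> \<open>the flex of the old graph in which \<open>v\<close> has the common velocity of \<open>K\<close>\<close>
    define c0 where "c0 = c(v := c k0)"
    have across: "c0 x = of_int g * c0 v" if e: "({x, v}, g) \<in> E" "horizontal a b x v g" "x \<noteq> v" for x g
    proof -
      obtain k where k: "k \<in> K" "({x, k}, g) \<in> E'" using lift[OF e(3,1)] by blast
      have "c x = of_int g * c k"
        using cD[OF k(2)] h0[OF k(2)] liftcol[of x k g] k(1) e signed_graph_memD(1)[OF sg e(1)] by blast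
      moreover have "c k = c k0" using cK k(1) k0 by blast
      ultimately show ?thesis using e(3) by (simp add: c0_def)
    qed
    have "horizontal_flex E a b c0" unfolding horizontal_flex_def
    proof (intro allI impI)
      fix x y g assume e: "({x, y}, g) \<in> E" and h: "horizontal a b x y g"
      have g: "g = 1 \<or> g = -1" by (rule signed_graph_memD(3)[OF sg e])
      consider "x \<noteq> v" "y \<noteq> v" | "x \<noteq> v" "y = v" | "x = v" "y \<noteq> v" | "x = v" "y = v" by blast
      then show "c0 x = of_int g * c0 y"
      proof cases
        case 1
        then have e': "({x, y}, g) \<in> E'" using old[OF e] by auto
        have "c x = of_int g * c y"
          using cD[OF e'] h0[OF e'] h oldcol[of x y g] signed_graph_memD[OF sg e] by blast
        then show ?thesis using 1 by (simp add: c0_def)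
      next
        case 2
        then show ?thesis using across e h by blast
      next
        case 3
        then have "({y, v}, g) \<in> E" "horizontal a b y v g" using e h horizontal_commute[OF g, of a b x y]
          by (simp_all add: insert_commute)
        then show ?thesis using across[of y g] 3 gain_eq_commute[OF g] by blast
      next
        case 4
        then have g1: "g = -1" using signed_graph_memD(4)[OF sg e] by simp
        then obtain k l where kl: "k \<in> K" "l \<in> K" "({k, l}, -1) \<in> E'" using loop e 4 by auto
        then have "c k = - c l" using cD[OF kl(3)] h0[OF kl(3)] loopcol[OF kl(1,2)] by simp
        moreover have "c k = c k0" "c l = c k0" using cK kl k0 by blast+
        ultimately show ?thesis using 4 g1 by (simp add: c0_def)
      qed
    qed
    then have zero: "\<forall>x\<in>V. c0 x = 0" using rp unfolding rigidly_placed_def by blast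
    then have "c k0 = 0" using v(1) by (auto simp: c0_def)
    then have "c k = 0" if "k \<in> K" for k using cK k0 that by metis
    moreover have "c x = 0" if "x \<in> V - {v}" for x using zero that by (auto simp: c0_def split: if_splits)
    ultimately show ?thesis by blast
  qed
  have vflex: "\<forall>x\<in>?V. \<forall>y\<in>?V. d x = d y" if d: "vertical_flex E' a' b' d" for d
  proof -
    have dD: "d x = d y" if "({x, y}, g) \<in> E'" "vertical a' b' x y g" for x y g
      using d that unfolding vertical_flex_def by blast
    have dK: "\<forall>k\<in>K. \<forall>l\<in>K. d k = d l"
    proof (rule vconn)
      fix k l assume kl: "k \<in> K" "l \<in> K" "({k, l}, 1) \<in> E'" "\<bar>\<alpha> k - \<alpha> l\<bar> < \<bar>\<beta> k - \<beta> l\<bar>"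
      then show "d k = d l" using dD[OF kl(3)] inner(2)[OF kl(1,2)] by simp
    next
      fix x k g assume x: "x \<in> V" "x \<noteq> v" "k \<in> K" "({x, k}, g) \<in> E'" "vertical a b x v g"
      then show "d x = d k" using dD[OF x(4)] v0[OF x(4)] liftcol[OF x(1,3)] by blast
    qed
    define d0 where "d0 = d(v := d k0)"
    have across: "d0 x = d0 v" if e: "({x, v}, g) \<in> E" "vertical a b x v g" "x \<noteq> v" for x g
    proof -
      obtain k where k: "k \<in> K" "({x, k}, g) \<in> E'" using lift[OF e(3,1)] by blast
      have "d x = d k"
        using dD[OF k(2)] v0[OF k(2)] liftcol[of x k g] k(1) e signed_graph_memD(1)[OF sg e(1)] by blast
      moreover have "d k = d k0" using dK k(1) k0 by blast
      ultimately show ?thesis using e(3) by (simp add: d0_def)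
    qed
    have "vertical_flex E a b d0" unfolding vertical_flex_def
    proof (intro allI impI)
      fix x y g assume e: "({x, y}, g) \<in> E" and h: "vertical a b x y g"
      have g: "g = 1 \<or> g = -1" by (rule signed_graph_memD(3)[OF sg e])
      consider "x \<noteq> v" "y \<noteq> v" | "x \<noteq> v" "y = v" | "x = v" "y \<noteq> v" | "x = v" "y = v" by blast
      then show "d0 x = d0 y"
      proof cases
        case 1
        then have e': "({x, y}, g) \<in> E'" using old[OF e] by auto
        have "d x = d y"
          using dD[OF e'] v0[OF e'] h oldcol[of x y g] signed_graph_memD[OF sg e] by blast
        then show ?thesis using 1 by (simp add: d0_def)
      next
        case 2
        then show ?thesis using across e h by blast
      next
        case 3
        then have "({y, v}, g) \<in> E" "vertical a b y v g" using e h vertical_commute[OF g, of a b x y]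
          by (simp_all add: insert_commute)
        then have "d0 y = d0 v" using across[of y g] 3 by blast
        then show ?thesis using 3 by simp
      qed simp
    qed
    then have eq: "\<forall>x\<in>V. \<forall>y\<in>V. d0 x = d0 y" using rp unfolding rigidly_placed_def by blast
    have "d x = d k0" if "x \<in> ?V" for x
    proof (cases "x \<in> K")
      case True
      then show ?thesis using dK k0 by blast
    next
      case False
      then have "x \<in> V" "x \<noteq> v" using that by auto
      then have "d0 x = d0 v" using eq v(1) by blast
      then show ?thesis using \<open>x \<noteq> v\<close> by (simp add: d0_def)
    qed
    then show ?thesis by simp
  qed
  have "realisation ?V E' a' b'"
    unfolding realisation_def rigidly_placed_def using wp' hflex vflex by blast
  then show ?thesis by blast
qed

section \<open>Constructible signed graphs are realisable\<close>

definition realisable :: "'a set \<Rightarrow> 'a sedge set \<Rightarrow> bool" where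
  "realisable V E \<longleftrightarrow> signed_graph V E \<and> card E + 1 = 2 * card V \<and> (\<exists>a b. realisation V E a b)"

lemma realisable_tight: "realisable V E \<Longrightarrow> tight V E"
  unfolding realisable_def realisation_def using rigidly_placed_tight by blast

text \<open>A small perturbation keeps all colours.\<close>

lemma realisable_generic:
  assumes "realisable V E"
  obtains a b where "realisation V E a b" "generic V a b"
proof -
  obtain a b where "signed_graph V E" "realisation V E a b" using assms unfolding realisable_def by blast
  from generic_realisation[OF this] show thesis using that by metis
qed

lemma realisable_loop: "realisable {x} {({x}, -1)}"
proof -
  have e: "{({x}, -1 :: int)} = insert ({x, x}, -1) {}" by simp
  have h: "horizontal (\<lambda>_. 1) (\<lambda>_. 0) x x (-1)" by (simp add: horizontal_def)
  have "signed_graph {x} {({x}, -1)}" by (rule signed_graphI) auto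
  moreover have "well_placed {({x}, -1)} (\<lambda>_. 1) (\<lambda>_. 0)"
    unfolding e using h by (subst well_placed_insert) (simp_all add: well_placed_def)
  moreover have "c x = 0" if "horizontal_flex {({x}, -1)} (\<lambda>_. 1) (\<lambda>_. 0) c" for c
  proof -
    have "c x = of_int (-1) * c x" using that h unfolding e horizontal_flex_def by blast
    then show ?thesis by simp
  qed
  ultimately show ?thesis unfolding realisable_def realisation_def rigidly_placed_def by auto
qed

text \<open>Switching at \<open>v\<close> exchanges the two points over \<open>v\<close>.\<close>

lemma realisable_flip:
  assumes r: "realisable V E" shows "realisable V (flip_edge v ` E)"
proof -
  note t = tightD[OF realisable_tight[OF r]] and t' = tightD[OF tight_flip[OF realisable_tight[OF r], of v]]
  obtain a b where ab: "realisation V E a b" using r unfolding realisable_def by blast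
  define a' where "a' = a(v := - a v)"
  define flip where "flip x y g = (if v \<in> {x, y} \<and> x \<noteq> y then - g else g)" for x y and g :: int
  have mem: "({x, y}, g) \<in> E \<Longrightarrow> ({x, y}, flip x y g) \<in> flip_edge v ` E" for x y g
    unfolding in_flip_image flip_edge_doubleton flip_def by (cases "x = y") simp_all
  have mem': "({x, y}, g) \<in> flip_edge v ` E \<Longrightarrow> ({x, y}, flip x y g) \<in> E" for x y g
    unfolding in_flip_image flip_edge_doubleton flip_def by (cases "x = y") simp_all
  have abs_eq: "\<bar>a' x - of_int (flip x y g) * a' y\<bar> = \<bar>a x - of_int g * a y\<bar>" if "g = 1 \<or> g = -1" for x y g
    using that by (auto simp: a'_def flip_def)
  have col: "horizontal a' b x y (flip x y g) = horizontal a b x y g" "vertical a' b x y (flip x y g) = vertical a b x y g"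
    if "g = 1 \<or> g = -1" for x y g
    unfolding horizontal_def vertical_def using abs_eq[OF that] by simp_all
  have flip_flip: "flip x y (flip x y g) = g" for x y g by (simp add: flip_def)
  have "well_placed (flip_edge v ` E) a' b" unfolding well_placed_def
  proof (intro allI impI)
    fix x y g assume "({x, y}, g) \<in> flip_edge v ` E"
    then have e: "({x, y}, flip x y g) \<in> E" by (rule mem')
    then have "horizontal a b x y (flip x y g) \<or> vertical a b x y (flip x y g)"
      using ab unfolding realisation_def well_placed_def by blast
    then show "horizontal a' b x y g \<or> vertical a' b x y g"
      using col[OF signed_graph_memD(3)[OF t(1) e], of x y] unfolding flip_flip by blast
  qed
  moreover have "\<forall>x\<in>V. c x = 0" if c: "horizontal_flex (flip_edge v ` E) a' b c" for c
  proof -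
    have "horizontal_flex E a b (c(v := - c v))" unfolding horizontal_flex_def
    proof (intro allI impI)
      fix x y g assume e: "({x, y}, g) \<in> E" and h: "horizontal a b x y g"
      have g: "g = 1 \<or> g = -1" by (rule signed_graph_memD(3)[OF t(1) e])
      have "c x = of_int (flip x y g) * c y" using c mem[OF e] h col(1)[OF g, of x y] unfolding horizontal_flex_def by blast
      then show "(c(v := - c v)) x = of_int g * (c(v := - c v)) y" using g by (auto simp: flip_def split: if_splits)
    qed
    then have z: "\<forall>x\<in>V. (c(v := - c v)) x = 0" using ab unfolding realisation_def rigidly_placed_def by blast
    show ?thesis
    proof
      fix x assume "x \<in> V"
      then show "c x = 0" using z by (cases "x = v") (auto dest: bspec[of _ _ x])
    qed
  qed
  moreover have "\<forall>x\<in>V. \<forall>y\<in>V. d x = d y" if d: "vertical_flex (flip_edge v ` E) a' b d" for d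
  proof -
    have "vertical_flex E a b d" unfolding vertical_flex_def
    proof (intro allI impI)
      fix x y g assume e: "({x, y}, g) \<in> E" and h: "vertical a b x y g"
      have g: "g = 1 \<or> g = -1" by (rule signed_graph_memD(3)[OF t(1) e])
      show "d x = d y" using d mem[OF e] h col(2)[OF g, of x y] unfolding vertical_flex_def by blast
    qed
    then show ?thesis using ab unfolding realisation_def rigidly_placed_def by blast
  qed
  ultimately show ?thesis using t' unfolding realisable_def realisation_def rigidly_placed_def by blast
qed

lemma realisable_add_vertex:
  assumes r: "realisable V E" "realisation V E a b" and v: "v \<notin> V" and x: "x \<in> V" and y: "y \<in> insert v V"
    and g: "g = 1 \<or> g = -1" "y = v \<Longrightarrow> g = -1" and h: "h = 1 \<or> h = -1"
    and hor: "horizontal (a(v := s)) (b(v := t)) v y g" and ver: "vertical (a(v := s)) (b(v := t)) v x h"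
  shows "realisable (insert v V) (insert ({v, y}, g) (insert ({v, x}, h) E))"
proof -
  note t = tightD[OF realisable_tight[OF r(1)]]
  have "signed_graph (insert v V) (insert ({v, y}, g) (insert ({v, x}, h) E))"
  proof (rule signed_graphI)
    fix e assume "e \<in> insert ({v, y}, g) (insert ({v, x}, h) E)"
    then consider "e = ({v, y}, g)" | "e = ({v, x}, h)" | "e \<in> E" by blast
    then show "\<exists>p q k. e = ({p, q}, k) \<and> p \<in> insert v V \<and> q \<in> insert v V \<and> (k = 1 \<or> k = -1) \<and> (p = q \<longrightarrow> k = -1)"
    proof cases
      case 1
      then show ?thesis using g y by (intro exI[of _ v] exI[of _ y] exI[of _ g]) auto
    next
      case 2
      then show ?thesis using h x v by (intro exI[of _ v] exI[of _ x] exI[of _ h]) auto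
    next
      case 3
      then show ?thesis using signed_graph_edgeE[OF t(1) 3] by (metis insertI2)
    qed
  qed (use t in simp)
  moreover have "card (insert ({v, y}, g) (insert ({v, x}, h) E)) = card E + 2"
  proof -
    have nE: "({v, z}, k) \<notin> E" for z k by (rule edge_notinI[OF t(6) v]) simp
    have "({v, y}, g) \<noteq> ({v, x}, h)"
    proof
      assume "({v, y}, g) = ({v, x}, h)"
      then have "y = x" "g = h" by (auto simp: doubleton_eq_iff)
      then show False using hor ver not_horizontal_and_vertical by metis
    qed
    then show ?thesis using nE t(5) by simp
  qed
  moreover have "card (insert v V) = card V + 1" using v t(4) by simp
  moreover have "realisation (insert v V) (insert ({v, y}, g) (insert ({v, x}, h) E)) (a(v := s)) (b(v := t))"
    by (rule realisation_add_vertex[OF t(1) r(2) v x y g h hor ver])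
  ultimately show ?thesis using t(3) unfolding realisable_def by (intro conjI exI) auto
qed

lemma realisable_subdivide:
  assumes r: "realisable V E" "realisation V E a b" and v: "v \<notin> V" and e: "({x, y}, k) \<in> E" and z: "z \<in> V"
    and g: "g1 = 1 \<or> g1 = -1" "g2 = 1 \<or> g2 = -1" "g3 = 1 \<or> g3 = -1" "g1 * g2 = k"
    and col: "horizontal a b x y k \<and> horizontal (a(v := s)) (b(v := t)) v x g1 \<and>
        horizontal (a(v := s)) (b(v := t)) v y g2 \<and> vertical (a(v := s)) (b(v := t)) v z g3 \<or>
      vertical a b x y k \<and> vertical (a(v := s)) (b(v := t)) v x g1 \<and>
        vertical (a(v := s)) (b(v := t)) v y g2 \<and> horizontal (a(v := s)) (b(v := t)) v z g3"
  shows "realisable (insert v V)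
    (insert ({v, x}, g1) (insert ({v, y}, g2) (insert ({v, z}, g3) (E - {({x, y}, k)}))))"
proof -
  note t = tightD[OF realisable_tight[OF r(1)]]
  let ?F = "E - {({x, y}, k)}"
  let ?E' = "insert ({v, x}, g1) (insert ({v, y}, g2) (insert ({v, z}, g3) ?F))"
  note m = signed_graph_memD[OF t(1) e]
  have "signed_graph (insert v V) ?E'"
  proof (rule signed_graphI)
    fix e assume "e \<in> ?E'"
    then consider w l where "e = ({v, w}, l)" "w \<in> V" "l = 1 \<or> l = -1" | "e \<in> E"
      using m z g by blast
    then show "\<exists>p q k. e = ({p, q}, k) \<and> p \<in> insert v V \<and> q \<in> insert v V \<and> (k = 1 \<or> k = -1) \<and> (p = q \<longrightarrow> k = -1)"
    proof cases
      case (1 w l)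
      then show ?thesis using v by (intro exI[of _ v] exI[of _ w] exI[of _ l]) auto
    next
      case 2
      then show ?thesis using signed_graph_edgeE[OF t(1) 2] by (metis insertI2)
    qed
  qed (use t in simp)
  moreover have "card ?E' = card E + 2"
  proof -
    have nE: "({v, w}, l) \<notin> ?F" for w l using edge_notinI[OF t(6) v, of "{v, w}" l] by simp
    have ne: "({v, x}, g1) \<noteq> ({v, y}, g2)"
    proof
      assume "({v, x}, g1) = ({v, y}, g2)"
      then have "x = y" "g1 = g2" by (auto simp: doubleton_eq_iff)
      then show False using m(4) g by auto
    qed
    have ne': "({v, x}, g1) \<noteq> ({v, z}, g3)" "({v, y}, g2) \<noteq> ({v, z}, g3)"
    proof -
      show "({v, x}, g1) \<noteq> ({v, z}, g3)"
      proof
        assume "({v, x}, g1) = ({v, z}, g3)"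
        then have "x = z" "g1 = g3" by (auto simp: doubleton_eq_iff)
        then show False using col not_horizontal_and_vertical by metis
      qed
      show "({v, y}, g2) \<noteq> ({v, z}, g3)"
      proof
        assume "({v, y}, g2) = ({v, z}, g3)"
        then have "y = z" "g2 = g3" by (auto simp: doubleton_eq_iff)
        then show False using col not_horizontal_and_vertical by metis
      qed
    qed
    have "card ?F + 1 = card E" using e t(5) by (metis Suc_eq_plus1 card_Suc_Diff1)
    moreover have "card ?E' = card ?F + 3" using nE ne ne' t(5) by simp
    ultimately show ?thesis by simp
  qed
  moreover have "card (insert v V) = card V + 1" using v t(4) by simp
  moreover have "realisation (insert v V) ?E' (a(v := s)) (b(v := t))"
    by (rule realisation_subdivide[OF t(1) r(2) v e z g col])
  ultimately show ?thesis using t(3) unfolding realisable_def by (intro conjI exI) auto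
qed

text \<open>A line through \<open>(P1, P2)\<close> and \<open>(Q1, Q2)\<close> of slope less than 1 meets the vertical line at \<open>s\<close> in a
  point from which both \<open>P\<close> and \<open>Q\<close> are seen along horizontal edges; a small shift avoids \<open>z\<close>.\<close>

lemma interpolate_steep:
  fixes P1 P2 Q1 Q2 s z :: real
  assumes m: "\<bar>P2 - Q2\<bar> < \<bar>P1 - Q1\<bar>" and s: "s \<noteq> P1" "s \<noteq> Q1"
  shows "\<exists>t. t \<noteq> z \<and> \<bar>t - P2\<bar> < \<bar>s - P1\<bar> \<and> \<bar>t - Q2\<bar> < \<bar>s - Q1\<bar>"
proof -
  define m where "m = (Q2 - P2) / (Q1 - P1)"
  define t0 where "t0 = P2 + m * (s - P1)"
  have ne: "Q1 - P1 \<noteq> 0" using m by auto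
  have "\<bar>m\<bar> < 1" using m ne by (simp add: m_def abs_divide abs_minus_commute)
  have "Q2 - P2 = m * (Q1 - P1)" using ne by (simp add: m_def)
  then have "t0 - Q2 = m * (s - Q1)" by (simp add: t0_def algebra_simps)
  then have 1: "\<bar>t0 - Q2\<bar> < \<bar>s - Q1\<bar>"
    using mult_strict_right_mono[OF \<open>\<bar>m\<bar> < 1\<close>, of "\<bar>s - Q1\<bar>"] s(2) by (simp add: abs_mult)
  have 2: "\<bar>t0 - P2\<bar> < \<bar>s - P1\<bar>"
    using mult_strict_right_mono[OF \<open>\<bar>m\<bar> < 1\<close>, of "\<bar>s - P1\<bar>"] s(1) by (simp add: t0_def abs_mult)
  show ?thesis
  proof (cases "t0 = z")
    case False
    then show ?thesis using 1 2 by blast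
  next
    case True
    define d where "d = min (\<bar>s - P1\<bar> - \<bar>t0 - P2\<bar>) (\<bar>s - Q1\<bar> - \<bar>t0 - Q2\<bar>) / 2"
    have d: "d > 0" "d < \<bar>s - P1\<bar> - \<bar>t0 - P2\<bar>" "d < \<bar>s - Q1\<bar> - \<bar>t0 - Q2\<bar>"
      using 1 2 by (auto simp: d_def min_def)
    have "t0 + d \<noteq> z" "\<bar>(t0 + d) - P2\<bar> < \<bar>s - P1\<bar>" "\<bar>(t0 + d) - Q2\<bar> < \<bar>s - Q1\<bar>" using d True by auto
    then show ?thesis by blast
  qed
qed

text \<open>The new point is placed at the height of \<open>x\<close> and almost above or below \<open>y\<close>.\<close>

lemma realisable_H1a:
  assumes r: "realisable V E" and v: "v \<notin> V" and xy: "x \<in> V" "y \<in> V" "x \<noteq> y"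
    and g: "g = 1 \<or> g = -1" "h = 1 \<or> h = -1"
  shows "realisable (insert v V) (insert ({v, x}, g) (insert ({v, y}, h) E))"
proof -
  obtain a b where ab: "realisation V E a b" "generic V a b" using realisable_generic[OF r] .
  have bxy: "b x \<noteq> b y" using ab(2) xy unfolding generic_def by blast
  define s where "s = (if of_int h * a y \<noteq> of_int g * a x then of_int h * a y else of_int h * a y + \<bar>b x - b y\<bar> / 2)"
  have s: "\<bar>s - of_int h * a y\<bar> < \<bar>b x - b y\<bar>" "s \<noteq> of_int g * a x" using bxy by (auto simp: s_def)
  have ne: "x \<noteq> v" "y \<noteq> v" using xy v by auto
  have hor: "horizontal (a(v := s)) (b(v := b x)) v x g" using s(2) ne by (simp add: horizontal_def)
  have ver: "vertical (a(v := s)) (b(v := b x)) v y h" using s(1) ne by (simp add: vertical_def)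
  show ?thesis
    by (rule realisable_add_vertex[OF r ab(1) v xy(2) _ g(1) _ g(2) hor ver]) (use xy ne in simp_all)
qed

lemma realisable_H1b:
  assumes r: "realisable V E" and v: "v \<notin> V" and x: "x \<in> V"
  shows "realisable (insert v V) (insert ({v, x}, -1) (insert ({v, x}, 1) E))"
proof -
  obtain a b where ab: "realisation V E a b" "generic V a b" using realisable_generic[OF r] .
  have ax: "a x \<noteq> 0" using ab(2) x unfolding generic_def by blast
  have ne: "x \<noteq> v" using x v by auto
  have hor: "horizontal (a(v := a x)) (b(v := b x + \<bar>a x\<bar>)) v x (-1)" using ax ne by (simp add: horizontal_def)
  have ver: "vertical (a(v := a x)) (b(v := b x + \<bar>a x\<bar>)) v x 1" using ax ne by (simp add: vertical_def)
  show ?thesis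
    by (rule realisable_add_vertex[OF r ab(1) v x _ _ _ _ hor ver]) (use x ne in simp_all)
qed

lemma realisable_H1c:
  assumes r: "realisable V E" and v: "v \<notin> V" and x: "x \<in> V" and g: "g = 1 \<or> g = -1"
  shows "realisable (insert v V) (insert ({v}, -1) (insert ({v, x}, g) E))"
proof -
  obtain a b where ab: "realisation V E a b" "generic V a b" using realisable_generic[OF r] .
  have ax: "a x \<noteq> 0" using ab(2) x unfolding generic_def by blast
  have ne: "x \<noteq> v" using x v by auto
  have "realisable (insert v V) (insert ({v, v}, -1) (insert ({v, x}, g) E))"
    by (rule realisable_add_vertex[OF r ab(1) v x, where s = "of_int g * a x" and t = "b x + 1"])
      (use x ax ne g in \<open>auto simp: horizontal_def vertical_def\<close>)
  then show ?thesis by simp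
qed

text \<open>The new point is placed where the line of the subdivided edge meets the perpendicular axis-parallel
  line through the third neighbour; then the halves keep the colour and the third edge gets the other
  one. This fails if the edge is vertical and the third neighbour is the mirror image of \<open>P\<close>.\<close>

lemma realisable_H2:
  assumes r: "realisable V E" and v: "v \<notin> V" and e: "({x, y}, k) \<in> E" and z: "z \<in> V"
    and g: "g1 = 1 \<or> g1 = -1" "g2 = 1 \<or> g2 = -1" "g3 = 1 \<or> g3 = -1" "g1 * g2 = k"
    and new: "x = z \<Longrightarrow> g3 = - g1" "z \<noteq> y"
  shows "realisable (insert v V)
    (insert ({v, x}, g1) (insert ({v, y}, g2) (insert ({v, z}, g3) (E - {({x, y}, k)}))))"
proof -
  obtain a b where ab: "realisation V E a b" "generic V a b" using realisable_generic[OF r] .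
  note t = tightD[OF realisable_tight[OF r]]
  note m = signed_graph_memD[OF t(1) e]
  have a0: "a x \<noteq> 0" "a y \<noteq> 0" "a z \<noteq> 0" using ab(2) m z unfolding generic_def by blast+
  have ne: "x \<noteq> v" "y \<noteq> v" "z \<noteq> v" using v m z by auto
  have azy: "a z \<noteq> a y" "a z \<noteq> - a y" "b z \<noteq> b y" using ab(2) m z new(2) unfolding generic_def by blast+
  have gen: "\<forall>x\<in>V. \<forall>y\<in>V. x \<noteq> y \<longrightarrow> a x \<noteq> a y \<and> a x \<noteq> - a y \<and> b x \<noteq> b y" using ab(2) by (simp add: generic_def)
  have azx: "a z \<noteq> a x \<and> a z \<noteq> - a x \<and> b z \<noteq> b x" if "x \<noteq> z"
    using gen[rule_format, OF z m(1)] that by metis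
  let ?P1 = "of_int g1 * a x" and ?Q1 = "of_int g2 * a y" and ?Z1 = "of_int g3 * a z"
  have diff: "\<bar>a x - of_int k * a y\<bar> = \<bar>?P1 - ?Q1\<bar>" using g by auto
  have ZQ: "?Z1 \<noteq> ?Q1" using g azy by auto
  have ZP: "?Z1 \<noteq> ?P1"
  proof (cases "x = z")
    case True
    then show ?thesis using new(1) g a0 by auto
  next
    case False
    from azx[OF this] show ?thesis using g by auto
  qed
  have col: "horizontal a b x y k \<or> vertical a b x y k"
    using ab(1) e unfolding realisation_def well_placed_def by blast
  have hv: "horizontal (a(v := s)) (b(v := t)) v w l \<longleftrightarrow> \<bar>t - b w\<bar> < \<bar>s - of_int l * a w\<bar>"
    "vertical (a(v := s)) (b(v := t)) v w l \<longleftrightarrow> \<bar>s - of_int l * a w\<bar> < \<bar>t - b w\<bar>" if "w \<noteq> v" for s t w l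
    using that by (simp_all add: horizontal_def vertical_def)
  have "\<exists>s t. horizontal a b x y k \<and> \<bar>t - b x\<bar> < \<bar>s - ?P1\<bar> \<and> \<bar>t - b y\<bar> < \<bar>s - ?Q1\<bar> \<and> \<bar>s - ?Z1\<bar> < \<bar>t - b z\<bar> \<or>
      vertical a b x y k \<and> \<bar>s - ?P1\<bar> < \<bar>t - b x\<bar> \<and> \<bar>s - ?Q1\<bar> < \<bar>t - b y\<bar> \<and> \<bar>t - b z\<bar> < \<bar>s - ?Z1\<bar>"
    using col
  proof
    assume h: "horizontal a b x y k"
    then have "\<bar>b x - b y\<bar> < \<bar>?P1 - ?Q1\<bar>" unfolding horizontal_def diff .
    from interpolate_steep[OF this ZP ZQ, of "b z"] obtain t where
      "t \<noteq> b z" "\<bar>t - b x\<bar> < \<bar>?Z1 - ?P1\<bar>" "\<bar>t - b y\<bar> < \<bar>?Z1 - ?Q1\<bar>" by blast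
    then show ?thesis using h by (intro exI[of _ ?Z1] exI[of _ t]) simp
  next
    assume h: "vertical a b x y k"
    then have lt: "\<bar>?P1 - ?Q1\<bar> < \<bar>b x - b y\<bar>" unfolding vertical_def diff .
    show ?thesis
    proof (cases "x = z")
      case False
      have "b z \<noteq> b x" "b z \<noteq> b y" using azx[OF False] azy by auto
      from interpolate_steep[OF lt this, of ?Z1] obtain s where
        "s \<noteq> ?Z1" "\<bar>s - ?P1\<bar> < \<bar>b z - b x\<bar>" "\<bar>s - ?Q1\<bar> < \<bar>b z - b y\<bar>" by blast
      then show ?thesis using h by (intro exI[of _ s] exI[of _ "b z"]) simp
    next
      case True
      \<comment> \<open>the third edge ends at the mirror image of P, so the new vertex goes close to P on the segment PQ\<close>
      have Z1: "?Z1 = - ?P1" using True new(1) by simp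
      define D where "D = \<bar>b x - b y\<bar> + \<bar>?P1 - ?Q1\<bar>"
      have D: "D > 0" using lt by (simp add: D_def)
      define d where "d = min (1/2) (\<bar>?P1\<bar> / D)"
      have P0: "\<bar>?P1\<bar> > 0" using a0 g by auto
      have d: "0 < d" "d < 1" "d * D \<le> \<bar>?P1\<bar>" using D P0 by (auto simp: d_def min_def field_simps)
      let ?s = "?P1 + d * (?Q1 - ?P1)" and ?t = "b x + d * (b y - b x)"
      have 1: "\<bar>?s - ?P1\<bar> < \<bar>?t - b x\<bar>"
        using lt d(1) by (simp add: abs_mult abs_minus_commute)
      have "?s - ?Q1 = (1 - d) * (?P1 - ?Q1)" "?t - b y = (1 - d) * (b x - b y)" by (simp_all add: algebra_simps)
      then have 2: "\<bar>?s - ?Q1\<bar> < \<bar>?t - b y\<bar>" using lt d(2) by (simp add: abs_mult)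
      have 3: "\<bar>?t - b z\<bar> < \<bar>?s - ?Z1\<bar>"
      proof -
        have "\<bar>?t - b z\<bar> = d * \<bar>b x - b y\<bar>" "\<bar>d * (?Q1 - ?P1)\<bar> = d * \<bar>?P1 - ?Q1\<bar>"
          using True d(1) by (simp_all add: abs_mult abs_minus_commute)
        then have "\<bar>?t - b z\<bar> + \<bar>d * (?Q1 - ?P1)\<bar> = d * D" by (simp only: D_def distrib_left)
        moreover have "?s - ?Z1 = 2 * ?P1 + d * (?Q1 - ?P1)" using Z1 by simp
        ultimately show ?thesis using d(3) P0 by linarith
      qed
      show ?thesis using h 1 2 3 by (intro exI[of _ ?s] exI[of _ ?t]) blast
    qed
  qed
  then obtain s t where "horizontal a b x y k \<and> \<bar>t - b x\<bar> < \<bar>s - ?P1\<bar> \<and> \<bar>t - b y\<bar> < \<bar>s - ?Q1\<bar> \<and> \<bar>s - ?Z1\<bar> < \<bar>t - b z\<bar> \<or>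
      vertical a b x y k \<and> \<bar>s - ?P1\<bar> < \<bar>t - b x\<bar> \<and> \<bar>s - ?Q1\<bar> < \<bar>t - b y\<bar> \<and> \<bar>t - b z\<bar> < \<bar>s - ?Z1\<bar>"
    by blast
  then show ?thesis
    unfolding hv(1)[OF ne(1), symmetric] hv(1)[OF ne(2), symmetric] hv(1)[OF ne(3), symmetric]
      hv(2)[OF ne(1), symmetric] hv(2)[OF ne(2), symmetric] hv(2)[OF ne(3), symmetric]
    by (rule realisable_subdivide[OF r ab(1) v e z g])
qed

text \<open>The common part of the last two moves. Collapsing \<open>K\<close> onto \<open>v\<close> maps the new edges bijectively to
  the old ones, which gives their number.\<close>

lemma vertex_split_edges:
  assumes sg: "signed_graph V E" and v: "v \<in> V" and K: "finite K" "K \<inter> V = {}"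
    and f: "\<And>x g. x \<noteq> v \<Longrightarrow> ({x, v}, g) \<in> E \<Longrightarrow> f x g \<in> K" and yz: "y \<in> K" "z \<in> K"
    and E'': "E'' = {e \<in> E. v \<notin> fst e} \<union> {({x, f x g}, g) | x g. x \<noteq> v \<and> ({x, v}, g) \<in> E}
        \<union> (if ({v}, -1) \<in> E then {({y, z}, -1)} else {})"
  shows "signed_graph ((V - {v}) \<union> K) E''" "card E'' = card E" "\<And>k l. k \<in> K \<Longrightarrow> l \<in> K \<Longrightarrow> ({k, l}, 1) \<notin> E''"
    "\<And>x k g. x \<in> V \<Longrightarrow> k \<in> K \<Longrightarrow> ({x, k}, g) \<in> E'' \<Longrightarrow> f x g = k"
proof -
  have notK: "x \<notin> K" if "x \<in> V" for x using K(2) that by blast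
  have cases: "(\<exists>p q g. e = ({p, q}, g) \<and> p \<in> V \<and> q \<in> V \<and> p \<noteq> v \<and> q \<noteq> v \<and> (g = 1 \<or> g = -1) \<and> (p = q \<longrightarrow> g = -1) \<and> e \<in> E) \<or>
      (\<exists>x g. e = ({x, f x g}, g) \<and> x \<in> V \<and> x \<noteq> v \<and> f x g \<in> K \<and> (g = 1 \<or> g = -1) \<and> ({x, v}, g) \<in> E) \<or>
      e = ({y, z}, -1) \<and> ({v}, -1) \<in> E" if e: "e \<in> E''" for e
  proof -
    from e consider "e \<in> E" "v \<notin> fst e" | x g where "e = ({x, f x g}, g)" "x \<noteq> v" "({x, v}, g) \<in> E"
      | "e = ({y, z}, -1)" "({v}, -1) \<in> E"
      unfolding E'' by (auto split: if_splits)
    then show ?thesis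
    proof cases
      case 1
      obtain p q g where pq: "p \<in> V" "q \<in> V" "g = 1 \<or> g = -1" "e = ({p, q}, g)" "p = q \<Longrightarrow> g = -1"
        using signed_graph_edgeE[OF sg 1(1)] by metis
      then have "p \<noteq> v" "q \<noteq> v" using 1(2) by auto
      then show ?thesis using pq 1(1) by blast
    next
      case (2 x g)
      then show ?thesis using f[OF 2(2,3)] signed_graph_memD[OF sg 2(3)] by blast
    qed blast
  qed
  show sg'': "signed_graph ((V - {v}) \<union> K) E''"
  proof (rule signed_graphI)
    fix e assume "e \<in> E''"
    from cases[OF this] consider
      p q g where "e = ({p, q}, g)" "p \<in> V" "q \<in> V" "p \<noteq> v" "q \<noteq> v" "g = 1 \<or> g = -1" "p = q \<longrightarrow> g = -1"
      | x g where "e = ({x, f x g}, g)" "x \<in> V" "x \<noteq> v" "f x g \<in> K" "g = 1 \<or> g = -1"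
      | "e = ({y, z}, -1)" by blast
    then show "\<exists>x y g. e = ({x, y}, g) \<and> x \<in> V - {v} \<union> K \<and> y \<in> V - {v} \<union> K \<and> (g = 1 \<or> g = -1) \<and> (x = y \<longrightarrow> g = -1)"
    proof cases
      case (1 p q g)
      then show ?thesis by (intro exI[of _ p] exI[of _ q] exI[of _ g]) simp
    next
      case (2 x g)
      then have "x \<noteq> f x g" using notK[of x] by metis
      then show ?thesis using 2 by (intro exI[of _ x] exI[of _ "f x g"] exI[of _ g]) simp
    next
      case 3
      then show ?thesis using yz by (intro exI[of _ y] exI[of _ z] exI[of _ "-1"]) simp
    qed
  qed (use sg K in \<open>simp add: signed_graph_def\<close>)
  show in1: "({k, l}, 1) \<notin> E''" if kl: "k \<in> K" "l \<in> K" for k l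
  proof
    assume "({k, l}, 1) \<in> E''"
    from cases[OF this] show False
      using kl notK by (auto simp: doubleton_eq_iff)
  qed
  show fk: "f x g = k" if xk: "x \<in> V" "k \<in> K" and e: "({x, k}, g) \<in> E''" for x k g
    using cases[OF e] xk notK yz by (auto simp: doubleton_eq_iff)
  have inj: "inj_on (collapse_edge K v) E''"
  proof (rule inj_on_collapse_edge[OF sg''])
    show "v \<notin> V - {v} \<union> K" using notK[OF v] by blast
  next
    fix x k l g assume x: "x \<notin> K" "k \<in> K" "l \<in> K" and e: "({x, k}, g) \<in> E''" "({x, l}, g) \<in> E''"
    have "x \<in> V" using signed_graph_memD(1)[OF sg'' e(1)] x(1) by blast
    then show "k = l" using fk x e by blast
  next
    fix e e' assume e: "e \<in> E''" "e' \<in> E''" "fst e \<subseteq> K" "fst e' \<subseteq> K"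
    have "d = ({y, z}, -1)" if "d \<in> E''" "fst d \<subseteq> K" for d
      using cases[OF that(1)] that(2) notK by auto
    then show "e = e'" using e by metis
  qed
  have "collapse_edge K v ` E'' = E"
  proof (rule equalityI; rule subsetI)
    fix e assume "e \<in> collapse_edge K v ` E''"
    then obtain d where d: "d \<in> E''" "e = collapse_edge K v d" by blast
    from cases[OF d(1)] consider p q g where "d = ({p, q}, g)" "p \<in> V" "q \<in> V" "d \<in> E"
      | x g where "d = ({x, f x g}, g)" "x \<in> V" "f x g \<in> K" "({x, v}, g) \<in> E"
      | "d = ({y, z}, -1)" "({v}, -1) \<in> E" by blast
    then show "e \<in> E"
      by cases (use d(2) notK yz in \<open>simp_all add: collapse_edge_doubleton\<close>)
  next
    fix e assume e: "e \<in> E"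
    show "e \<in> collapse_edge K v ` E''"
    proof (cases "v \<in> fst e")
      case False
      obtain p q g where pq: "p \<in> V" "q \<in> V" "e = ({p, q}, g)" using signed_graph_edgeE[OF sg e] by metis
      then have "collapse_edge K v e = e" using notK by (simp add: collapse_edge_doubleton)
      moreover have "e \<in> E''" unfolding E'' using e False by blast
      ultimately show ?thesis by (metis imageI)
    next
      case True
      then have "e \<in> star E v" using e by (simp add: star_def)
      then obtain x g where xg: "e = ({v, x}, g)" "x \<in> V" "x = v \<Longrightarrow> g = -1" using star_edgeE[OF sg] by metis
      show ?thesis
      proof (cases "x = v")
        case True
        then have ev: "e = ({v}, -1)" using xg by simp
        then have "({y, z}, -1) \<in> E''" unfolding E'' using e by simp
        moreover have "collapse_edge K v ({y, z}, -1) = e" using ev yz by (simp add: collapse_edge_doubleton)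
        ultimately show ?thesis by (metis imageI)
      next
        case False
        then have xv: "({x, v}, g) \<in> E" using xg e by (simp add: insert_commute)
        then have "({x, f x g}, g) \<in> E''" unfolding E'' using False by blast
        moreover have "collapse_edge K v ({x, f x g}, g) = e"
          using xg f[OF False xv] notK by (simp add: collapse_edge_doubleton insert_commute)
        ultimately show ?thesis by (metis imageI)
      qed
    qed
  qed
  then show "card E'' = card E" using card_image[OF inj] by simp
qed

text \<open>Four points whose six connecting edges split into a horizontal and a vertical path form the cluster.\<close>

lemma realisable_vertex_to_K4:
  assumes r: "realisable V E" and v: "v \<in> V" and K: "card K = 4" "K \<inter> V = {}"
    and f: "\<And>x g. x \<noteq> v \<Longrightarrow> ({x, v}, g) \<in> E \<Longrightarrow> f x g \<in> K" and yz: "y \<in> K" "z \<in> K"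
  shows "realisable ((V - {v}) \<union> K)
    ({e \<in> E. v \<notin> fst e} \<union> {({a, b}, 1) | a b. a \<in> K \<and> b \<in> K \<and> a \<noteq> b}
      \<union> {({x, f x g}, g) | x g. x \<noteq> v \<and> ({x, v}, g) \<in> E} \<union> (if ({v}, -1) \<in> E then {({y, z}, -1)} else {}))"
proof -
  note t = tightD[OF realisable_tight[OF r]]
  obtain a b where ab: "realisation V E a b" "generic V a b" using realisable_generic[OF r] .
  have finK: "finite K" "K \<noteq> {}" using K(1) by (auto intro: card_ge_0_finite)
  define D where "D = {({a, b}, 1 :: int) | a b. a \<in> K \<and> b \<in> K \<and> a \<noteq> b}"
  define E'' where "E'' = {e \<in> E. v \<notin> fst e} \<union> {({x, f x g}, g) | x g. x \<noteq> v \<and> ({x, v}, g) \<in> E}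
        \<union> (if ({v}, -1) \<in> E then {({y, z}, -1)} else {})"
  note s = vertex_split_edges[OF t(1) v finK(1) K(2) f yz E''_def]
  let ?V' = "(V - {v}) \<union> K" and ?E' = "E'' \<union> D"
  have finE'': "finite E''" by (rule signed_graph_finite_edges[OF s(1)])
  have cD: "card D = 6" unfolding D_def card_complete_edges[OF finK(1)] K(1) by (simp add: numeral_eq_Suc)
  then have finD: "finite D" using card_ge_0_finite by force
  have "E'' \<inter> D = {}" using s(3) unfolding D_def by blast
  then have cE': "card ?E' = card E + 6" using card_Un_disjoint[OF finE'' finD] s(2) cD by simp
  have cV': "card ?V' = card V + 3"
  proof -
    have "card ?V' = card (V - {v}) + card K" using t(4) finK K(2) by (intro card_Un_disjoint) auto
    moreover have "card (V - {v}) + 1 = card V" using v t(4) by (metis Suc_eq_plus1 card_Suc_Diff1)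
    ultimately show ?thesis using K(1) by simp
  qed
  have sg': "signed_graph ?V' ?E'"
  proof (rule signed_graphI)
    fix e assume "e \<in> ?E'"
    then consider "e \<in> E''" | p q where "e = ({p, q}, 1)" "p \<in> K" "q \<in> K" "p \<noteq> q" unfolding D_def by blast
    then show "\<exists>x y g. e = ({x, y}, g) \<and> x \<in> ?V' \<and> y \<in> ?V' \<and> (g = 1 \<or> g = -1) \<and> (x = y \<longrightarrow> g = -1)"
    proof cases
      case 1
      then show ?thesis using signed_graph_edgeE[OF s(1) 1] by metis
    next
      case (2 p q)
      then show ?thesis by (intro exI[of _ p] exI[of _ q] exI[of _ 1]) simp
    qed
  qed (use t finK in simp)
  obtain k1 where k1: "k1 \<in> K" using finK by blast
  have "card (K - {k1}) = 3" using k1 K(1) finK by simp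
  then obtain k2 k3 k4 where k: "K - {k1} = {k2, k3, k4}" "k2 \<noteq> k3" "k2 \<noteq> k4" "k3 \<noteq> k4" by (metis card_3_iff)
  then have ne: "k1 \<noteq> k2" "k1 \<noteq> k3" "k1 \<noteq> k4" by auto
  have K_eq: "K = {k1, k2, k3, k4}" using k(1) k1 by blast
  have inD: "({p, q}, 1) \<in> ?E'" if "p \<in> K" "q \<in> K" "p \<noteq> q" for p q using that unfolding D_def by blast
  \<comment> \<open>positions for which the six edges split into a horizontal and a vertical path\<close>
  define \<alpha> :: "_ \<Rightarrow> real" where "\<alpha> p = (if p = k2 then 20 else if p = k4 then 10 else 0)" for p
  define \<beta> :: "_ \<Rightarrow> real" where "\<beta> p = (if p = k2 then 5 else if p = k3 then 10 else if p = k4 then 18 else 0)" for p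
  have pos: "\<alpha> k1 = 0" "\<alpha> k2 = 20" "\<alpha> k3 = 0" "\<alpha> k4 = 10" "\<beta> k1 = 0" "\<beta> k2 = 5" "\<beta> k3 = 10" "\<beta> k4 = 18"
    using ne k by (auto simp: \<alpha>_def \<beta>_def)
  have "\<exists>a' b'. realisation ?V' ?E' a' b'"
  proof (rule realisation_vertex_split[OF t(1) ab(1) v _ finK K(2) sg', where \<alpha> = \<alpha> and \<beta> = \<beta>])
    show "a v \<noteq> 0" using ab(2) v unfolding generic_def by blast
  next
    fix e assume "e \<in> ?E'"
    then consider "e \<in> E" "v \<notin> fst e" | x g where "e = ({x, f x g}, g)" "x \<noteq> v" "({x, v}, g) \<in> E"
      | "e = ({y, z}, -1)" | p q where "e = ({p, q}, 1)" "p \<in> K" "q \<in> K" "p \<noteq> q"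
      unfolding E''_def D_def by (auto split: if_splits)
    then show "(e \<in> E \<and> v \<notin> fst e) \<or>
        (\<exists>x k g. e = ({x, k}, g) \<and> x \<in> V \<and> x \<noteq> v \<and> k \<in> K \<and> ({x, v}, g) \<in> E) \<or>
        (\<exists>k l. e = ({k, l}, -1) \<and> k \<in> K \<and> l \<in> K) \<or>
        (\<exists>k l. e = ({k, l}, 1) \<and> k \<in> K \<and> l \<in> K \<and> \<bar>\<alpha> k - \<alpha> l\<bar> \<noteq> \<bar>\<beta> k - \<beta> l\<bar>)"
    proof cases
      case 1
      then show ?thesis by blast
    next
      case (2 x g)
      then show ?thesis using f[OF 2(2,3)] signed_graph_memD(1)[OF t(1) 2(3)] by blast
    next
      case 3
      then show ?thesis using yz by blast
    next
      case (4 p q)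
      then have "\<bar>\<alpha> p - \<alpha> q\<bar> \<noteq> \<bar>\<beta> p - \<beta> q\<bar>" using pos unfolding K_eq by auto
      then show ?thesis using 4 by blast
    qed
  next
    show "e \<in> ?E'" if "e \<in> E" "v \<notin> fst e" for e using that unfolding E''_def by blast
    show "\<exists>k\<in>K. ({x, k}, g) \<in> ?E'" if "x \<noteq> v" "({x, v}, g) \<in> E" for x g
      using f[OF that] that unfolding E''_def by blast
    show "\<exists>k\<in>K. \<exists>l\<in>K. ({k, l}, -1) \<in> ?E'" if "({v}, -1) \<in> E"
      using yz that unfolding E''_def by auto
  next
    fix c :: "'a \<Rightarrow> real"
    assume c: "\<And>k l. k \<in> K \<Longrightarrow> l \<in> K \<Longrightarrow> ({k, l}, 1) \<in> ?E' \<Longrightarrow> \<bar>\<beta> k - \<beta> l\<bar> < \<bar>\<alpha> k - \<alpha> l\<bar> \<Longrightarrow> c k = c l"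
    have "c k1 = c k2" using ne k pos by (intro c inD) (auto simp: K_eq)
    moreover have "c k2 = c k3" using ne k pos by (intro c inD) (auto simp: K_eq)
    moreover have "c k3 = c k4" using ne k pos by (intro c inD) (auto simp: K_eq)
    ultimately show "\<forall>k\<in>K. \<forall>l\<in>K. c k = c l" unfolding K_eq by simp
  next
    fix d :: "'a \<Rightarrow> real"
    assume d: "\<And>k l. k \<in> K \<Longrightarrow> l \<in> K \<Longrightarrow> ({k, l}, 1) \<in> ?E' \<Longrightarrow> \<bar>\<alpha> k - \<alpha> l\<bar> < \<bar>\<beta> k - \<beta> l\<bar> \<Longrightarrow> d k = d l"
    have "d k1 = d k3" using ne k pos by (intro d inD) (auto simp: K_eq)
    moreover have "d k1 = d k4" using ne k pos by (intro d inD) (auto simp: K_eq)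
    moreover have "d k2 = d k4" using ne k pos by (intro d inD) (auto simp: K_eq)
    ultimately show "\<forall>k\<in>K. \<forall>l\<in>K. d k = d l" unfolding K_eq by simp
  qed
  then have "realisable ?V' ?E'" using sg' cE' cV' t(3) unfolding realisable_def by simp
  moreover have "?E' = {e \<in> E. v \<notin> fst e} \<union> {({a, b}, 1) | a b. a \<in> K \<and> b \<in> K \<and> a \<noteq> b}
      \<union> {({x, f x g}, g) | x g. x \<noteq> v \<and> ({x, v}, g) \<in> E} \<union> (if ({v}, -1) \<in> E then {({y, z}, -1)} else {})"
  proof -
    have "A \<union> B \<union> L \<union> D = A \<union> D \<union> B \<union> L" for A B L D :: "'a sedge set" by blast
    then show ?thesis unfolding E''_def D_def .
  qed
  ultimately show ?thesis by metis
qed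

text \<open>Two points form the cluster. Flexes of the colour of \<open>uv\<close> agree on them because both are joined to
  \<open>u\<close>, flexes of the other colour because the edge between the two points has that colour.\<close>

lemma realisable_edge_to_K3:
  assumes r: "realisable V E" and uv: "u \<noteq> v" "({v, u}, 1) \<in> E" and v01: "v0 \<notin> V" "v1 \<notin> V" "v0 \<noteq> v1"
    and f: "\<And>x g. x \<noteq> v \<Longrightarrow> ({x, v}, g) \<in> E \<Longrightarrow> f x g \<in> {v0, v1}" and y: "y \<in> {v0, v1}"
  shows "realisable ((V - {v}) \<union> {v0, v1})
    ({e \<in> E. v \<notin> fst e} \<union> {({v0, v1}, 1), ({v0, u}, 1), ({v1, u}, 1)}
      \<union> {({x, f x g}, g) | x g. x \<noteq> v \<and> ({x, v}, g) \<in> E \<and> (x, g) \<noteq> (u, 1)}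
      \<union> (if ({v}, -1) \<in> E then {({y}, -1)} else {}))"
proof -
  note t = tightD[OF realisable_tight[OF r]]
  obtain a b where ab: "realisation V E a b" "generic V a b" using realisable_generic[OF r] .
  have v: "v \<in> V" and u: "u \<in> V" using signed_graph_memD[OF t(1) uv(2)] by auto
  have uvE: "({u, v}, 1) \<in> E" using uv by (simp add: insert_commute)
  define K where "K = {v0, v1}"
  have K: "finite K" "K \<noteq> {}" "K \<inter> V = {}" using v01 by (auto simp: K_def)
  \<comment> \<open>the split edge becomes one of the two edges at \<open>u\<close>; the other one is added separately in \<open>D\<close>\<close>
  define f' where "f' x g = (if (x, g) = (u, 1) then v0 else f x g)" for x and g :: int
  have f': "f' x g \<in> K" if "x \<noteq> v" "({x, v}, g) \<in> E" for x g using f[OF that] by (auto simp: f'_def K_def)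
  have yK: "y \<in> K" using y by (simp add: K_def)
  define D where "D = {({v0, v1}, 1 :: int), ({v1, u}, 1)}"
  define E'' where "E'' = {e \<in> E. v \<notin> fst e} \<union> {({x, f' x g}, g) | x g. x \<noteq> v \<and> ({x, v}, g) \<in> E}
        \<union> (if ({v}, -1) \<in> E then {({y, y}, -1)} else {})"
  note s = vertex_split_edges[OF t(1) v K(1,3) f' yK yK E''_def]
  let ?V' = "(V - {v}) \<union> K" and ?E' = "E'' \<union> D"
  have finE'': "finite E''" by (rule signed_graph_finite_edges[OF s(1)])
  have une: "u \<noteq> v0" "u \<noteq> v1" using u v01 by auto
  have cD: "card D = 2" "finite D" unfolding D_def using une v01 by (auto simp: doubleton_eq_iff)
  have "({v0, v1}, 1) \<notin> E''" by (rule s(3)) (simp_all add: K_def)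
  moreover have "({u, v1}, 1) \<notin> E''"
  proof
    assume "({u, v1}, 1) \<in> E''"
    have "f' u 1 = v1" by (rule s(4)[OF _ _ u _ \<open>({u, v1}, 1) \<in> E''\<close>]) (simp_all add: K_def)
    then show False using v01 by (simp add: f'_def)
  qed
  ultimately have "E'' \<inter> D = {}" unfolding D_def by (simp add: insert_commute)
  then have cE': "card ?E' = card E + 2" using card_Un_disjoint[OF finE'' cD(2)] s(2) cD by simp
  have cV': "card ?V' = card V + 1"
  proof -
    have "card ?V' = card (V - {v}) + card K" using t(4) K by (intro card_Un_disjoint) auto
    moreover have "card (V - {v}) + 1 = card V" using v t(4) by (metis Suc_eq_plus1 card_Suc_Diff1)
    ultimately show ?thesis using v01 by (simp add: K_def)
  qed
  have sg': "signed_graph ?V' ?E'"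
  proof (rule signed_graphI)
    fix e assume "e \<in> ?E'"
    then consider "e \<in> E''" | "e = ({v0, v1}, 1)" | "e = ({v1, u}, 1)" unfolding D_def by blast
    then show "\<exists>x y g. e = ({x, y}, g) \<and> x \<in> ?V' \<and> y \<in> ?V' \<and> (g = 1 \<or> g = -1) \<and> (x = y \<longrightarrow> g = -1)"
    proof cases
      case 1
      then show ?thesis using signed_graph_edgeE[OF s(1) 1] by metis
    next
      case 2
      then show ?thesis using v01 by (intro exI[of _ v0] exI[of _ v1] exI[of _ 1]) (simp add: K_def)
    next
      case 3
      then show ?thesis using u uv une by (intro exI[of _ v1] exI[of _ u] exI[of _ 1]) (simp add: K_def)
    qed
  qed (use t K in simp)
  have uv0: "({u, v0}, 1) \<in> ?E'"
  proof -
    have "({u, f' u 1}, 1) \<in> E''" unfolding E''_def using uv uvE by blast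
    then show ?thesis by (simp add: f'_def)
  qed
  have uv1: "({u, v1}, 1) \<in> ?E'" and v0v1: "({v0, v1}, 1) \<in> ?E'" unfolding D_def by (auto simp: insert_commute)
  \<comment> \<open>the new edge gets the colour that the split edge does not have\<close>
  define \<alpha> :: "_ \<Rightarrow> real" where "\<alpha> p = (if p = v1 \<and> \<not> horizontal a b u v 1 then 1 else 0)" for p
  define \<beta> :: "_ \<Rightarrow> real" where "\<beta> p = (if p = v1 \<and> horizontal a b u v 1 then 1 else 0)" for p
  have "\<exists>a' b'. realisation ?V' ?E' a' b'"
  proof (rule realisation_vertex_split[OF t(1) ab(1) v _ K sg', where \<alpha> = \<alpha> and \<beta> = \<beta>])
    show "a v \<noteq> 0" using ab(2) v unfolding generic_def by blast
  next
    fix e assume "e \<in> ?E'"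
    then consider "e \<in> E" "v \<notin> fst e" | x g where "e = ({x, f' x g}, g)" "x \<noteq> v" "({x, v}, g) \<in> E"
      | "e = ({y, y}, -1)" | "e = ({v0, v1}, 1)" | "e = ({u, v1}, 1)"
      unfolding E''_def D_def by (auto simp: insert_commute split: if_splits)
    then show "(e \<in> E \<and> v \<notin> fst e) \<or>
        (\<exists>x k g. e = ({x, k}, g) \<and> x \<in> V \<and> x \<noteq> v \<and> k \<in> K \<and> ({x, v}, g) \<in> E) \<or>
        (\<exists>k l. e = ({k, l}, -1) \<and> k \<in> K \<and> l \<in> K) \<or>
        (\<exists>k l. e = ({k, l}, 1) \<and> k \<in> K \<and> l \<in> K \<and> \<bar>\<alpha> k - \<alpha> l\<bar> \<noteq> \<bar>\<beta> k - \<beta> l\<bar>)"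
    proof cases
      case 1
      then show ?thesis by blast
    next
      case (2 x g)
      then show ?thesis using f'[OF 2(2,3)] signed_graph_memD(1)[OF t(1) 2(3)] by blast
    next
      case 3
      then show ?thesis using yK by blast
    next
      case 4
      moreover have "\<bar>\<alpha> v0 - \<alpha> v1\<bar> \<noteq> \<bar>\<beta> v0 - \<beta> v1\<bar>" using v01 by (simp add: \<alpha>_def \<beta>_def)
      moreover have "v0 \<in> K" "v1 \<in> K" by (simp_all add: K_def)
      ultimately show ?thesis by blast
    next
      case 5
      moreover have "v1 \<in> K" by (simp add: K_def)
      ultimately show ?thesis using u uv(1) uvE by blast
    qed
  next
    show "e \<in> ?E'" if "e \<in> E" "v \<notin> fst e" for e using that unfolding E''_def by blast
    show "\<exists>k\<in>K. ({x, k}, g) \<in> ?E'" if "x \<noteq> v" "({x, v}, g) \<in> E" for x g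
      using f'[OF that] that unfolding E''_def by blast
    show "\<exists>k\<in>K. \<exists>l\<in>K. ({k, l}, -1) \<in> ?E'" if "({v}, -1) \<in> E"
      using yK that unfolding E''_def by auto
  next
    fix c :: "'a \<Rightarrow> real"
    assume c1: "\<And>k l. k \<in> K \<Longrightarrow> l \<in> K \<Longrightarrow> ({k, l}, 1) \<in> ?E' \<Longrightarrow> \<bar>\<beta> k - \<beta> l\<bar> < \<bar>\<alpha> k - \<alpha> l\<bar> \<Longrightarrow> c k = c l"
      and c2: "\<And>x k g. x \<in> V \<Longrightarrow> x \<noteq> v \<Longrightarrow> k \<in> K \<Longrightarrow> ({x, k}, g) \<in> ?E' \<Longrightarrow> ({x, v}, g) \<in> E \<Longrightarrow> horizontal a b x v g \<Longrightarrow> c x = of_int g * c k"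
    have "c v0 = c v1"
    proof (cases "horizontal a b u v 1")
      case True
      then have "c u = of_int 1 * c v0" "c u = of_int 1 * c v1"
        using c2[OF u uv(1) _ uv0 uvE] c2[OF u uv(1) _ uv1 uvE] by (simp_all add: K_def)
      then show ?thesis by simp
    next
      case False
      then show ?thesis using v01 by (intro c1 v0v1) (simp_all add: K_def \<alpha>_def \<beta>_def)
    qed
    then show "\<forall>k\<in>K. \<forall>l\<in>K. c k = c l" unfolding K_def by simp
  next
    fix d :: "'a \<Rightarrow> real"
    assume d1: "\<And>k l. k \<in> K \<Longrightarrow> l \<in> K \<Longrightarrow> ({k, l}, 1) \<in> ?E' \<Longrightarrow> \<bar>\<alpha> k - \<alpha> l\<bar> < \<bar>\<beta> k - \<beta> l\<bar> \<Longrightarrow> d k = d l"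
      and d2: "\<And>x k g. x \<in> V \<Longrightarrow> x \<noteq> v \<Longrightarrow> k \<in> K \<Longrightarrow> ({x, k}, g) \<in> ?E' \<Longrightarrow> ({x, v}, g) \<in> E \<Longrightarrow> vertical a b x v g \<Longrightarrow> d x = d k"
    have "d v0 = d v1"
    proof (cases "horizontal a b u v 1")
      case True
      then show ?thesis using v01 by (intro d1 v0v1) (simp_all add: K_def \<alpha>_def \<beta>_def)
    next
      case False
      then have "vertical a b u v 1" using ab(1) uvE unfolding realisation_def well_placed_def by blast
      then have "d u = d v0" "d u = d v1"
        using d2[OF u uv(1) _ uv0 uvE] d2[OF u uv(1) _ uv1 uvE] by (simp_all add: K_def)
      then show ?thesis by simp
    qed
    then show "\<forall>k\<in>K. \<forall>l\<in>K. d k = d l" unfolding K_def by simp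
  qed
  then have "realisable ?V' ?E'" using sg' cE' cV' t(3) unfolding realisable_def by simp
  moreover have "?E' = {e \<in> E. v \<notin> fst e} \<union> {({v0, v1}, 1), ({v0, u}, 1), ({v1, u}, 1)}
      \<union> {({x, f x g}, g) | x g. x \<noteq> v \<and> ({x, v}, g) \<in> E \<and> (x, g) \<noteq> (u, 1)}
      \<union> (if ({v}, -1) \<in> E then {({y}, -1)} else {})"
  proof -
    have "{({x, f' x g}, g) | x g. x \<noteq> v \<and> ({x, v}, g) \<in> E}
        = insert ({v0, u}, 1) {({x, f x g}, g) | x g. x \<noteq> v \<and> ({x, v}, g) \<in> E \<and> (x, g) \<noteq> (u, 1)}" (is "?A = ?B")
    proof (rule equalityI; rule subsetI)
      fix e assume "e \<in> ?A"
      then obtain x g where e: "e = ({x, f' x g}, g)" "x \<noteq> v" "({x, v}, g) \<in> E" by blast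
      show "e \<in> ?B"
      proof (cases "(x, g) = (u, 1)")
        case True
        then have "e = ({v0, u}, 1)" using e(1) by (simp add: f'_def insert_commute)
        then show ?thesis by blast
      next
        case False
        then have "f' x g = f x g" by (auto simp: f'_def)
        then show ?thesis using e False by auto
      qed
    next
      fix e assume "e \<in> ?B"
      then consider "e = ({v0, u}, 1)" | x g where "e = ({x, f x g}, g)" "x \<noteq> v" "({x, v}, g) \<in> E" "(x, g) \<noteq> (u, 1)" by blast
      then show "e \<in> ?A"
      proof cases
        case 1
        then have "e = ({u, f' u 1}, 1)" by (simp add: f'_def insert_commute)
        then show ?thesis using uv(1) uvE by blast
      next
        case (2 x g)
        then have "f' x g = f x g" by (auto simp: f'_def)
        then have "e = ({x, f' x g}, g)" using 2 by simp
        then show ?thesis using 2 by blast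
      qed
    qed
    moreover have "A \<union> insert e1 B \<union> L \<union> {e2, e3} = A \<union> {e2, e1, e3} \<union> B \<union> L" for A B L and e1 e2 e3 :: "'a sedge"
      by blast
    ultimately show ?thesis unfolding E''_def D_def insert_absorb2 by simp
  qed
  ultimately show ?thesis unfolding K_def by metis
qed

lemma realisable_move:
  assumes r: "realisable (verts H) (edges H)" and m: "move H H'"
  shows "realisable (verts H') (edges H')"
  using m
proof cases
  case (H1a v x y g h)
  then show ?thesis using realisable_H1a[OF r, of v x y g h] by simp
next
  case (H1b v x)
  then show ?thesis using realisable_H1b[OF r, of v x] by (simp add: insert_commute)
next
  case (H1c v x g)
  then show ?thesis using realisable_H1c[OF r, of v x g] by (simp add: insert_commute)
next
  case (H2a v x y k z g1 g2 g3)
  have "realisable (insert v (verts H))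
    (insert ({v, x}, g1) (insert ({v, y}, g2) (insert ({v, z}, g3) (edges H - {({x, y}, k)}))))"
    by (rule realisable_H2[OF r]) (use H2a in auto)
  then show ?thesis using H2a(1) by simp
next
  case (H2b v x y k g1 g2)
  have "realisable (insert v (verts H))
    (insert ({v, x}, g1) (insert ({v, y}, g2) (insert ({v, x}, - g1) (edges H - {({x, y}, k)}))))"
    by (rule realisable_H2[OF r])
      (use H2b signed_graph_memD[OF tightD(1)[OF realisable_tight[OF r]], of x y k] in auto)
  then show ?thesis using H2b(1) by simp
next
  case (H2c v x z g3)
  have "realisable (insert v (verts H))
    (insert ({v, x}, 1) (insert ({v, x}, -1) (insert ({v, z}, g3) (edges H - {({x, x}, -1)}))))"
    by (rule realisable_H2[OF r]) (use H2c in auto)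
  then show ?thesis using H2c(1) by simp
next
  case (vertex_to_K4 v K f y z)
  have "realisable ((verts H - {v}) \<union> K)
    ({e \<in> edges H. v \<notin> fst e} \<union> {({a, b}, 1) | a b. a \<in> K \<and> b \<in> K \<and> a \<noteq> b}
      \<union> {({x, f x g}, g) | x g. x \<noteq> v \<and> ({x, v}, g) \<in> edges H}
      \<union> (if ({v}, -1) \<in> edges H then {({y, z}, -1)} else {}))"
    by (rule realisable_vertex_to_K4[OF r vertex_to_K4(2-4)]) (use vertex_to_K4(5-7) in simp_all)
  then show ?thesis unfolding vertex_to_K4(1) by simp
next
  case (edge_to_K3 u v v0 v1 f y)
  have "realisable ((verts H - {v}) \<union> {v0, v1})
    ({e \<in> edges H. v \<notin> fst e} \<union> {({v0, v1}, 1), ({v0, u}, 1), ({v1, u}, 1)}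
      \<union> {({x, f x g}, g) | x g. x \<noteq> v \<and> ({x, v}, g) \<in> edges H \<and> (x, g) \<noteq> (u, 1)}
      \<union> (if ({v}, -1) \<in> edges H then {({y}, -1)} else {}))"
    by (rule realisable_edge_to_K3[OF r edge_to_K3(2-6)]) (use edge_to_K3(7,8) in simp_all)
  then show ?thesis unfolding edge_to_K3(1) HOL.induct_conj_def by simp
qed

lemma constructible_realisable:
  "constructible H \<Longrightarrow> realisable (verts H) (edges H)"
proof (induction rule: constructible.induct)
  case (loop a)
  then show ?case using realisable_loop by simp
next
  case (switching H v)
  have "switch v H = \<lparr>verts = verts H, edges = flip_edge v ` edges H\<rparr>"
    by (cases H) (simp add: switch_eq)
  then show ?case using realisable_flip[OF switching.IH] by simp
next
  case (move H H')
  then show ?case using realisable_move by blast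
qed

section \<open>Isomorphisms\<close>

definition relabel :: "('a \<Rightarrow> 'b) \<Rightarrow> 'a sedge \<Rightarrow> 'b sedge" where
  "relabel f = (\<lambda>(S, g). (f ` S, g))"

lemma relabel_doubleton [simp]: "relabel f ({x, y}, g) = ({f x, f y}, g)"
  by (simp add: relabel_def)

lemma inj_on_relabel:
  assumes sg: "signed_graph V E" and f: "inj_on f V"
  shows "inj_on (relabel f) E"
proof (rule inj_onI)
  fix e e' assume e: "e \<in> E" "e' \<in> E" "relabel f e = relabel f e'"
  have "fst e \<subseteq> V" "fst e' \<subseteq> V" using signed_graph_incident[OF sg] e by (auto simp: incident_verts_def)
  then have "fst e = fst e'" using e(3) inj_on_image_eq_iff[OF f] by (auto simp: relabel_def split: prod.splits)
  then show "e = e'" using e(3) by (auto simp: relabel_def split: prod.splits)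
qed

lemma relabel_memE:
  assumes sg: "signed_graph V E" and e: "({x', y'}, g) \<in> relabel f ` E"
  obtains x y where "x' = f x" "y' = f y" "({x, y}, g) \<in> E"
proof -
  obtain e where e: "e \<in> E" "({x', y'}, g) = relabel f e" using e by blast
  obtain p q h where pq: "e = ({p, q}, h)" using signed_graph_edgeE[OF sg e(1)] by metis
  then have "g = h" "x' = f p \<and> y' = f q \<or> x' = f q \<and> y' = f p" using e(2) by (auto simp: doubleton_eq_iff)
  moreover have "({q, p}, h) \<in> E" using e(1) pq by (simp add: insert_commute)
  ultimately show thesis using that e(1) pq by metis
qed

lemma tight_relabel:
  assumes t: "tight V E" and f: "inj_on f V"
  shows "tight (f ` V) (relabel f ` E)"
proof -
  note t' = tightD[OF t]
  have "card (relabel f ` E) + 1 = 2 * card (f ` V)"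
    using t'(3) card_image[OF inj_on_relabel[OF t'(1) f]] card_image[OF f] by simp
  moreover have "signed_graph (f ` V) (relabel f ` E)"
  proof (rule signed_graphI)
    fix e' assume "e' \<in> relabel f ` E"
    then obtain e where e: "e \<in> E" "e' = relabel f e" by blast
    obtain x y g where xy: "x \<in> V" "y \<in> V" "g = 1 \<or> g = -1" "e = ({x, y}, g)" "x = y \<Longrightarrow> g = -1"
      using signed_graph_edgeE[OF t'(1) e(1)] by metis
    have "f x = f y \<longrightarrow> g = -1" using xy f by (meson inj_onD)
    then show "\<exists>x y g. e' = ({x, y}, g) \<and> x \<in> f ` V \<and> y \<in> f ` V \<and> (g = 1 \<or> g = -1) \<and> (x = y \<longrightarrow> g = -1)"
      using xy e(2) by (intro exI[of _ "f x"] exI[of _ "f y"] exI[of _ g]) simp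
  qed (use t' in simp)
  moreover have "sparse_edges (relabel f ` E)"
    unfolding sparse_edges_def
  proof (intro allI impI)
    fix F' X' assume F': "F' \<subseteq> relabel f ` E" "finite X'" "X' \<noteq> {}" "incident_verts F' \<subseteq> X'"
    define F where "F = {e \<in> E. relabel f e \<in> F'}"
    define X where "X = {x \<in> V. f x \<in> X'}"
    have FE: "F \<subseteq> E" by (auto simp: F_def)
    have img: "F' = relabel f ` F" using F'(1) by (auto simp: F_def)
    have cF: "card F' = card F"
      unfolding img by (rule card_image[OF inj_on_subset[OF inj_on_relabel[OF t'(1) f] FE]])
    have finX: "finite X" using t'(4) by (simp add: X_def)
    have cX: "card X \<le> card X'"
      by (rule card_inj_on_le[of f]) (use f F'(2) in \<open>auto simp: X_def inj_on_def\<close>)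
    have inc: "incident_verts F \<subseteq> X"
    proof
      fix z assume "z \<in> incident_verts F"
      then obtain e where e: "e \<in> F" "z \<in> fst e" by (auto simp: incident_verts_def)
      have "z \<in> V" using e FE t'(6) by (auto simp: incident_verts_def)
      moreover have "f z \<in> X'"
      proof -
        have "relabel f e \<in> F'" using e(1) by (simp add: F_def)
        moreover have "f z \<in> fst (relabel f e)" using e(2) by (auto simp: relabel_def split: prod.splits)
        ultimately show ?thesis using F'(4) by (auto simp: incident_verts_def)
      qed
      ultimately show "z \<in> X" by (simp add: X_def)
    qed
    have cX': "card X' \<ge> 1" using F'(2,3) by (simp add: Suc_le_eq card_gt_0_iff)
    show "card F' + 1 \<le> 2 * card X' \<and> ((\<exists>\<sigma>. potential \<sigma> F') \<longrightarrow> card F' + 2 \<le> 2 * card X')"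
    proof (cases "F = {}")
      case True
      then show ?thesis using cF cX' by simp
    next
      case False
      then obtain e where e: "e \<in> F" by blast
      obtain x y g where "e = ({x, y}, g)" using signed_graph_edgeE[OF t'(1)] e FE by (metis subsetD)
      then have "x \<in> X" using inc incident_vertsI[of "{x, y}" g F x] e by auto
      then have ne: "X \<noteq> {}" by blast
      show ?thesis
      proof (intro conjI impI)
        show "card F' + 1 \<le> 2 * card X'" using sparse_edgesD(1)[OF t'(2) FE finX ne inc] cF cX by linarith
        assume "\<exists>\<sigma>. potential \<sigma> F'"
        then obtain \<sigma> where \<sigma>: "potential \<sigma> F'" by blast
        have "potential (\<lambda>x. \<sigma> (f x)) F"
          unfolding potential_def
        proof (intro conjI allI impI)
          show "\<sigma> (f x) = 1 \<or> \<sigma> (f x) = -1" for x by (rule potential_sign[OF \<sigma>])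
          fix x y g assume "({x, y}, g) \<in> F"
          then have "({f x, f y}, g) \<in> F'" by (simp add: F_def)
          then show "g = \<sigma> (f x) * \<sigma> (f y)" using \<sigma> unfolding potential_def by blast
        qed
        then show "card F' + 2 \<le> 2 * card X'" using sparse_edgesD(2)[OF t'(2) FE finX ne inc] cF cX by fastforce
      qed
    qed
  qed
  ultimately show ?thesis by (simp add: tight_def)
qed

lemma realisable_relabel:
  assumes r: "realisable V E" and f: "inj_on f V"
  shows "realisable (f ` V) (relabel f ` E)"
proof -
  note t = tightD[OF realisable_tight[OF r]] and t' = tightD[OF tight_relabel[OF realisable_tight[OF r] f]]
  obtain a b where ab: "realisation V E a b" using r unfolding realisable_def by blast
  define a' where "a' x = a (inv_into V f x)" for x
  define b' where "b' x = b (inv_into V f x)" for x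
  have ab': "a' (f x) = a x" "b' (f x) = b x" if "x \<in> V" for x using that f by (simp_all add: a'_def b'_def)
  have col: "horizontal a' b' (f x) (f y) g = horizontal a b x y g" "vertical a' b' (f x) (f y) g = vertical a b x y g"
    if "({x, y}, g) \<in> E" for x y g
    using signed_graph_memD(1,2)[OF t(1) that] by (simp_all add: horizontal_def vertical_def ab')
  have mem: "({f x, f y}, g) \<in> relabel f ` E" if "({x, y}, g) \<in> E" for x y g
    using imageI[OF that, of "relabel f"] by simp
  have "well_placed (relabel f ` E) a' b'" unfolding well_placed_def
  proof (intro allI impI)
    fix x' y' g assume "({x', y'}, g) \<in> relabel f ` E"
    then obtain x y where "x' = f x" "y' = f y" "({x, y}, g) \<in> E" by (rule relabel_memE[OF t(1)])
    then show "horizontal a' b' x' y' g \<or> vertical a' b' x' y' g"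
      using col[of x y g] ab unfolding realisation_def well_placed_def by metis
  qed
  moreover have "\<forall>x\<in>f ` V. c x = 0" if c: "horizontal_flex (relabel f ` E) a' b' c" for c
  proof -
    have "horizontal_flex E a b (\<lambda>x. c (f x))" unfolding horizontal_flex_def
    proof (intro allI impI)
      fix x y g assume e: "({x, y}, g) \<in> E" and h: "horizontal a b x y g"
      show "c (f x) = of_int g * c (f y)"
        using c mem[OF e] h col(1)[OF e] unfolding horizontal_flex_def by blast
    qed
    then have "\<forall>x\<in>V. c (f x) = 0" using ab unfolding realisation_def rigidly_placed_def by blast
    then show ?thesis by blast
  qed
  moreover have "\<forall>x\<in>f ` V. \<forall>y\<in>f ` V. d x = d y" if d: "vertical_flex (relabel f ` E) a' b' d" for d
  proof -
    have "vertical_flex E a b (\<lambda>x. d (f x))" unfolding vertical_flex_def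
    proof (intro allI impI)
      fix x y g assume e: "({x, y}, g) \<in> E" and h: "vertical a b x y g"
      show "d (f x) = d (f y)"
        using d mem[OF e] h col(2)[OF e] unfolding vertical_flex_def by blast
    qed
    then have "\<forall>x\<in>V. \<forall>y\<in>V. d (f x) = d (f y)" using ab unfolding realisation_def rigidly_placed_def by blast
    then show ?thesis by blast
  qed
  ultimately have "realisation (f ` V) (relabel f ` E) a' b'" unfolding realisation_def rigidly_placed_def by blast
  then show ?thesis using t' unfolding realisable_def by blast
qed

lemma sgraph_iso_relabel:
  "sgraph_iso H K \<longleftrightarrow> (\<exists>f. inj_on f (verts H) \<and> verts K = f ` verts H \<and> edges K = relabel f ` edges H)"
  unfolding sgraph_iso_def relabel_def bij_betw_def by blast

lemma relabel_inverse:
  assumes sg: "signed_graph V E" and f: "inj_on f V"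
  shows "relabel (inv_into V f) ` relabel f ` E = E"
proof -
  have "relabel (inv_into V f) (relabel f e) = e" if e: "e \<in> E" for e
  proof -
    obtain x y g where "x \<in> V" "y \<in> V" "e = ({x, y}, g)" using signed_graph_edgeE[OF sg e] by metis
    then show ?thesis using f by simp
  qed
  then show ?thesis by (simp add: image_image)
qed

text \<open>Constructibility is proved for a copy with natural numbers as vertices, so that fresh vertices exist.
  Realisability is transported back along the isomorphism.\<close>

theorem tight_iff_constructible:
  assumes sg: "signed_quotient_graph K"
  shows "gain_tight K \<longleftrightarrow> (\<exists>H :: nat sgraph. constructible H \<and> sgraph_iso H K)"
    and "gain_tight K \<longleftrightarrow> realisable (verts K) (edges K)"
proof -
  have t: "gain_tight K \<longleftrightarrow> tight (verts K) (edges K)" using tight_iff[of K] sg by blast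
  have 1: "\<exists>H :: nat sgraph. constructible H \<and> sgraph_iso H K" if tK: "tight (verts K) (edges K)"
  proof -
    obtain f :: "_ \<Rightarrow> nat" where f: "inj_on f (verts K)"
      using finite_imp_inj_to_nat_seg[OF tightD(4)[OF tK]] by blast
    let ?H = "\<lparr>verts = f ` verts K, edges = relabel f ` edges K\<rparr>"
    have "constructible ?H" by (rule tight_imp_constructible[OF tight_relabel[OF tK f]])
    moreover have "sgraph_iso ?H K"
      unfolding sgraph_iso_relabel
    proof (intro exI[of _ "inv_into (verts K) f"] conjI)
      show "inj_on (inv_into (verts K) f) (verts ?H)" by (simp add: inj_on_inv_into)
      show "verts K = inv_into (verts K) f ` verts ?H" using f by simp
      show "edges K = relabel (inv_into (verts K) f) ` edges ?H"
        using relabel_inverse[OF tightD(1)[OF tK] f] by simp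
    qed
    ultimately show ?thesis by blast
  qed
  have 2: "realisable (verts K) (edges K)" if H: "constructible H" "sgraph_iso H K" for H :: "nat sgraph"
  proof -
    obtain f where f: "inj_on f (verts H)" "verts K = f ` verts H" "edges K = relabel f ` edges H"
      using H(2) unfolding sgraph_iso_relabel by blast
    show ?thesis unfolding f(2,3) by (rule realisable_relabel[OF constructible_realisable[OF H(1)] f(1)])
  qed
  show "gain_tight K \<longleftrightarrow> (\<exists>H :: nat sgraph. constructible H \<and> sgraph_iso H K)"
    using t 1 2 realisable_tight by blast
  show "gain_tight K \<longleftrightarrow> realisable (verts K) (edges K)"
    using t 1 2 realisable_tight by blast
qed

section \<open>Differentiating the norm\<close>

lemma quad_norm_commute: "quad_norm h1 h2 = quad_norm h2 h1"
  by (rule ext) (simp add: quad_norm_def max.commute)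

lemma quad_norm_separates:
  assumes "is_norm (quad_norm h1 h2)" "h1 \<bullet> z = 0" "h2 \<bullet> z = 0"
  shows "z = 0"
proof -
  have "quad_norm h1 h2 z = 0" using assms(2,3) by (simp add: quad_norm_def)
  then show ?thesis using assms(1) unfolding is_norm_def by blast
qed

text \<open>The two functionals separate points, hence are a basis of the dual of the plane.\<close>

lemma quad_norm_coordinates:
  assumes N: "is_norm (quad_norm h1 h2)"
  obtains pt :: "real \<Rightarrow> real \<Rightarrow> real ^ 2" where "\<And>a b. h1 \<bullet> pt a b = a" "\<And>a b. h2 \<bullet> pt a b = b"
proof -
  define L :: "real ^ 2 \<Rightarrow> real ^ 2" where "L x = (h1 \<bullet> x) *\<^sub>R axis 1 1 + (h2 \<bullet> x) *\<^sub>R axis 2 1" for x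
  have lin: "linear L"
    by (rule linearI) (simp_all add: L_def inner_add_right algebra_simps)
  have comp: "L x $ 1 = h1 \<bullet> x" "L x $ 2 = h2 \<bullet> x" for x by (simp_all add: L_def axis_def)
  have "inj L"
    unfolding linear_injective_0[OF lin]
  proof (intro allI impI)
    fix x assume "L x = 0"
    then have "h1 \<bullet> x = 0" "h2 \<bullet> x = 0" using comp[of x] by simp_all
    then show "x = 0" by (rule quad_norm_separates[OF N])
  qed
  then have "surj L" using linear_injective_imp_surjective[OF lin] by simp
  then have "\<forall>a b. \<exists>x. h1 \<bullet> x = a \<and> h2 \<bullet> x = b"
  proof (intro allI)
    fix a b :: real
    obtain x where "L x = a *\<^sub>R axis 1 1 + b *\<^sub>R axis 2 1" using \<open>surj L\<close> by (metis surjD)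
    then have "h1 \<bullet> x = a" "h2 \<bullet> x = b" using comp[of x] by (simp_all add: axis_def)
    then show "\<exists>x. h1 \<bullet> x = a \<and> h2 \<bullet> x = b" by blast
  qed
  then show thesis using that by metis
qed

definition norm_differential :: "real ^ 2 \<Rightarrow> real ^ 2 \<Rightarrow> real ^ 2 \<Rightarrow> real ^ 2 \<Rightarrow> real" where
  "norm_differential h1 h2 z \<omega> =
     (if \<bar>h2 \<bullet> z\<bar> < \<bar>h1 \<bullet> z\<bar> then sgn (h1 \<bullet> z) * (h1 \<bullet> \<omega>) else sgn (h2 \<bullet> z) * (h2 \<bullet> \<omega>))"

lemma quad_norm_has_derivative_dominant:
  assumes "\<bar>h2 \<bullet> z\<bar> < \<bar>h1 \<bullet> z\<bar>"
  shows "(quad_norm h1 h2 has_derivative (\<lambda>\<omega>. sgn (h1 \<bullet> z) * (h1 \<bullet> \<omega>))) (at z)"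
proof -
  define s where "s = sgn (h1 \<bullet> z)"
  have "h1 \<bullet> z \<noteq> 0" using assms by auto
  then have s: "s = 1 \<or> s = -1" and sz: "0 < s * (h1 \<bullet> z)" by (auto simp: s_def sgn_real_def)
  have abs_eq: "\<bar>r\<bar> = s * r" if "0 < s * r" for r using s that by auto
  let ?S = "{x. \<bar>h2 \<bullet> x\<bar> < \<bar>h1 \<bullet> x\<bar>} \<inter> {x. 0 < s * (h1 \<bullet> x)}"
  have "(quad_norm h1 h2 has_derivative (\<lambda>\<omega>. s * (h1 \<bullet> \<omega>))) (at z)"
  proof (rule has_derivative_transform_within_open)
    show "((\<lambda>x. s * (h1 \<bullet> x)) has_derivative (\<lambda>\<omega>. s * (h1 \<bullet> \<omega>))) (at z)"
      by (intro bounded_linear_imp_has_derivative bounded_linear_const_mult bounded_linear_inner_right)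
    show "open ?S" by (intro open_Int open_Collect_less continuous_intros)
    show "z \<in> ?S" using assms sz by simp
    fix x assume "x \<in> ?S"
    then have x: "\<bar>h2 \<bullet> x\<bar> < \<bar>h1 \<bullet> x\<bar>" "0 < s * (h1 \<bullet> x)" by simp_all
    from x(1) abs_eq[OF x(2)] show "s * (h1 \<bullet> x) = quad_norm h1 h2 x" by (simp add: quad_norm_def)
  qed
  then show ?thesis by (simp add: s_def)
qed

lemma quad_norm_has_derivative:
  assumes "\<bar>h1 \<bullet> z\<bar> \<noteq> \<bar>h2 \<bullet> z\<bar>"
  shows "(quad_norm h1 h2 has_derivative norm_differential h1 h2 z) (at z)"
proof (cases "\<bar>h2 \<bullet> z\<bar> < \<bar>h1 \<bullet> z\<bar>")
  case True
  then show ?thesis using quad_norm_has_derivative_dominant[OF True] unfolding norm_differential_def by simp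
next
  case False
  then have "\<bar>h1 \<bullet> z\<bar> < \<bar>h2 \<bullet> z\<bar>" using assms by simp
  from quad_norm_has_derivative_dominant[OF this] show ?thesis
    using False unfolding norm_differential_def quad_norm_commute[of h1 h2] by simp
qed

text \<open>No edge lies on a diagonal of the norm, so that each is longer in exactly one coordinate.\<close>

definition coloured :: "real ^ 2 \<Rightarrow> real ^ 2 \<Rightarrow> 'v::finite set set \<Rightarrow> (real ^ 2) ^ 'v \<Rightarrow> bool" where
  "coloured h1 h2 E p \<longleftrightarrow> (\<forall>v w. {v, w} \<in> E \<longrightarrow> \<bar>h1 \<bullet> (p $ v - p $ w)\<bar> \<noteq> \<bar>h2 \<bullet> (p $ v - p $ w)\<bar>)"

lemma edge_lengths_has_derivative:
  fixes p :: "(real ^ 2) ^ 'v::finite"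
  assumes col: "coloured h1 h2 E p"
  shows "(edge_lengths (quad_norm h1 h2) E has_derivative
    (\<lambda>u. \<chi> vw. if {fst vw, snd vw} \<in> E
       then norm_differential h1 h2 (p $ fst vw - p $ snd vw) (u $ fst vw - u $ snd vw) else 0)) (at p)"
proof (subst has_derivative_componentwise_within, rule ballI)
  fix i :: "real ^ ('v \<times> 'v)" assume "i \<in> Basis"
  then obtain vw where i: "i = axis vw 1" by (auto simp: Basis_vec_def)
  obtain v w where vw: "vw = (v, w)" by (cases vw)
  let ?z = "p $ v - p $ w"
  have diff: "((\<lambda>x :: (real ^ 2) ^ 'v. x $ v - x $ w) has_derivative (\<lambda>u. u $ v - u $ w)) (at p)"
    by (intro has_derivative_diff bounded_linear_imp_has_derivative bounded_linear_vec_nth)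
  have comp: "y \<bullet> i = y $ (v, w)" for y by (simp add: i vw inner_axis)
  show "((\<lambda>x. edge_lengths (quad_norm h1 h2) E x \<bullet> i) has_derivative
      (\<lambda>x. (\<chi> vw. if {fst vw, snd vw} \<in> E
         then norm_differential h1 h2 (p $ fst vw - p $ snd vw) (x $ fst vw - x $ snd vw) else 0) \<bullet> i)) (at p)"
  proof (cases "{v, w} \<in> E")
    case True
    then have "\<bar>h1 \<bullet> ?z\<bar> \<noteq> \<bar>h2 \<bullet> ?z\<bar>" using col unfolding coloured_def by blast
    from has_derivative_compose[OF diff quad_norm_has_derivative[OF this]] show ?thesis
      unfolding comp edge_lengths_def using True by simp
  next
    case False
    then show ?thesis unfolding comp edge_lengths_def by simp
  qed
qed

text \<open>The chain rule along the line in direction \<open>u\<close>.\<close>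

lemma edge_lengths_along_line:
  fixes F :: "('a::real_normed_vector) ^ 'v::finite \<Rightarrow> 'b::real_normed_vector"
  assumes "(F has_derivative F') (at p)"
  shows "((\<lambda>t. F (p + t *\<^sub>R u)) has_vector_derivative F' u) (at 0)"
proof -
  have "((\<lambda>t. p + t *\<^sub>R u) has_derivative (\<lambda>t. t *\<^sub>R u)) (at 0)"
    by (auto intro!: derivative_eq_intros)
  from has_derivative_compose[OF this, of F F'] assms
  have "((\<lambda>t. F (p + t *\<^sub>R u)) has_derivative (\<lambda>t. F' (t *\<^sub>R u))) (at 0)" by simp
  moreover have "F' (t *\<^sub>R u) = t *\<^sub>R F' u" for t
    using has_derivative_linear[OF assms] by (rule linear_scale)
  ultimately show ?thesis by (simp add: has_vector_derivative_def)
qed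

lemma inf_flex_iff:
  fixes p :: "(real ^ 2) ^ 'v::finite"
  assumes col: "coloured h1 h2 E p"
  shows "inf_flex (quad_norm h1 h2) E p u \<longleftrightarrow> (\<forall>v w. {v, w} \<in> E \<longrightarrow>
    (if \<bar>h2 \<bullet> (p $ v - p $ w)\<bar> < \<bar>h1 \<bullet> (p $ v - p $ w)\<bar> then h1 \<bullet> (u $ v - u $ w) = 0 else h2 \<bullet> (u $ v - u $ w) = 0))"
proof -
  let ?D = "\<chi> vw. if {fst vw, snd vw} \<in> E
       then norm_differential h1 h2 (p $ fst vw - p $ snd vw) (u $ fst vw - u $ snd vw) else 0"
  have der: "((\<lambda>t. edge_lengths (quad_norm h1 h2) E (p + t *\<^sub>R u)) has_vector_derivative ?D) (at 0)"
    by (rule edge_lengths_along_line[OF edge_lengths_has_derivative[OF col]])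
  have "inf_flex (quad_norm h1 h2) E p u \<longleftrightarrow> ?D = 0"
  proof
    assume "inf_flex (quad_norm h1 h2) E p u"
    from vector_derivative_unique_at[OF der this[unfolded inf_flex_def]] show "?D = 0" .
  next
    assume "?D = 0"
    show "inf_flex (quad_norm h1 h2) E p u" using der unfolding \<open>?D = 0\<close> inf_flex_def .
  qed
  also have "\<dots> \<longleftrightarrow> (\<forall>v w. {v, w} \<in> E \<longrightarrow> norm_differential h1 h2 (p $ v - p $ w) (u $ v - u $ w) = 0)"
    by (auto simp: vec_eq_iff)
  also have "\<dots> \<longleftrightarrow> (\<forall>v w. {v, w} \<in> E \<longrightarrow>
    (if \<bar>h2 \<bullet> (p $ v - p $ w)\<bar> < \<bar>h1 \<bullet> (p $ v - p $ w)\<bar> then h1 \<bullet> (u $ v - u $ w) = 0 else h2 \<bullet> (u $ v - u $ w) = 0))"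
  proof (intro all_cong1 imp_cong refl)
    fix v w assume "{v, w} \<in> E"
    then have "\<bar>h1 \<bullet> (p $ v - p $ w)\<bar> \<noteq> \<bar>h2 \<bullet> (p $ v - p $ w)\<bar>" using col unfolding coloured_def by blast
    then have "\<not> \<bar>h2 \<bullet> (p $ v - p $ w)\<bar> < \<bar>h1 \<bullet> (p $ v - p $ w)\<bar> \<Longrightarrow> h2 \<bullet> (p $ v - p $ w) \<noteq> 0"
      and "\<bar>h2 \<bullet> (p $ v - p $ w)\<bar> < \<bar>h1 \<bullet> (p $ v - p $ w)\<bar> \<Longrightarrow> h1 \<bullet> (p $ v - p $ w) \<noteq> 0"
      by auto
    then show "(norm_differential h1 h2 (p $ v - p $ w) (u $ v - u $ w) = 0) \<longleftrightarrow>
      (if \<bar>h2 \<bullet> (p $ v - p $ w)\<bar> < \<bar>h1 \<bullet> (p $ v - p $ w)\<bar> then h1 \<bullet> (u $ v - u $ w) = 0 else h2 \<bullet> (u $ v - u $ w) = 0)"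
      unfolding norm_differential_def by (simp add: sgn_zero_iff)
  qed
  finally show ?thesis .
qed

text \<open>In the direction \<open>\<omega>\<close> that lengthens one coordinate and shortens the other at unit speed, the norm is
  \<open>m + \<bar>t\<bar>\<close>.\<close>

lemma not_differentiable_on_diagonal:
  assumes N: "is_norm (quad_norm h1 h2)" and z: "z \<noteq> 0" "\<bar>h1 \<bullet> z\<bar> = \<bar>h2 \<bullet> z\<bar>"
  shows "\<exists>\<omega>. \<forall>D. \<not> ((\<lambda>t. quad_norm h1 h2 (z + t *\<^sub>R \<omega>)) has_vector_derivative D) (at 0)"
proof -
  define m where "m = \<bar>h1 \<bullet> z\<bar>"
  have m: "m > 0"
  proof (rule ccontr)
    assume "\<not> m > 0"
    then have "h1 \<bullet> z = 0" "h2 \<bullet> z = 0" using z(2) by (auto simp: m_def)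
    then show False using quad_norm_separates[OF N] z(1) by blast
  qed
  obtain pt where pt: "\<And>a b. h1 \<bullet> pt a b = a" "\<And>a b. h2 \<bullet> pt a b = b" using quad_norm_coordinates[OF N] by metis
  define \<omega> where "\<omega> = pt (sgn (h1 \<bullet> z)) (- sgn (h2 \<bullet> z))"
  define f where "f t = quad_norm h1 h2 (z + t *\<^sub>R \<omega>)" for t
  have f: "f t = m + \<bar>t\<bar>" if "\<bar>t\<bar> < m" for t
  proof -
    have nz: "h1 \<bullet> z \<noteq> 0" "h2 \<bullet> z \<noteq> 0" using m z(2) by (auto simp: m_def)
    have "\<bar>h1 \<bullet> z + t * sgn (h1 \<bullet> z)\<bar> = m + t"
      using that nz(1) by (cases "h1 \<bullet> z > 0") (auto simp: m_def)
    moreover have "\<bar>h2 \<bullet> z + t * - sgn (h2 \<bullet> z)\<bar> = m - t"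
      using that nz(2) z(2) by (cases "h2 \<bullet> z > 0") (auto simp: m_def)
    ultimately have "f t = max (m + t) (m - t)"
      by (simp only: f_def quad_norm_def \<omega>_def inner_add_right inner_scaleR_right pt)
    then show ?thesis by (simp add: max_def)
  qed
  have "\<not> (f has_vector_derivative D) (at 0)" for D
  proof
    assume "(f has_vector_derivative D) (at 0)"
    then have D: "DERIV f 0 :> D" by (simp add: has_real_derivative_iff_has_vector_derivative)
    have "\<forall>y. \<bar>0 - y\<bar> < m \<longrightarrow> f 0 \<le> f y" using f m by simp
    then have "D = 0" by (rule DERIV_local_min[OF D m])
    moreover have D': "DERIV (\<lambda>t. f t - t) 0 :> D - 1" using D by (auto intro!: derivative_eq_intros)
    have "\<forall>y. \<bar>0 - y\<bar> < m \<longrightarrow> f 0 - 0 \<le> f y - y" using f m by auto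
    then have "D - 1 = 0" by (rule DERIV_local_min[OF D' m])
    ultimately show False by simp
  qed
  then show ?thesis unfolding f_def by blast
qed

lemma well_positioned_iff_coloured:
  fixes p :: "(real ^ 2) ^ 'v::finite"
  assumes N: "is_norm (quad_norm h1 h2)" and fw: "framework E p"
  shows "well_positioned (quad_norm h1 h2) E p \<longleftrightarrow> coloured h1 h2 E p"
proof
  assume "coloured h1 h2 E p"
  from edge_lengths_has_derivative[OF this] show "well_positioned (quad_norm h1 h2) E p"
    unfolding well_positioned_def differentiable_def by blast
next
  assume wp: "well_positioned (quad_norm h1 h2) E p"
  then obtain F' where F': "(edge_lengths (quad_norm h1 h2) E has_derivative F') (at p)"
    unfolding well_positioned_def differentiable_def by blast
  show "coloured h1 h2 E p" unfolding coloured_def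
  proof (intro allI impI notI)
    fix v w assume e: "{v, w} \<in> E" and eq: "\<bar>h1 \<bullet> (p $ v - p $ w)\<bar> = \<bar>h2 \<bullet> (p $ v - p $ w)\<bar>"
    let ?z = "p $ v - p $ w"
    have z: "?z \<noteq> 0" using fw e unfolding framework_def by auto
    have vw: "v \<noteq> w"
    proof
      assume "v = w"
      then have "card {v, w} = 1" by simp
      then show False using fw e unfolding framework_def simple_graph_def by fastforce
    qed
    obtain \<omega> where \<omega>: "\<And>D. \<not> ((\<lambda>t. quad_norm h1 h2 (?z + t *\<^sub>R \<omega>)) has_vector_derivative D) (at 0)"
      using not_differentiable_on_diagonal[OF N z eq] by blast
    have "((\<lambda>t. edge_lengths (quad_norm h1 h2) E (p + t *\<^sub>R axis v \<omega>) $ (v, w)) has_vector_derivative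
        F' (axis v \<omega>) $ (v, w)) (at 0)"
      by (rule bounded_linear.has_vector_derivative[OF bounded_linear_vec_nth edge_lengths_along_line[OF F']])
    moreover have "edge_lengths (quad_norm h1 h2) E (p + t *\<^sub>R axis v \<omega>) $ (v, w) = quad_norm h1 h2 (?z + t *\<^sub>R \<omega>)" for t
      using e vw by (simp add: edge_lengths_def axis_def algebra_simps)
    ultimately show False using \<omega> by simp
  qed
qed

section \<open>Rigid motions\<close>

text \<open>While the first coordinate dominates, its absolute value is the norm, which a rigid motion preserves.\<close>

lemma rigid_motion_derivative_dominant:
  assumes rm: "rigid_motion (quad_norm h1 h2) \<alpha>" and dom: "\<bar>h2 \<bullet> (x - y)\<bar> < \<bar>h1 \<bullet> (x - y)\<bar>"
    and ux: "(\<alpha> x has_vector_derivative ux) (at 0)" and uy: "(\<alpha> y has_vector_derivative uy) (at 0)"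
  shows "h1 \<bullet> ux = h1 \<bullet> uy"
proof -
  let ?\<delta> = "\<lambda>t. \<alpha> x t - \<alpha> y t"
  have \<delta>0: "?\<delta> 0 = x - y" using rm unfolding rigid_motion_def by simp
  have der: "(?\<delta> has_vector_derivative ux - uy) (at 0)" by (intro derivative_intros ux uy)
  have cont: "(?\<delta> \<longlongrightarrow> x - y) (at 0)"
    using has_vector_derivative_continuous[OF der] \<delta>0 by (simp add: continuous_at)
  have "((\<lambda>t. \<bar>h1 \<bullet> ?\<delta> t\<bar> - \<bar>h2 \<bullet> ?\<delta> t\<bar>) \<longlongrightarrow> \<bar>h1 \<bullet> (x - y)\<bar> - \<bar>h2 \<bullet> (x - y)\<bar>) (at 0)"
    by (intro tendsto_intros cont)
  then have e1: "\<forall>\<^sub>F t in at 0. 0 < \<bar>h1 \<bullet> ?\<delta> t\<bar> - \<bar>h2 \<bullet> ?\<delta> t\<bar>" using dom by (intro order_tendstoD(1)) auto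
  have "((\<lambda>t. (h1 \<bullet> ?\<delta> t) * (h1 \<bullet> (x - y))) \<longlongrightarrow> (h1 \<bullet> (x - y)) * (h1 \<bullet> (x - y))) (at 0)"
    by (intro tendsto_intros cont)
  moreover have "0 < (h1 \<bullet> (x - y)) * (h1 \<bullet> (x - y))"
  proof -
    have "h1 \<bullet> (x - y) \<noteq> 0" using dom by auto
    then show ?thesis by (auto simp: zero_less_mult_iff linorder_neq_iff)
  qed
  ultimately have e2: "\<forall>\<^sub>F t in at 0. 0 < (h1 \<bullet> ?\<delta> t) * (h1 \<bullet> (x - y))" by (rule order_tendstoD(1))
  have e3: "\<forall>\<^sub>F t in at (0::real). t \<in> {-1<..<1}" by (rule eventually_at_in_open') auto
  have "\<forall>\<^sub>F t in at 0. h1 \<bullet> ?\<delta> t = h1 \<bullet> (x - y)"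
    using e1 e2 e3
  proof eventually_elim
    case (elim t)
    have "t \<in> {-1..1}" using elim(3) by simp
    then have "quad_norm h1 h2 (?\<delta> t) = quad_norm h1 h2 (x - y)" using rm unfolding rigid_motion_def by blast
    then have "\<bar>h1 \<bullet> ?\<delta> t\<bar> = \<bar>h1 \<bullet> (x - y)\<bar>" using elim(1) dom unfolding quad_norm_def by simp
    then show ?case using elim(2) by (auto simp: abs_if zero_less_mult_iff split: if_splits)
  qed
  then have ev: "\<forall>\<^sub>F t in at 0. h1 \<bullet> (x - y) = h1 \<bullet> ?\<delta> t" by (rule eventually_mono) (rule sym)
  have zero: "((\<lambda>_. h1 \<bullet> (x - y)) has_derivative (\<lambda>_. 0)) (at (0::real))" by (rule has_derivative_const)
  have eq0: "h1 \<bullet> (x - y) = h1 \<bullet> ?\<delta> 0" unfolding \<delta>0 by (rule refl)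
  have "((\<lambda>t. h1 \<bullet> ?\<delta> t) has_derivative (\<lambda>_. 0)) (at 0)"
    by (rule has_derivative_transform_eventually[OF zero ev eq0 UNIV_I])
  then have "((\<lambda>t. h1 \<bullet> ?\<delta> t) has_vector_derivative 0) (at 0)" by (simp add: has_vector_derivative_def)
  moreover have "((\<lambda>t. h1 \<bullet> ?\<delta> t) has_vector_derivative h1 \<bullet> (ux - uy)) (at 0)"
    by (rule bounded_linear.has_vector_derivative[OF bounded_linear_inner_right der])
  ultimately have "h1 \<bullet> (ux - uy) = 0" using vector_derivative_unique_at by metis
  then show ?thesis by (simp add: inner_diff_right)
qed

text \<open>Any two points are compared through a third point that is far away from both in the first coordinate.\<close>

lemma rigid_motion_derivative_component:
  assumes N: "is_norm (quad_norm h1 h2)" and rm: "rigid_motion (quad_norm h1 h2) \<alpha>"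
    and ux: "(\<alpha> x has_vector_derivative ux) (at 0)" and uy: "(\<alpha> y has_vector_derivative uy) (at 0)"
  shows "h1 \<bullet> ux = h1 \<bullet> uy"
proof -
  obtain pt where pt: "\<And>a b. h1 \<bullet> pt a b = a" "\<And>a b. h2 \<bullet> pt a b = b" using quad_norm_coordinates[OF N] by metis
  \<comment> \<open>far enough that the first coordinate dominates the difference to \<open>y\<close> too\<close>
  define M where "M = \<bar>h1 \<bullet> (y - x)\<bar> + \<bar>h2 \<bullet> (y - x)\<bar> + 1"
  define z where "z = x + pt M 0"
  have "\<alpha> z differentiable (at 0)" using rm unfolding rigid_motion_def by blast
  then obtain uz where uz: "(\<alpha> z has_vector_derivative uz) (at 0)"
    using vector_derivative_works by blast
  have "\<bar>h2 \<bullet> (x - z)\<bar> < \<bar>h1 \<bullet> (x - z)\<bar>"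
    by (simp add: z_def M_def pt inner_diff_right inner_add_right)
  then have "h1 \<bullet> ux = h1 \<bullet> uz" by (rule rigid_motion_derivative_dominant[OF rm _ ux uz])
  moreover have "\<bar>h2 \<bullet> (y - z)\<bar> < \<bar>h1 \<bullet> (y - z)\<bar>"
  proof -
    have "h2 \<bullet> (y - z) = h2 \<bullet> (y - x)" "h1 \<bullet> (y - z) = h1 \<bullet> (y - x) - M"
      by (simp_all add: z_def pt inner_diff_right inner_add_right)
    then show ?thesis by (simp add: M_def)
  qed
  then have "h1 \<bullet> uy = h1 \<bullet> uz" by (rule rigid_motion_derivative_dominant[OF rm _ uy uz])
  ultimately show ?thesis by simp
qed

text \<open>The derivative of a rigid motion has the same two coordinates at all points.\<close>

lemma trivial_flex_iff:
  fixes p :: "(real ^ 2) ^ 'v::finite"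
  assumes N: "is_norm (quad_norm h1 h2)"
  shows "trivial_flex (quad_norm h1 h2) p u \<longleftrightarrow> (\<forall>v w. u $ v = u $ w)"
proof
  assume "trivial_flex (quad_norm h1 h2) p u"
  then obtain \<alpha> where rm: "rigid_motion (quad_norm h1 h2) \<alpha>"
    and u: "\<And>v. (\<alpha> (p $ v) has_vector_derivative u $ v) (at 0)"
    unfolding trivial_flex_def by blast
  have N': "is_norm (quad_norm h2 h1)" and rm': "rigid_motion (quad_norm h2 h1) \<alpha>"
    using N rm by (simp_all add: quad_norm_commute)
  show "\<forall>v w. u $ v = u $ w"
  proof (intro allI)
    fix v w
    have "h1 \<bullet> (u $ v - u $ w) = 0"
      using rigid_motion_derivative_component[OF N rm u u, of v w] by (simp add: inner_diff_right)
    moreover have "h2 \<bullet> (u $ v - u $ w) = 0"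
      using rigid_motion_derivative_component[OF N' rm' u u, of v w] by (simp add: inner_diff_right)
    ultimately have "u $ v - u $ w = 0" by (rule quad_norm_separates[OF N])
    then show "u $ v = u $ w" by simp
  qed
next
  assume c: "\<forall>v w. u $ v = u $ w"
  define d where "d = u $ undefined"
  have ud: "u $ v = d" for v using c by (simp add: d_def)
  define \<alpha> where "\<alpha> x t = x + t *\<^sub>R d" for x :: "real ^ 2" and t :: real
  have der: "(\<alpha> x has_vector_derivative d) (at 0)" for x
    unfolding \<alpha>_def by (auto intro!: derivative_eq_intros)
  have "rigid_motion (quad_norm h1 h2) \<alpha>"
    unfolding rigid_motion_def
  proof (intro conjI allI ballI)
    fix x
    show "continuous_on {-1..1} (\<alpha> x)" unfolding \<alpha>_def by (intro continuous_intros)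
    show "\<alpha> x differentiable (at 0)" using der by (rule differentiableI_vector)
    show "\<alpha> x 0 = x" by (simp add: \<alpha>_def)
  qed (simp add: \<alpha>_def)
  then show "trivial_flex (quad_norm h1 h2) p u" unfolding trivial_flex_def using der ud by metis
qed

section \<open>Quotients of symmetric frameworks\<close>

text \<open>The sign with which the first coordinate of a symmetric placement at \<open>v\<close> differs from the one at the
  representative of the orbit of \<open>v\<close>.\<close>

definition side :: "'v set \<Rightarrow> 'v \<Rightarrow> int" where
  "side R v = (if v \<in> R then 1 else -1)"

definition orbit_rep :: "'v set \<Rightarrow> 'v set \<Rightarrow> 'v" where
  "orbit_rep R x = (THE v. v \<in> x \<inter> R)"

lemma side_square [simp]: "side R v * side R v = 1"
  by (simp add: side_def)

lemma orbit_facts: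
  assumes G: "Z2_symmetric_graph E \<theta>" and free: "free_on_vertices \<theta>" and R: "representatives \<theta> R"
  shows "\<theta> (-1) v \<in> R \<longleftrightarrow> v \<notin> R" "side R (\<theta> (-1) v) = - side R v"
    "vertex_orbit \<theta> (\<theta> (-1) v) = vertex_orbit \<theta> v"
    "orbit_rep R (vertex_orbit \<theta> v) = (if v \<in> R then v else \<theta> (-1) v)"
    "vertex_orbit \<theta> v = vertex_orbit \<theta> w \<longleftrightarrow> v = w \<or> w = \<theta> (-1) v"
proof -
  have s: "\<theta> (-1) (\<theta> (-1) v) = v" for v by (rule theta_facts(1)[OF G])
  have ne: "\<theta> (-1) v \<noteq> v" for v using free by (simp add: free_on_vertices_def)
  have ex1: "\<exists>!u. u \<in> vertex_orbit \<theta> v \<inter> R" for v using R by (simp add: representatives_def)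
  show sv: "\<theta> (-1) v \<in> R \<longleftrightarrow> v \<notin> R" for v
    using ex1[of v] ne[of v] unfolding vertex_orbit_def by blast
  show "side R (\<theta> (-1) v) = - side R v" using sv by (simp add: side_def)
  show "vertex_orbit \<theta> (\<theta> (-1) v) = vertex_orbit \<theta> v" by (auto simp: vertex_orbit_def s)
  show "orbit_rep R (vertex_orbit \<theta> v) = (if v \<in> R then v else \<theta> (-1) v)"
    unfolding orbit_rep_def
  proof (rule the1_equality[OF ex1])
    show "(if v \<in> R then v else \<theta> (-1) v) \<in> vertex_orbit \<theta> v \<inter> R"
      using sv[of v] by (simp add: vertex_orbit_def)
  qed
  show "vertex_orbit \<theta> v = vertex_orbit \<theta> w \<longleftrightarrow> v = w \<or> w = \<theta> (-1) v"
    unfolding vertex_orbit_def doubleton_eq_iff using s by metis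
qed

text \<open>Writes the gain as a product of signs, which makes it the coefficient in the constraints of the
  quotient.\<close>

lemma quotient_edge_doubleton:
  assumes G: "Z2_symmetric_graph E \<theta>" and free: "free_on_vertices \<theta>" and R: "representatives \<theta> R"
  shows "quotient_edge \<theta> R (edge_orbit \<theta> {v, w}) = ({vertex_orbit \<theta> v, vertex_orbit \<theta> w}, side R v * side R w)"
proof -
  let ?s = "\<theta> (-1)" and ?o = "vertex_orbit \<theta>"
  note of = orbit_facts[OF G free R]
  have s: "?s (?s v) = v" for v by (rule theta_facts(1)[OF G])
  have mem: "u \<in> ?o v \<longleftrightarrow> ?o u = ?o v" for u v
  proof -
    have "u \<in> ?o v \<longleftrightarrow> u = v \<or> u = ?s v" by (simp add: vertex_orbit_def)
    moreover have "u = ?s v \<longleftrightarrow> v = ?s u" using s by metis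
    ultimately show ?thesis unfolding of(5)[of u v] by blast
  qed
  have "quotient_ends \<theta> (edge_orbit \<theta> {v, w}) = {?o v, ?o w}"
  proof (rule equalityI; rule subsetI)
    fix y assume "y \<in> quotient_ends \<theta> (edge_orbit \<theta> {v, w})"
    then obtain z e u where y: "y = ?o z" and e: "e \<in> edge_orbit \<theta> {v, w}" and u: "u \<in> ?o z" "u \<in> e"
      unfolding quotient_ends_def by blast
    have "u = v \<or> u = w \<or> u = ?s v \<or> u = ?s w" using e u(2) unfolding edge_orbit_def by auto
    then have "?o u = ?o v \<or> ?o u = ?o w" using of(3) by metis
    moreover have "?o u = y" using u(1) mem y by blast
    ultimately show "y \<in> {?o v, ?o w}" by blast
  next
    fix y assume "y \<in> {?o v, ?o w}"
    then obtain u where u: "y = ?o u" "u \<in> {v, w}" by blast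
    have 1: "u \<in> ?o u" by (simp add: vertex_orbit_def)
    have 2: "{v, w} \<in> edge_orbit \<theta> {v, w}" by (simp add: edge_orbit_def)
    have "\<exists>e\<in>edge_orbit \<theta> {v, w}. \<exists>z\<in>y. z \<in> e"
      unfolding u(1) by (intro bexI[OF _ 2] bexI[OF _ 1] u(2))
    then show "y \<in> quotient_ends \<theta> (edge_orbit \<theta> {v, w})"
      unfolding quotient_ends_def u(1) by simp
  qed
  moreover have "quotient_gain R (edge_orbit \<theta> {v, w}) = side R v * side R w"
    unfolding quotient_gain_def edge_orbit_def side_def using of(1)[of v] of(1)[of w] by auto
  ultimately show ?thesis by (simp add: quotient_edge_def)
qed

lemma graph_edgeE:
  assumes "Z2_symmetric_graph E \<theta>" "e \<in> E"
  obtains v w where "e = {v, w}" "v \<noteq> w"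
  using assms by (metis Z2_symmetric_graph_def simple_graph_def card_2_iff)

lemma quotient_edge_memI:
  assumes G: "Z2_symmetric_graph E \<theta>" and free: "free_on_vertices \<theta>" and R: "representatives \<theta> R"
    and e: "{v, w} \<in> E"
  shows "({vertex_orbit \<theta> v, vertex_orbit \<theta> w}, side R v * side R w) \<in> edges (quotient_graph E \<theta> R)"
  unfolding quotient_edge_doubleton[OF G free R, symmetric] quotient_graph_def using e by simp

lemma quotient_edge_memE:
  assumes G: "Z2_symmetric_graph E \<theta>" and free: "free_on_vertices \<theta>" and R: "representatives \<theta> R"
    and e: "({x, y}, g) \<in> edges (quotient_graph E \<theta> R)"
  obtains v w where "{v, w} \<in> E" "v \<noteq> w" "x = vertex_orbit \<theta> v" "y = vertex_orbit \<theta> w" "g = side R v * side R w"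
proof -
  obtain f where f: "f \<in> E" "({x, y}, g) = quotient_edge \<theta> R (edge_orbit \<theta> f)"
    using e unfolding quotient_graph_def by auto
  obtain v w where vw: "f = {v, w}" "v \<noteq> w" using graph_edgeE[OF G f(1)] .
  have "({x, y}, g) = ({vertex_orbit \<theta> v, vertex_orbit \<theta> w}, side R v * side R w)"
    using f(2) quotient_edge_doubleton[OF G free R] vw(1) by simp
  then have "g = side R v * side R w"
    "x = vertex_orbit \<theta> v \<and> y = vertex_orbit \<theta> w \<or> x = vertex_orbit \<theta> w \<and> y = vertex_orbit \<theta> v"
    by (auto simp: doubleton_eq_iff)
  then show thesis using that[of v w] that[of w v] f(1) vw by (auto simp: insert_commute mult.commute)
qed

lemma signed_quotient_graph_quotient:
  assumes G: "Z2_symmetric_graph E \<theta>" and free: "free_on_vertices \<theta>" and R: "representatives \<theta> R"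
  shows "signed_quotient_graph (quotient_graph (E :: 'v::finite set set) \<theta> R)"
  unfolding signed_quotient_graph_iff
proof (rule signed_graphI)
  show "finite (verts (quotient_graph E \<theta> R))" by (simp add: quotient_graph_def)
  fix e assume "e \<in> edges (quotient_graph E \<theta> R)"
  then obtain f where f: "f \<in> E" "e = quotient_edge \<theta> R (edge_orbit \<theta> f)" unfolding quotient_graph_def by auto
  obtain v w where vw: "f = {v, w}" "v \<noteq> w" using graph_edgeE[OF G f(1)] .
  have e: "e = ({vertex_orbit \<theta> v, vertex_orbit \<theta> w}, side R v * side R w)"
    using f(2) quotient_edge_doubleton[OF G free R] vw(1) by simp
  have "vertex_orbit \<theta> v = vertex_orbit \<theta> w \<longrightarrow> side R v * side R w = -1"
    using orbit_facts(2,5)[OF G free R] vw(2) by (metis minus_mult_right side_square)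
  then show "\<exists>x y g. e = ({x, y}, g) \<and> x \<in> verts (quotient_graph E \<theta> R) \<and> y \<in> verts (quotient_graph E \<theta> R) \<and>
      (g = 1 \<or> g = -1) \<and> (x = y \<longrightarrow> g = -1)"
    using e by (intro exI[of _ "vertex_orbit \<theta> v"] exI[of _ "vertex_orbit \<theta> w"] exI[of _ "side R v * side R w"])
      (simp add: quotient_graph_def side_def)
qed

lemma theta_one:
  assumes "Z2_symmetric_graph E \<theta>" shows "\<theta> 1 v = v"
proof -
  have h: "\<theta> \<in> hom Z2 (aut_group E)" using assms by (simp add: Z2_symmetric_graph_def)
  have b: "bij (\<theta> 1)" using h by (auto simp: hom_def Z2_def aut_group_def Pi_def)
  have "\<theta> (1 * 1) = \<theta> 1 \<circ> \<theta> 1" using h by (auto simp: hom_def Z2_def aut_group_def)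
  then have "\<theta> 1 (\<theta> 1 v) = \<theta> 1 v" by (metis comp_apply mult_1)
  then show ?thesis using b by (simp add: bij_is_inj inj_eq)
qed

lemma Z2_symmetric_subgraph:
  assumes G: "Z2_symmetric_graph E \<theta>" and E': "E' \<subseteq> E" "invariant_edges \<theta> E'"
  shows "Z2_symmetric_graph E' \<theta>"
proof -
  have s: "\<theta> (-1) (\<theta> (-1) v) = v" for v by (rule theta_facts(1)[OF G])
  have fwd: "{\<theta> (-1) v, \<theta> (-1) w} \<in> E'" if "{v, w} \<in> E'" for v w
    using E'(2) that unfolding invariant_edges_def by force
  have inv: "{\<theta> (-1) v, \<theta> (-1) w} \<in> E' \<longleftrightarrow> {v, w} \<in> E'" for v w
    using fwd[of v w] fwd[of "\<theta> (-1) v" "\<theta> (-1) w"] s by auto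
  have one: "\<theta> 1 v = v" for v by (rule theta_one[OF G])
  have "simple_graph E'" using G E'(1) unfolding Z2_symmetric_graph_def simple_graph_def by blast
  moreover have "\<theta> \<in> hom Z2 (aut_group E')"
  proof -
    have h: "\<theta> \<in> hom Z2 (aut_group E)" using G by (simp add: Z2_symmetric_graph_def)
    have m: "\<theta> (x * y) = \<theta> x \<circ> \<theta> y" if "x \<in> carrier Z2" "y \<in> carrier Z2" for x y
      using hom_mult[OF h that] by (simp add: Z2_def aut_group_def)
    have b: "bij (\<theta> 1)" "bij (\<theta> (-1))" using h by (auto simp: hom_def Z2_def aut_group_def Pi_def)
    show ?thesis
    proof (rule homI)
      fix x assume "x \<in> carrier Z2"
      then have "x = 1 \<or> x = -1" by (simp add: Z2_def)
      then show "\<theta> x \<in> carrier (aut_group E')" using b inv one by (auto simp: aut_group_def)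
    next
      fix x y assume xy: "x \<in> carrier Z2" "y \<in> carrier Z2"
      show "\<theta> (x \<otimes>\<^bsub>Z2\<^esub> y) = \<theta> x \<otimes>\<^bsub>aut_group E'\<^esub> \<theta> y"
        using m[OF xy] by (simp add: Z2_def aut_group_def)
    qed
  qed
  ultimately show ?thesis by (simp add: Z2_symmetric_graph_def)
qed

text \<open>The projection has kernel \<open>h1 = 0\<close> and range \<open>h2 = 0\<close>, so it keeps the first coordinate and kills
  the second.\<close>

lemma reflection_coordinates:
  assumes "is_reflection T {x. h1 \<bullet> x = 0} {x. h2 \<bullet> x = 0}"
  shows "h1 \<bullet> T x = - (h1 \<bullet> x)" "h2 \<bullet> T x = h2 \<bullet> x"
proof -
  obtain P where P: "linear P" "P \<circ> P = P" "range P = {x. h2 \<bullet> x = 0}" "{x. P x = 0} = {x. h1 \<bullet> x = 0}"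
    "T = (\<lambda>x. x - 2 *\<^sub>R P x)"
    using assms unfolding is_reflection_def by blast
  have "P (x - P x) = 0" using P(1,2) by (simp add: linear_diff) (metis comp_apply)
  then have "h1 \<bullet> (x - P x) = 0" using P(4) by blast
  then show "h1 \<bullet> T x = - (h1 \<bullet> x)" unfolding P(5) by (simp add: inner_diff_right)
  have "h2 \<bullet> P x = 0" using P(3) by blast
  then show "h2 \<bullet> T x = h2 \<bullet> x" unfolding P(5) by (simp add: inner_diff_right)
qed

lemma symmetric_coordinates:
  assumes G: "Z2_symmetric_graph E \<theta>" and free: "free_on_vertices \<theta>" and R: "representatives \<theta> R"
    and T: "\<And>x. h1 \<bullet> \<tau> (-1) x = - (h1 \<bullet> x)" "\<And>x. h2 \<bullet> \<tau> (-1) x = h2 \<bullet> x"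
    and u: "Z2_symmetric \<theta> \<tau> u"
  shows "h1 \<bullet> u $ v = of_int (side R v) * (h1 \<bullet> u $ orbit_rep R (vertex_orbit \<theta> v))"
    "h2 \<bullet> u $ v = h2 \<bullet> u $ orbit_rep R (vertex_orbit \<theta> v)"
proof -
  have "u $ \<theta> (-1) v = \<tau> (-1) (u $ v)" using u unfolding Z2_symmetric_def by simp
  then have "h1 \<bullet> u $ \<theta> (-1) v = - (h1 \<bullet> u $ v)" "h2 \<bullet> u $ \<theta> (-1) v = h2 \<bullet> u $ v" using T by simp_all
  then show "h1 \<bullet> u $ v = of_int (side R v) * (h1 \<bullet> u $ orbit_rep R (vertex_orbit \<theta> v))"
    "h2 \<bullet> u $ v = h2 \<bullet> u $ orbit_rep R (vertex_orbit \<theta> v)"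
    unfolding orbit_facts(4)[OF G free R] by (simp_all add: side_def)
qed

lemma signed_difference:
  fixes s t :: int and \<alpha> \<beta> :: real
  assumes "s = 1 \<or> s = -1" "t = 1 \<or> t = -1"
  shows "\<bar>\<alpha> - of_int (s * t) * \<beta>\<bar> = \<bar>of_int s * \<alpha> - of_int t * \<beta>\<bar>"
    "of_int s * \<alpha> - of_int t * \<beta> = 0 \<longleftrightarrow> \<alpha> = of_int (s * t) * \<beta>"
  using assms by auto

lemma side_cases: "side R v = 1 \<or> side R v = -1"
  by (simp add: side_def)

lemma quotient_colours:
  assumes c: "\<And>v. h1 \<bullet> p $ v = of_int (side R v) * a (vertex_orbit \<theta> v)" "\<And>v. h2 \<bullet> p $ v = b (vertex_orbit \<theta> v)"
  shows "horizontal a b (vertex_orbit \<theta> v) (vertex_orbit \<theta> w) (side R v * side R w) \<longleftrightarrow>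
      \<bar>h2 \<bullet> (p $ v - p $ w)\<bar> < \<bar>h1 \<bullet> (p $ v - p $ w)\<bar>"
    "vertical a b (vertex_orbit \<theta> v) (vertex_orbit \<theta> w) (side R v * side R w) \<longleftrightarrow>
      \<bar>h1 \<bullet> (p $ v - p $ w)\<bar> < \<bar>h2 \<bullet> (p $ v - p $ w)\<bar>"
  unfolding horizontal_def vertical_def inner_diff_right c
  using signed_difference(1)[OF side_cases[of R v] side_cases[of R w]] by simp_all

text \<open>A symmetric velocity field is the same as its coordinates on the orbits, and the condition of an edge
  is that of its orbit. In the forward direction, a field that is constant has horizontal velocity 0
  because this velocity changes its sign under the reflection.\<close>

lemma symm_inf_rigid_iff:
  fixes p :: "(real ^ 2) ^ 'v::finite"
  assumes N: "is_norm (quad_norm h1 h2)"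
    and G: "Z2_symmetric_graph E \<theta>" and free: "free_on_vertices \<theta>" and R: "representatives \<theta> R"
    and T: "\<And>x. h1 \<bullet> \<tau> (-1) x = - (h1 \<bullet> x)" "\<And>x. h2 \<bullet> \<tau> (-1) x = h2 \<bullet> x"
    and c: "\<And>v. h1 \<bullet> p $ v = of_int (side R v) * a (vertex_orbit \<theta> v)" "\<And>v. h2 \<bullet> p $ v = b (vertex_orbit \<theta> v)"
    and col: "coloured h1 h2 E p"
  shows "symm_inf_rigid (quad_norm h1 h2) \<theta> \<tau> E p \<longleftrightarrow>
    rigidly_placed (range (vertex_orbit \<theta>)) (edges (quotient_graph E \<theta> R)) a b"
proof
  let ?o = "vertex_orbit \<theta>" and ?Q = "edges (quotient_graph E \<theta> R)"
  note colours = quotient_colours[of h1 p R a \<theta> h2 b, OF c]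
  note of = orbit_facts[OF G free R]
  obtain pt where pt: "\<And>a b. h1 \<bullet> pt a b = a" "\<And>a b. h2 \<bullet> pt a b = b" using quad_norm_coordinates[OF N] by metis
  have sep: "x = y" if "h1 \<bullet> x = h1 \<bullet> y" "h2 \<bullet> x = h2 \<bullet> y" for x y
    using quad_norm_separates[OF N, of "x - y"] that by (simp add: inner_diff_right)
  assume rigid: "symm_inf_rigid (quad_norm h1 h2) \<theta> \<tau> E p"
  have flex: "\<forall>v w. u $ v = u $ w"
    if cd: "horizontal_flex ?Q a b c'" "vertical_flex ?Q a b d" and u: "u = (\<chi> v. pt (of_int (side R v) * c' (?o v)) (d (?o v)))" for c' d u
  proof -
    have uc: "h1 \<bullet> u $ v = of_int (side R v) * c' (?o v)" "h2 \<bullet> u $ v = d (?o v)" for v by (simp_all add: u pt)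
    have "Z2_symmetric \<theta> \<tau> u" unfolding Z2_symmetric_def
      by (intro allI sep) (simp_all add: T uc of(2,3))
    moreover have "inf_flex (quad_norm h1 h2) E p u"
      unfolding inf_flex_iff[OF col]
    proof (intro allI impI)
      fix v w assume e: "{v, w} \<in> E"
      note q = quotient_edge_memI[OF G free R e]
      have dif: "\<bar>h1 \<bullet> (p $ v - p $ w)\<bar> \<noteq> \<bar>h2 \<bullet> (p $ v - p $ w)\<bar>" using col e unfolding coloured_def by blast
      show "if \<bar>h2 \<bullet> (p $ v - p $ w)\<bar> < \<bar>h1 \<bullet> (p $ v - p $ w)\<bar> then h1 \<bullet> (u $ v - u $ w) = 0 else h2 \<bullet> (u $ v - u $ w) = 0"
      proof (cases "\<bar>h2 \<bullet> (p $ v - p $ w)\<bar> < \<bar>h1 \<bullet> (p $ v - p $ w)\<bar>")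
        case True
        then have "c' (?o v) = of_int (side R v * side R w) * c' (?o w)"
          using cd(1) q colours(1) unfolding horizontal_flex_def by blast
        then have "h1 \<bullet> (u $ v - u $ w) = 0"
          unfolding inner_diff_right uc using signed_difference(2)[OF side_cases[of R v] side_cases[of R w]] by blast
        then show ?thesis using True by simp
      next
        case False
        then have "vertical a b (?o v) (?o w) (side R v * side R w)" using dif colours(2) by simp
        then have "d (?o v) = d (?o w)" using cd(2) q unfolding vertical_flex_def by blast
        then show ?thesis using False by (simp add: inner_diff_right uc)
      qed
    qed
    ultimately have "trivial_flex (quad_norm h1 h2) p u" using rigid unfolding symm_inf_rigid_def by blast
    then show ?thesis unfolding trivial_flex_iff[OF N] .
  qed
  show "rigidly_placed (range ?o) ?Q a b" unfolding rigidly_placed_def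
  proof (rule conjI; intro allI impI)
    fix c' assume c': "horizontal_flex ?Q a b c'"
    have z: "vertical_flex ?Q a b (\<lambda>_. 0)" by (simp add: vertical_flex_def)
    show "\<forall>x\<in>range ?o. c' x = 0"
    proof
      fix x assume "x \<in> range ?o"
      then obtain v where x: "x = ?o v" by blast
      define u where "u = (\<chi> v. pt (of_int (side R v) * c' (?o v)) ((\<lambda>_. 0) (?o v)))"
      have "u $ v = u $ \<theta> (-1) v" using flex[OF c' z u_def] by blast
      then have "h1 \<bullet> u $ v = h1 \<bullet> u $ \<theta> (-1) v" by simp
      then have "of_int (side R v) * c' (?o v) = - (of_int (side R v) * c' (?o v))"
        by (simp add: u_def pt of(2,3))
      then show "c' x = 0" using side_cases[of R v] by (auto simp: x)
    qed
  next
    fix d assume d: "vertical_flex ?Q a b d"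
    have z: "horizontal_flex ?Q a b (\<lambda>_. 0)" by (simp add: horizontal_flex_def)
    define u where "u = (\<chi> v. pt (of_int (side R v) * (\<lambda>_. 0) (?o v)) (d (?o v)))"
    have "d (?o v) = d (?o w)" for v w
    proof -
      have "u $ v = u $ w" using flex[OF z d u_def] by blast
      then have "h2 \<bullet> u $ v = h2 \<bullet> u $ w" by simp
      then show ?thesis by (simp add: u_def pt)
    qed
    then show "\<forall>x\<in>range ?o. \<forall>y\<in>range ?o. d x = d y" by blast
  qed
next
  let ?o = "vertex_orbit \<theta>" and ?Q = "edges (quotient_graph E \<theta> R)"
  note colours = quotient_colours[of h1 p R a \<theta> h2 b, OF c]
  have sep: "x = y" if "h1 \<bullet> x = h1 \<bullet> y" "h2 \<bullet> x = h2 \<bullet> y" for x y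
    using quad_norm_separates[OF N, of "x - y"] that by (simp add: inner_diff_right)
  assume rigid: "rigidly_placed (range ?o) ?Q a b"
  show "symm_inf_rigid (quad_norm h1 h2) \<theta> \<tau> E p"
    unfolding symm_inf_rigid_def trivial_flex_iff[OF N]
  proof (intro allI impI)
    fix u :: "(real ^ 2) ^ 'v" and v w assume u: "Z2_symmetric \<theta> \<tau> u" and fl: "inf_flex (quad_norm h1 h2) E p u"
    define c' where "c' x = h1 \<bullet> u $ orbit_rep R x" for x
    define d where "d x = h2 \<bullet> u $ orbit_rep R x" for x
    have uc: "h1 \<bullet> u $ v = of_int (side R v) * c' (?o v)" "h2 \<bullet> u $ v = d (?o v)" for v
      using symmetric_coordinates[of E \<theta> R h1 \<tau> h2 u, OF G free R T u, of v] by (simp_all add: c'_def d_def)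
    have "horizontal_flex ?Q a b c'" unfolding horizontal_flex_def
    proof (intro allI impI)
      fix x y g assume q: "({x, y}, g) \<in> ?Q" and h: "horizontal a b x y g"
      obtain v w where vw: "{v, w} \<in> E" "x = ?o v" "y = ?o w" "g = side R v * side R w"
        using quotient_edge_memE[OF G free R q] by metis
      have "\<bar>h2 \<bullet> (p $ v - p $ w)\<bar> < \<bar>h1 \<bullet> (p $ v - p $ w)\<bar>" using h colours(1)[of v w] unfolding vw(2-4) by blast
      then have "h1 \<bullet> (u $ v - u $ w) = 0" using fl vw(1) unfolding inf_flex_iff[OF col] by (metis (full_types))
      then show "c' x = of_int g * c' y"
        unfolding vw(2-4) inner_diff_right uc using signed_difference(2)[OF side_cases[of R v] side_cases[of R w]] by blast
    qed
    then have c0: "\<forall>x\<in>range ?o. c' x = 0" using rigid unfolding rigidly_placed_def by blast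
    have "vertical_flex ?Q a b d" unfolding vertical_flex_def
    proof (intro allI impI)
      fix x y g assume q: "({x, y}, g) \<in> ?Q" and h: "vertical a b x y g"
      obtain v w where vw: "{v, w} \<in> E" "x = ?o v" "y = ?o w" "g = side R v * side R w"
        using quotient_edge_memE[OF G free R q] by metis
      have "\<not> \<bar>h2 \<bullet> (p $ v - p $ w)\<bar> < \<bar>h1 \<bullet> (p $ v - p $ w)\<bar>" using h colours(2)[of v w] unfolding vw(2-4) by simp
      then have "h2 \<bullet> (u $ v - u $ w) = 0" using fl vw(1) unfolding inf_flex_iff[OF col] by (metis (full_types))
      then show "d x = d y" unfolding vw(2-4) inner_diff_right uc by simp
    qed
    then have "\<forall>x\<in>range ?o. \<forall>y\<in>range ?o. d x = d y" using rigid unfolding rigidly_placed_def by blast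
    then have "d (?o v) = d (?o w)" by blast
    then show "u $ v = u $ w" using c0 by (intro sep) (simp_all add: uc)
  qed
qed

text \<open>Edge sets of the quotient are in bijection with invariant edge sets of the covering graph.\<close>

lemma subgraph_of_quotient_edges:
  assumes G: "Z2_symmetric_graph E \<theta>" and F: "F \<subseteq> edges (quotient_graph E \<theta> R)"
  obtains E' where "E' \<subseteq> E" "invariant_edges \<theta> E'" "edges (quotient_graph E' \<theta> R) = F"
proof -
  let ?q = "\<lambda>e. quotient_edge \<theta> R (edge_orbit \<theta> e)"
  define E' where "E' = {e \<in> E. ?q e \<in> F}"
  have s: "\<theta> (-1) (\<theta> (-1) v) = v" for v by (rule theta_facts(1)[OF G])
  have "\<theta> (-1) ` e \<in> E'" if e: "e \<in> E'" for e
  proof -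
    have eE: "e \<in> E" using e by (simp add: E'_def)
    obtain v w where vw: "e = {v, w}" using graph_edgeE[OF G eE] by metis
    have "\<theta> (-1) ` e \<in> E" using theta_facts(3)[OF G, of v w] eE vw by simp
    moreover have "edge_orbit \<theta> (\<theta> (-1) ` e) = edge_orbit \<theta> e" by (auto simp: edge_orbit_def image_image s)
    ultimately show ?thesis using e by (simp add: E'_def)
  qed
  then have "invariant_edges \<theta> E'" by (simp add: invariant_edges_def)
  moreover have "edges (quotient_graph E' \<theta> R) = F"
    using F unfolding quotient_graph_def E'_def by auto
  moreover have "E' \<subseteq> E" by (auto simp: E'_def)
  ultimately show thesis using that by blast
qed

lemma quotient_edges_strict_mono:
  assumes G: "Z2_symmetric_graph E \<theta>" and R: "representatives \<theta> R" and E': "E' \<subset> E" "invariant_edges \<theta> E'"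
  shows "edges (quotient_graph E' \<theta> R) \<subset> edges (quotient_graph E \<theta> R)"
proof -
  let ?q = "\<lambda>e. quotient_edge \<theta> R (edge_orbit \<theta> e)"
  obtain e where e: "e \<in> E" "e \<notin> E'" using E'(1) by blast
  have "?q e \<notin> edges (quotient_graph E' \<theta> R)"
  proof
    assume "?q e \<in> edges (quotient_graph E' \<theta> R)"
    then obtain e' where e': "e' \<in> E'" "?q e = ?q e'" unfolding quotient_graph_def by auto
    have "edge_orbit \<theta> e = edge_orbit \<theta> e'"
      using inj_onD[OF quotient_edge_inj[OF G R] e'(2)] e(1) e'(1) E'(1) by blast
    then have "e \<in> edge_orbit \<theta> e'" by (metis edge_orbit_def insertI1)
    then show False using e(2) e'(1) E'(2) unfolding edge_orbit_def invariant_edges_def by blast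
  qed
  moreover have "?q e \<in> edges (quotient_graph E \<theta> R)" using e(1) unfolding quotient_graph_def by simp
  moreover have "edges (quotient_graph E' \<theta> R) \<subseteq> edges (quotient_graph E \<theta> R)" using E'(1) unfolding quotient_graph_def by auto
  ultimately show ?thesis by blast
qed

lemma coloured_mono: "coloured h1 h2 E p \<Longrightarrow> E' \<subseteq> E \<Longrightarrow> coloured h1 h2 E' p"
  unfolding coloured_def by blast

text \<open>A redundant edge of the quotient lifts to an orbit of edges whose removal preserves rigidity, so
  minimality fixes the number of edges.\<close>

lemma isostatic_imp_realisable:
  fixes E :: "'v::finite set set" and p :: "(real ^ 2) ^ 'v"
  assumes N: "is_norm (quad_norm h1 h2)"
    and G: "Z2_symmetric_graph E \<theta>" and free: "free_on_vertices \<theta>" and R: "representatives \<theta> R"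
    and refl: "is_reflection (\<tau> (-1)) {x. h1 \<bullet> x = 0} {x. h2 \<bullet> x = 0}"
    and fw: "framework E p" and wp: "well_positioned (quad_norm h1 h2) E p"
    and sym: "Z2_symmetric \<theta> \<tau> p" and iso: "symm_isostatic (quad_norm h1 h2) \<theta> \<tau> E p"
  shows "realisable (verts (quotient_graph E \<theta> R)) (edges (quotient_graph E \<theta> R))"
proof -
  let ?o = "vertex_orbit \<theta>" and ?Q = "edges (quotient_graph E \<theta> R)"
  note T = reflection_coordinates[OF refl]
  have col: "coloured h1 h2 E p" using well_positioned_iff_coloured[OF N fw] wp by blast
  define a where "a x = h1 \<bullet> p $ orbit_rep R x" for x
  define b where "b x = h2 \<bullet> p $ orbit_rep R x" for x
  have c: "h1 \<bullet> p $ v = of_int (side R v) * a (?o v)" "h2 \<bullet> p $ v = b (?o v)" for v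
    using symmetric_coordinates[of E \<theta> R h1 \<tau> h2 p, OF G free R T sym, of v] by (simp_all add: a_def b_def)
  have V: "verts (quotient_graph E \<theta> R) = range ?o" by (simp add: quotient_graph_def)
  have sg: "signed_graph (range ?o) ?Q"
    using signed_quotient_graph_quotient[OF G free R] unfolding signed_quotient_graph_iff V .
  have rigid: "rigidly_placed (range ?o) ?Q a b"
    using iso symm_inf_rigid_iff[where \<tau> = \<tau> and a = a and b = b, OF N G free R T c col] unfolding symm_isostatic_def by blast
  have wpQ: "well_placed ?Q a b" unfolding well_placed_def
  proof (intro allI impI)
    fix x y g assume "({x, y}, g) \<in> ?Q"
    then obtain v w where vw: "{v, w} \<in> E" "x = ?o v" "y = ?o w" "g = side R v * side R w"
      using quotient_edge_memE[OF G free R] by metis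
    then have "\<bar>h1 \<bullet> (p $ v - p $ w)\<bar> \<noteq> \<bar>h2 \<bullet> (p $ v - p $ w)\<bar>" using col unfolding coloured_def by blast
    then show "horizontal a b x y g \<or> vertical a b x y g"
      unfolding vw(2-4) quotient_colours[of h1 p R a \<theta> h2 b, OF c] by linarith
  qed
  have o0: "?o undefined \<in> range ?o" by blast
  have "card ?Q + 1 = 2 * card (range ?o)"
  proof (rule ccontr)
    assume "card ?Q + 1 \<noteq> 2 * card (range ?o)"
    then have big: "2 * card (range ?o) \<le> card ?Q" using rigidly_placed_card[OF sg rigid o0] by linarith
    obtain e where e: "e \<in> ?Q" "rigidly_placed (range ?o) (?Q - {e}) a b"
      using redundant_edge[OF sg wpQ rigid big o0] .
    obtain E' where E': "E' \<subseteq> E" "invariant_edges \<theta> E'" "edges (quotient_graph E' \<theta> R) = ?Q - {e}"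
      using subgraph_of_quotient_edges[OF G, of "?Q - {e}"] by blast
    have G': "Z2_symmetric_graph E' \<theta>" by (rule Z2_symmetric_subgraph[OF G E'(1,2)])
    have "symm_inf_rigid (quad_norm h1 h2) \<theta> \<tau> E' p"
      using symm_inf_rigid_iff[where \<tau> = \<tau> and a = a and b = b, OF N G' free R T c coloured_mono[OF col E'(1)]] e(2) unfolding E'(3) by blast
    moreover have "E' \<subset> E" using E'(1,3) e(1) by blast
    ultimately show False using iso E'(2) unfolding symm_isostatic_def by blast
  qed
  then show ?thesis unfolding V realisable_def realisation_def using sg wpQ rigid by blast
qed

text \<open>The projection with the required range and kernel, written in coordinates.\<close>

lemma exists_reflection:
  assumes N: "is_norm (quad_norm h1 h2)"
  obtains T where "T \<in> carrier (isom_group (quad_norm h1 h2))" "T \<circ> T = id"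
    "is_reflection T {x. h1 \<bullet> x = 0} {x. h2 \<bullet> x = 0}"
proof -
  obtain pt where pt: "\<And>a b. h1 \<bullet> pt a b = a" "\<And>a b. h2 \<bullet> pt a b = b" using quad_norm_coordinates[OF N] by metis
  have sep: "x = y" if "h1 \<bullet> x = h1 \<bullet> y" "h2 \<bullet> x = h2 \<bullet> y" for x y
    using quad_norm_separates[OF N, of "x - y"] that by (simp add: inner_diff_right)
  define P where "P x = pt (h1 \<bullet> x) 0" for x
  have P: "h1 \<bullet> P x = h1 \<bullet> x" "h2 \<bullet> P x = 0" for x by (simp_all add: P_def pt)
  have lin: "linear P"
    by (rule linearI; rule sep) (simp_all add: P inner_add_right)
  define T where "T x = x - 2 *\<^sub>R P x" for x
  have T: "h1 \<bullet> T x = - (h1 \<bullet> x)" "h2 \<bullet> T x = h2 \<bullet> x" for x by (simp_all add: T_def inner_diff_right P)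
  have TT: "T (T x) = x" for x by (rule sep) (simp_all add: T)
  have "linear T" by (rule linearI; rule sep) (simp_all add: T inner_add_right)
  moreover have "bij T" by (rule o_bij[of T]) (simp_all add: fun_eq_iff TT)
  moreover have "quad_norm h1 h2 (T x) = quad_norm h1 h2 x" for x by (simp add: quad_norm_def T)
  ultimately have "T \<in> carrier (isom_group (quad_norm h1 h2))" by (simp add: isom_group_def)
  moreover have "T \<circ> T = id" by (simp add: fun_eq_iff TT)
  moreover have "is_reflection T {x. h1 \<bullet> x = 0} {x. h2 \<bullet> x = 0}"
    unfolding is_reflection_def
  proof (intro conjI exI[of _ P])
    show "subspace {x. h1 \<bullet> x = 0}" "subspace {x. h2 \<bullet> x = 0}" by (rule subspace_hyperplane)+
    show "{x. h1 \<bullet> x = 0} \<inter> {x. h2 \<bullet> x = 0} = {0}" using sep[of _ 0] by auto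
    show "{z + w |z w. z \<in> {x. h1 \<bullet> x = 0} \<and> w \<in> {x. h2 \<bullet> x = 0}} = UNIV"
    proof (intro equalityI subset_UNIV subsetI)
      fix x :: "real ^ 2"
      have "x = (x - P x) + P x" "h1 \<bullet> (x - P x) = 0" "h2 \<bullet> P x = 0" by (simp_all add: P inner_diff_right)
      then show "x \<in> {z + w |z w. z \<in> {x. h1 \<bullet> x = 0} \<and> w \<in> {x. h2 \<bullet> x = 0}}" by blast
    qed
    have "h2 \<noteq> 0" using pt(2)[of 0 1] by auto
    then show "dim {x. h2 \<bullet> x = 0} = 1" by (simp add: dim_hyperplane)
    show "linear P" by (rule lin)
    show "P \<circ> P = P" by (simp add: fun_eq_iff P_def pt)
    show "range P = {x. h2 \<bullet> x = 0}"
    proof (intro equalityI subsetI)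
      fix x assume "x \<in> {x. h2 \<bullet> x = 0}"
      then have "x = P x" by (intro sep) (simp_all add: P)
      then show "x \<in> range P" by blast
    qed (auto simp: P)
    show "{x. P x = 0} = {x. h1 \<bullet> x = 0}"
    proof (intro equalityI subsetI)
      fix x assume "x \<in> {x. P x = 0}"
      then have "h1 \<bullet> P x = 0" by simp
      then show "x \<in> {x. h1 \<bullet> x = 0}" by (simp add: P)
    next
      fix x assume "x \<in> {x. h1 \<bullet> x = 0}"
      then have "P x = 0" by (intro sep) (simp_all add: P)
      then show "x \<in> {x. P x = 0}" by simp
    qed
    show "T = (\<lambda>x. x - 2 *\<^sub>R P x)" by (simp add: fun_eq_iff T_def)
  qed
  ultimately show thesis using that by blast
qed

text \<open>A proper invariant subgraph has too few edges in the quotient to be rigid.\<close>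

lemma realisable_imp_isostatic:
  fixes E :: "'v::finite set set"
  assumes N: "is_norm (quad_norm h1 h2)"
    and G: "Z2_symmetric_graph E \<theta>" and free: "free_on_vertices \<theta>" and R: "representatives \<theta> R"
    and r: "realisable (verts (quotient_graph E \<theta> R)) (edges (quotient_graph E \<theta> R))"
  shows "\<exists>(\<tau> :: int \<Rightarrow> real ^ 2 \<Rightarrow> real ^ 2) (p :: (real ^ 2) ^ 'v).
             \<tau> \<in> hom Z2 (isom_group (quad_norm h1 h2)) \<and>
             is_reflection (\<tau> (-1)) {x. h1 \<bullet> x = 0} {x. h2 \<bullet> x = 0} \<and>
             framework E p \<and>
             well_positioned (quad_norm h1 h2) E p \<and>
             Z2_symmetric \<theta> \<tau> p \<and>
             symm_isostatic (quad_norm h1 h2) \<theta> \<tau> E p"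
proof -
  let ?o = "vertex_orbit \<theta>" and ?Q = "edges (quotient_graph E \<theta> R)"
  have V: "verts (quotient_graph E \<theta> R) = range ?o" by (simp add: quotient_graph_def)
  obtain a b where sg: "signed_graph (range ?o) ?Q" and card: "card ?Q + 1 = 2 * card (range ?o)"
    and wpQ: "well_placed ?Q a b" and rigid: "rigidly_placed (range ?o) ?Q a b"
    using r unfolding V realisable_def realisation_def by blast
  obtain T where T: "T \<in> carrier (isom_group (quad_norm h1 h2))" "T \<circ> T = id"
    "is_reflection T {x. h1 \<bullet> x = 0} {x. h2 \<bullet> x = 0}" using exists_reflection[OF N] .
  define \<tau> :: "int \<Rightarrow> real ^ 2 \<Rightarrow> real ^ 2" where "\<tau> g = (if g = 1 then id else T)" for g
  have \<tau>: "\<tau> (-1) = T" by (simp add: \<tau>_def)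
  have hom: "\<tau> \<in> hom Z2 (isom_group (quad_norm h1 h2))"
  proof -
    have "linear (id :: real ^ 2 \<Rightarrow> real ^ 2)" by (rule linearI) simp_all
    then have "id \<in> carrier (isom_group (quad_norm h1 h2))" by (simp add: isom_group_def)
    then show ?thesis using T(1,2) by (auto simp: hom_def Z2_def \<tau>_def isom_group_def)
  qed
  have refl: "is_reflection (\<tau> (-1)) {x. h1 \<bullet> x = 0} {x. h2 \<bullet> x = 0}" using T(3) \<tau> by simp
  note T' = reflection_coordinates[OF refl]
  obtain pt where pt: "\<And>a b. h1 \<bullet> pt a b = a" "\<And>a b. h2 \<bullet> pt a b = b" using quad_norm_coordinates[OF N] by metis
  have sep: "x = y" if "h1 \<bullet> x = h1 \<bullet> y" "h2 \<bullet> x = h2 \<bullet> y" for x y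
    using quad_norm_separates[OF N, of "x - y"] that by (simp add: inner_diff_right)
  define p :: "(real ^ 2) ^ 'v" where "p = (\<chi> v. pt (of_int (side R v) * a (?o v)) (b (?o v)))"
  have c: "h1 \<bullet> p $ v = of_int (side R v) * a (?o v)" "h2 \<bullet> p $ v = b (?o v)" for v by (simp_all add: p_def pt)
  have sym: "Z2_symmetric \<theta> \<tau> p" unfolding Z2_symmetric_def
    by (intro allI sep) (simp_all add: T' c orbit_facts(2,3)[OF G free R])
  have col: "coloured h1 h2 E p" unfolding coloured_def
  proof (intro allI impI)
    fix v w assume e: "{v, w} \<in> E"
    have "horizontal a b (?o v) (?o w) (side R v * side R w) \<or> vertical a b (?o v) (?o w) (side R v * side R w)"
      using wpQ quotient_edge_memI[OF G free R e] unfolding well_placed_def by blast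
    then show "\<bar>h1 \<bullet> (p $ v - p $ w)\<bar> \<noteq> \<bar>h2 \<bullet> (p $ v - p $ w)\<bar>"
      unfolding quotient_colours[of h1 p R a \<theta> h2 b, OF c] by linarith
  qed
  have fw: "framework E p" unfolding framework_def
  proof (intro conjI allI impI notI)
    show "simple_graph E" using G by (simp add: Z2_symmetric_graph_def)
    fix v w assume "{v, w} \<in> E" "p $ v = p $ w"
    then show False using col unfolding coloured_def by fastforce
  qed
  have wp: "well_positioned (quad_norm h1 h2) E p" using well_positioned_iff_coloured[OF N fw] col by blast
  have "symm_isostatic (quad_norm h1 h2) \<theta> \<tau> E p" unfolding symm_isostatic_def
  proof (intro conjI allI impI notI)
    show "symm_inf_rigid (quad_norm h1 h2) \<theta> \<tau> E p"
      using symm_inf_rigid_iff[where \<tau> = \<tau> and a = a and b = b, OF N G free R T' c col] rigid by blast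
    fix E' assume E': "E' \<subset> E" "invariant_edges \<theta> E'" and rg: "symm_inf_rigid (quad_norm h1 h2) \<theta> \<tau> E' p"
    have sub: "E' \<subseteq> E" using E'(1) by blast
    have G': "Z2_symmetric_graph E' \<theta>" by (rule Z2_symmetric_subgraph[OF G sub E'(2)])
    have rQ: "rigidly_placed (range ?o) (edges (quotient_graph E' \<theta> R)) a b"
      using symm_inf_rigid_iff[where \<tau> = \<tau> and a = a and b = b, OF N G' free R T' c coloured_mono[OF col sub]] rg by blast
    have lt: "edges (quotient_graph E' \<theta> R) \<subset> ?Q" by (rule quotient_edges_strict_mono[OF G R E'])
    then have "signed_graph (range ?o) (edges (quotient_graph E' \<theta> R))" using signed_graph_mono[OF sg] by blast
    from rigidly_placed_card[OF this rQ, of "?o undefined"]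
    have "2 * card (range ?o) \<le> card (edges (quotient_graph E' \<theta> R)) + 1" by blast
    moreover have "card (edges (quotient_graph E' \<theta> R)) < card ?Q"
      by (rule psubset_card_mono[OF signed_graph_finite_edges[OF sg] lt])
    ultimately show False using card by linarith
  qed
  then show ?thesis using hom refl fw wp sym by blast
qed

theorem theorem22:
  fixes h1 h2 :: "real ^ 2"
    and E :: "'v::finite set set"
    and \<theta> :: "int \<Rightarrow> 'v \<Rightarrow> 'v"
    and R :: "'v set"
  assumes norm: "quadrilateral_norm h1 h2"
    and G: "Z2_symmetric_graph E \<theta>"
    and free: "free_on_vertices \<theta>"
    and R: "representatives \<theta> R"
  shows "((\<exists>(\<tau> :: int \<Rightarrow> real ^ 2 \<Rightarrow> real ^ 2) (p :: (real ^ 2) ^ 'v).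
             \<tau> \<in> hom Z2 (isom_group (quad_norm h1 h2)) \<and>
             is_reflection (\<tau> (-1)) {x. h1 \<bullet> x = 0} {x. h2 \<bullet> x = 0} \<and>
             framework E p \<and>
             well_positioned (quad_norm h1 h2) E p \<and>
             Z2_symmetric \<theta> \<tau> p \<and>
             symm_isostatic (quad_norm h1 h2) \<theta> \<tau> E p)
          \<longleftrightarrow> gain_tight (quotient_graph E \<theta> R)) \<and>
         (gain_tight (quotient_graph E \<theta> R)
          \<longleftrightarrow> (\<exists>H :: nat sgraph. constructible H \<and> sgraph_iso H (quotient_graph E \<theta> R)))"
proof -
  have N: "is_norm (quad_norm h1 h2)" using norm by (simp add: quadrilateral_norm_def)
  note iff = tight_iff_constructible[OF signed_quotient_graph_quotient[OF G free R]]
  show ?thesis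
  proof (rule conjI)
    show "(\<exists>(\<tau> :: int \<Rightarrow> real ^ 2 \<Rightarrow> real ^ 2) (p :: (real ^ 2) ^ 'v).
             \<tau> \<in> hom Z2 (isom_group (quad_norm h1 h2)) \<and>
             is_reflection (\<tau> (-1)) {x. h1 \<bullet> x = 0} {x. h2 \<bullet> x = 0} \<and>
             framework E p \<and>
             well_positioned (quad_norm h1 h2) E p \<and>
             Z2_symmetric \<theta> \<tau> p \<and>
             symm_isostatic (quad_norm h1 h2) \<theta> \<tau> E p)
          \<longleftrightarrow> gain_tight (quotient_graph E \<theta> R)"
      unfolding iff(2)
      using isostatic_imp_realisable[OF N G free R] realisable_imp_isostatic[OF N G free R] by blast
    show "gain_tight (quotient_graph E \<theta> R)
          \<longleftrightarrow> (\<exists>H :: nat sgraph. constructible H \<and> sgraph_iso H (quotient_graph E \<theta> R))"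
      by (rule iff(1))
  qed
qed


end
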